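(* Let $k$ be a field of characteristic $p$ (possibly $p=0$), let $c\ge 1$ be an integer, and let $A$ be a finite dimensional commutative complete intersection of the form $$A=k[X_1,\dots,X_c]/(X_1^{a},\dots,X_c^{a}),$$ where $a\ge 2$. Then $$\dim_k\widehat{\mathrm{HH}}_n(A,A)=\begin{cases}\binom{c+n-1}{n}a^c & \text{if } p\mid a\\ a^c-1 & \text{if } p\nmid a \text{ and } n=0\\ \sum_{t=0}^{c}\binom{c}{t}\binom{n-1}{n-c+t}a^t(a-1)^{c-t} & \text{if } p\nmid a \text{ and } n\ge 1\end{cases}$$ for $n\ge 0$, and $$\dim_k\widehat{\mathrm{HH}}_n(A,A)=\dim_k\widehat{\mathrm{HH}}^n(A,A)=\dim_k\widehat{\mathrm{HH}}_{-(n+1)}(A,A)=\dim_k\widehat{\mathrm{HH}}^{-(n+1)}(A,A)$$ for all $n\in\mathbb{Z}$.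
   Context: Binomial coefficients $\binom{m}{r}$ with $m\ge0$ are zero if $r<0$ or $r>m$. If $p=0$ then $p\nmid a$. $A^e=A\otimes_kA^{op}$ is the enveloping algebra, which is selfinjective here; a bimodule $B$ is a left $A^e$-module via $(\lambda\otimes\lambda')b=\lambda b\lambda'$ and a right $A^e$-module via $b(\lambda\otimes\lambda')=\lambda'b\lambda$. A complete resolution of $A$ over $A^e$ is an acyclic complex $\mathbb{T}$ of finitely generated projective left $A^e$-modules, indexed by $\mathbb{Z}$, such that $\mathrm{Hom}_{A^e}(\mathbb{T},A^e)$ is acyclic and such that there are a projective resolution $\mathbb{P}$ of $A$ and a chain map $f\colon\mathbb{T}\to\mathbb{P}$ with $f_n$ bijective for $n\ge 0$. For $n\in\mathbb{Z}$ and a bimodule $B$, the Tate-Hochschild groups are $\widehat{\mathrm{HH}}^n(A,B)=H^n(\mathrm{Hom}_{A^e}(\mathbb{T},B))$ and $\widehat{\mathrm{HH}}_n(A,B)=H_n(B\otimes_{A^e}\mathbb{T})$. *)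

theory Defs
  imports
    "Jordan_Normal_Form.Missing_VectorSpace"
    "HOL-Algebra.Free_Abelian_Groups"
    "HOL-Algebra.Algebraic_Closure_Type"
begin

text \<open>
  Modules and algebras are those of \<^theory>\<open>HOL-Algebra.Module\<close>.  A module over \<open>R\<close> is a record
  whose ring multiplication and unit are irrelevant; an algebra over \<open>R\<close> is a record which is
  also a ring.  The ground field is a type \<open>'k\<close> of class \<open>field\<close>, turned into the ring record
  \<open>ring_of_type_algebra\<close>.  The algebra \<open>A\<close> under consideration is commutative, hence so is its
  enveloping algebra, and the module theory below is over commutative rings, as in the library.
\<close>

definition with_smult :: "('b, 'z) ring_scheme \<Rightarrow> ('a \<Rightarrow> 'b \<Rightarrow> 'b) \<Rightarrow> ('a, 'b) module" where
  "with_smult M s = ring.extend (ring.truncate M) (module.fields s)"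

definition regular_module :: "('r, 'z) ring_scheme \<Rightarrow> ('r, 'r) module" where
  "regular_module R = with_smult R (\<lambda>r x. r \<otimes>\<^bsub>R\<^esub> x)"

text \<open>The quotient of an \<open>R\<close>-module by a submodule, and also that of an \<open>R\<close>-algebra by an ideal.\<close>

definition quotient :: "('r, 'm) module \<Rightarrow> 'm set \<Rightarrow> ('r, 'm set) module" where
  "quotient M N = with_smult (M Quot N) (\<lambda>r C. \<Union>x\<in>C. N +>\<^bsub>M\<^esub> (r \<odot>\<^bsub>M\<^esub> x))"

text \<open>Restriction of scalars from a \<open>K\<close>-algebra \<open>R\<close> to \<open>K\<close>.\<close>

definition restrict_scalars :: "('k, 'r) module \<Rightarrow> ('r, 'm) module \<Rightarrow> ('k, 'm) module" where
  "restrict_scalars R M = with_smult M (\<lambda>c x. (c \<odot>\<^bsub>R\<^esub> \<one>\<^bsub>R\<^esub>) \<odot>\<^bsub>M\<^esub> x)"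


section \<open>Finitely generated and projective modules, \<open>Hom\<close>\<close>

definition finitely_generated :: "('r, 'z) ring_scheme \<Rightarrow> ('r, 'm) module \<Rightarrow> bool" where
  "finitely_generated R M \<longleftrightarrow>
     (\<exists>S. finite S \<and> S \<subseteq> carrier M \<and> LinearCombinations.module.span R M S = carrier M)"

definition free_module :: "('r, 'z) ring_scheme \<Rightarrow> 'i set \<Rightarrow> ('r, 'i \<Rightarrow> 'r) module" where
  "free_module R I = (ring.func_space R I)
     \<lparr>carrier := {f \<in> I \<rightarrow>\<^sub>E carrier R. finite {i \<in> I. f i \<noteq> \<zero>\<^bsub>R\<^esub>}}\<rparr>"

text \<open>
  Projective means: direct summand of a free module.  Taking the index set \<open>I\<close> in the type of
  elements of \<open>M\<close> is no restriction: if \<open>M\<close> is a summand of any free module, then it is a summand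
  of the free module on \<open>carrier M\<close>.
\<close>

definition projective_module :: "('r, 'z) ring_scheme \<Rightarrow> ('r, 'm) module \<Rightarrow> bool" where
  "projective_module R M \<longleftrightarrow> Module.module R M \<and>
     (\<exists>(I :: 'm set) i q. i \<in> LinearCombinations.module_hom R M (free_module R I)
        \<and> q \<in> LinearCombinations.module_hom R (free_module R I) M
        \<and> (\<forall>x\<in>carrier M. q (i x) = x))"

definition hom_module ::
  "('r, 'z) ring_scheme \<Rightarrow> ('r, 'm) module \<Rightarrow> ('r, 'n) module \<Rightarrow> ('r, 'm \<Rightarrow> 'n) module" where
  "hom_module R M N =
     \<lparr>carrier = LinearCombinations.module_hom R M N \<inter> extensional (carrier M),
      monoid.mult = undefined, one = undefined,
      ring.zero = (\<lambda>x\<in>carrier M. \<zero>\<^bsub>N\<^esub>),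
      add = (\<lambda>f g. \<lambda>x\<in>carrier M. f x \<oplus>\<^bsub>N\<^esub> g x),
      module.smult = (\<lambda>r f. \<lambda>x\<in>carrier M. r \<odot>\<^bsub>N\<^esub> f x)\<rparr>"


section \<open>Tensor products\<close>

text \<open>
  The tensor product of a right \<open>R\<close>-module \<open>B\<close> and a left \<open>R\<close>-module \<open>M\<close>: the free abelian group
  on pairs modulo the usual relations.  For a right module the scalar multiplication
  \<open>r \<odot>\<^bsub>B\<^esub> b\<close> stands for \<open>b r\<close>.
\<close>

abbreviation tensor_free ::
  "('r, 'b) module \<Rightarrow> ('r, 'm) module \<Rightarrow> ('b \<times> 'm \<Rightarrow>\<^sub>0 int) monoid" where
  "tensor_free B M \<equiv> free_Abelian_group (carrier B \<times> carrier M)"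

definition tensor_relations ::
  "('r, 'z) ring_scheme \<Rightarrow> ('r, 'b) module \<Rightarrow> ('r, 'm) module \<Rightarrow> ('b \<times> 'm \<Rightarrow>\<^sub>0 int) set" where
  "tensor_relations R B M = generate (tensor_free B M)
     ({frag_of (b \<oplus>\<^bsub>B\<^esub> b', m) - frag_of (b, m) - frag_of (b', m) | b b' m.
         b \<in> carrier B \<and> b' \<in> carrier B \<and> m \<in> carrier M}
    \<union> {frag_of (b, m \<oplus>\<^bsub>M\<^esub> m') - frag_of (b, m) - frag_of (b, m') | b m m'.
         b \<in> carrier B \<and> m \<in> carrier M \<and> m' \<in> carrier M}
    \<union> {frag_of (r \<odot>\<^bsub>B\<^esub> b, m) - frag_of (b, r \<odot>\<^bsub>M\<^esub> m) | r b m.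
         r \<in> carrier R \<and> b \<in> carrier B \<and> m \<in> carrier M})"

text \<open>The coset of a formal sum of pairs, i.e. the tensor represented by it.\<close>

definition tensor_class :: "('r, 'z) ring_scheme \<Rightarrow> ('r, 'b) module \<Rightarrow> ('r, 'm) module \<Rightarrow>
    ('b \<times> 'm \<Rightarrow>\<^sub>0 int) \<Rightarrow> ('b \<times> 'm \<Rightarrow>\<^sub>0 int) set" where
  "tensor_class R B M z = tensor_relations R B M #>\<^bsub>tensor_free B M\<^esub> z"

definition tensor_module :: "('r, 'z) ring_scheme \<Rightarrow> ('r, 'b) module \<Rightarrow> ('r, 'm) module \<Rightarrow>
    ('r, ('b \<times> 'm \<Rightarrow>\<^sub>0 int) set) module" where
  "tensor_module R B M =
     \<lparr>carrier = rcosets\<^bsub>tensor_free B M\<^esub> (tensor_relations R B M),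
      monoid.mult = undefined, one = undefined,
      ring.zero = tensor_relations R B M,
      add = (\<lambda>C D. C <#>\<^bsub>tensor_free B M\<^esub> D),
      module.smult = (\<lambda>r C. \<Union>z\<in>C. tensor_class R B M
                 (frag_extend (\<lambda>(b, m). frag_of (r \<odot>\<^bsub>B\<^esub> b, m)) z))\<rparr>"

text \<open>The map \<open>B \<otimes> M \<rightarrow> B \<otimes> M'\<close> induced by \<open>f : M \<rightarrow> M'\<close>.\<close>

definition tensor_map :: "('r, 'z) ring_scheme \<Rightarrow> ('r, 'b) module \<Rightarrow> ('r, 'n) module \<Rightarrow>
    ('m \<Rightarrow> 'n) \<Rightarrow> ('b \<times> 'm \<Rightarrow>\<^sub>0 int) set \<Rightarrow> ('b \<times> 'n \<Rightarrow>\<^sub>0 int) set" where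
  "tensor_map R B M' f C =
     (\<Union>z\<in>C. tensor_class R B M' (frag_extend (\<lambda>(b, m). frag_of (b, f m)) z))"

definition tensor_algebra :: "('k, 'z) ring_scheme \<Rightarrow> ('k, 'a) module \<Rightarrow> ('k, 'b) module \<Rightarrow>
    ('k, ('a \<times> 'b \<Rightarrow>\<^sub>0 int) set) module" where
  "tensor_algebra K A B = (tensor_module K A B)
     \<lparr>monoid.mult := (\<lambda>C D. \<Union>z\<in>C. \<Union>w\<in>D. tensor_class K A B
        (frag_extend (\<lambda>(x, y). frag_extend
           (\<lambda>(x', y'). frag_of (x \<otimes>\<^bsub>A\<^esub> x', y \<otimes>\<^bsub>B\<^esub> y')) w) z)),
      one := tensor_class K A B (frag_of (\<one>\<^bsub>A\<^esub>, \<one>\<^bsub>B\<^esub>))\<rparr>"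


section \<open>The enveloping algebra\<close>

type_synonym 'a env = "('a \<times> 'a \<Rightarrow>\<^sub>0 int) set"

definition op_algebra :: "('k, 'a) module \<Rightarrow> ('k, 'a) module" where
  "op_algebra A = A\<lparr>monoid.mult := (\<lambda>x y. y \<otimes>\<^bsub>A\<^esub> x)\<rparr>"

definition enveloping_algebra ::
  "('k, 'z) ring_scheme \<Rightarrow> ('k, 'a) module \<Rightarrow> ('k, 'a env) module" where
  "enveloping_algebra K A = tensor_algebra K A (op_algebra A)"

text \<open>
  \<open>env_eval A h\<close> is the additive map on the enveloping algebra which sends \<open>x \<otimes> y\<close> to \<open>h x y\<close>,
  for \<open>h\<close> bilinear: all representatives of a tensor then have the same image.
\<close>

definition env_eval :: "('k, 'a) module \<Rightarrow> ('a \<Rightarrow> 'a \<Rightarrow> 'a) \<Rightarrow> 'a env \<Rightarrow> 'a" where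
  "env_eval A h C = the_elem
     ((\<lambda>z. \<Oplus>\<^bsub>A\<^esub>v\<in>Poly_Mapping.keys z.
          add_pow A (Poly_Mapping.lookup z v) (h (fst v) (snd v))) ` C)"

text \<open>\<open>A\<close> as a left module, \<open>(x \<otimes> y) b = x b y\<close>, and as a right module, \<open>b (x \<otimes> y) = y b x\<close>.\<close>

definition left_env_module :: "('k, 'a) module \<Rightarrow> ('a env, 'a) module" where
  "left_env_module A =
     with_smult A (\<lambda>C b. env_eval A (\<lambda>x y. x \<otimes>\<^bsub>A\<^esub> b \<otimes>\<^bsub>A\<^esub> y) C)"

definition right_env_module :: "('k, 'a) module \<Rightarrow> ('a env, 'a) module" where
  "right_env_module A =
     with_smult A (\<lambda>C b. env_eval A (\<lambda>x y. y \<otimes>\<^bsub>A\<^esub> b \<otimes>\<^bsub>A\<^esub> x) C)"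


section \<open>Complexes and complete resolutions\<close>

text \<open>\<open>cdiff T n\<close> is the differential from degree \<open>n\<close> to degree \<open>n - 1\<close>.\<close>

record ('r, 'm) mod_complex =
  cobj :: "int \<Rightarrow> ('r, 'm) module"
  cdiff :: "int \<Rightarrow> 'm \<Rightarrow> 'm"

definition chain_complex :: "('r, 'z) ring_scheme \<Rightarrow> ('r, 'm) mod_complex \<Rightarrow> bool" where
  "chain_complex R T \<longleftrightarrow>
     (\<forall>n. Module.module R (cobj T n) \<and> cdiff T n \<in>
          LinearCombinations.module_hom R (cobj T n) (cobj T (n - 1))
        \<and> (\<forall>x\<in>carrier (cobj T n). cdiff T (n - 1) (cdiff T n x) = \<zero>\<^bsub>cobj T (n - 2)\<^esub>))"

text \<open>Kernel, exactness and homology at the middle term of \<open>L \<rightarrow> M \<rightarrow> N\<close>, with maps \<open>g\<close> and \<open>f\<close>.\<close>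

definition kernel_of :: "('r, 'm) module \<Rightarrow> ('m \<Rightarrow> 'n) \<Rightarrow> ('r, 'n) module \<Rightarrow> 'm set" where
  "kernel_of M f N = {x \<in> carrier M. f x = \<zero>\<^bsub>N\<^esub>}"

definition exact_at :: "('r, 'l) module \<Rightarrow> ('l \<Rightarrow> 'm) \<Rightarrow> ('r, 'm) module \<Rightarrow>
    ('m \<Rightarrow> 'n) \<Rightarrow> ('r, 'n) module \<Rightarrow> bool" where
  "exact_at L g M f N \<longleftrightarrow> g ` carrier L = kernel_of M f N"

definition homology_at :: "('r, 'l) module \<Rightarrow> ('l \<Rightarrow> 'm) \<Rightarrow> ('r, 'm) module \<Rightarrow>
    ('m \<Rightarrow> 'n) \<Rightarrow> ('r, 'n) module \<Rightarrow> ('r, 'm set) module" where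
  "homology_at L g M f N = quotient (M\<lparr>carrier := kernel_of M f N\<rparr>) (g ` carrier L)"

abbreviation complex_exact_at :: "('r, 'm) mod_complex \<Rightarrow> int \<Rightarrow> bool" where
  "complex_exact_at T n \<equiv>
     exact_at (cobj T (n + 1)) (cdiff T (n + 1)) (cobj T n) (cdiff T n) (cobj T (n - 1))"

text \<open>The coboundary \<open>Hom(T\<^sub>n, B) \<rightarrow> Hom(T\<^sub>n\<^sub>+\<^sub>1, B)\<close>.\<close>

definition coboundary :: "('r, 'm) mod_complex \<Rightarrow> int \<Rightarrow> ('m \<Rightarrow> 'b) \<Rightarrow> 'm \<Rightarrow> 'b" where
  "coboundary T n g = (\<lambda>x\<in>carrier (cobj T (n + 1)). g (cdiff T (n + 1) x))"

definition projective_resolution :: "('r, 'z) ring_scheme \<Rightarrow> ('r, 'b) module \<Rightarrow>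
    ('r, 'm) mod_complex \<Rightarrow> bool" where
  "projective_resolution R M P \<longleftrightarrow> chain_complex R P
     \<and> (\<forall>n. projective_module R (cobj P n))
     \<and> (\<forall>n<0. carrier (cobj P n) = {\<zero>\<^bsub>cobj P n\<^esub>})
     \<and> (\<forall>n\<ge>1. complex_exact_at P n)
     \<and> (\<exists>\<epsilon>\<in>LinearCombinations.module_hom R (cobj P 0) M. \<epsilon> ` carrier (cobj P 0) = carrier M
          \<and> exact_at (cobj P 1) (cdiff P 1) (cobj P 0) \<epsilon> M)"

definition chain_map :: "('r, 'z) ring_scheme \<Rightarrow> ('r, 'm) mod_complex \<Rightarrow>
    ('r, 'n) mod_complex \<Rightarrow> (int \<Rightarrow> 'm \<Rightarrow> 'n) \<Rightarrow> bool" where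
  "chain_map R T P f \<longleftrightarrow> (\<forall>n. f n \<in> LinearCombinations.module_hom R (cobj T n) (cobj P n)
     \<and> (\<forall>x\<in>carrier (cobj T n). f (n - 1) (cdiff T n x) = cdiff P n (f n x)))"

text \<open>
  The projective resolution \<open>P\<close> may be taken over the same element type as \<open>T\<close>, since its nonzero
  terms are isomorphic to terms of \<open>T\<close>.
\<close>

definition complete_resolution :: "('r, 'z) ring_scheme \<Rightarrow> ('r, 'b) module \<Rightarrow>
    ('r, 'm) mod_complex \<Rightarrow> bool" where
  "complete_resolution R M T \<longleftrightarrow> chain_complex R T
     \<and> (\<forall>n. complex_exact_at T n)
     \<and> (\<forall>n. finitely_generated R (cobj T n) \<and> projective_module R (cobj T n))
     \<and> (\<forall>n. exact_at
          (hom_module R (cobj T (n - 1)) (regular_module R)) (coboundary T (n - 1))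
          (hom_module R (cobj T n) (regular_module R)) (coboundary T n)
          (hom_module R (cobj T (n + 1)) (regular_module R)))
     \<and> (\<exists>(P :: ('r, 'm) mod_complex) f. projective_resolution R M P \<and> chain_map R T P f
          \<and> (\<forall>n\<ge>0. bij_betw (f n) (carrier (cobj T n)) (carrier (cobj P n))))"


section \<open>Tate-Hochschild homology and cohomology\<close>

text \<open>
  Here \<open>T\<close> is a complete resolution of \<open>A\<close> over its enveloping algebra; the coefficients \<open>B\<close> are
  a left module in cohomology and a right module in homology.  The results are \<open>K\<close>-spaces.
\<close>

definition tate_HH_cohomology :: "('k, 'z) ring_scheme \<Rightarrow> ('k, 'a) module \<Rightarrow>
    ('a env, 'm) mod_complex \<Rightarrow> ('a env, 'b) module \<Rightarrow> int \<Rightarrow> ('k, ('m \<Rightarrow> 'b) set) module" where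
  "tate_HH_cohomology K A T B n = (let E = enveloping_algebra K A in
     restrict_scalars E (homology_at
       (hom_module E (cobj T (n - 1)) B) (coboundary T (n - 1))
       (hom_module E (cobj T n) B) (coboundary T n)
       (hom_module E (cobj T (n + 1)) B)))"

definition tate_HH_homology :: "('k, 'z) ring_scheme \<Rightarrow> ('k, 'a) module \<Rightarrow>
    ('a env, 'm) mod_complex \<Rightarrow> ('a env, 'b) module \<Rightarrow> int \<Rightarrow>
    ('k, ('b \<times> 'm \<Rightarrow>\<^sub>0 int) set set) module" where
  "tate_HH_homology K A T B n = (let E = enveloping_algebra K A in
     restrict_scalars E (homology_at
       (tensor_module E B (cobj T (n + 1)))
       (tensor_map E B (cobj T n) (cdiff T (n + 1)))
       (tensor_module E B (cobj T n))
       (tensor_map E B (cobj T (n - 1)) (cdiff T n))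
       (tensor_module E B (cobj T (n - 1)))))"


section \<open>The algebra \<open>k[X\<^sub>1,\<dots>,X\<^sub>c]/(X\<^sub>1\<^sup>a,\<dots>,X\<^sub>c\<^sup>a)\<close> and dimensions\<close>

type_synonym 'k mpoly = "(nat \<Rightarrow>\<^sub>0 nat) \<Rightarrow>\<^sub>0 'k"

abbreviation ground_field :: "'k::field ring" where
  "ground_field \<equiv> ring_of_type_algebra"

text \<open>Polynomials in the variables \<open>X\<^sub>1, \<dots>, X\<^sub>c\<close>.\<close>

definition poly_algebra :: "nat \<Rightarrow> ('k::field, 'k mpoly) module" where
  "poly_algebra c = with_smult
     (ring_of_type_algebra
        \<lparr>carrier := {q. \<forall>m\<in>Poly_Mapping.keys q. Poly_Mapping.keys m \<subseteq> {1..c}}\<rparr>)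
     (\<lambda>r q. Poly_Mapping.single 0 r * q)"

definition poly_var :: "nat \<Rightarrow> 'k::field mpoly" where
  "poly_var i = Poly_Mapping.single (Poly_Mapping.single i 1) 1"

definition ci_algebra :: "nat \<Rightarrow> nat \<Rightarrow> ('k::field, 'k mpoly set) module" where
  "ci_algebra c a = quotient (poly_algebra c)
     (genideal (poly_algebra c) ((\<lambda>i. poly_var i ^ a) ` {1..c}))"

text \<open>\<open>vectorspace.dim\<close> is meaningful only for finite dimensional spaces.\<close>

definition fd_space :: "('k::field, 'v) module \<Rightarrow> bool" where
  "fd_space V \<longleftrightarrow> vectorspace ground_field V \<and> vectorspace.fin_dim ground_field V"

definition k_dim :: "('k::field, 'v) module \<Rightarrow> nat" where
  "k_dim V = vectorspace.dim ground_field V"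

text \<open>Binomial coefficients vanish for a negative lower index.\<close>

definition binom :: "nat \<Rightarrow> int \<Rightarrow> nat" where
  "binom m r = (if r < 0 then 0 else m choose nat r)"

end

theory Submission
  imports Defs "HOL-Library.Function_Algebras" "HOL-Computational_Algebra.Formal_Power_Series"
begin

text \<open>
  With \<open>u = x \<otimes> 1 - 1 \<otimes> x\<close> and \<open>v = \<Sum>\<^sub>i x\<^sup>i \<otimes> x\<^sup>a\<^sup>-\<^sup>1\<^sup>-\<^sup>i\<close>, the periodic resolutions of
  \<open>k[x]/(x\<^sup>a)\<close> over its enveloping algebra give, by tensoring over the variables, a free resolution
  of \<open>A\<close> and a free coresolution; splicing them by \<open>N = v\<^sub>1 \<cdots> v\<^sub>c\<close> yields an exact complex \<open>S\<close>,
  indexed by lattice points.  If \<open>T\<close> is any complete resolution, then dimension shifting along \<open>S\<close>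
  in the second argument of \<open>Hom(T, -)\<close> identifies \<open>H\<^sup>n(Hom(T, A))\<close> with \<open>H\<^bsub>-1-n\<^esub>(A \<otimes> S)\<close>; no
  comparison of complete resolutions is needed.  On \<open>A\<close> the element \<open>u\<close> acts as zero and \<open>v\<close> as
  \<open>a x\<^sup>a\<^sup>-\<^sup>1\<close>, so the homology of \<open>A \<otimes> S\<close> has a basis of monomials on lattice points: all of them if
  \<open>p\<close> divides \<open>a\<close>, and otherwise those which survive in every direction.  Negation of lattice points
  gives the symmetry of the dimensions, and a generating function counts them.  Finally \<open>A\<close> is a
  Frobenius algebra, hence \<open>Hom(T, A)\<close> is the dual of \<open>A \<otimes> T\<close> and homology is dual to cohomology.
\<close>

text \<open>\<open>T\<close> lives over an arbitrary element type and is known only through its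
  defining properties, so a comparison with \<open>S\<close> would need chain maps and homotopies in
  both directions. What is used instead: the terms of \<open>T\<close> are projective, Hom(T, R) is
  acyclic for the enveloping algebra R, and T_0 modulo the image of T_1 is \<open>A\<close>. Write
  Z_i for the cycles of \<open>S\<close> in degree i. The first two facts give H^n(Hom(T, Z_i)) =
  H^(n+1)(Hom(T, Z_(i+1))). The splice makes Z_(-1) = N R, a copy of \<open>A\<close>, so the shift
  carries H^n(Hom(T, A)) to maps from T_0 to Z_(-1-n) that kill the image of T_1, modulo those that
  factor through T_(-1). Such a map is an element of Z_(-1-n) killed by the annihilator J of 1 in
  \<open>A\<close>; since N R is the annihilator of J, it is a cycle with values in
  \<open>A\<close>. Hence the index -1-n. The isomorphisms are kept as linear relations between
  representatives, so that no quotient is formed before the dimension count. The Frobenius form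
  reads off the coefficient of (X_1 ... X_c)^(a-1), and the homotopies behind exactness come from
  the divided difference (Y^n - X^n)/(X - Y).\<close>

abbreviation "Hom \<equiv> LinearCombinations.module_hom"

section \<open>Multigraded complexes with contracting homotopies in each direction\<close>

text \<open>The sign (-1)^s in an abelian group, where there is no multiplication to write it
  with.\<close>

definition parity_sign :: "int \<Rightarrow> 'b::ab_group_add \<Rightarrow> 'b" where
  "parity_sign s x = (if even s then x else - x)"

lemma parity_sign_0 [simp]: "parity_sign s 0 = 0"
  and parity_sign_add: "parity_sign s (x + y) = parity_sign s x + parity_sign s y"
  and parity_sign_twice: "parity_sign s (parity_sign s x) = x"
  and parity_sign_minus: "parity_sign s (- x) = - parity_sign s x"
  by (auto simp: parity_sign_def)

text \<open>\<open>W j l\<close> is the differential in direction \<open>j\<close> that arrives at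
  coordinate \<open>l\<close>, and \<open>H j l\<close> the homotopy arriving there from
  \<open>l - 1\<close>. No homotopy identity is imposed: each direction may have homology, and
  \<open>pproj\<close> below measures the defect. The operators are total on one group, so chains
  are arbitrary functions on the lattice.\<close>

locale multi_complex =
  fixes c :: nat and W H :: "nat \<Rightarrow> int \<Rightarrow> 'b::ab_group_add \<Rightarrow> 'b"
  assumes W_add: "W j l (x + y) = W j l x + W j l y"
    and H_add: "H j l (x + y) = H j l x + H j l y"
    and W_comm: "i \<noteq> j \<Longrightarrow> W i l (W j m x) = W j m (W i l x)"
    and WH_comm: "i \<noteq> j \<Longrightarrow> W i l (H j m x) = H j m (W i l x)"
    and W_W: "W j l (W j (l + 1) x) = 0"
begin

lemma W_0: "W j l 0 = 0" using W_add[of j l 0 0] by simp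
lemma H_0: "H j l 0 = 0" using H_add[of j l 0 0] by simp
lemma W_minus: "W j l (- x) = - W j l x" using W_add[of j l x "-x"] by (simp add: W_0 eq_neg_iff_add_eq_0 add.commute)
lemma H_minus: "H j l (- x) = - H j l x" using H_add[of j l x "-x"] by (simp add: H_0 eq_neg_iff_add_eq_0 add.commute)
lemma W_sign: "W j l (parity_sign s x) = parity_sign s (W j l x)" by (simp add: parity_sign_def W_minus)
lemma H_sign: "H j l (parity_sign s x) = parity_sign s (H j l x)" by (simp add: parity_sign_def H_minus)

definition prefix :: "nat \<Rightarrow> (nat \<Rightarrow> int) \<Rightarrow> int" where
  "prefix j \<nu> = (\<Sum>i<j. \<nu> i)"

text \<open>The sign is the Koszul sign of a tensor product of complexes: it counts the degrees in
  front of direction \<open>j\<close>.\<close>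

definition pdiff :: "nat \<Rightarrow> ((nat \<Rightarrow> int) \<Rightarrow> 'b) \<Rightarrow> (nat \<Rightarrow> int) \<Rightarrow> 'b" where
  "pdiff j z \<nu> = parity_sign (prefix j \<nu>) (W j (\<nu> j) (z (\<nu>(j := \<nu> j + 1))))"

definition phomotopy :: "nat \<Rightarrow> ((nat \<Rightarrow> int) \<Rightarrow> 'b) \<Rightarrow> (nat \<Rightarrow> int) \<Rightarrow> 'b" where
  "phomotopy j z \<nu> = parity_sign (prefix j \<nu>) (H j (\<nu> j) (z (\<nu>(j := \<nu> j - 1))))"

text \<open>The defect of \<open>H\<close> as a contracting homotopy in direction \<open>j\<close>;
  it is zero where that direction is contracted.\<close>

definition pproj :: "nat \<Rightarrow> ((nat \<Rightarrow> int) \<Rightarrow> 'b) \<Rightarrow> (nat \<Rightarrow> int) \<Rightarrow> 'b" where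
  "pproj j z \<nu> = z \<nu> - W j (\<nu> j) (H j (\<nu> j + 1) (z \<nu>)) - H j (\<nu> j) (W j (\<nu> j - 1) (z \<nu>))"

definition tdiff :: "nat \<Rightarrow> ((nat \<Rightarrow> int) \<Rightarrow> 'b) \<Rightarrow> (nat \<Rightarrow> int) \<Rightarrow> 'b" where
  "tdiff n z \<nu> = (\<Sum>j<n. pdiff j z \<nu>)"

fun tproj :: "nat \<Rightarrow> ((nat \<Rightarrow> int) \<Rightarrow> 'b) \<Rightarrow> (nat \<Rightarrow> int) \<Rightarrow> 'b" where
  "tproj 0 z = z"
| "tproj (Suc n) z = pproj n (tproj n z)"

lemma prefix_upd: "prefix j (\<nu>(i := l)) = (if i < j then prefix j \<nu> - \<nu> i + l else prefix j \<nu>)"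
proof (cases "i < j")
  case True
  then have "{..<j} = insert i ({..<j} - {i})" by auto
  then have "prefix j \<mu> = \<mu> i + (\<Sum>k\<in>{..<j} - {i}. \<mu> k)" for \<mu>
    unfolding prefix_def by (metis finite_Diff finite_lessThan insert_Diff_single insert_absorb lessThan_iff
        True sum.insert_remove)
  then show ?thesis using True by simp
next
  case False
  then show ?thesis by (auto simp: prefix_def intro: sum.cong)
qed

lemma pdiff_add: "pdiff j (\<lambda>\<nu>. z \<nu> + w \<nu>) = (\<lambda>\<nu>. pdiff j z \<nu> + pdiff j w \<nu>)"
  by (rule ext) (simp add: pdiff_def W_add parity_sign_add)

lemma pdiff_sum: "pdiff j (\<lambda>\<nu>. \<Sum>i\<in>I. z i \<nu>) = (\<lambda>\<nu>. \<Sum>i\<in>I. pdiff j (z i) \<nu>)"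
proof (induction I rule: infinite_finite_induct)
  case (insert x F)
  then show ?case by (simp add: pdiff_add)
qed (simp_all add: pdiff_def W_0)

lemma phomotopy_add: "phomotopy j (\<lambda>\<nu>. z \<nu> + w \<nu>) = (\<lambda>\<nu>. phomotopy j z \<nu> + phomotopy j w \<nu>)"
  by (rule ext) (simp add: phomotopy_def H_add parity_sign_add)

lemma phomotopy_sum: "phomotopy j (\<lambda>\<nu>. \<Sum>i\<in>I. z i \<nu>) = (\<lambda>\<nu>. \<Sum>i\<in>I. phomotopy j (z i) \<nu>)"
proof (induction I rule: infinite_finite_induct)
  case (insert x F)
  then show ?case by (simp add: phomotopy_add)
qed (simp_all add: phomotopy_def H_0)

lemma tdiff_add: "tdiff n (\<lambda>\<nu>. z \<nu> + w \<nu>) = (\<lambda>\<nu>. tdiff n z \<nu> + tdiff n w \<nu>)"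
  by (rule ext) (simp add: tdiff_def pdiff_add sum.distrib)

lemma tdiff_0: "tdiff n (\<lambda>\<nu>. 0) = (\<lambda>\<nu>. 0)"
  by (rule ext) (simp add: tdiff_def pdiff_def W_0)

lemma tdiff_minus: "tdiff n (\<lambda>\<nu>. - z \<nu>) = (\<lambda>\<nu>. - tdiff n z \<nu>)"
  by (rule ext) (simp add: tdiff_def pdiff_def W_minus parity_sign_minus sum_negf)

lemma tdiff_diff: "tdiff n (\<lambda>\<nu>. z \<nu> - w \<nu>) = (\<lambda>\<nu>. tdiff n z \<nu> - tdiff n w \<nu>)"
  using tdiff_add[of n z "\<lambda>\<nu>. - w \<nu>"] by (simp add: tdiff_minus)

text \<open>Raising coordinate \<open>i\<close> changes the parity of \<open>prefix j\<close>, while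
  raising coordinate \<open>j\<close> leaves \<open>prefix i\<close> alone, so the two orders come
  with opposite signs.\<close>

lemma pdiff_anticommute_less:
  assumes "i < j"
  shows "pdiff i (pdiff j z) \<nu> + pdiff j (pdiff i z) \<nu> = 0"
proof -
  have "\<nu>(i := \<nu> i + 1, j := \<nu> j + 1) = \<nu>(j := \<nu> j + 1, i := \<nu> i + 1)"
    using assms by (auto simp: fun_eq_iff)
  then show ?thesis using assms
    by (simp add: pdiff_def prefix_upd W_sign W_minus W_comm[of i j] parity_sign_def)
qed

lemma pdiff_anticommute:
  assumes "i \<noteq> j"
  shows "pdiff i (pdiff j z) \<nu> + pdiff j (pdiff i z) \<nu> = 0"
  using assms pdiff_anticommute_less[of i j] pdiff_anticommute_less[of j i]
  by (metis add.commute linorder_neqE_nat)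

lemma pdiff_pdiff: "pdiff j (pdiff j z) \<nu> = 0"
  by (simp add: pdiff_def prefix_upd W_sign W_W)

lemma pdiff_phomotopy_anticommute:
  assumes "i \<noteq> j"
  shows "pdiff i (phomotopy j z) \<nu> + phomotopy j (pdiff i z) \<nu> = 0"
proof -
  have "\<nu>(i := \<nu> i + 1, j := \<nu> j - 1) = \<nu>(j := \<nu> j - 1, i := \<nu> i + 1)"
    using assms by (auto simp: fun_eq_iff)
  then show ?thesis using assms
    by (cases "i < j")
      (simp_all add: pdiff_def phomotopy_def prefix_upd W_sign H_sign W_minus H_minus WH_comm[of i j] parity_sign_def)
qed

text \<open>\<open>prefix j\<close> does not involve coordinate \<open>j\<close>, so the signs
  cancel and the one-dimensional identity remains.\<close>

lemma pdiff_phomotopy: "pdiff j (phomotopy j z) \<nu> + phomotopy j (pdiff j z) \<nu> = z \<nu> - pproj j z \<nu>"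
  by (simp add: pdiff_def phomotopy_def prefix_upd W_sign H_sign parity_sign_twice pproj_def)

lemma tdiff_tdiff: "tdiff n (tdiff n z) \<nu> = 0"
proof (induction n)
  case 0
  then show ?case by (simp add: tdiff_def)
next
  case (Suc n)
  have split: "tdiff (Suc n) y = (\<lambda>\<nu>. tdiff n y \<nu> + pdiff n y \<nu>)" for y
    by (rule ext) (simp add: tdiff_def)
  have "tdiff n (pdiff n z) \<nu> + pdiff n (tdiff n z) \<nu>
      = (\<Sum>i<n. pdiff i (pdiff n z) \<nu> + pdiff n (pdiff i z) \<nu>)"
    unfolding tdiff_def[abs_def] by (simp add: pdiff_sum sum.distrib)
  also have "\<dots> = 0" by (rule sum.neutral) (simp add: pdiff_anticommute)
  finally show ?case
    by (simp add: split tdiff_add pdiff_add Suc.IH pdiff_pdiff add.commute)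
qed

text \<open>The homotopy of direction \<open>j\<close> anticommutes with every other partial
  differential; only the terms of direction \<open>j\<close> survive.\<close>

lemma tdiff_phomotopy:
  assumes "j < n"
  shows "tdiff n (phomotopy j z) \<nu> + phomotopy j (tdiff n z) \<nu> = z \<nu> - pproj j z \<nu>"
proof -
  have "tdiff n (phomotopy j z) \<nu> + phomotopy j (tdiff n z) \<nu>
      = (\<Sum>i<n. pdiff i (phomotopy j z) \<nu> + phomotopy j (pdiff i z) \<nu>)"
    unfolding tdiff_def[abs_def] by (simp add: phomotopy_sum sum.distrib)
  also have "\<dots> = (\<Sum>i<n. if i = j then z \<nu> - pproj j z \<nu> else 0)"
    by (rule sum.cong) (auto simp: pdiff_phomotopy pdiff_phomotopy_anticommute)
  finally show ?thesis using assms by simp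
qed

text \<open>One direction at a time: on a cycle the homotopy formula loses its second term, so
  projecting in one direction changes the cycle by a boundary, and the result is again a cycle.
  Homology is therefore carried by what \<open>tproj\<close> leaves.\<close>

lemma cycle_minus_tproj_is_boundary:
  assumes cyc: "tdiff c z = (\<lambda>\<nu>. 0)" and "n \<le> c"
  shows "\<exists>y. z = (\<lambda>\<nu>. tproj n z \<nu> + tdiff c y \<nu>)"
  using \<open>n \<le> c\<close>
proof (induction n)
  case 0
  show ?case by (rule exI[of _ "\<lambda>\<nu>. 0"]) (simp add: tdiff_0)
next
  case (Suc n)
  then obtain y where y: "z = (\<lambda>\<nu>. tproj n z \<nu> + tdiff c y \<nu>)" by auto
  define w where "w = tproj n z"
  have w: "w = (\<lambda>\<nu>. z \<nu> - tdiff c y \<nu>)"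
    using fun_cong[OF y] by (auto simp: w_def fun_eq_iff eq_diff_eq)
  have "tdiff c w = (\<lambda>\<nu>. 0)"
    unfolding w by (simp add: tdiff_diff cyc tdiff_tdiff)
  then have "phomotopy n (tdiff c w) = (\<lambda>\<nu>. 0)"
    by (simp add: phomotopy_def[abs_def] H_0)
  then have "tdiff c (phomotopy n w) \<nu> = w \<nu> - pproj n w \<nu>" for \<nu>
    using tdiff_phomotopy[of n c w \<nu>] Suc.prems by simp
  moreover have "z \<nu> = w \<nu> + tdiff c y \<nu>" for \<nu> using fun_cong[OF w, of \<nu>] by simp
  ultimately have "z = (\<lambda>\<nu>. tproj (Suc n) z \<nu> + tdiff c (\<lambda>\<nu>. phomotopy n w \<nu> + y \<nu>) \<nu>)"
    by (simp add: tdiff_add fun_eq_iff w_def[symmetric])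
  then show ?case by blast
qed

end

section \<open>Linear algebra over the ground field\<close>

lemma ground_field_simps [simp]:
  "carrier (ground_field :: 'k::field ring) = UNIV"
  "x \<otimes>\<^bsub>(ground_field :: 'k::field ring)\<^esub> y = x * y"
  "\<one>\<^bsub>(ground_field :: 'k::field ring)\<^esub> = 1"
  "\<zero>\<^bsub>(ground_field :: 'k::field ring)\<^esub> = 0"
  "x \<oplus>\<^bsub>(ground_field :: 'k::field ring)\<^esub> y = x + y"
  by (auto simp: ring_of_type_algebra_def)

lemma with_smult_simps [simp]:
  "carrier (with_smult M s) = carrier M"
  "x \<otimes>\<^bsub>with_smult M s\<^esub> y = x \<otimes>\<^bsub>M\<^esub> y"
  "\<one>\<^bsub>with_smult M s\<^esub> = \<one>\<^bsub>M\<^esub>"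
  "\<zero>\<^bsub>with_smult M s\<^esub> = \<zero>\<^bsub>M\<^esub>"
  "x \<oplus>\<^bsub>with_smult M s\<^esub> y = x \<oplus>\<^bsub>M\<^esub> y"
  "r \<odot>\<^bsub>with_smult M s\<^esub> y = s r y"
  by (auto simp: with_smult_def ring.defs module.defs)

text \<open>A submodule, stated as a single closure condition that passes easily from
  \<open>E\<close> to the ground field.\<close>

definition axpy_closed :: "('r, 'z) ring_scheme \<Rightarrow> ('r, 'm) module \<Rightarrow> 'm set \<Rightarrow> bool" where
  "axpy_closed R M U \<longleftrightarrow> \<zero>\<^bsub>M\<^esub> \<in> U \<and> U \<subseteq> carrier M
     \<and> (\<forall>r\<in>carrier R. \<forall>x\<in>U. \<forall>y\<in>U. r \<odot>\<^bsub>M\<^esub> x \<oplus>\<^bsub>M\<^esub> y \<in> U)"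

text \<open>That \<open>V\<close> is a vector space is part of the conclusion: all axioms are pulled
  back along the injective coordinate map. This suits quotients, whose elements are cosets.\<close>

lemma fd_space_if_coordinates:
  fixes V :: "('k::field, 'v) module" and \<Theta> :: "'v \<Rightarrow> 'x \<Rightarrow> 'k"
  assumes fin: "finite S"
    and bij: "bij_betw \<Theta> (carrier V) {f. \<forall>x. x \<notin> S \<longrightarrow> f x = 0}"
    and zero: "\<zero>\<^bsub>V\<^esub> \<in> carrier V" "\<And>x. \<Theta> \<zero>\<^bsub>V\<^esub> x = 0"
    and add: "\<And>v w. v \<in> carrier V \<Longrightarrow> w \<in> carrier V \<Longrightarrow> v \<oplus>\<^bsub>V\<^esub> w \<in> carrier V"
      "\<And>v w x. v \<in> carrier V \<Longrightarrow> w \<in> carrier V \<Longrightarrow> \<Theta> (v \<oplus>\<^bsub>V\<^esub> w) x = \<Theta> v x + \<Theta> w x"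
    and smult: "\<And>r v. v \<in> carrier V \<Longrightarrow> r \<odot>\<^bsub>V\<^esub> v \<in> carrier V"
      "\<And>r v x. v \<in> carrier V \<Longrightarrow> \<Theta> (r \<odot>\<^bsub>V\<^esub> v) x = r * \<Theta> v x"
  shows "fd_space V \<and> k_dim V = card S"
proof -
  have inj: "v = w" if "v \<in> carrier V" "w \<in> carrier V" "\<And>x. \<Theta> v x = \<Theta> w x" for v w
    using bij that inj_onD[of \<Theta> "carrier V" v w] ext[of "\<Theta> v" "\<Theta> w"] by (simp add: bij_betw_def)
  have field: "Ring.field (ground_field :: 'k ring)" by (rule field_from_type_algebra)
  then interpret K: Ring.field "ground_field :: 'k ring" .
  have surj: "\<exists>v\<in>carrier V. \<Theta> v = f" if "\<And>x. x \<notin> S \<Longrightarrow> f x = 0" for f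
  proof -
    have "f \<in> \<Theta> ` carrier V" using bij that by (auto simp: bij_betw_def)
    then show ?thesis by auto
  qed
  have out: "\<Theta> v x = 0" if "v \<in> carrier V" "x \<notin> S" for v x
    using bij that by (auto simp: bij_betw_def)
  have neg: "\<exists>w\<in>carrier V. w \<oplus>\<^bsub>V\<^esub> v = \<zero>\<^bsub>V\<^esub>" if "v \<in> carrier V" for v
    by (rule bexI[of _ "(-1) \<odot>\<^bsub>V\<^esub> v"]) (auto intro!: inj simp: add smult zero that)
  have grp: "abelian_group V"
    by (rule abelian_groupI) (auto intro!: inj simp: add zero neg algebra_simps)
  have mod: "Module.module (ground_field :: 'k ring) V"
    by (rule moduleI) (auto intro!: inj grp K.is_cring simp: add smult zero algebra_simps)
  interpret V: vectorspace "ground_field :: 'k ring" V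
    using mod field by (simp add: vectorspace_def)
  \<comment> \<open>Preimages of the indicator functions; they become the basis.\<close>
  define e where "e x = (SOME v. v \<in> carrier V \<and> \<Theta> v = (\<lambda>y. if y = x then 1 else 0))" for x
  have e: "e x \<in> carrier V \<and> \<Theta> (e x) = (\<lambda>y. if y = x then 1 else 0)" if "x \<in> S" for x
  proof -
    have "\<exists>v\<in>carrier V. \<Theta> v = (\<lambda>y. if y = x then 1 else 0)"
      by (rule surj) (use that in auto)
    then show ?thesis unfolding e_def Bex_def by (rule someI_ex)
  qed
  have inje: "inj_on e S"
  proof (rule inj_onI)
    fix x y assume "x \<in> S" "y \<in> S" "e x = e y"
    have "\<Theta> (e x) x = 1" using e[OF \<open>x \<in> S\<close>] by simp
    moreover have "\<Theta> (e y) x = (if x = y then 1 else 0)" using e[OF \<open>y \<in> S\<close>] by simp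
    ultimately show "x = y" using \<open>e x = e y\<close> by (simp split: if_splits)
  qed
  have lc: "V.lincomb k (e ` F) \<in> carrier V \<and> \<Theta> (V.lincomb k (e ` F)) = (\<lambda>y. if y \<in> F then k (e y) else 0)"
    if "finite F" "F \<subseteq> S" for k F
    using that
  proof (induction F)
    case empty
    show ?case by (auto simp: V.lincomb_def zero)
  next
    case (insert x F)
    have nin: "e x \<notin> e ` F" using insert inje by (auto simp: inj_on_def)
    have eF: "e ` F \<subseteq> carrier V" "e x \<in> carrier V" using insert e by auto
    have "V.lincomb k (e ` insert x F) = k (e x) \<odot>\<^bsub>V\<^esub> e x \<oplus>\<^bsub>V\<^esub> V.lincomb k (e ` F)"
      unfolding V.lincomb_def image_insert
      using insert.hyps nin eF by (subst V.finsum_insert) (auto simp: smult Pi_def)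
    then show ?case using insert eF nin e[of x] by (auto simp: add smult fun_eq_iff)
  qed
  have li: "V.lin_indpt (e ` S)"
  proof
    assume "V.lin_dep (e ` S)"
    then obtain B k v where B: "finite B" "B \<subseteq> e ` S" "V.lincomb k B = \<zero>\<^bsub>V\<^esub>" "v \<in> B" "k v \<noteq> 0"
      unfolding V.lin_dep_def by auto
    then obtain F where F: "F \<subseteq> S" "B = e ` F" by (meson subset_image_iff)
    have "finite F" using F fin finite_subset by blast
    obtain x where x: "x \<in> F" "v = e x" using B F by auto
    have "\<Theta> (V.lincomb k B) x = k (e x)" using lc[OF \<open>finite F\<close> F(1)] F x by auto
    then show False using B x zero(2) by auto
  qed
  have sp: "carrier V \<subseteq> V.span (e ` S)"
  proof
    fix v assume v: "v \<in> carrier V"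
    define k where "k w = \<Theta> v (the_inv_into S e w)" for w
    have "k (e x) = \<Theta> v x" if "x \<in> S" for x
      using that inje by (simp add: k_def the_inv_into_f_f)
    then have v_eq: "v = V.lincomb k (e ` S)"
      using lc[OF fin subset_refl, of k] v by (auto intro!: inj simp: out)
    have "V.lincomb k (e ` S) \<in> V.span (e ` S)"
      unfolding V.span_def using fin by (intro CollectI exI[of _ k] exI[of _ "e ` S"]) simp
    then show "v \<in> V.span (e ` S)" by (simp only: v_eq[symmetric])
  qed
  have eS: "e ` S \<subseteq> carrier V" using e by auto
  have gen: "V.gen_set (e ` S)" using sp V.span_is_subset2[OF eS] by auto
  have fd: "V.fin_dim" unfolding V.fin_dim_def using gen fin eS by blast
  have "V.basis (e ` S)" unfolding V.basis_def using li gen eS by auto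
  then have "V.dim = card (e ` S)" by (intro V.dim_basis) (use fin in auto)
  then show ?thesis unfolding fd_space_def k_dim_def
    using fd V.vectorspace_axioms card_image[OF inje] by simp
qed

definition functional_on :: "('k::field, 'v) module \<Rightarrow> 'v set \<Rightarrow> ('v \<Rightarrow> 'k) \<Rightarrow> bool" where
  "functional_on V U \<psi> \<longleftrightarrow> (\<forall>r. \<forall>x\<in>U. \<forall>y\<in>U. \<psi> (r \<odot>\<^bsub>V\<^esub> x \<oplus>\<^bsub>V\<^esub> y) = r * \<psi> x + \<psi> y)"

lemma axpy_closedD:
  assumes "axpy_closed (ground_field :: 'k::field ring) V U"
  shows "\<zero>\<^bsub>V\<^esub> \<in> U" "x \<in> U \<Longrightarrow> x \<in> carrier V"
    "x \<in> U \<Longrightarrow> y \<in> U \<Longrightarrow> r \<odot>\<^bsub>V\<^esub> x \<oplus>\<^bsub>V\<^esub> y \<in> U"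
  using assms by (auto simp: axpy_closed_def)

text \<open>Zorn's lemma among the subspaces that contain \<open>U\<close> and avoid
  \<open>z\<close>; it stands in for a choice of basis, as \<open>V\<close> may have infinite
  dimension.\<close>

lemma ex_maximal_subspace:
  fixes V :: "('k::field, 'v) module"
  assumes U: "axpy_closed (ground_field :: 'k ring) V U" and z: "z \<notin> U"
  shows "\<exists>H. axpy_closed (ground_field :: 'k ring) V H \<and> U \<subseteq> H \<and> z \<notin> H
    \<and> (\<forall>H'. axpy_closed (ground_field :: 'k ring) V H' \<and> H \<subseteq> H' \<and> z \<notin> H' \<longrightarrow> H' = H)"
proof -
  define S where "S = {H. axpy_closed (ground_field :: 'k ring) V H \<and> U \<subseteq> H \<and> z \<notin> H}"
  have "\<exists>M\<in>S. \<forall>Y\<in>S. M \<subseteq> Y \<longrightarrow> Y = M"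
  proof (rule subset_Zorn_nonempty)
    show "S \<noteq> {}" using U z by (auto simp: S_def)
    fix C assume C: "C \<noteq> {}" "subset.chain S C"
    have CS: "axpy_closed (ground_field :: 'k ring) V H" "U \<subseteq> H" "z \<notin> H" if "H \<in> C" for H
      using C that by (auto simp: S_def subset.chain_def)
    have "axpy_closed (ground_field :: 'k ring) V (\<Union>C)"
      unfolding axpy_closed_def
    proof (intro conjI ballI)
      obtain H where "H \<in> C" using C(1) by blast
      then show "\<zero>\<^bsub>V\<^esub> \<in> \<Union>C" using axpy_closedD(1)[OF CS(1)] by auto
      show "\<Union>C \<subseteq> carrier V" using axpy_closedD(2)[OF CS(1)] by auto
      fix r :: 'k and x y assume "x \<in> \<Union>C" "y \<in> \<Union>C"
      then obtain H H' where H: "H \<in> C" "H' \<in> C" "x \<in> H" "y \<in> H'" by auto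
      then have "H \<subseteq> H' \<or> H' \<subseteq> H" using C(2) by (auto simp: subset.chain_def)
      then obtain H'' where "H'' \<in> C" "x \<in> H''" "y \<in> H''" using H by blast
      then show "r \<odot>\<^bsub>V\<^esub> x \<oplus>\<^bsub>V\<^esub> y \<in> \<Union>C" using axpy_closedD(3)[OF CS(1)] by blast
    qed
    then show "\<Union>C \<in> S" using C(1) CS(2,3) by (auto simp: S_def)
  qed
  then obtain M where M: "M \<in> S" "\<And>Y. Y \<in> S \<Longrightarrow> M \<subseteq> Y \<Longrightarrow> Y = M" by auto
  show ?thesis
    by (rule exI[of _ M]) (use M in \<open>auto simp: S_def\<close>)
qed

text \<open>A maximal subspace \<open>H\<close> avoiding \<open>z\<close> is a complement of the
  line through \<open>z\<close>, and the functional is the coefficient of \<open>z\<close> in this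
  decomposition.\<close>

lemma functional_separation:
  fixes V :: "('k::field, 'v) module"
  assumes V: "Module.module (ground_field :: 'k ring) V"
    and U: "axpy_closed (ground_field :: 'k ring) V U" and z: "z \<in> carrier V" "z \<notin> U"
  shows "\<exists>\<psi>. functional_on V (carrier V) \<psi> \<and> (\<forall>u\<in>U. \<psi> u = 0) \<and> \<psi> z = 1"
proof -
  interpret V: Module.module "ground_field :: 'k ring" V by (rule V)
  have sc [simp]: "r \<odot>\<^bsub>V\<^esub> x \<in> carrier V" if "x \<in> carrier V" for r x
    using V.smult_closed[of r x] that by simp
  have assoc: "r \<odot>\<^bsub>V\<^esub> (s \<odot>\<^bsub>V\<^esub> x) = (r * s) \<odot>\<^bsub>V\<^esub> x" if "x \<in> carrier V" for r s x
    using V.smult_assoc1[of r s x] that by simp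
  have ldist: "(r + s) \<odot>\<^bsub>V\<^esub> x = r \<odot>\<^bsub>V\<^esub> x \<oplus>\<^bsub>V\<^esub> s \<odot>\<^bsub>V\<^esub> x" if "x \<in> carrier V" for r s x
    using V.smult_l_distr[of r s x] that by simp
  have rdist: "r \<odot>\<^bsub>V\<^esub> (x \<oplus>\<^bsub>V\<^esub> y) = r \<odot>\<^bsub>V\<^esub> x \<oplus>\<^bsub>V\<^esub> r \<odot>\<^bsub>V\<^esub> y" if "x \<in> carrier V" "y \<in> carrier V" for r x y
    using V.smult_r_distr[of r x y] that by simp
  have one: "1 \<odot>\<^bsub>V\<^esub> x = x" if "x \<in> carrier V" for x
    using V.smult_one[of x] that by simp
  have zero: "0 \<odot>\<^bsub>V\<^esub> x = \<zero>\<^bsub>V\<^esub>" if "x \<in> carrier V" for x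
    using V.smult_l_null[of x] that by simp
  obtain H where H: "axpy_closed (ground_field :: 'k ring) V H" "U \<subseteq> H" "z \<notin> H"
    and max: "\<And>H'. axpy_closed (ground_field :: 'k ring) V H' \<Longrightarrow> H \<subseteq> H' \<Longrightarrow> z \<notin> H' \<Longrightarrow> H' = H"
    using ex_maximal_subspace[OF U z(2)] by blast
  note HD = axpy_closedD[OF H(1)]
  have Hs: "r \<odot>\<^bsub>V\<^esub> h \<in> H" if "h \<in> H" for r h
    using HD(3)[OF that HD(1), of r] HD(2)[OF that] by simp
  have Ha: "h \<oplus>\<^bsub>V\<^esub> h' \<in> H" if "h \<in> H" "h' \<in> H" for h h'
    using HD(3)[OF that, of 1] one HD(2) that by simp
  have ex: "\<exists>c. \<exists>h\<in>H. v = c \<odot>\<^bsub>V\<^esub> z \<oplus>\<^bsub>V\<^esub> h" if v: "v \<in> carrier V" for v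
  proof (cases "v \<in> H")
    case True
    then show ?thesis using z v by (intro exI[of _ 0] bexI[of _ v]) (auto simp: zero)
  next
    case False
    \<comment> \<open>Adjoining \<open>v\<close> to \<open>H\<close> gives a strictly larger
      subspace, which by maximality contains \<open>z\<close>; solving for \<open>v\<close> places
      it in the sum of the line and \<open>H\<close>.\<close>
    define H' where "H' = {a \<odot>\<^bsub>V\<^esub> v \<oplus>\<^bsub>V\<^esub> h | a h. h \<in> H}"
    have HH': "H \<subseteq> H'"
    proof
      fix h assume "h \<in> H"
      then show "h \<in> H'" unfolding H'_def using v HD(2)
        by (intro CollectI exI[of _ 0] exI[of _ h]) (auto simp: zero)
    qed
    have "v \<in> H'" unfolding H'_def using v HD(1)
      by (intro CollectI exI[of _ 1] exI[of _ "\<zero>\<^bsub>V\<^esub>"]) (auto simp: one)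
    moreover have "axpy_closed (ground_field :: 'k ring) V H'"
      unfolding axpy_closed_def
    proof (intro conjI ballI)
      show "\<zero>\<^bsub>V\<^esub> \<in> H'" using HH' HD(1) by auto
      show "H' \<subseteq> carrier V" using v HD(2) by (auto simp: H'_def)
      fix r :: 'k and x y assume "x \<in> H'" "y \<in> H'"
      then obtain a h b k where xy: "x = a \<odot>\<^bsub>V\<^esub> v \<oplus>\<^bsub>V\<^esub> h" "y = b \<odot>\<^bsub>V\<^esub> v \<oplus>\<^bsub>V\<^esub> k" "h \<in> H" "k \<in> H"
        by (auto simp: H'_def)
      have "r \<odot>\<^bsub>V\<^esub> x \<oplus>\<^bsub>V\<^esub> y = (r * a + b) \<odot>\<^bsub>V\<^esub> v \<oplus>\<^bsub>V\<^esub> (r \<odot>\<^bsub>V\<^esub> h \<oplus>\<^bsub>V\<^esub> k)"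
        using v xy HD(2) by (simp add: rdist ldist assoc V.a_ac)
      then show "r \<odot>\<^bsub>V\<^esub> x \<oplus>\<^bsub>V\<^esub> y \<in> H'"
        unfolding H'_def using HD(3)[OF xy(3,4)] by blast
    qed
    ultimately have "z \<in> H'" using max[of H'] HH' False by blast
    then obtain a h where ah: "z = a \<odot>\<^bsub>V\<^esub> v \<oplus>\<^bsub>V\<^esub> h" "h \<in> H" by (auto simp: H'_def)
    have "a \<noteq> 0" using ah H(3) v HD(2) by (auto simp: zero)
    then have "v = (1 / a) \<odot>\<^bsub>V\<^esub> z \<oplus>\<^bsub>V\<^esub> (- 1 / a) \<odot>\<^bsub>V\<^esub> h"
      using ah v HD(2)[OF ah(2)] ldist[of h "1 / a" "- 1 / a"]
      by (simp add: rdist assoc one V.a_assoc zero)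
    then show ?thesis using Hs[OF ah(2)] by blast
  qed
  have uniq: "c = c'" if "c \<odot>\<^bsub>V\<^esub> z \<oplus>\<^bsub>V\<^esub> h = c' \<odot>\<^bsub>V\<^esub> z \<oplus>\<^bsub>V\<^esub> h'" "h \<in> H" "h' \<in> H" for c c' h h'
  proof (rule ccontr)
    assume ne: "c \<noteq> c'"
    \<comment> \<open>Otherwise a nonzero multiple of \<open>z\<close> would lie in
      \<open>H\<close>.\<close>
    have "(c - c') \<odot>\<^bsub>V\<^esub> z = (c \<odot>\<^bsub>V\<^esub> z \<oplus>\<^bsub>V\<^esub> h) \<oplus>\<^bsub>V\<^esub> ((- c') \<odot>\<^bsub>V\<^esub> z \<oplus>\<^bsub>V\<^esub> (-1) \<odot>\<^bsub>V\<^esub> h)"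
    proof -
      have "h \<oplus>\<^bsub>V\<^esub> (-1) \<odot>\<^bsub>V\<^esub> h = \<zero>\<^bsub>V\<^esub>"
        using ldist[of h 1 "-1"] HD(2)[OF that(2)] by (simp add: one zero)
      then have "(c \<odot>\<^bsub>V\<^esub> z \<oplus>\<^bsub>V\<^esub> h) \<oplus>\<^bsub>V\<^esub> ((- c') \<odot>\<^bsub>V\<^esub> z \<oplus>\<^bsub>V\<^esub> (-1) \<odot>\<^bsub>V\<^esub> h) = c \<odot>\<^bsub>V\<^esub> z \<oplus>\<^bsub>V\<^esub> (- c') \<odot>\<^bsub>V\<^esub> z"
        using HD(2)[OF that(2)] z(1) V.a_assoc[of "c \<odot>\<^bsub>V\<^esub> z" h "(- c') \<odot>\<^bsub>V\<^esub> z \<oplus>\<^bsub>V\<^esub> (-1) \<odot>\<^bsub>V\<^esub> h"]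
          V.a_lcomm[of h "(- c') \<odot>\<^bsub>V\<^esub> z" "(-1) \<odot>\<^bsub>V\<^esub> h"] by simp
      then show ?thesis using ldist[of z c "- c'"] z(1) by simp
    qed
    also have "\<dots> = (c' \<odot>\<^bsub>V\<^esub> z \<oplus>\<^bsub>V\<^esub> (- c') \<odot>\<^bsub>V\<^esub> z) \<oplus>\<^bsub>V\<^esub> (h' \<oplus>\<^bsub>V\<^esub> (-1) \<odot>\<^bsub>V\<^esub> h)"
      unfolding that(1) using HD(2) that(2,3) z(1) by (simp add: V.a_ac)
    also have "\<dots> = h' \<oplus>\<^bsub>V\<^esub> (-1) \<odot>\<^bsub>V\<^esub> h"
      using ldist[of z c' "- c'"] z(1) HD(2) that(2,3) by (simp add: zero)
    finally have "(c - c') \<odot>\<^bsub>V\<^esub> z \<in> H" using Ha Hs that(2,3) by simp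
    then have "(1 / (c - c')) \<odot>\<^bsub>V\<^esub> ((c - c') \<odot>\<^bsub>V\<^esub> z) \<in> H" by (rule Hs)
    then show False using H(3) z(1) ne by (simp add: assoc one)
  qed
  define \<psi> where "\<psi> v = (THE c. \<exists>h\<in>H. v = c \<odot>\<^bsub>V\<^esub> z \<oplus>\<^bsub>V\<^esub> h)" for v
  have \<psi>: "\<psi> (c \<odot>\<^bsub>V\<^esub> z \<oplus>\<^bsub>V\<^esub> h) = c" if "h \<in> H" for c h
    unfolding \<psi>_def using that by (intro the_equality) (auto dest: uniq)
  have "functional_on V (carrier V) \<psi>"
    unfolding functional_on_def
  proof (intro ballI allI)
    fix r x y assume "x \<in> carrier V" "y \<in> carrier V"
    then obtain c h d k where xy: "x = c \<odot>\<^bsub>V\<^esub> z \<oplus>\<^bsub>V\<^esub> h" "h \<in> H" "y = d \<odot>\<^bsub>V\<^esub> z \<oplus>\<^bsub>V\<^esub> k" "k \<in> H"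
      using ex by meson
    have "r \<odot>\<^bsub>V\<^esub> x \<oplus>\<^bsub>V\<^esub> y = (r * c + d) \<odot>\<^bsub>V\<^esub> z \<oplus>\<^bsub>V\<^esub> (r \<odot>\<^bsub>V\<^esub> h \<oplus>\<^bsub>V\<^esub> k)"
      using z(1) xy HD(2) by (simp add: rdist ldist assoc V.a_ac)
    then show "\<psi> (r \<odot>\<^bsub>V\<^esub> x \<oplus>\<^bsub>V\<^esub> y) = r * \<psi> x + \<psi> y"
      using \<psi> HD(3)[OF xy(2,4)] xy by simp
  qed
  moreover have "\<psi> u = 0" if "u \<in> U" for u
    using \<psi>[of u 0] that H(2) HD(2) z(1) by (auto simp: zero subset_iff)
  moreover have "\<psi> z = 1" using \<psi>[OF HD(1), of 1] z(1) by (simp add: one)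
  ultimately show ?thesis by blast
qed

text \<open>Reduction to separation: choose \<open>u0\<close> with value 1 and separate it from the
  kernel of \<open>g\<close>. Since u - g(u) u0 lies in that kernel, the separating functional
  agrees with \<open>g\<close> on \<open>U\<close>.\<close>

lemma functional_extension:
  fixes V :: "('k::field, 'v) module"
  assumes V: "Module.module (ground_field :: 'k ring) V"
    and U: "axpy_closed (ground_field :: 'k ring) V U" and g: "functional_on V U g"
  shows "\<exists>\<psi>. functional_on V (carrier V) \<psi> \<and> (\<forall>u\<in>U. \<psi> u = g u)"
proof (cases "\<forall>u\<in>U. g u = 0")
  case True
  then show ?thesis by (intro exI[of _ "\<lambda>_. 0"]) (simp add: functional_on_def)
next
  case False
  interpret V: Module.module "ground_field :: 'k ring" V by (rule V)
  note UD = axpy_closedD[OF U]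
  have lin: "g (r \<odot>\<^bsub>V\<^esub> x \<oplus>\<^bsub>V\<^esub> y) = r * g x + g y" if "x \<in> U" "y \<in> U" for r x y
    using g that by (auto simp: functional_on_def)
  have g0: "g \<zero>\<^bsub>V\<^esub> = 0" using lin[OF UD(1) UD(1), of "-1"] V.smult_r_null[of "-1"] by simp
  have lin1: "g (r \<odot>\<^bsub>V\<^esub> x) = r * g x" if "x \<in> U" for r x
    using lin[OF that UD(1), of r] V.smult_closed[of r x] UD(2)[OF that] by (simp add: g0)
  obtain u1 where u1: "u1 \<in> U" "g u1 \<noteq> 0" using False by auto
  define u0 where "u0 = (1 / g u1) \<odot>\<^bsub>V\<^esub> u1"
  have u0: "u0 \<in> U" "g u0 = 1"
    using UD(3)[OF u1(1) UD(1), of "1 / g u1"] UD(2)[OF u1(1)] V.smult_closed[of "1 / g u1" u1] u1 lin1[OF u1(1)]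
    by (simp_all add: u0_def)
  define H where "H = {u \<in> U. g u = 0}"
  have H: "axpy_closed (ground_field :: 'k ring) V H"
    unfolding axpy_closed_def H_def using UD by (auto simp: lin g0)
  obtain \<psi> where \<psi>: "functional_on V (carrier V) \<psi>" "\<And>u. u \<in> H \<Longrightarrow> \<psi> u = 0" "\<psi> u0 = 1"
    using functional_separation[OF V H, of u0] u0 UD(2) by (auto simp: H_def)
  have "\<psi> u = g u" if u: "u \<in> U" for u
  proof -
    have "\<psi> ((- g u) \<odot>\<^bsub>V\<^esub> u0 \<oplus>\<^bsub>V\<^esub> u) = 0"
      by (rule \<psi>(2)) (use u u0 UD(3) in \<open>auto simp: H_def lin\<close>)
    moreover have "\<psi> ((- g u) \<odot>\<^bsub>V\<^esub> u0 \<oplus>\<^bsub>V\<^esub> u) = (- g u) * \<psi> u0 + \<psi> u"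
      using \<psi>(1) u u0(1) UD(2) by (simp add: functional_on_def)
    ultimately show ?thesis using \<psi>(3) by simp
  qed
  then show ?thesis using \<psi>(1) by blast
qed

section \<open>Quotients, homology and restriction of scalars\<close>

lemma restrict_scalars_simps [simp]:
  "carrier (restrict_scalars R M) = carrier M"
  "\<zero>\<^bsub>restrict_scalars R M\<^esub> = \<zero>\<^bsub>M\<^esub>"
  "x \<oplus>\<^bsub>restrict_scalars R M\<^esub> y = x \<oplus>\<^bsub>M\<^esub> y"
  "r \<odot>\<^bsub>restrict_scalars R M\<^esub> y = (r \<odot>\<^bsub>R\<^esub> \<one>\<^bsub>R\<^esub>) \<odot>\<^bsub>M\<^esub> y"
  by (auto simp: restrict_scalars_def)

lemma quotient_simps:
  "carrier (quotient M B) = {B +>\<^bsub>M\<^esub> x | x. x \<in> carrier M}"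
  "\<zero>\<^bsub>quotient M B\<^esub> = B"
  "C \<oplus>\<^bsub>quotient M B\<^esub> D = C <+>\<^bsub>M\<^esub> D"
  "r \<odot>\<^bsub>quotient M B\<^esub> C = (\<Union>x\<in>C. B +>\<^bsub>M\<^esub> (r \<odot>\<^bsub>M\<^esub> x))"
  by (auto simp: quotient_def FactRing_def A_RCOSETS_def')

lemma submoduleD:
  assumes M: "Module.module R M" and U: "axpy_closed R M U"
  shows "\<zero>\<^bsub>M\<^esub> \<in> U" "x \<in> U \<Longrightarrow> x \<in> carrier M"
    "x \<in> U \<Longrightarrow> y \<in> U \<Longrightarrow> x \<oplus>\<^bsub>M\<^esub> y \<in> U"
    "r \<in> carrier R \<Longrightarrow> x \<in> U \<Longrightarrow> r \<odot>\<^bsub>M\<^esub> x \<in> U"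
    "x \<in> U \<Longrightarrow> \<ominus>\<^bsub>M\<^esub> x \<in> U"
proof -
  interpret M: Module.module R M by (rule M)
  show zero: "\<zero>\<^bsub>M\<^esub> \<in> U" using U by (simp add: axpy_closed_def)
  show sub: "x \<in> U \<Longrightarrow> x \<in> carrier M" for x using U by (auto simp: axpy_closed_def)
  have axpy: "r \<odot>\<^bsub>M\<^esub> x \<oplus>\<^bsub>M\<^esub> y \<in> U" if "r \<in> carrier R" "x \<in> U" "y \<in> U" for r x y
    using U that by (simp add: axpy_closed_def)
  show "x \<in> U \<Longrightarrow> y \<in> U \<Longrightarrow> x \<oplus>\<^bsub>M\<^esub> y \<in> U" using axpy[of "\<one>\<^bsub>R\<^esub>" x y] sub by simp
  show sm: "r \<in> carrier R \<Longrightarrow> x \<in> U \<Longrightarrow> r \<odot>\<^bsub>M\<^esub> x \<in> U" for r x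
    using axpy[OF _ _ zero, of r x] sub by simp
  show "x \<in> U \<Longrightarrow> \<ominus>\<^bsub>M\<^esub> x \<in> U"
    using sm[of "\<ominus>\<^bsub>R\<^esub> \<one>\<^bsub>R\<^esub>" x] sub M.smult_l_minus[of "\<one>\<^bsub>R\<^esub>" x] by simp
qed

lemma module_homD:
  assumes "f \<in> Hom R M N"
  shows "x \<in> carrier M \<Longrightarrow> f x \<in> carrier N"
    "x \<in> carrier M \<Longrightarrow> y \<in> carrier M \<Longrightarrow> f (x \<oplus>\<^bsub>M\<^esub> y) = f x \<oplus>\<^bsub>N\<^esub> f y"
    "r \<in> carrier R \<Longrightarrow> x \<in> carrier M \<Longrightarrow> f (r \<odot>\<^bsub>M\<^esub> x) = r \<odot>\<^bsub>N\<^esub> f x"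
  using assms by (auto simp: LinearCombinations.module_hom_def)

lemma module_homI:
  assumes "\<And>x. x \<in> carrier M \<Longrightarrow> f x \<in> carrier N"
    "\<And>x y. x \<in> carrier M \<Longrightarrow> y \<in> carrier M \<Longrightarrow> f (x \<oplus>\<^bsub>M\<^esub> y) = f x \<oplus>\<^bsub>N\<^esub> f y"
    "\<And>r x. r \<in> carrier R \<Longrightarrow> x \<in> carrier M \<Longrightarrow> f (r \<odot>\<^bsub>M\<^esub> x) = r \<odot>\<^bsub>N\<^esub> f x"
  shows "f \<in> Hom R M N"
  using assms by (auto simp: LinearCombinations.module_hom_def)

lemma module_hom_zero:
  assumes "Module.module R M" "Module.module R N" "f \<in> Hom R M N"
  shows "f \<zero>\<^bsub>M\<^esub> = \<zero>\<^bsub>N\<^esub>"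
proof -
  interpret M: Module.module R M by fact
  interpret N: Module.module R N by fact
  have "f (\<zero>\<^bsub>R\<^esub> \<odot>\<^bsub>M\<^esub> \<zero>\<^bsub>M\<^esub>) = \<zero>\<^bsub>R\<^esub> \<odot>\<^bsub>N\<^esub> f \<zero>\<^bsub>M\<^esub>" by (rule module_homD(3)[OF assms(3)]) auto
  then show ?thesis using module_homD(1)[OF assms(3), of "\<zero>\<^bsub>M\<^esub>"] by simp
qed

lemma axpy_closed_kernel:
  assumes M: "Module.module R M" and N: "Module.module R N"
    and f: "f \<in> Hom R M N"
  shows "axpy_closed R M (kernel_of M f N)"
proof -
  interpret M: Module.module R M by fact
  interpret N: Module.module R N by fact
  show ?thesis
    using module_hom_zero[OF M N f] by (auto simp: axpy_closed_def kernel_of_def module_homD[OF f])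
qed

lemma axpy_closed_image:
  assumes M: "Module.module R M" and N: "Module.module R N"
    and f: "f \<in> Hom R M N"
  shows "axpy_closed R N (f ` carrier M)"
proof -
  interpret M: Module.module R M by fact
  interpret N: Module.module R N by fact
  show ?thesis unfolding axpy_closed_def
  proof (intro conjI ballI)
    show "\<zero>\<^bsub>N\<^esub> \<in> f ` carrier M" using module_hom_zero[OF M N f] by (metis M.zero_closed image_eqI)
    show "f ` carrier M \<subseteq> carrier N" using module_homD(1)[OF f] by auto
    fix r x y assume "r \<in> carrier R" "x \<in> f ` carrier M" "y \<in> f ` carrier M"
    then obtain x' y' where "r \<in> carrier R" "x' \<in> carrier M" "y' \<in> carrier M" "x = f x'" "y = f y'" by auto
    then show "r \<odot>\<^bsub>N\<^esub> x \<oplus>\<^bsub>N\<^esub> y \<in> f ` carrier M"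
      by (intro image_eqI[of _ _ "r \<odot>\<^bsub>M\<^esub> x' \<oplus>\<^bsub>M\<^esub> y'"]) (auto simp: module_homD[OF f])
  qed
qed

text \<open>A linear map from the cycles onto the functions on a finite set, with the boundaries as
  kernel, computes the dimension of the homology. Linearity over \<open>k\<close> is phrased through
  the elements r 1 of \<open>E\<close>, matching \<open>restrict_scalars\<close>.\<close>

lemma dim_quotient:
  fixes E :: "('k::field, 'r) module" and M :: "('r, 'm) module" and \<Theta> :: "'m \<Rightarrow> 'x \<Rightarrow> 'k"
  assumes M: "Module.module E M" and Z: "axpy_closed E M Z" and B: "axpy_closed E M B" "B \<subseteq> Z"
    and scal: "\<And>r. r \<odot>\<^bsub>E\<^esub> \<one>\<^bsub>E\<^esub> \<in> carrier E"
    and fin: "finite S"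
    and add: "\<And>x y i. x \<in> Z \<Longrightarrow> y \<in> Z \<Longrightarrow> \<Theta> (x \<oplus>\<^bsub>M\<^esub> y) i = \<Theta> x i + \<Theta> y i"
    and smult: "\<And>r x i. x \<in> Z \<Longrightarrow> \<Theta> ((r \<odot>\<^bsub>E\<^esub> \<one>\<^bsub>E\<^esub>) \<odot>\<^bsub>M\<^esub> x) i = r * \<Theta> x i"
    and supp: "\<And>x i. x \<in> Z \<Longrightarrow> i \<notin> S \<Longrightarrow> \<Theta> x i = 0"
    and onto: "\<And>w. (\<And>i. i \<notin> S \<Longrightarrow> w i = 0) \<Longrightarrow> \<exists>x\<in>Z. \<Theta> x = w"
    and ker: "\<And>x. x \<in> Z \<Longrightarrow> (\<forall>i. \<Theta> x i = 0) \<longleftrightarrow> x \<in> B"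
  shows "fd_space (restrict_scalars E (quotient (M\<lparr>carrier := Z\<rparr>) B))
    \<and> k_dim (restrict_scalars E (quotient (M\<lparr>carrier := Z\<rparr>) B)) = card S"
proof -
  interpret M: Module.module E M by (rule M)
  note ZD = submoduleD[OF M Z] and BD = submoduleD[OF M B(1)]
  \<comment> \<open>A coset depends on addition only, so it is the same in \<open>M\<close> and in
    \<open>M\<close> with its carrier cut down to \<open>Z\<close>.\<close>
  define cs where "cs x = {b \<oplus>\<^bsub>M\<^esub> x | b. b \<in> B}" for x
  have cs: "B +>\<^bsub>M\<lparr>carrier := Z\<rparr>\<^esub> x = cs x" for x
    by (auto simp: cs_def a_r_coset_def')
  have add0: "\<Theta> \<zero>\<^bsub>M\<^esub> i = 0" for i using smult[OF ZD(1), of 0 i] scal[of 0] by simp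
  have minus: "\<Theta> (\<ominus>\<^bsub>M\<^esub> x) i = - \<Theta> x i" if "x \<in> Z" for x i
    using add[OF that ZD(5)[OF that], of i] ZD(2)[OF that] by (simp add: M.r_neg add0 eq_neg_iff_add_eq_0 add.commute)
  have \<Theta>cs: "\<Theta> y = \<Theta> x" if x: "x \<in> Z" and y: "y \<in> cs x" for x y
  proof -
    obtain b where b: "b \<in> B" "y = b \<oplus>\<^bsub>M\<^esub> x" using y by (auto simp: cs_def)
    have "\<Theta> b i = 0" for i using b ker[of b] B(2) by auto
    then show ?thesis using b x B(2) by (auto simp: add fun_eq_iff)
  qed
  have csZ: "cs x \<subseteq> Z" if "x \<in> Z" for x using that B(2) ZD(3) by (auto simp: cs_def)
  have self: "x \<in> cs x" if "x \<in> Z" for x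
    unfolding cs_def using BD(1) ZD(2)[OF that] by (intro CollectI exI[of _ "\<zero>\<^bsub>M\<^esub>"]) auto
  have cs_mono: "cs x \<subseteq> cs y" if "x \<in> Z" "y \<in> Z" "\<Theta> x = \<Theta> y" for x y
  proof
    fix v assume "v \<in> cs x"
    then obtain b where b: "b \<in> B" "v = b \<oplus>\<^bsub>M\<^esub> x" by (auto simp: cs_def)
    have d: "x \<oplus>\<^bsub>M\<^esub> \<ominus>\<^bsub>M\<^esub> y \<in> B"
      using that ker[of "x \<oplus>\<^bsub>M\<^esub> \<ominus>\<^bsub>M\<^esub> y"] ZD(3,5) by (auto simp: add minus)
    have "v = (b \<oplus>\<^bsub>M\<^esub> (x \<oplus>\<^bsub>M\<^esub> \<ominus>\<^bsub>M\<^esub> y)) \<oplus>\<^bsub>M\<^esub> y"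
      using that b BD(2) ZD(2) by (simp add: M.a_assoc M.l_neg)
    then show "v \<in> cs y" using BD(3)[OF b(1) d] by (auto simp: cs_def)
  qed
  have cs_eq: "cs x = cs y" if "x \<in> Z" "y \<in> Z" "\<Theta> x = \<Theta> y" for x y
    using cs_mono[OF that] cs_mono[OF that(2,1)] that(3) by auto
  define Q where "Q = restrict_scalars E (quotient (M\<lparr>carrier := Z\<rparr>) B)"
  have carrQ: "carrier Q = cs ` Z"
    by (auto simp: Q_def quotient_simps cs)
  have zeroQ: "\<zero>\<^bsub>Q\<^esub> = cs \<zero>\<^bsub>M\<^esub>"
  proof -
    have "cs \<zero>\<^bsub>M\<^esub> = (\<lambda>b. b) ` B"
      unfolding cs_def Setcompr_eq_image using BD(2) by (intro image_cong) auto
    then show ?thesis by (simp add: Q_def quotient_simps)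
  qed
  have addQ: "cs x \<oplus>\<^bsub>Q\<^esub> cs y = cs (x \<oplus>\<^bsub>M\<^esub> y)" if "x \<in> Z" "y \<in> Z" for x y
  proof -
    have "cs x \<oplus>\<^bsub>Q\<^esub> cs y = (\<Union>v\<in>cs x. \<Union>w\<in>cs y. {v \<oplus>\<^bsub>M\<^esub> w})"
      by (simp add: Q_def quotient_simps set_add_def' )
    also have "\<dots> = cs (x \<oplus>\<^bsub>M\<^esub> y)"
    proof (intro equalityI subsetI)
      fix u assume "u \<in> (\<Union>v\<in>cs x. \<Union>w\<in>cs y. {v \<oplus>\<^bsub>M\<^esub> w})"
      then obtain b b' where b: "b \<in> B" "b' \<in> B" "u = (b \<oplus>\<^bsub>M\<^esub> x) \<oplus>\<^bsub>M\<^esub> (b' \<oplus>\<^bsub>M\<^esub> y)" by (auto simp: cs_def)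
      then have "u = (b \<oplus>\<^bsub>M\<^esub> b') \<oplus>\<^bsub>M\<^esub> (x \<oplus>\<^bsub>M\<^esub> y)" using that BD(2) ZD(2) by (simp add: M.a_ac)
      then show "u \<in> cs (x \<oplus>\<^bsub>M\<^esub> y)" using BD(3)[OF b(1,2)] by (auto simp: cs_def)
    next
      fix u assume "u \<in> cs (x \<oplus>\<^bsub>M\<^esub> y)"
      then obtain b where b: "b \<in> B" "u = b \<oplus>\<^bsub>M\<^esub> (x \<oplus>\<^bsub>M\<^esub> y)" by (auto simp: cs_def)
      then have "u = (b \<oplus>\<^bsub>M\<^esub> x) \<oplus>\<^bsub>M\<^esub> y" using that BD(2) ZD(2) by (simp add: M.a_ac)
      moreover have "b \<oplus>\<^bsub>M\<^esub> x \<in> cs x" using b by (auto simp: cs_def)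
      ultimately show "u \<in> (\<Union>v\<in>cs x. \<Union>w\<in>cs y. {v \<oplus>\<^bsub>M\<^esub> w})" using self[OF that(2)] by auto
    qed
    finally show ?thesis .
  qed
  have smQ: "r \<odot>\<^bsub>Q\<^esub> cs x = cs ((r \<odot>\<^bsub>E\<^esub> \<one>\<^bsub>E\<^esub>) \<odot>\<^bsub>M\<^esub> x)" if "x \<in> Z" for r x
  proof -
    have "cs ((r \<odot>\<^bsub>E\<^esub> \<one>\<^bsub>E\<^esub>) \<odot>\<^bsub>M\<^esub> v) = cs ((r \<odot>\<^bsub>E\<^esub> \<one>\<^bsub>E\<^esub>) \<odot>\<^bsub>M\<^esub> x)" if v: "v \<in> cs x" for v
    proof -
      have "v \<in> Z" using v csZ[OF \<open>x \<in> Z\<close>] by auto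
      then show ?thesis
        using \<Theta>cs[OF \<open>x \<in> Z\<close> v] \<open>x \<in> Z\<close> by (intro cs_eq) (auto simp: smult fun_eq_iff intro!: ZD(4) scal)
    qed
    then have "(\<Union>v\<in>cs x. cs ((r \<odot>\<^bsub>E\<^esub> \<one>\<^bsub>E\<^esub>) \<odot>\<^bsub>M\<^esub> v)) = (\<Union>v\<in>cs x. cs ((r \<odot>\<^bsub>E\<^esub> \<one>\<^bsub>E\<^esub>) \<odot>\<^bsub>M\<^esub> x))"
      by (intro SUP_cong refl)
    moreover have "cs x \<noteq> {}" using self[OF that] by blast
    ultimately show ?thesis by (simp add: Q_def quotient_simps cs)
  qed
  \<comment> \<open>\<open>\<Theta>\<close> is constant on cosets by \<open>\<Theta>cs\<close>, so
    any representative may be chosen.\<close>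
  define \<Theta>' where "\<Theta>' C = \<Theta> (SOME x. x \<in> C)" for C
  have \<Theta>': "\<Theta>' (cs x) = \<Theta> x" if "x \<in> Z" for x
    unfolding \<Theta>'_def by (rule \<Theta>cs[OF that]) (rule someI[of "\<lambda>y. y \<in> cs x", OF self[OF that]])
  have "fd_space Q \<and> k_dim Q = card S"
  proof (rule fd_space_if_coordinates[OF fin, of \<Theta>'])
    show "bij_betw \<Theta>' (carrier Q) {f. \<forall>x. x \<notin> S \<longrightarrow> f x = 0}"
      unfolding bij_betw_def
    proof (intro conjI equalityI subsetI)
      show "inj_on \<Theta>' (carrier Q)"
        unfolding carrQ by (rule inj_onI, elim imageE, hypsubst, rule cs_eq) (simp_all add: \<Theta>')
      show "f \<in> \<Theta>' ` carrier Q" if f: "f \<in> {f. \<forall>x. x \<notin> S \<longrightarrow> f x = 0}" for f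
      proof -
        obtain x where "x \<in> Z" "\<Theta> x = f" using onto[of f] f by auto
        then show ?thesis unfolding carrQ by (intro image_eqI[of _ _ "cs x"]) (auto simp: \<Theta>')
      qed
    qed (auto simp: carrQ \<Theta>' supp)
  next
    fix r v assume "v \<in> carrier Q"
    then obtain x where x: "x \<in> Z" "v = cs x" by (auto simp: carrQ)
    have xr: "(r \<odot>\<^bsub>E\<^esub> \<one>\<^bsub>E\<^esub>) \<odot>\<^bsub>M\<^esub> x \<in> Z" using x scal ZD(4) by auto
    show "r \<odot>\<^bsub>Q\<^esub> v \<in> carrier Q" using x xr by (auto simp: carrQ smQ)
    show "\<Theta>' (r \<odot>\<^bsub>Q\<^esub> v) i = r * \<Theta>' v i" for i using x xr by (simp add: smQ \<Theta>' smult)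
  qed (use ZD(1,3) in \<open>auto simp: carrQ zeroQ addQ \<Theta>' add add0\<close>)
  then show ?thesis by (simp add: Q_def)
qed

lemma restrict_scalars_module:
  fixes E :: "('k::field, 'r) module" and M :: "('r, 'm) module"
  assumes M: "Module.module E M"
    and scal: "\<And>r. r \<odot>\<^bsub>E\<^esub> \<one>\<^bsub>E\<^esub> \<in> carrier E"
      "\<And>r s. (r + s) \<odot>\<^bsub>E\<^esub> \<one>\<^bsub>E\<^esub> = r \<odot>\<^bsub>E\<^esub> \<one>\<^bsub>E\<^esub> \<oplus>\<^bsub>E\<^esub> s \<odot>\<^bsub>E\<^esub> \<one>\<^bsub>E\<^esub>"
      "\<And>r s. (r * s) \<odot>\<^bsub>E\<^esub> \<one>\<^bsub>E\<^esub> = (r \<odot>\<^bsub>E\<^esub> \<one>\<^bsub>E\<^esub>) \<otimes>\<^bsub>E\<^esub> (s \<odot>\<^bsub>E\<^esub> \<one>\<^bsub>E\<^esub>)"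
      "1 \<odot>\<^bsub>E\<^esub> \<one>\<^bsub>E\<^esub> = \<one>\<^bsub>E\<^esub>"
  shows "Module.module (ground_field :: 'k ring) (restrict_scalars E M)"
proof -
  interpret M: Module.module E M by (rule M)
  have "abelian_group (restrict_scalars E M)"
    by (rule abelian_groupI) (auto simp: M.a_ac intro: M.l_neg M.a_inv_closed bexI[of _ "\<ominus>\<^bsub>M\<^esub> x" for x])
  then show ?thesis
    by (intro moduleI) (auto intro: cring_from_type_algebra simp: scal M.smult_l_distr M.smult_r_distr M.smult_assoc1)
qed

lemma axpy_closed_restrict_scalars:
  fixes E :: "('k::field, 'r) module"
  assumes "axpy_closed E M U" "\<And>r. r \<odot>\<^bsub>E\<^esub> \<one>\<^bsub>E\<^esub> \<in> carrier E"
  shows "axpy_closed (ground_field :: 'k ring) (restrict_scalars E M) U"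
  using assms by (auto simp: axpy_closed_def)

section \<open>Tensor products\<close>

text \<open>The additive extension of \<open>\<beta>\<close> to formal sums; the target is a ring so
  that integers act through \<open>of_int\<close>.\<close>

definition frag_eval :: "('v \<Rightarrow> 'g::comm_ring_1) \<Rightarrow> ('v \<Rightarrow>\<^sub>0 int) \<Rightarrow> 'g" where
  "frag_eval \<beta> z = (\<Sum>v\<in>Poly_Mapping.keys z. of_int (Poly_Mapping.lookup z v) * \<beta> v)"

lemma frag_eval_superset:
  assumes "finite S" "Poly_Mapping.keys z \<subseteq> S"
  shows "frag_eval \<beta> z = (\<Sum>v\<in>S. of_int (Poly_Mapping.lookup z v) * \<beta> v)"
  unfolding frag_eval_def using assms
  by (intro sum.mono_neutral_left) (auto simp: in_keys_iff)

lemma frag_eval_diff: "frag_eval \<beta> (z - w) = frag_eval \<beta> z - frag_eval \<beta> w"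
proof -
  let ?S = "Poly_Mapping.keys z \<union> Poly_Mapping.keys w"
  have "frag_eval \<beta> u = (\<Sum>v\<in>?S. of_int (Poly_Mapping.lookup u v) * \<beta> v)" if "Poly_Mapping.keys u \<subseteq> ?S" for u
    by (rule frag_eval_superset) (use that in auto)
  then show ?thesis
    using keys_diff[of z w] by (simp add: lookup_minus left_diff_distrib sum_subtractf)
qed

lemma frag_eval_0 [simp]: "frag_eval \<beta> 0 = 0" by (simp add: frag_eval_def)
lemma frag_eval_of [simp]: "frag_eval \<beta> (frag_of v) = \<beta> v" by (simp add: frag_eval_def)
lemma frag_eval_minus: "frag_eval \<beta> (- z) = - frag_eval \<beta> z" using frag_eval_diff[of \<beta> 0 z] by simp
lemma frag_eval_add: "frag_eval \<beta> (z + w) = frag_eval \<beta> z + frag_eval \<beta> w"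
  using frag_eval_diff[of \<beta> z "- w"] by (simp add: frag_eval_minus)

lemma frag_extend_fun_diff:
  fixes f g :: "'v \<Rightarrow> 'w \<Rightarrow>\<^sub>0 int"
  shows "frag_extend (\<lambda>v. f v - g v) z = frag_extend f z - frag_extend g z"
proof -
  have "frag_cmul c (a - b) = frag_cmul c a - frag_cmul c b" for c :: int and a b :: "'w \<Rightarrow>\<^sub>0 int"
    by (rule poly_mapping_eqI) (simp add: lookup_minus right_diff_distrib)
  then show ?thesis by (simp add: frag_extend_def sum_subtractf)
qed

text \<open>Over a commutative ring the right module \<open>B\<close> obeys the same axioms as a
  left one.\<close>

locale tensor_pair = B: Module.module R B + M: Module.module R M
  for R :: "('r, 'z) ring_scheme" and B :: "('r, 'b) module" and M :: "('r, 'm) module"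
begin

abbreviation "F \<equiv> tensor_free B M"
abbreviation "rel \<equiv> tensor_relations R B M"
abbreviation "tc \<equiv> tensor_class R B M"
abbreviation "BM \<equiv> tensor_module R B M"

definition tens :: "'b \<Rightarrow> 'm \<Rightarrow> ('b \<times> 'm \<Rightarrow>\<^sub>0 int) set" where
  "tens b m = tc (frag_of (b, m))"

lemma F_simps [simp]: "x \<otimes>\<^bsub>F\<^esub> y = x + y" "\<one>\<^bsub>F\<^esub> = 0" "x \<in> carrier F \<Longrightarrow> inv\<^bsub>F\<^esub> x = - x"
  "z \<in> carrier F \<longleftrightarrow> Poly_Mapping.keys z \<subseteq> carrier B \<times> carrier M"
  by (simp_all add: carrier_free_Abelian_group_iff)

lemma F_closed: "z \<in> carrier F \<Longrightarrow> w \<in> carrier F \<Longrightarrow> z + w \<in> carrier F"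
    "z \<in> carrier F \<Longrightarrow> w \<in> carrier F \<Longrightarrow> z - w \<in> carrier F"
    "z \<in> carrier F \<Longrightarrow> - z \<in> carrier F" "0 \<in> carrier F"
  unfolding F_simps using keys_add[of z w] keys_diff[of z w] by (auto simp: keys_minus)

lemma F_comm_group: "comm_group F" by (rule abelian_free_Abelian_group)

text \<open>The three kinds of tensor relations as an inductive set, so that proofs about relations
  can go by cases.\<close>

inductive_set gens :: "('b \<times> 'm \<Rightarrow>\<^sub>0 int) set" where
  "b \<in> carrier B \<Longrightarrow> b' \<in> carrier B \<Longrightarrow> m \<in> carrier M \<Longrightarrow>
    frag_of (b \<oplus>\<^bsub>B\<^esub> b', m) - frag_of (b, m) - frag_of (b', m) \<in> gens"
| "b \<in> carrier B \<Longrightarrow> m \<in> carrier M \<Longrightarrow> m' \<in> carrier M \<Longrightarrow>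
    frag_of (b, m \<oplus>\<^bsub>M\<^esub> m') - frag_of (b, m) - frag_of (b, m') \<in> gens"
| "r \<in> carrier R \<Longrightarrow> b \<in> carrier B \<Longrightarrow> m \<in> carrier M \<Longrightarrow>
    frag_of (r \<odot>\<^bsub>B\<^esub> b, m) - frag_of (b, r \<odot>\<^bsub>M\<^esub> m) \<in> gens"

lemma frag_of_in_F: "b \<in> carrier B \<Longrightarrow> m \<in> carrier M \<Longrightarrow> frag_of (b, m) \<in> carrier F"
  by (simp add: keys_frag_of)

lemma gens_in_F: "g \<in> gens \<Longrightarrow> g \<in> carrier F"
  by (induction rule: gens.induct) (intro F_closed frag_of_in_F B.a_closed M.a_closed B.smult_closed M.smult_closed; assumption)+

lemma rel_eq: "rel = generate F gens"
proof -
  have "gens = {frag_of (b \<oplus>\<^bsub>B\<^esub> b', m) - frag_of (b, m) - frag_of (b', m) | b b' m.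
         b \<in> carrier B \<and> b' \<in> carrier B \<and> m \<in> carrier M}
    \<union> {frag_of (b, m \<oplus>\<^bsub>M\<^esub> m') - frag_of (b, m) - frag_of (b, m') | b m m'.
         b \<in> carrier B \<and> m \<in> carrier M \<and> m' \<in> carrier M}
    \<union> {frag_of (r \<odot>\<^bsub>B\<^esub> b, m) - frag_of (b, r \<odot>\<^bsub>M\<^esub> m) | r b m.
         r \<in> carrier R \<and> b \<in> carrier B \<and> m \<in> carrier M}"
    unfolding set_eq_iff gens.simps by blast
  then show ?thesis by (simp add: tensor_relations_def)
qed

lemma rel_subgroup: "subgroup rel F"
  unfolding rel_eq using F_comm_group gens_in_F
  by (intro group.generate_is_subgroup) (auto simp: comm_group_def simp del: F_simps)

lemma rel_closed: "0 \<in> rel" "z \<in> rel \<Longrightarrow> w \<in> rel \<Longrightarrow> z + w \<in> rel" "z \<in> rel \<Longrightarrow> - z \<in> rel"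
    "z \<in> rel \<Longrightarrow> w \<in> rel \<Longrightarrow> z - w \<in> rel" "z \<in> rel \<Longrightarrow> z \<in> carrier F"
proof -
  interpret S: subgroup rel F by (rule rel_subgroup)
  show a: "z \<in> rel \<Longrightarrow> w \<in> rel \<Longrightarrow> z + w \<in> rel" for z w using S.m_closed[of z w] by simp
  show "0 \<in> rel" using S.one_closed by simp
  show c: "z \<in> rel \<Longrightarrow> z \<in> carrier F" for z by (rule S.mem_carrier)
  show m: "z \<in> rel \<Longrightarrow> - z \<in> rel" for z
    using S.m_inv_closed[of z] F_simps(3)[OF c[of z]] by metis
  show "z \<in> rel \<Longrightarrow> w \<in> rel \<Longrightarrow> z - w \<in> rel" using a[of z "- w"] m[of w] by simp
qed

lemma gens_rel: "g \<in> gens \<Longrightarrow> g \<in> rel"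
  unfolding rel_eq by (rule generate.incl)

lemma rel_induct [consumes 1, case_names zero gen add minus]:
  assumes "z \<in> rel" and "P 0" and "\<And>g. g \<in> gens \<Longrightarrow> P g"
    and "\<And>z w. z \<in> rel \<Longrightarrow> w \<in> rel \<Longrightarrow> P z \<Longrightarrow> P w \<Longrightarrow> P (z + w)" and "\<And>z. z \<in> rel \<Longrightarrow> P z \<Longrightarrow> P (- z)"
  shows "P z"
proof -
  have "z \<in> generate F gens" using assms(1) by (simp add: rel_eq)
  then show ?thesis
  proof (induction rule: generate.induct)
    case (inv h)
    then show ?case using assms(3)[of h] assms(5)[of h] gens_rel[of h] F_simps(3)[OF gens_in_F[of h]] by metis
  next
    case (eng h1 h2)
    then show ?case using assms(4)[of h1 h2] by (simp add: rel_eq)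
  qed (use assms in auto)
qed

lemma tc_eq: "tc z = {r + z | r. r \<in> rel}"
  by (auto simp: tensor_class_def r_coset_def)

lemma tc_self: "z \<in> tc z" using rel_closed(1) by (force simp: tc_eq)

lemma tc_eq_iff: "tc z = tc w \<longleftrightarrow> z - w \<in> rel"
proof
  assume "tc z = tc w"
  then have "z \<in> tc w" using tc_self by auto
  then show "z - w \<in> rel" by (auto simp: tc_eq)
next
  assume d: "z - w \<in> rel"
  have "r + z = (r + (z - w)) + w" "r + w = (r - (z - w)) + z" for r by simp_all
  then show "tc z = tc w" unfolding tc_eq using rel_closed(2,4) d by (auto; metis)
qed

lemma tc_rel: "z \<in> tc w \<Longrightarrow> z - w \<in> rel" by (auto simp: tc_eq)

lemma carrier_BM: "carrier BM = tc ` carrier F"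
  by (auto simp: tensor_module_def RCOSETS_def tensor_class_def)

lemma zero_BM: "\<zero>\<^bsub>BM\<^esub> = tc 0"
  by (simp add: tensor_module_def tc_eq)

lemma add_BM: "tc z \<oplus>\<^bsub>BM\<^esub> tc w = tc (z + w)"
proof -
  have "tc z \<oplus>\<^bsub>BM\<^esub> tc w = {r + z + (s + w) | r s. r \<in> rel \<and> s \<in> rel}"
    by (auto simp: tensor_module_def set_mult_def tc_eq)
  also have "\<dots> = {r + (z + w) | r. r \<in> rel}"
  proof (intro equalityI subsetI)
    fix u assume "u \<in> {r + z + (s + w) | r s. r \<in> rel \<and> s \<in> rel}"
    then obtain r s where "r \<in> rel" "s \<in> rel" "u = (r + s) + (z + w)" by (auto simp: algebra_simps)
    then show "u \<in> {r + (z + w) | r. r \<in> rel}" using rel_closed(2) by blast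
  next
    fix u assume "u \<in> {r + (z + w) | r. r \<in> rel}"
    then obtain r where "r \<in> rel" "u = r + z + (0 + w)" by (auto simp: algebra_simps)
    then show "u \<in> {r + z + (s + w) | r s. r \<in> rel \<and> s \<in> rel}" using rel_closed(1) by blast
  qed
  finally show ?thesis by (simp add: tc_eq)
qed

text \<open>Operations on tensors are unions over representatives; when the value does not depend on
  the representative, the union collapses to it.\<close>

lemma UN_tc:
  assumes "\<And>u. u \<in> rel \<Longrightarrow> h (u + z) = h z"
  shows "(\<Union>u\<in>tc z. h u) = h z"
  using assms tc_self[of z] by (auto simp: tc_eq)

lemma smult_frag_rel:
  assumes r: "r \<in> carrier R" and "u \<in> rel"
  shows "frag_extend (\<lambda>(b, m). frag_of (r \<odot>\<^bsub>B\<^esub> b, m)) u \<in> rel"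
  using assms(2)
proof (induction rule: rel_induct)
  case (gen g)
  then show ?case
  proof cases
    case (1 b b' m)
    then show ?thesis using r gens.intros(1)[of "r \<odot>\<^bsub>B\<^esub> b" "r \<odot>\<^bsub>B\<^esub> b'" m]
      by (auto simp: frag_extend_diff B.smult_r_distr intro: gens_rel)
  next
    case (2 b m m')
    then show ?thesis using r gens.intros(2)[of "r \<odot>\<^bsub>B\<^esub> b" m m']
      by (auto simp: frag_extend_diff intro: gens_rel)
  next
    case (3 s b m)
    \<comment> \<open>The balancing relation survives because scalars commute.\<close>
    then have "r \<odot>\<^bsub>B\<^esub> (s \<odot>\<^bsub>B\<^esub> b) = s \<odot>\<^bsub>B\<^esub> (r \<odot>\<^bsub>B\<^esub> b)"
      using r by (simp add: B.smult_assoc1[symmetric] B.R.m_comm)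
    then show ?thesis using 3 r gens.intros(3)[of s "r \<odot>\<^bsub>B\<^esub> b" m]
      by (auto simp: frag_extend_diff intro: gens_rel)
  qed
qed (auto simp: frag_extend_add frag_extend_minus intro: rel_closed)

lemma smult_BM:
  assumes "r \<in> carrier R"
  shows "r \<odot>\<^bsub>BM\<^esub> tc z = tc (frag_extend (\<lambda>(b, m). frag_of (r \<odot>\<^bsub>B\<^esub> b, m)) z)"
proof -
  have "r \<odot>\<^bsub>BM\<^esub> tc z = (\<Union>u\<in>tc z. tc (frag_extend (\<lambda>(b, m). frag_of (r \<odot>\<^bsub>B\<^esub> b, m)) u))"
    by (simp add: tensor_module_def)
  also have "\<dots> = tc (frag_extend (\<lambda>(b, m). frag_of (r \<odot>\<^bsub>B\<^esub> b, m)) z)"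
    by (rule UN_tc) (simp add: tc_eq_iff frag_extend_add smult_frag_rel assms)
  finally show ?thesis .
qed

lemma tens_closed [simp]: "b \<in> carrier B \<Longrightarrow> m \<in> carrier M \<Longrightarrow> tens b m \<in> carrier BM"
  unfolding carrier_BM tens_def by (rule imageI, rule frag_of_in_F)

lemma tens_add_l: "b \<in> carrier B \<Longrightarrow> b' \<in> carrier B \<Longrightarrow> m \<in> carrier M \<Longrightarrow> tens (b \<oplus>\<^bsub>B\<^esub> b') m = tens b m \<oplus>\<^bsub>BM\<^esub> tens b' m"
  using gens_rel[OF gens.intros(1)] by (simp add: tens_def add_BM tc_eq_iff diff_diff_add)

lemma tens_add_r: "b \<in> carrier B \<Longrightarrow> m \<in> carrier M \<Longrightarrow> m' \<in> carrier M \<Longrightarrow> tens b (m \<oplus>\<^bsub>M\<^esub> m') = tens b m \<oplus>\<^bsub>BM\<^esub> tens b m'"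
  using gens_rel[OF gens.intros(2)] by (simp add: tens_def add_BM tc_eq_iff diff_diff_add)

lemma tens_balanced: "r \<in> carrier R \<Longrightarrow> b \<in> carrier B \<Longrightarrow> m \<in> carrier M \<Longrightarrow> tens (r \<odot>\<^bsub>B\<^esub> b) m = tens b (r \<odot>\<^bsub>M\<^esub> m)"
  using gens_rel[OF gens.intros(3)] by (simp add: tens_def tc_eq_iff)

lemma smult_tens: "r \<in> carrier R \<Longrightarrow> r \<odot>\<^bsub>BM\<^esub> tens b m = tens (r \<odot>\<^bsub>B\<^esub> b) m"
  by (simp add: tens_def smult_BM)

lemma BM_abelian_group: "abelian_group BM"
proof (rule abelian_groupI)
  fix x assume "x \<in> carrier BM"
  then obtain z where "z \<in> carrier F" "x = tc z" by (auto simp: carrier_BM simp del: F_simps)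
  then show "\<exists>y\<in>carrier BM. y \<oplus>\<^bsub>BM\<^esub> x = \<zero>\<^bsub>BM\<^esub>"
    by (intro bexI[of _ "tc (- z)"]) (auto simp: add_BM zero_BM carrier_BM simp del: F_simps intro: F_closed)
qed (auto simp: carrier_BM add_BM zero_BM add_ac simp del: F_simps intro!: imageI intro: F_closed)

sublocale BM: abelian_group BM by (rule BM_abelian_group)

lemma tc_closed: "z \<in> carrier F \<Longrightarrow> tc z \<in> carrier BM"
  by (simp add: carrier_BM del: F_simps)

lemma minus_BM: "z \<in> carrier F \<Longrightarrow> \<ominus>\<^bsub>BM\<^esub> tc z = tc (- z)"
  by (rule BM.minus_equality)
    (auto simp: add_BM zero_BM simp del: F_simps intro: F_closed tc_closed)

text \<open>Every tensor is a finite sum of pure tensors; a negative coefficient is absorbed into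
  the first factor.\<close>

lemma tens_induct [consumes 1, case_names zero tens]:
  assumes C: "C \<in> carrier BM" and zero: "P \<zero>\<^bsub>BM\<^esub>"
    and tens: "\<And>b m D. b \<in> carrier B \<Longrightarrow> m \<in> carrier M \<Longrightarrow> D \<in> carrier BM \<Longrightarrow> P D \<Longrightarrow> P (tens b m \<oplus>\<^bsub>BM\<^esub> D)"
  shows "P C"
proof -
  obtain z where z: "z \<in> carrier F" "C = tc z" using C by (auto simp: carrier_BM simp del: F_simps)
  \<comment> \<open>Induction on formal sums passes through differences, so the claim is
    strengthened to both signs and to an arbitrary summand \<open>D\<close>.\<close>
  have "z \<in> carrier F \<and> (\<forall>D\<in>carrier BM. P D \<longrightarrow> P (tc z \<oplus>\<^bsub>BM\<^esub> D) \<and> P (tc (- z) \<oplus>\<^bsub>BM\<^esub> D))"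
    if "Poly_Mapping.keys z \<subseteq> carrier B \<times> carrier M" for z
    using that
  proof (induction z rule: frag_induction)
    case zero
    have "tc 0 \<oplus>\<^bsub>BM\<^esub> D = D" if "D \<in> carrier BM" for D using BM.l_zero[OF that] by (simp add: zero_BM)
    then show ?case using F_closed(4) by (simp del: F_simps)
  next
    case (one x)
    then obtain b m where bm: "x = (b, m)" "b \<in> carrier B" "m \<in> carrier M" by auto
    have "tens (\<ominus>\<^bsub>B\<^esub> b) m \<oplus>\<^bsub>BM\<^esub> tens b m = tens \<zero>\<^bsub>B\<^esub> m"
      using tens_add_l[of "\<ominus>\<^bsub>B\<^esub> b" b m] bm by (simp add: B.l_neg)
    moreover have "tens \<zero>\<^bsub>B\<^esub> m = \<zero>\<^bsub>BM\<^esub>"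
      using tens_add_l[of "\<zero>\<^bsub>B\<^esub>" "\<zero>\<^bsub>B\<^esub>" m] bm tens_closed[of "\<zero>\<^bsub>B\<^esub>" m] by (simp add: BM.add.r_cancel_one)
    ultimately have "\<ominus>\<^bsub>BM\<^esub> tens b m = tens (\<ominus>\<^bsub>B\<^esub> b) m"
      using bm by (intro BM.minus_equality) auto
    moreover have "\<ominus>\<^bsub>BM\<^esub> tens b m = tc (- frag_of x)"
      using bm by (simp add: tens_def minus_BM frag_of_in_F del: F_simps)
    ultimately show ?case using tens[OF bm(2,3)] tens[of "\<ominus>\<^bsub>B\<^esub> b" m] bm frag_of_in_F[of b m]
      by (auto simp: tens_def simp del: F_simps)
  next
    case (diff a b)
    have "tc (a - b) \<oplus>\<^bsub>BM\<^esub> D = tc a \<oplus>\<^bsub>BM\<^esub> (tc (- b) \<oplus>\<^bsub>BM\<^esub> D)"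
      "tc (- (a - b)) \<oplus>\<^bsub>BM\<^esub> D = tc (- a) \<oplus>\<^bsub>BM\<^esub> (tc b \<oplus>\<^bsub>BM\<^esub> D)" if D: "D \<in> carrier BM" for D
    proof -
      obtain d where "D = tc d" using D by (auto simp: carrier_BM)
      then show "tc (a - b) \<oplus>\<^bsub>BM\<^esub> D = tc a \<oplus>\<^bsub>BM\<^esub> (tc (- b) \<oplus>\<^bsub>BM\<^esub> D)"
        "tc (- (a - b)) \<oplus>\<^bsub>BM\<^esub> D = tc (- a) \<oplus>\<^bsub>BM\<^esub> (tc b \<oplus>\<^bsub>BM\<^esub> D)" by (auto simp: add_BM algebra_simps)
    qed
    moreover have "tc b \<oplus>\<^bsub>BM\<^esub> D \<in> carrier BM" "tc (- b) \<oplus>\<^bsub>BM\<^esub> D \<in> carrier BM" if "D \<in> carrier BM" for D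
      using that diff F_closed(3)[of b] by (auto intro!: BM.a_closed tc_closed simp del: F_simps)
    moreover have "a - b \<in> carrier F" using diff F_closed(2)[of a b] by blast
    ultimately show ?case using diff by (simp del: F_simps)
  qed
  then have "P (tc z \<oplus>\<^bsub>BM\<^esub> \<zero>\<^bsub>BM\<^esub>)" using z zero BM.zero_closed by simp
  then show ?thesis using z by (simp add: add_BM zero_BM)
qed

lemma BM_module: "Module.module R BM"
proof (rule moduleI)
  show "cring R" by (rule B.R.is_cring)
  show "abelian_group BM" by (rule BM_abelian_group)
  have cl: "r \<odot>\<^bsub>BM\<^esub> x \<in> carrier BM" if "r \<in> carrier R" "x \<in> carrier BM" for r x
  proof -
    obtain z where z: "z \<in> carrier F" "x = tc z" using \<open>x \<in> carrier BM\<close> by (auto simp: carrier_BM simp del: F_simps)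
    have "Poly_Mapping.keys z \<subseteq> carrier B \<times> carrier M" using z(1) by simp
    then have "frag_extend (\<lambda>(b, m). frag_of (r \<odot>\<^bsub>B\<^esub> b, m)) z \<in> carrier F"
      using keys_frag_extend[of "\<lambda>(b, m). frag_of (r \<odot>\<^bsub>B\<^esub> b, m)" z] \<open>r \<in> carrier R\<close> by (force simp: keys_frag_of)
    then show ?thesis using that z by (simp add: smult_BM tc_closed del: F_simps)
  qed
  have dist: "r \<odot>\<^bsub>BM\<^esub> (x \<oplus>\<^bsub>BM\<^esub> y) = r \<odot>\<^bsub>BM\<^esub> x \<oplus>\<^bsub>BM\<^esub> r \<odot>\<^bsub>BM\<^esub> y"
    if "r \<in> carrier R" "x \<in> carrier BM" "y \<in> carrier BM" for r x y
    using that by (auto simp: carrier_BM smult_BM add_BM frag_extend_add simp del: F_simps)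
  have zero: "r \<odot>\<^bsub>BM\<^esub> \<zero>\<^bsub>BM\<^esub> = \<zero>\<^bsub>BM\<^esub>" if "r \<in> carrier R" for r
    using that by (simp add: zero_BM smult_BM)
  show "r \<odot>\<^bsub>BM\<^esub> x \<in> carrier BM" if "r \<in> carrier R" "x \<in> carrier BM" for r x by (rule cl[OF that])
  show "r \<odot>\<^bsub>BM\<^esub> (x \<oplus>\<^bsub>BM\<^esub> y) = r \<odot>\<^bsub>BM\<^esub> x \<oplus>\<^bsub>BM\<^esub> r \<odot>\<^bsub>BM\<^esub> y"
    if "r \<in> carrier R" "x \<in> carrier BM" "y \<in> carrier BM" for r x y by (rule dist[OF that])
  show "(r \<oplus>\<^bsub>R\<^esub> s) \<odot>\<^bsub>BM\<^esub> x = r \<odot>\<^bsub>BM\<^esub> x \<oplus>\<^bsub>BM\<^esub> s \<odot>\<^bsub>BM\<^esub> x" if rs: "r \<in> carrier R" "s \<in> carrier R" and x: "x \<in> carrier BM" for r s x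
    using x
  proof (induction rule: tens_induct)
    case (tens b m D)
    then show ?case
      using rs by (simp add: dist smult_tens B.smult_l_distr tens_add_l cl BM.a_ac)
  qed (use rs in \<open>simp add: zero\<close>)
  show "(r \<otimes>\<^bsub>R\<^esub> s) \<odot>\<^bsub>BM\<^esub> x = r \<odot>\<^bsub>BM\<^esub> (s \<odot>\<^bsub>BM\<^esub> x)" if rs: "r \<in> carrier R" "s \<in> carrier R" and x: "x \<in> carrier BM" for r s x
    using x
  proof (induction rule: tens_induct)
    case (tens b m D)
    then show ?case
      using rs by (simp add: dist smult_tens B.smult_assoc1 cl)
  qed (use rs in \<open>simp add: zero\<close>)
  show "\<one>\<^bsub>R\<^esub> \<odot>\<^bsub>BM\<^esub> x = x" if x: "x \<in> carrier BM" for x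
    using x
  proof (induction rule: tens_induct)
    case (tens b m D)
    then show ?case by (simp add: dist smult_tens)
  qed (simp add: zero)
qed

definition balanced :: "('b \<Rightarrow> 'm \<Rightarrow> 'g::comm_ring_1) \<Rightarrow> bool" where
  "balanced \<beta> \<longleftrightarrow> (\<forall>b\<in>carrier B. \<forall>b'\<in>carrier B. \<forall>m\<in>carrier M. \<beta> (b \<oplus>\<^bsub>B\<^esub> b') m = \<beta> b m + \<beta> b' m)
    \<and> (\<forall>b\<in>carrier B. \<forall>m\<in>carrier M. \<forall>m'\<in>carrier M. \<beta> b (m \<oplus>\<^bsub>M\<^esub> m') = \<beta> b m + \<beta> b m')
    \<and> (\<forall>r\<in>carrier R. \<forall>b\<in>carrier B. \<forall>m\<in>carrier M. \<beta> (r \<odot>\<^bsub>B\<^esub> b) m = \<beta> b (r \<odot>\<^bsub>M\<^esub> m))"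

lemma frag_eval_rel:
  assumes \<beta>: "balanced \<beta>" and "u \<in> rel"
  shows "frag_eval (\<lambda>(b, m). \<beta> b m) u = 0"
  using assms(2)
proof (induction rule: rel_induct)
  case (gen g)
  then show ?case
    by cases (use \<beta> in \<open>auto simp: frag_eval_diff balanced_def\<close>)
qed (auto simp: frag_eval_add frag_eval_minus)

text \<open>The map induced on the tensor product by a balanced map, evaluated at a chosen
  representative; by \<open>frag_eval_rel\<close> all choices agree.\<close>

definition tlift :: "('b \<Rightarrow> 'm \<Rightarrow> 'g::comm_ring_1) \<Rightarrow> ('b \<times> 'm \<Rightarrow>\<^sub>0 int) set \<Rightarrow> 'g" where
  "tlift \<beta> C = frag_eval (\<lambda>(b, m). \<beta> b m) (SOME z. z \<in> C)"

lemma frag_eval_tc: "balanced \<beta> \<Longrightarrow> z \<in> tc w \<Longrightarrow> frag_eval (\<lambda>(b, m). \<beta> b m) z = frag_eval (\<lambda>(b, m). \<beta> b m) w"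
  using frag_eval_rel[of \<beta> "z - w"] tc_rel[of z w] by (simp add: frag_eval_diff)

lemma tlift_tc: "balanced \<beta> \<Longrightarrow> tlift \<beta> (tc z) = frag_eval (\<lambda>(b, m). \<beta> b m) z"
  unfolding tlift_def by (rule frag_eval_tc, assumption, rule someI[of "\<lambda>y. y \<in> tc z", OF tc_self])

lemma tlift_tens: "balanced \<beta> \<Longrightarrow> tlift \<beta> (tens b m) = \<beta> b m"
  by (simp add: tens_def tlift_tc)

lemma tlift_add:
  assumes "balanced \<beta>" "C \<in> carrier BM" "D \<in> carrier BM"
  shows "tlift \<beta> (C \<oplus>\<^bsub>BM\<^esub> D) = tlift \<beta> C + tlift \<beta> D"
  using assms by (auto simp: carrier_BM add_BM tlift_tc frag_eval_add)

lemma tlift_zero: "balanced \<beta> \<Longrightarrow> tlift \<beta> \<zero>\<^bsub>BM\<^esub> = 0"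
  by (simp add: zero_BM tlift_tc)

lemma
  assumes M': "Module.module R M'" and f: "f \<in> Hom R M M'"
  shows tensor_map_hom: "tensor_map R B M' f \<in> Hom R BM (tensor_module R B M')"
    and tensor_map_tens: "b \<in> carrier B \<Longrightarrow> m \<in> carrier M \<Longrightarrow> tensor_map R B M' f (tens b m) = tensor_pair.tens R B M' b (f m)"
proof -
  interpret M': Module.module R M' by fact
  interpret N: tensor_pair R B M' by unfold_locales
  let ?e = "frag_extend (\<lambda>(b, m). frag_of (b, f m))"
  note fD = module_homD[OF f]
  have rel: "?e u \<in> N.rel" if "u \<in> rel" for u
    using that
  proof (induction rule: rel_induct)
    case (gen g)
    then show ?case
    proof cases
      case (1 b b' m)
      then show ?thesis using N.gens.intros(1)[of b b' "f m"] fD by (auto simp: frag_extend_diff intro: N.gens_rel)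
    next
      case (2 b m m')
      then show ?thesis using N.gens.intros(2)[of b "f m" "f m'"] fD by (auto simp: frag_extend_diff intro: N.gens_rel)
    next
      case (3 s b m)
      then show ?thesis using N.gens.intros(3)[of s b "f m"] fD by (auto simp: frag_extend_diff intro: N.gens_rel)
    qed
  qed (auto simp: frag_extend_add frag_extend_minus intro: N.rel_closed)
  have tc: "tensor_map R B M' f (tc z) = N.tc (?e z)" for z
    unfolding tensor_map_def by (rule UN_tc) (simp add: N.tc_eq_iff frag_extend_add rel)
  have smult: "?e (frag_extend (\<lambda>(b, m). frag_of (r \<odot>\<^bsub>B\<^esub> b, m)) z) = frag_extend (\<lambda>(b, m). frag_of (r \<odot>\<^bsub>B\<^esub> b, m)) (?e z)" for r z
    by (rule frag_induction[where S = UNIV and c = z]) (auto simp: frag_extend_diff)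
  have closed: "?e z \<in> carrier N.F" if "z \<in> carrier F" for z
  proof (rule frag_induction[where S = "carrier B \<times> carrier M" and c = z])
    show "?e (frag_of v) \<in> carrier N.F" if "v \<in> carrier B \<times> carrier M" for v
      using that fD(1) by (auto simp: keys_frag_of)
    show "?e (x - y) \<in> carrier N.F" if "?e x \<in> carrier N.F" "?e y \<in> carrier N.F" for x y
      using N.F_closed(2)[OF that] by (simp only: frag_extend_diff)
  qed (use that in simp_all)
  show "tensor_map R B M' f \<in> Hom R BM N.BM"
  proof (rule module_homI)
    show "tensor_map R B M' f x \<in> carrier N.BM" if "x \<in> carrier BM" for x
      using that unfolding carrier_BM by (elim imageE) (simp only: tc N.tc_closed closed)
    show "tensor_map R B M' f (x \<oplus>\<^bsub>BM\<^esub> y) = tensor_map R B M' f x \<oplus>\<^bsub>N.BM\<^esub> tensor_map R B M' f y"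
      if "x \<in> carrier BM" "y \<in> carrier BM" for x y
      using that unfolding carrier_BM by (elim imageE) (simp only: tc add_BM N.add_BM frag_extend_add)
    show "tensor_map R B M' f (r \<odot>\<^bsub>BM\<^esub> x) = r \<odot>\<^bsub>N.BM\<^esub> tensor_map R B M' f x"
      if "r \<in> carrier R" "x \<in> carrier BM" for r x
      using that unfolding carrier_BM by (elim imageE) (simp only: tc smult_BM N.smult_BM smult)
  qed
  show "b \<in> carrier B \<Longrightarrow> m \<in> carrier M \<Longrightarrow> tensor_map R B M' f (tens b m) = N.tens b (f m)"
    by (simp add: tens_def N.tens_def tc)
qed

end

section \<open>Complete resolutions and dimension shifting\<close>

lemma free_module_simps:
  assumes "Ring.ring R"
  shows "v \<in> carrier (free_module R I) \<longleftrightarrow> v \<in> I \<rightarrow>\<^sub>E carrier R \<and> finite {i \<in> I. v i \<noteq> \<zero>\<^bsub>R\<^esub>}"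
    "v \<oplus>\<^bsub>free_module R I\<^esub> w = (\<lambda>i\<in>I. v i \<oplus>\<^bsub>R\<^esub> w i)"
    "r \<odot>\<^bsub>free_module R I\<^esub> v = (\<lambda>i\<in>I. r \<otimes>\<^bsub>R\<^esub> v i)"
proof -
  interpret R: Ring.ring R by fact
  show "v \<in> carrier (free_module R I) \<longleftrightarrow> v \<in> I \<rightarrow>\<^sub>E carrier R \<and> finite {i \<in> I. v i \<noteq> \<zero>\<^bsub>R\<^esub>}"
    "v \<oplus>\<^bsub>free_module R I\<^esub> w = (\<lambda>i\<in>I. v i \<oplus>\<^bsub>R\<^esub> w i)"
    "r \<odot>\<^bsub>free_module R I\<^esub> v = (\<lambda>i\<in>I. r \<otimes>\<^bsub>R\<^esub> v i)"
    by (auto simp: free_module_def R.func_space_def)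
qed

definition free_unit :: "('r, 'z) ring_scheme \<Rightarrow> 'i set \<Rightarrow> 'i \<Rightarrow> 'i \<Rightarrow> 'r" where
  "free_unit R I x = (\<lambda>i\<in>I. if i = x then \<one>\<^bsub>R\<^esub> else \<zero>\<^bsub>R\<^esub>)"

lemma free_unit_closed:
  assumes "Ring.ring R"
  shows "free_unit R I x \<in> carrier (free_module R I)"
proof -
  interpret R: Ring.ring R by fact
  have "{i \<in> I. free_unit R I x i \<noteq> \<zero>\<^bsub>R\<^esub>} \<subseteq> {x}" by (auto simp: free_unit_def)
  then show ?thesis using finite_subset by (auto simp: free_module_simps[OF assms] free_unit_def)
qed

text \<open>Induction on a finite set containing the support, splitting off one coordinate at a
  time.\<close>

lemma free_module_hom_eqI:
  assumes R: "cring R" and N: "Module.module R N"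
    and f: "f \<in> Hom R (free_module R I) N"
    and g: "g \<in> Hom R (free_module R I) N"
    and eq: "\<And>x. x \<in> I \<Longrightarrow> f (free_unit R I x) = g (free_unit R I x)"
    and v: "v \<in> carrier (free_module R I)"
  shows "f v = g v"
proof -
  interpret R: cring R by fact
  interpret N: Module.module R N by fact
  note sm = free_module_simps[OF R.ring_axioms]
  have "f v = g v" if "finite S" "v \<in> carrier (free_module R I)" "{i \<in> I. v i \<noteq> \<zero>\<^bsub>R\<^esub>} \<subseteq> S" for S v
    using that
  proof (induction S arbitrary: v)
    case empty
    have v0: "v = \<zero>\<^bsub>R\<^esub> \<odot>\<^bsub>free_module R I\<^esub> v"
      using empty by (intro ext) (auto simp: sm PiE_iff extensional_def)
    have hv: "h v = \<zero>\<^bsub>N\<^esub>" if h: "h \<in> Hom R (free_module R I) N" for h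
      using module_homD(3)[OF h, of "\<zero>\<^bsub>R\<^esub>" v] module_homD(1)[OF h empty(1)] empty(1) v0 by simp
    show ?case using hv[OF f] hv[OF g] by simp
  next
    case (insert x S)
    show ?case
    proof (cases "x \<in> I")
      case False
      then show ?thesis using insert by auto
    next
      case True
      define w where "w = v(x := \<zero>\<^bsub>R\<^esub>)"
      have vc: "v i \<in> carrier R" if "i \<in> I" for i using insert.prems that by (auto simp: sm PiE_iff)
      have "{i \<in> I. w i \<noteq> \<zero>\<^bsub>R\<^esub>} \<subseteq> {i \<in> I. v i \<noteq> \<zero>\<^bsub>R\<^esub>}" by (auto simp: w_def)
      then have w: "w \<in> carrier (free_module R I)" "{i \<in> I. w i \<noteq> \<zero>\<^bsub>R\<^esub>} \<subseteq> S"
        using insert.prems True finite_subset[of "{i \<in> I. w i \<noteq> \<zero>\<^bsub>R\<^esub>}"]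
        by (auto simp: sm w_def PiE_iff extensional_def)
      have sv: "v x \<odot>\<^bsub>free_module R I\<^esub> free_unit R I x \<in> carrier (free_module R I)"
      proof -
        have "{i \<in> I. (v x \<odot>\<^bsub>free_module R I\<^esub> free_unit R I x) i \<noteq> \<zero>\<^bsub>R\<^esub>} \<subseteq> {x}"
          using vc[OF True] by (auto simp: free_unit_def sm)
        then show ?thesis using vc True finite_subset by (auto simp: sm free_unit_def PiE_iff)
      qed
      have v: "v = w \<oplus>\<^bsub>free_module R I\<^esub> (v x \<odot>\<^bsub>free_module R I\<^esub> free_unit R I x)"
        using insert.prems True vc by (intro ext) (auto simp: sm w_def free_unit_def PiE_iff extensional_def)
      have hv: "h v = h w \<oplus>\<^bsub>N\<^esub> v x \<odot>\<^bsub>N\<^esub> h (free_unit R I x)"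
        if h: "h \<in> Hom R (free_module R I) N" for h
        using arg_cong[OF v, of h] module_homD(2)[OF h w(1) sv] module_homD(3)[OF h vc[OF True] free_unit_closed[OF R.ring_axioms, of I x]]
        by simp
      show ?thesis using hv[OF f] hv[OF g] insert.IH[OF w] eq[OF True] by simp
    qed
  qed
  from this[of "{i \<in> I. v i \<noteq> \<zero>\<^bsub>R\<^esub>}"] show ?thesis using v by (auto simp: sm)
qed

lemma free_module_ex_hom:
  assumes R: "cring R" and N: "Module.module R N" and l: "\<And>x. x \<in> I \<Longrightarrow> l x \<in> carrier N"
  shows "\<exists>h \<in> Hom R (free_module R I) N. \<forall>x\<in>I. h (free_unit R I x) = l x"
proof -
  interpret R: cring R by fact
  interpret N: Module.module R N by fact
  note sm = free_module_simps[OF R.ring_axioms]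
  define h where "h v = (\<Oplus>\<^bsub>N\<^esub>x\<in>{i \<in> I. v i \<noteq> \<zero>\<^bsub>R\<^esub>}. v x \<odot>\<^bsub>N\<^esub> l x)" for v
  \<comment> \<open>The sum may run over any finite set containing the support, so summands can be
    compared on a common index set.\<close>
  have hS: "h v = (\<Oplus>\<^bsub>N\<^esub>x\<in>S. v x \<odot>\<^bsub>N\<^esub> l x)"
    if "v \<in> carrier (free_module R I)" "finite S" "S \<subseteq> I" "{i \<in> I. v i \<noteq> \<zero>\<^bsub>R\<^esub>} \<subseteq> S" for v S
    unfolding h_def using that l
    by (intro N.add.finprod_mono_neutral_cong_left) (auto simp: sm PiE_iff)
  have "h \<in> Hom R (free_module R I) N"
  proof (rule module_homI)
    fix v w assume v: "v \<in> carrier (free_module R I)" and w: "w \<in> carrier (free_module R I)"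
    then show "h v \<in> carrier N" unfolding h_def using l by (auto simp: sm PiE_iff)
    define S where "S = {i \<in> I. v i \<noteq> \<zero>\<^bsub>R\<^esub>} \<union> {i \<in> I. w i \<noteq> \<zero>\<^bsub>R\<^esub>}"
    have S: "finite S" "S \<subseteq> I" using v w by (auto simp: S_def sm)
    have sup: "{i \<in> I. (v \<oplus>\<^bsub>free_module R I\<^esub> w) i \<noteq> \<zero>\<^bsub>R\<^esub>} \<subseteq> S" by (auto simp: S_def sm)
    have vw: "v \<oplus>\<^bsub>free_module R I\<^esub> w \<in> carrier (free_module R I)"
      using v w finite_subset[OF sup S(1)] by (auto simp: sm PiE_iff)
    have "h (v \<oplus>\<^bsub>free_module R I\<^esub> w) = (\<Oplus>\<^bsub>N\<^esub>x\<in>S. v x \<odot>\<^bsub>N\<^esub> l x \<oplus>\<^bsub>N\<^esub> w x \<odot>\<^bsub>N\<^esub> l x)"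
      unfolding hS[OF vw S sup] using v w l S(2)
      by (intro N.finsum_cong') (auto simp: sm PiE_iff subset_iff N.smult_l_distr)
    also have "\<dots> = (\<Oplus>\<^bsub>N\<^esub>x\<in>S. v x \<odot>\<^bsub>N\<^esub> l x) \<oplus>\<^bsub>N\<^esub> (\<Oplus>\<^bsub>N\<^esub>x\<in>S. w x \<odot>\<^bsub>N\<^esub> l x)"
      using v w l S(2) by (intro N.finsum_addf) (auto simp: sm PiE_iff subset_iff)
    also have "\<dots> = h v \<oplus>\<^bsub>N\<^esub> h w"
      using hS[OF v S] hS[OF w S] by (simp add: S_def)
    finally show "h (v \<oplus>\<^bsub>free_module R I\<^esub> w) = h v \<oplus>\<^bsub>N\<^esub> h w" .
  next
    fix r v assume r: "r \<in> carrier R" and v: "v \<in> carrier (free_module R I)"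
    define S where "S = {i \<in> I. v i \<noteq> \<zero>\<^bsub>R\<^esub>}"
    have S: "finite S" "S \<subseteq> I" using v by (auto simp: S_def sm)
    have sup: "{i \<in> I. (r \<odot>\<^bsub>free_module R I\<^esub> v) i \<noteq> \<zero>\<^bsub>R\<^esub>} \<subseteq> S" using r by (auto simp: S_def sm)
    have vw: "r \<odot>\<^bsub>free_module R I\<^esub> v \<in> carrier (free_module R I)"
      using v r finite_subset[OF sup S(1)] by (auto simp: sm PiE_iff)
    have "h (r \<odot>\<^bsub>free_module R I\<^esub> v) = (\<Oplus>\<^bsub>N\<^esub>x\<in>S. r \<odot>\<^bsub>N\<^esub> (v x \<odot>\<^bsub>N\<^esub> l x))"
      unfolding hS[OF vw S sup] using v r l S(2)
      by (intro N.finsum_cong') (auto simp: sm PiE_iff subset_iff N.smult_assoc1)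
    also have "\<dots> = r \<odot>\<^bsub>N\<^esub> h v"
      unfolding hS[OF v S S_def[THEN equalityD2]] using r v l S(2)
      by (intro N.finsum_smult[symmetric]) (auto simp: sm PiE_iff subset_iff)
    finally show "h (r \<odot>\<^bsub>free_module R I\<^esub> v) = r \<odot>\<^bsub>N\<^esub> h v" .
  qed
  moreover have "h (free_unit R I x) = l x" if x: "x \<in> I" for x
  proof -
    have "h (free_unit R I x) = (\<Oplus>\<^bsub>N\<^esub>y\<in>{x}. free_unit R I x y \<odot>\<^bsub>N\<^esub> l y)"
      using x by (intro hS free_unit_closed R.ring_axioms) (auto simp: free_unit_def)
    then show ?thesis using x l by (simp add: free_unit_def)
  qed
  ultimately show ?thesis by blast
qed

lemma module_hom_comp:
  assumes "f \<in> Hom R L M" "h \<in> Hom R M N"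
  shows "(\<lambda>x. h (f x)) \<in> Hom R L N"
  by (rule module_homI) (simp_all add: module_homD[OF assms(1)] module_homD[OF assms(2)])

text \<open>The images of the free basis are lifted one by one, and the resulting map is restricted
  along the inclusion of the summand.\<close>

lemma projective_lift:
  fixes M :: "('r, 'm) module"
  assumes M: "projective_module R M" and N: "Module.module R N" "Module.module R N'"
    and s: "s \<in> Hom R N N'" and f: "f \<in> Hom R M N'"
    and im: "\<And>x. x \<in> carrier M \<Longrightarrow> f x \<in> s ` carrier N"
  shows "\<exists>h \<in> Hom R M N. \<forall>x\<in>carrier M. s (h x) = f x"
proof -
  interpret N: Module.module R N by fact
  obtain I :: "'m set" and i q where i: "i \<in> Hom R M (free_module R I)"
    and q: "q \<in> Hom R (free_module R I) M"
    and qi: "\<And>x. x \<in> carrier M \<Longrightarrow> q (i x) = x"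
    using M unfolding projective_module_def by blast
  have u: "free_unit R I x \<in> carrier (free_module R I)" for x
    by (rule free_unit_closed[OF N.R.ring_axioms])
  have "\<exists>l. l \<in> carrier N \<and> s l = f (q (free_unit R I x))" for x
    using im[OF module_homD(1)[OF q u[of x]]] by auto
  then obtain l where l: "\<And>x. l x \<in> carrier N" "\<And>x. s (l x) = f (q (free_unit R I x))" by metis
  obtain h where h: "h \<in> Hom R (free_module R I) N" "\<And>x. x \<in> I \<Longrightarrow> h (free_unit R I x) = l x"
    using free_module_ex_hom[OF N.R.is_cring N(1), of I l] l(1) by blast
  have "s (h v) = f (q v)" if "v \<in> carrier (free_module R I)" for v
    by (rule free_module_hom_eqI[OF N.R.is_cring N(2) module_hom_comp[OF h(1) s] module_hom_comp[OF q f] _ that])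
      (simp add: h(2) l(2))
  then show ?thesis
    using module_hom_comp[OF i h(1)] qi module_homD(1)[OF i] by (intro bexI[of _ "\<lambda>x. h (i x)"]) auto
qed

text \<open>In a free module the claim holds coordinate by coordinate, since whatever
  \<open>J\<close> annihilates in \<open>R\<close> is a multiple of \<open>N\<close>; the splitting
  transfers it to a summand.\<close>

lemma projective_annihilated:
  fixes M :: "('r, 'm) module"
  assumes M: "projective_module R M" and t: "t \<in> carrier M" and J: "J \<subseteq> carrier R"
    and N: "N \<in> carrier R" and ann: "\<And>r. r \<in> carrier R \<Longrightarrow> (\<forall>s\<in>J. s \<otimes>\<^bsub>R\<^esub> r = \<zero>\<^bsub>R\<^esub>) \<Longrightarrow> \<exists>r'\<in>carrier R. r = N \<otimes>\<^bsub>R\<^esub> r'"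
    and tJ: "\<And>s. s \<in> J \<Longrightarrow> s \<odot>\<^bsub>M\<^esub> t = \<zero>\<^bsub>M\<^esub>"
  shows "\<exists>t'\<in>carrier M. t = N \<odot>\<^bsub>M\<^esub> t'"
proof -
  interpret M: Module.module R M using M by (simp add: projective_module_def)
  note sm = free_module_simps[OF M.R.ring_axioms]
  obtain I :: "'m set" and i q where i: "i \<in> Hom R M (free_module R I)"
    and q: "q \<in> Hom R (free_module R I) M"
    and qi: "\<And>x. x \<in> carrier M \<Longrightarrow> q (i x) = x"
    using M unfolding projective_module_def by blast
  have it: "i t \<in> carrier (free_module R I)" by (rule module_homD(1)[OF i t])
  \<comment> \<open>A zero coordinate is given the quotient zero, which keeps the support of
    \<open>v\<close> finite.\<close>
  have "\<exists>r'\<in>carrier R. i t x = N \<otimes>\<^bsub>R\<^esub> r' \<and> (i t x = \<zero>\<^bsub>R\<^esub> \<longrightarrow> r' = \<zero>\<^bsub>R\<^esub>)" if x: "x \<in> I" for x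
  proof (cases "i t x = \<zero>\<^bsub>R\<^esub>")
    case True
    then show ?thesis using N by auto
  next
    case False
    have "s \<otimes>\<^bsub>R\<^esub> i t x = \<zero>\<^bsub>R\<^esub>" if s: "s \<in> J" for s
    proof -
      have sR: "s \<in> carrier R" using J s by auto
      have "i (\<zero>\<^bsub>R\<^esub> \<odot>\<^bsub>M\<^esub> t) = \<zero>\<^bsub>R\<^esub> \<odot>\<^bsub>free_module R I\<^esub> i t" by (rule module_homD(3)[OF i _ t]) simp
      moreover have "i (s \<odot>\<^bsub>M\<^esub> t) = s \<odot>\<^bsub>free_module R I\<^esub> i t" by (rule module_homD(3)[OF i sR t])
      ultimately have "(\<zero>\<^bsub>R\<^esub> \<odot>\<^bsub>free_module R I\<^esub> i t) x = (s \<odot>\<^bsub>free_module R I\<^esub> i t) x"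
        using tJ[OF s] t by simp
      then show ?thesis using x it by (auto simp: sm PiE_iff)
    qed
    then show ?thesis using ann[of "i t x"] it x False by (auto simp: sm PiE_iff)
  qed
  then obtain r where r: "\<And>x. x \<in> I \<Longrightarrow> r x \<in> carrier R" "\<And>x. x \<in> I \<Longrightarrow> i t x = N \<otimes>\<^bsub>R\<^esub> r x"
      "\<And>x. x \<in> I \<Longrightarrow> i t x = \<zero>\<^bsub>R\<^esub> \<Longrightarrow> r x = \<zero>\<^bsub>R\<^esub>" by metis
  define v where "v = restrict r I"
  have "finite {x \<in> I. i t x \<noteq> \<zero>\<^bsub>R\<^esub>}" using it by (simp add: sm)
  moreover have "{x \<in> I. v x \<noteq> \<zero>\<^bsub>R\<^esub>} \<subseteq> {x \<in> I. i t x \<noteq> \<zero>\<^bsub>R\<^esub>}" using r(3) by (auto simp: v_def)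
  ultimately have "finite {x \<in> I. v x \<noteq> \<zero>\<^bsub>R\<^esub>}" by (rule rev_finite_subset)
  then have v: "v \<in> carrier (free_module R I)" using r(1) by (simp add: sm) (simp add: v_def)
  have "i t = N \<odot>\<^bsub>free_module R I\<^esub> v"
    using it r(2) by (intro ext) (auto simp: sm v_def PiE_iff extensional_def)
  then have "t = N \<odot>\<^bsub>M\<^esub> q v" using qi[OF t] module_homD(3)[OF q N v] by simp
  then show ?thesis using module_homD(1)[OF q v] by blast
qed

text \<open>
  Two spaces with a notion of boundary, both closed under \<open>(r, x, y) \<mapsto> r x + y\<close>, correspond when a
  linear relation, total on both sides, matches boundaries: they have the same homology.
\<close>

definition correspond :: "'r set \<Rightarrow> 'x set \<times> ('x \<Rightarrow> bool) \<times> ('r \<Rightarrow> 'x \<Rightarrow> 'x \<Rightarrow> 'x)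
    \<Rightarrow> 'y set \<times> ('y \<Rightarrow> bool) \<times> ('r \<Rightarrow> 'y \<Rightarrow> 'y \<Rightarrow> 'y) \<Rightarrow> bool" where
  "correspond K = (\<lambda>(U, bU, aU) (V, bV, aV). \<exists>Q.
     (\<forall>x\<in>U. \<exists>y\<in>V. Q x y) \<and> (\<forall>y\<in>V. \<exists>x\<in>U. Q x y)
     \<and> (\<forall>x\<in>U. \<forall>y\<in>V. Q x y \<longrightarrow> bU x = bV y)
     \<and> (\<forall>r\<in>K. \<forall>x\<in>U. \<forall>y\<in>V. \<forall>x'\<in>U. \<forall>y'\<in>V. Q x y \<longrightarrow> Q x' y' \<longrightarrow> Q (aU r x x') (aV r y y'))
     \<and> (\<forall>r\<in>K. \<forall>x\<in>U. \<forall>x'\<in>U. aU r x x' \<in> U) \<and> (\<forall>r\<in>K. \<forall>y\<in>V. \<forall>y'\<in>V. aV r y y' \<in> V))"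

lemma correspondI:
  assumes "\<And>x. x \<in> U \<Longrightarrow> \<exists>y\<in>V. Q x y" "\<And>y. y \<in> V \<Longrightarrow> \<exists>x\<in>U. Q x y"
    "\<And>x y. x \<in> U \<Longrightarrow> y \<in> V \<Longrightarrow> Q x y \<Longrightarrow> bU x = bV y"
    "\<And>r x y x' y'. r \<in> K \<Longrightarrow> x \<in> U \<Longrightarrow> y \<in> V \<Longrightarrow> x' \<in> U \<Longrightarrow> y' \<in> V \<Longrightarrow> Q x y \<Longrightarrow> Q x' y' \<Longrightarrow> Q (aU r x x') (aV r y y')"
    "\<And>r x x'. r \<in> K \<Longrightarrow> x \<in> U \<Longrightarrow> x' \<in> U \<Longrightarrow> aU r x x' \<in> U"
    "\<And>r y y'. r \<in> K \<Longrightarrow> y \<in> V \<Longrightarrow> y' \<in> V \<Longrightarrow> aV r y y' \<in> V"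
  shows "correspond K (U, bU, aU) (V, bV, aV)"
  unfolding correspond_def prod.case
  by (intro exI[of _ Q] conjI ballI impI; (elim assms; assumption)?; insert assms; blast)

lemma correspond_sym:
  assumes "correspond K p q"
  shows "correspond K q p"
proof -
  obtain U bU aU V bV aV where [simp]: "p = (U, bU, aU)" "q = (V, bV, aV)" by (metis prod_cases3)
  obtain Q where "(\<forall>x\<in>U. \<exists>y\<in>V. Q x y) \<and> (\<forall>y\<in>V. \<exists>x\<in>U. Q x y)
     \<and> (\<forall>x\<in>U. \<forall>y\<in>V. Q x y \<longrightarrow> bU x = bV y)
     \<and> (\<forall>r\<in>K. \<forall>x\<in>U. \<forall>y\<in>V. \<forall>x'\<in>U. \<forall>y'\<in>V. Q x y \<longrightarrow> Q x' y' \<longrightarrow> Q (aU r x x') (aV r y y'))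
     \<and> (\<forall>r\<in>K. \<forall>x\<in>U. \<forall>x'\<in>U. aU r x x' \<in> U) \<and> (\<forall>r\<in>K. \<forall>y\<in>V. \<forall>y'\<in>V. aV r y y' \<in> V)"
    using assms unfolding correspond_def by auto
  then show ?thesis unfolding correspond_def by (auto intro!: exI[of _ "\<lambda>y x. Q x y"])
qed

lemma correspond_trans:
  assumes "correspond K p q" "correspond K q s"
  shows "correspond K p s"
proof -
  obtain U bU aU V bV aV W bW aW where [simp]: "p = (U, bU, aU)" "q = (V, bV, aV)" "s = (W, bW, aW)"
    by (metis prod_cases3)
  obtain Q where Q: "\<forall>x\<in>U. \<exists>y\<in>V. Q x y" "\<forall>y\<in>V. \<exists>x\<in>U. Q x y"
     "\<forall>x\<in>U. \<forall>y\<in>V. Q x y \<longrightarrow> bU x = bV y"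
     "\<forall>r\<in>K. \<forall>x\<in>U. \<forall>y\<in>V. \<forall>x'\<in>U. \<forall>y'\<in>V. Q x y \<longrightarrow> Q x' y' \<longrightarrow> Q (aU r x x') (aV r y y')"
     "\<forall>r\<in>K. \<forall>x\<in>U. \<forall>x'\<in>U. aU r x x' \<in> U" "\<forall>r\<in>K. \<forall>y\<in>V. \<forall>y'\<in>V. aV r y y' \<in> V"
    using assms(1) unfolding correspond_def by auto
  obtain P where P: "\<forall>x\<in>V. \<exists>y\<in>W. P x y" "\<forall>y\<in>W. \<exists>x\<in>V. P x y"
     "\<forall>x\<in>V. \<forall>y\<in>W. P x y \<longrightarrow> bV x = bW y"
     "\<forall>r\<in>K. \<forall>x\<in>V. \<forall>y\<in>W. \<forall>x'\<in>V. \<forall>y'\<in>W. P x y \<longrightarrow> P x' y' \<longrightarrow> P (aV r x x') (aW r y y')"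
     "\<forall>r\<in>K. \<forall>y\<in>W. \<forall>y'\<in>W. aW r y y' \<in> W"
    using assms(2) unfolding correspond_def by auto
  have "correspond K (U, bU, aU) (W, bW, aW)"
  proof (rule correspondI[where Q = "\<lambda>x z. \<exists>y\<in>V. Q x y \<and> P y z"])
    fix r x y x' y'
    assume r: "r \<in> K" and xy: "x \<in> U" "y \<in> W" "x' \<in> U" "y' \<in> W"
      and ex: "\<exists>v\<in>V. Q x v \<and> P v y" "\<exists>v\<in>V. Q x' v \<and> P v y'"
    obtain v v' where v: "v \<in> V" "Q x v" "P v y" "v' \<in> V" "Q x' v'" "P v' y'" using ex by blast
    then have "Q (aU r x x') (aV r v v')" "P (aV r v v') (aW r y y')"
      using Q(4) P(4) r xy by simp_all
    then show "\<exists>v\<in>V. Q (aU r x x') v \<and> P v (aW r y y')" using Q(6) r v by blast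
  next
    fix x y assume "x \<in> U" "y \<in> W" "\<exists>v\<in>V. Q x v \<and> P v y"
    then show "bU x = bW y" using Q(3) P(3) by metis
  next
    fix x assume "x \<in> U"
    then obtain y where "y \<in> V" "Q x y" using Q(1) by blast
    moreover from this obtain z where "z \<in> W" "P y z" using P(1) by blast
    ultimately show "\<exists>z\<in>W. \<exists>y\<in>V. Q x y \<and> P y z" by blast
  next
    fix z assume "z \<in> W"
    then obtain y where "y \<in> V" "P y z" using P(2) by blast
    moreover from this obtain x where "x \<in> U" "Q x y" using Q(2) by blast
    ultimately show "\<exists>x\<in>U. \<exists>y\<in>V. Q x y \<and> P y z" by blast
  qed (use Q(5) P(5) in auto)
  then show ?thesis by simp
qed

text \<open>The data for dimension shifting: \<open>T\<close> has projective terms, \<open>S\<close>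
  is exact, and \<open>hom_extend\<close> says that each Hom(T, S_i) is exact. In the application
  S_i consists of functions with values in the ring, and \<open>hom_extend\<close> comes from the
  acyclicity of Hom(T, R).\<close>

locale complex_pair =
  fixes R :: "('r, 'z) ring_scheme" and T :: "('r, 'm) mod_complex"
    and S :: "int \<Rightarrow> ('r, 's) module" and d :: "int \<Rightarrow> 's \<Rightarrow> 's"
  assumes T_complex: "chain_complex R T" and T_proj: "projective_module R (cobj T n)"
    and S_module: "Module.module R (S i)"
    and d_hom: "d i \<in> Hom R (S i) (S (i - 1))"
    and S_exact: "x \<in> carrier (S i) \<Longrightarrow> d i x = \<zero>\<^bsub>S (i - 1)\<^esub> \<longleftrightarrow> (\<exists>y\<in>carrier (S (i + 1)). d (i + 1) y = x)"
    and hom_extend: "f \<in> Hom R (cobj T n) (S i) \<Longrightarrow>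
      (\<And>x. x \<in> carrier (cobj T (n + 1)) \<Longrightarrow> f (cdiff T (n + 1) x) = \<zero>\<^bsub>S i\<^esub>) \<Longrightarrow>
      \<exists>h\<in>Hom R (cobj T (n - 1)) (S i). \<forall>x\<in>carrier (cobj T n). f x = h (cdiff T n x)"
begin

abbreviation "THom n i \<equiv> Hom R (cobj T n) (S i)"

text \<open>The n-cocycles of Hom(T, Z_i), where Z_i is the kernel of \<open>d i\<close>; a map into
  Z_i is written as a map into S_i whose values are killed by \<open>d i\<close>.\<close>

definition cocycles :: "int \<Rightarrow> int \<Rightarrow> ('m \<Rightarrow> 's) set" where
  "cocycles n i = {f \<in> THom n i. (\<forall>x\<in>carrier (cobj T n). d i (f x) = \<zero>\<^bsub>S (i - 1)\<^esub>)
     \<and> (\<forall>x\<in>carrier (cobj T (n + 1)). f (cdiff T (n + 1) x) = \<zero>\<^bsub>S i\<^esub>)}"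

definition is_cobound :: "int \<Rightarrow> int \<Rightarrow> ('m \<Rightarrow> 's) \<Rightarrow> bool" where
  "is_cobound n i f \<longleftrightarrow> (\<exists>h \<in> THom (n - 1) i. (\<forall>x\<in>carrier (cobj T (n - 1)). d i (h x) = \<zero>\<^bsub>S (i - 1)\<^esub>)
     \<and> (\<forall>x\<in>carrier (cobj T n). f x = h (cdiff T n x)))"

definition haxpy :: "int \<Rightarrow> 'r \<Rightarrow> ('m \<Rightarrow> 's) \<Rightarrow> ('m \<Rightarrow> 's) \<Rightarrow> 'm \<Rightarrow> 's" where
  "haxpy i r f h = (\<lambda>x. r \<odot>\<^bsub>S i\<^esub> f x \<oplus>\<^bsub>S i\<^esub> h x)"

definition "coc n i = (cocycles n i, is_cobound n i, haxpy i)"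

lemma T_module: "Module.module R (cobj T n)"
  and T_hom: "cdiff T n \<in> Hom R (cobj T n) (cobj T (n - 1))"
  and T_diff: "x \<in> carrier (cobj T n) \<Longrightarrow> cdiff T (n - 1) (cdiff T n x) = \<zero>\<^bsub>cobj T (n - 2)\<^esub>"
  using T_complex by (auto simp: chain_complex_def)

lemma T_closed: "x \<in> carrier (cobj T n) \<Longrightarrow> cdiff T n x \<in> carrier (cobj T (n - 1))"
  "x \<in> carrier (cobj T (n + 1)) \<Longrightarrow> cdiff T (n + 1) x \<in> carrier (cobj T n)"
  using module_homD(1)[OF T_hom, of x n] module_homD(1)[OF T_hom, of x "n + 1"] by simp_all

lemma T_hom1: "cdiff T (n + 1) \<in> Hom R (cobj T (n + 1)) (cobj T n)"
  using T_hom[of "n + 1"] by simp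

lemma T_diff1: "x \<in> carrier (cobj T (n + 1)) \<Longrightarrow> cdiff T n (cdiff T (n + 1) x) = \<zero>\<^bsub>cobj T (n - 1)\<^esub>"
  using T_diff[of x "n + 1"] by simp

lemma d_hom1: "d (i + 1) \<in> Hom R (S (i + 1)) (S i)"
  using d_hom[of "i + 1"] by simp

lemma d_d: "x \<in> carrier (S (i + 1)) \<Longrightarrow> d i (d (i + 1) x) = \<zero>\<^bsub>S (i - 1)\<^esub>"
  using S_exact[of "d (i + 1) x" i] module_homD(1)[OF d_hom1, of x i] by blast

lemma hom_zero: "f \<in> THom n i \<Longrightarrow> f \<zero>\<^bsub>cobj T n\<^esub> = \<zero>\<^bsub>S i\<^esub>"
  by (rule module_hom_zero[OF T_module S_module])

lemma haxpy_hom: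
  assumes r: "r \<in> carrier R" and f: "f \<in> THom n i" and h: "h \<in> THom n i"
  shows "haxpy i r f h \<in> THom n i"
proof -
  interpret S: Module.module R "S i" by (rule S_module)
  show ?thesis unfolding haxpy_def
  proof (rule module_homI)
    fix s x assume s: "s \<in> carrier R" and x: "x \<in> carrier (cobj T n)"
    have "r \<odot>\<^bsub>S i\<^esub> (s \<odot>\<^bsub>S i\<^esub> f x) = s \<odot>\<^bsub>S i\<^esub> (r \<odot>\<^bsub>S i\<^esub> f x)"
      using r s module_homD(1)[OF f x] by (simp add: S.smult_assoc1[symmetric] S.R.m_comm)
    then show "r \<odot>\<^bsub>S i\<^esub> f (s \<odot>\<^bsub>cobj T n\<^esub> x) \<oplus>\<^bsub>S i\<^esub> h (s \<odot>\<^bsub>cobj T n\<^esub> x) = s \<odot>\<^bsub>S i\<^esub> (r \<odot>\<^bsub>S i\<^esub> f x \<oplus>\<^bsub>S i\<^esub> h x)"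
      using r s x by (simp add: module_homD[OF f] module_homD[OF h] S.smult_r_distr)
  qed (use r in \<open>simp_all add: module_homD[OF f] module_homD[OF h] S.smult_r_distr S.a_ac\<close>)
qed

lemma cocycles_haxpy:
  assumes r: "r \<in> carrier R" and f: "f \<in> cocycles n i" and h: "h \<in> cocycles n i"
  shows "haxpy i r f h \<in> cocycles n i"
proof -
  interpret S: Module.module R "S i" by (rule S_module)
  interpret S': Module.module R "S (i - 1)" by (rule S_module)
  have fh: "f \<in> THom n i" "h \<in> THom n i" using f h by (auto simp: cocycles_def)
  show ?thesis
    using haxpy_hom[OF r fh] f h r module_homD(1)[OF fh(1)] module_homD(1)[OF fh(2)]
    by (auto simp: cocycles_def haxpy_def module_homD[OF d_hom])
qed

lemma lift_hom:
  assumes "f \<in> THom n i" "\<And>x. x \<in> carrier (cobj T n) \<Longrightarrow> d i (f x) = \<zero>\<^bsub>S (i - 1)\<^esub>"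
  shows "\<exists>h\<in>THom n (i + 1). \<forall>x\<in>carrier (cobj T n). d (i + 1) (h x) = f x"
proof (rule projective_lift[OF T_proj S_module S_module d_hom1 assms(1)])
  fix x assume x: "x \<in> carrier (cobj T n)"
  then obtain y where "y \<in> carrier (S (i + 1))" "d (i + 1) y = f x"
    using S_exact[OF module_homD(1)[OF assms(1) x]] assms(2) by auto
  then show "f x \<in> d (i + 1) ` carrier (S (i + 1))" by (intro image_eqI[of _ _ y]) simp_all
qed

lemma hom_diff:
  assumes f: "f \<in> THom n i" and h: "h \<in> THom n i"
  shows "(\<lambda>x. f x \<ominus>\<^bsub>S i\<^esub> h x) \<in> THom n i"
proof -
  interpret S: Module.module R "S i" by (rule S_module)
  show ?thesis
  proof (rule module_homI)
    fix x y assume x: "x \<in> carrier (cobj T n)" and y: "y \<in> carrier (cobj T n)"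
    show "f x \<ominus>\<^bsub>S i\<^esub> h x \<in> carrier (S i)" using x module_homD(1)[OF f] module_homD(1)[OF h] by simp
    show "f (x \<oplus>\<^bsub>cobj T n\<^esub> y) \<ominus>\<^bsub>S i\<^esub> h (x \<oplus>\<^bsub>cobj T n\<^esub> y) = (f x \<ominus>\<^bsub>S i\<^esub> h x) \<oplus>\<^bsub>S i\<^esub> (f y \<ominus>\<^bsub>S i\<^esub> h y)"
      using x y module_homD(1)[OF f] module_homD(1)[OF h]
      by (simp add: module_homD(2)[OF f] module_homD(2)[OF h] S.minus_eq S.minus_add S.a_ac)
  next
    fix r x assume r: "r \<in> carrier R" and x: "x \<in> carrier (cobj T n)"
    show "f (r \<odot>\<^bsub>cobj T n\<^esub> x) \<ominus>\<^bsub>S i\<^esub> h (r \<odot>\<^bsub>cobj T n\<^esub> x) = r \<odot>\<^bsub>S i\<^esub> (f x \<ominus>\<^bsub>S i\<^esub> h x)"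
      using r x module_homD(1)[OF f] module_homD(1)[OF h]
      by (simp add: module_homD(3)[OF f] module_homD(3)[OF h] S.minus_eq S.smult_r_distr S.smult_r_minus)
  qed
qed

lemma d_minus:
  assumes "x \<in> carrier (S i)" "y \<in> carrier (S i)"
  shows "d i (x \<ominus>\<^bsub>S i\<^esub> y) = d i x \<ominus>\<^bsub>S (i - 1)\<^esub> d i y"
proof -
  interpret S: Module.module R "S i" by (rule S_module)
  interpret S': Module.module R "S (i - 1)" by (rule S_module)
  have c: "d i x \<in> carrier (S (i - 1))" "d i y \<in> carrier (S (i - 1))" "d i (x \<ominus>\<^bsub>S i\<^esub> y) \<in> carrier (S (i - 1))"
    using assms module_homD(1)[OF d_hom] by auto
  have "d i x = d i ((x \<ominus>\<^bsub>S i\<^esub> y) \<oplus>\<^bsub>S i\<^esub> y)" using assms by (simp add: S.minus_eq S.a_assoc S.l_neg)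
  also have "\<dots> = d i (x \<ominus>\<^bsub>S i\<^esub> y) \<oplus>\<^bsub>S (i - 1)\<^esub> d i y" using assms by (simp add: module_homD(2)[OF d_hom])
  finally show ?thesis using c by (simp add: S'.minus_eq S'.a_assoc S'.r_neg)
qed

lemma d_minus1:
  assumes "x \<in> carrier (S (i + 1))" "y \<in> carrier (S (i + 1))"
  shows "d (i + 1) (x \<ominus>\<^bsub>S (i + 1)\<^esub> y) = d (i + 1) x \<ominus>\<^bsub>S i\<^esub> d (i + 1) y"
  using d_minus[OF assms] by simp

text \<open>Dimension shifting along \<open>0 \<rightarrow> Z\<^bsub>i+1\<^esub> \<rightarrow> S\<^bsub>i+1\<^esub> \<rightarrow> Z\<^bsub>i\<^esub> \<rightarrow> 0\<close>, where \<open>Z\<^bsub>i\<^esub>\<close> is the kernel of \<open>d\<^bsub>i\<^esub>\<close>.\<close>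

lemma shift: "correspond (carrier R) (coc n i) (coc (n + 1) (i + 1))"
proof -
  \<comment> \<open>The connecting homomorphism as a relation: \<open>h\<close> lifts
    \<open>f\<close> through the surjection of S_(i+1) onto Z_i, and \<open>f'\<close> is
    \<open>h\<close> composed with the differential of \<open>T\<close>.\<close>
  let ?Q = "\<lambda>f f'. \<exists>h\<in>THom n (i + 1). (\<forall>x\<in>carrier (cobj T n). d (i + 1) (h x) = f x)
      \<and> (\<forall>x\<in>carrier (cobj T (n + 1)). f' x = h (cdiff T (n + 1) x))"
  interpret S: Module.module R "S i" by (rule S_module)
  interpret S1: Module.module R "S (i + 1)" by (rule S_module)
  show ?thesis unfolding coc_def
  proof (rule correspondI[where Q = ?Q])
    fix f assume f: "f \<in> cocycles n i"
    then obtain h where h: "h \<in> THom n (i + 1)" "\<And>x. x \<in> carrier (cobj T n) \<Longrightarrow> d (i + 1) (h x) = f x"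
      using lift_hom[of f n i] by (auto simp: cocycles_def)
    have c: "(\<lambda>x. h (cdiff T (n + 1) x)) \<in> cocycles (n + 1) (i + 1)"
      using f h(2) T_closed T_diff1[of _ "n + 1"] hom_zero[OF h(1)]
      by (auto simp: cocycles_def intro: module_hom_comp[OF T_hom1 h(1)])
    show "\<exists>f'\<in>cocycles (n + 1) (i + 1). ?Q f f'"
      by (rule bexI[OF _ c], rule bexI[OF _ h(1)]) (simp add: h(2))
  next
    \<comment> \<open>Projectivity gave the lift of \<open>f\<close>; in the other direction
      exactness of Hom(T, S_(i+1)) writes \<open>f'\<close> as some \<open>h\<close> composed with
      the differential.\<close>
    fix f' assume f': "f' \<in> cocycles (n + 1) (i + 1)"
    then have "\<exists>h\<in>THom (n + 1 - 1) (i + 1). \<forall>x\<in>carrier (cobj T (n + 1)). f' x = h (cdiff T (n + 1) x)"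
      by (intro hom_extend) (auto simp: cocycles_def)
    then obtain h where h: "h \<in> THom n (i + 1)" "\<And>x. x \<in> carrier (cobj T (n + 1)) \<Longrightarrow> f' x = h (cdiff T (n + 1) x)"
      by auto
    have c: "(\<lambda>x. d (i + 1) (h x)) \<in> cocycles n i"
      unfolding cocycles_def
    proof (intro CollectI conjI ballI)
      fix x assume x: "x \<in> carrier (cobj T (n + 1))"
      have "d (i + 1) (f' x) = \<zero>\<^bsub>S (i + 1 - 1)\<^esub>" using f' x by (auto simp: cocycles_def)
      then show "d (i + 1) (h (cdiff T (n + 1) x)) = \<zero>\<^bsub>S i\<^esub>" using x by (simp add: h(2))
    qed (simp_all add: d_d module_homD(1)[OF h(1)] module_hom_comp[OF h(1) d_hom1])
    show "\<exists>f\<in>cocycles n i. ?Q f f'"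
      by (rule bexI[OF _ c], rule bexI[OF _ h(1)]) (simp add: h(2))
  next
    fix f f' assume f: "f \<in> cocycles n i" and f': "f' \<in> cocycles (n + 1) (i + 1)" and Q: "?Q f f'"
    then obtain h where h: "h \<in> THom n (i + 1)" "\<And>x. x \<in> carrier (cobj T n) \<Longrightarrow> d (i + 1) (h x) = f x"
      "\<And>x. x \<in> carrier (cobj T (n + 1)) \<Longrightarrow> f' x = h (cdiff T (n + 1) x)" by auto
    have fh: "f \<in> THom n i" using f by (simp add: cocycles_def)
    note hc = module_homD(1)[OF h(1)]
    show "is_cobound n i f = is_cobound (n + 1) (i + 1) f'"
    proof
      assume "is_cobound n i f"
      then obtain g where g: "g \<in> THom (n - 1) i" "\<And>x. x \<in> carrier (cobj T (n - 1)) \<Longrightarrow> d i (g x) = \<zero>\<^bsub>S (i - 1)\<^esub>"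
        "\<And>x. x \<in> carrier (cobj T n) \<Longrightarrow> f x = g (cdiff T n x)" unfolding is_cobound_def by auto
      obtain g' where g': "g' \<in> THom (n - 1) (i + 1)" "\<And>x. x \<in> carrier (cobj T (n - 1)) \<Longrightarrow> d (i + 1) (g' x) = g x"
        using lift_hom[OF g(1,2)] by auto
      note gc = module_homD(1)[OF g'(1)]
      \<comment> \<open>Subtracting the lifted bounding map moves the values of \<open>h\<close>
        into Z_(i+1); the correction vanishes on boundaries of \<open>T\<close>, so
        \<open>f'\<close> is unchanged.\<close>
      let ?k = "\<lambda>x. h x \<ominus>\<^bsub>S (i + 1)\<^esub> g' (cdiff T n x)"
      have k: "?k \<in> THom n (i + 1)" by (rule hom_diff[OF h(1) module_hom_comp[OF T_hom g'(1)]])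
      show "is_cobound (n + 1) (i + 1) f'" unfolding is_cobound_def
      proof (rule bexI[of _ ?k], intro conjI ballI)
        fix x assume "x \<in> carrier (cobj T (n + 1 - 1))"
        then have x: "x \<in> carrier (cobj T n)" by simp
        have "d (i + 1) (?k x) = f x \<ominus>\<^bsub>S i\<^esub> f x"
          using x by (simp add: d_minus1 hc gc T_closed h(2) g'(2) g(3))
        then show "d (i + 1) (?k x) = \<zero>\<^bsub>S (i + 1 - 1)\<^esub>"
          using x module_homD(1)[OF fh] by (simp add: S.r_neg S.minus_eq)
      next
        fix x assume x: "x \<in> carrier (cobj T (n + 1))"
        then show "f' x = ?k (cdiff T (n + 1) x)"
          using hc T_closed(2) by (simp add: h(3) T_diff1 hom_zero[OF g'(1)] S1.minus_eq)
      qed (use k in simp)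
    next
      assume "is_cobound (n + 1) (i + 1) f'"
      then obtain g where g: "g \<in> THom n (i + 1)" "\<And>x. x \<in> carrier (cobj T n) \<Longrightarrow> d (i + 1) (g x) = \<zero>\<^bsub>S i\<^esub>"
        "\<And>x. x \<in> carrier (cobj T (n + 1)) \<Longrightarrow> f' x = g (cdiff T (n + 1) x)" unfolding is_cobound_def by auto
      note gc = module_homD(1)[OF g(1)]
      \<comment> \<open>The difference of two maps that both induce \<open>f'\<close> kills
        boundaries, so it factors through T_(n-1); applying \<open>d\<close> to the factor bounds
        \<open>f\<close>.\<close>
      have "\<exists>u\<in>THom (n - 1) (i + 1). \<forall>x\<in>carrier (cobj T n). h x \<ominus>\<^bsub>S (i + 1)\<^esub> g x = u (cdiff T n x)"
        using gc T_closed(2)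
        by (intro hom_extend hom_diff h(1) g(1)) (simp add: h(3)[symmetric] g(3) S1.minus_eq S1.r_neg)
      then obtain u where u: "u \<in> THom (n - 1) (i + 1)" "\<And>x. x \<in> carrier (cobj T n) \<Longrightarrow> h x \<ominus>\<^bsub>S (i + 1)\<^esub> g x = u (cdiff T n x)"
        by auto
      show "is_cobound n i f" unfolding is_cobound_def
      proof (rule bexI[of _ "\<lambda>x. d (i + 1) (u x)"], intro conjI ballI)
        fix x assume x: "x \<in> carrier (cobj T n)"
        have "d (i + 1) (u (cdiff T n x)) = f x \<ominus>\<^bsub>S i\<^esub> \<zero>\<^bsub>S i\<^esub>"
          using x by (simp add: u(2)[symmetric] d_minus1 hc gc h(2) g(2))
        then show "f x = d (i + 1) (u (cdiff T n x))"
          using module_homD(1)[OF fh x] by (simp add: S.minus_eq)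
      qed (use module_homD(1)[OF u(1)] d_d in \<open>auto intro: module_hom_comp[OF u(1) d_hom1]\<close>)
    qed
  next
    fix r f1 f1' f2 f2'
    assume r: "r \<in> carrier R" and "?Q f1 f1'" "?Q f2 f2'"
    then obtain h1 h2 where h1: "h1 \<in> THom n (i + 1)" "\<And>x. x \<in> carrier (cobj T n) \<Longrightarrow> d (i + 1) (h1 x) = f1 x"
      "\<And>x. x \<in> carrier (cobj T (n + 1)) \<Longrightarrow> f1' x = h1 (cdiff T (n + 1) x)"
      and h2: "h2 \<in> THom n (i + 1)" "\<And>x. x \<in> carrier (cobj T n) \<Longrightarrow> d (i + 1) (h2 x) = f2 x"
      "\<And>x. x \<in> carrier (cobj T (n + 1)) \<Longrightarrow> f2' x = h2 (cdiff T (n + 1) x)" by auto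
    show "?Q (haxpy i r f1 f2) (haxpy (i + 1) r f1' f2')"
      using r h1(2,3) h2(2,3) module_homD(1)[OF h1(1)] module_homD(1)[OF h2(1)]
      by (intro bexI[OF _ haxpy_hom[OF r h1(1) h2(1)]]) (simp add: haxpy_def module_homD[OF d_hom1])
  qed (use cocycles_haxpy in auto)
qed

text \<open>A shift followed by its inverse; this also supplies the closure conditions that a
  correspondence includes.\<close>

lemma correspond_refl: "correspond (carrier R) (coc n i) (coc n i)"
  using correspond_trans[OF shift correspond_sym[OF shift]] .

lemma shift_nat: "correspond (carrier R) (coc n i) (coc (n + int k) (i + int k))"
proof (induction k)
  case (Suc k)
  show ?case using correspond_trans[OF Suc.IH shift] by (simp add: add_ac)
qed (simp add: correspond_refl)

lemma shift_int: "correspond (carrier R) (coc n i) (coc (n + k) (i + k))"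
proof (cases "k \<ge> 0")
  case True
  then show ?thesis using shift_nat[of n i "nat k"] by simp
next
  case False
  then show ?thesis using correspond_sym[OF shift_nat[of "n + k" "i + k" "nat (- k)"]] by simp
qed

end

section \<open>Hom modules and their coboundaries\<close>

lemma hom_module_simps [simp]:
  "carrier (hom_module R M N) = Hom R M N \<inter> extensional (carrier M)"
  "\<zero>\<^bsub>hom_module R M N\<^esub> = (\<lambda>x\<in>carrier M. \<zero>\<^bsub>N\<^esub>)"
  "f \<oplus>\<^bsub>hom_module R M N\<^esub> g = (\<lambda>x\<in>carrier M. f x \<oplus>\<^bsub>N\<^esub> g x)"
  "r \<odot>\<^bsub>hom_module R M N\<^esub> f = (\<lambda>x\<in>carrier M. r \<odot>\<^bsub>N\<^esub> f x)"
  by (simp_all add: hom_module_def)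

lemma module_hom_restrict:
  assumes "Module.module R M" "f \<in> Hom R M N"
  shows "restrict f (carrier M) \<in> Hom R M N"
proof -
  interpret M: Module.module R M by fact
  show ?thesis by (rule module_homI) (simp_all add: module_homD[OF assms(2)])
qed

lemma module_hom_add:
  assumes "Module.module R M" "Module.module R N"
    and f: "f \<in> Hom R M N" and g: "g \<in> Hom R M N"
  shows "(\<lambda>x. f x \<oplus>\<^bsub>N\<^esub> g x) \<in> Hom R M N"
proof -
  interpret M: Module.module R M by fact
  interpret N: Module.module R N by fact
  show ?thesis
    by (rule module_homI) (simp_all add: module_homD[OF f] module_homD[OF g] N.a_ac N.smult_r_distr)
qed

lemma module_hom_smult:
  assumes "Module.module R M" "Module.module R N"
    and f: "f \<in> Hom R M N" and r: "r \<in> carrier R"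
  shows "(\<lambda>x. r \<odot>\<^bsub>N\<^esub> f x) \<in> Hom R M N"
proof -
  interpret M: Module.module R M by fact
  interpret N: Module.module R N by fact
  show ?thesis
  proof (rule module_homI)
    fix s x assume s: "s \<in> carrier R" and x: "x \<in> carrier M"
    have "r \<odot>\<^bsub>N\<^esub> (s \<odot>\<^bsub>N\<^esub> f x) = (r \<otimes>\<^bsub>R\<^esub> s) \<odot>\<^bsub>N\<^esub> f x"
      using r s module_homD(1)[OF f x] by (simp add: N.smult_assoc1)
    also have "\<dots> = s \<odot>\<^bsub>N\<^esub> (r \<odot>\<^bsub>N\<^esub> f x)"
      using r s module_homD(1)[OF f x] M.R.m_comm[OF r s] by (simp add: N.smult_assoc1)
    finally show "r \<odot>\<^bsub>N\<^esub> f (s \<odot>\<^bsub>M\<^esub> x) = s \<odot>\<^bsub>N\<^esub> (r \<odot>\<^bsub>N\<^esub> f x)" using s x by (simp add: module_homD[OF f])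
  qed (simp_all add: module_homD[OF f] r N.smult_r_distr)
qed

lemma module_hom_zero_map:
  assumes "Module.module R M" "Module.module R N"
  shows "(\<lambda>x. \<zero>\<^bsub>N\<^esub>) \<in> Hom R M N"
proof -
  interpret N: Module.module R N by fact
  show ?thesis by (rule module_homI) simp_all
qed

lemma hom_module_module:
  assumes M: "Module.module R M" and N: "Module.module R N"
  shows "Module.module R (hom_module R M N)"
proof -
  interpret M: Module.module R M by fact
  interpret N: Module.module R N by fact
  let ?H = "hom_module R M N"
  note res = module_hom_restrict[OF M]
  have c: "f x \<in> carrier N" if "f \<in> Hom R M N" "x \<in> carrier M" for f x
    by (rule module_homD(1)[OF that])
  have add: "f \<oplus>\<^bsub>?H\<^esub> g \<in> carrier ?H" if "f \<in> carrier ?H" "g \<in> carrier ?H" for f g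
    using that res[OF module_hom_add[OF M N, of f g]] by simp
  have smult: "r \<odot>\<^bsub>?H\<^esub> f \<in> carrier ?H" if "f \<in> carrier ?H" "r \<in> carrier R" for r f
    using that res[OF module_hom_smult[OF M N, of f r]] by simp
  have ab: "abelian_group ?H"
  proof (rule abelian_groupI)
    fix f assume f: "f \<in> carrier ?H"
    show "\<exists>g\<in>carrier ?H. g \<oplus>\<^bsub>?H\<^esub> f = \<zero>\<^bsub>?H\<^esub>"
    proof (rule bexI[of _ "(\<ominus>\<^bsub>R\<^esub> \<one>\<^bsub>R\<^esub>) \<odot>\<^bsub>?H\<^esub> f"])
      show "(\<ominus>\<^bsub>R\<^esub> \<one>\<^bsub>R\<^esub>) \<odot>\<^bsub>?H\<^esub> f \<oplus>\<^bsub>?H\<^esub> f = \<zero>\<^bsub>?H\<^esub>"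
        using f c[of f] by (auto simp: N.smult_l_minus N.l_neg intro!: restrict_ext)
    qed (rule smult[OF f], simp)
  qed (use add res[OF module_hom_zero_map[OF M N]] in \<open>auto simp: c N.a_ac extensional_def intro!: restrict_ext ext\<close>)
  show ?thesis
    by (rule moduleI[OF M.R.is_cring ab smult])
      (auto simp: c N.smult_l_distr N.smult_r_distr N.smult_assoc1 extensional_def intro!: restrict_ext ext)
qed

lemma coboundary_hom:
  assumes T: "Module.module R (cobj T n)" "Module.module R (cobj T (n + 1))"
    and d: "cdiff T (n + 1) \<in> Hom R (cobj T (n + 1)) (cobj T n)"
    and N: "Module.module R N"
  shows "coboundary T n \<in> Hom R (hom_module R (cobj T n) N) (hom_module R (cobj T (n + 1)) N)"
proof (rule module_homI)
  fix f assume f: "f \<in> carrier (hom_module R (cobj T n) N)"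
  then have "(\<lambda>x. f (cdiff T (n + 1) x)) \<in> Hom R (cobj T (n + 1)) N"
    using module_hom_comp[OF d, of f N] by simp
  then show "coboundary T n f \<in> carrier (hom_module R (cobj T (n + 1)) N)"
    using module_hom_restrict[OF T(2)] by (simp add: coboundary_def)
qed (auto simp: coboundary_def module_homD[OF d] intro!: restrict_ext)

section \<open>Tate cohomology through a complex of finite free modules\<close>

lemma module_hom_finsum:
  assumes M: "Module.module R M" and N: "Module.module R N" and f: "f \<in> Hom R M N"
    and g: "g \<in> I \<rightarrow> carrier M"
  shows "f (finsum M g I) = finsum N (\<lambda>j. f (g j)) I"
proof -
  interpret M: Module.module R M by fact
  interpret N: Module.module R N by fact
  show ?thesis using g
  proof (induction I rule: infinite_finite_induct)
    case (insert x F)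
    then have "f (finsum M g (insert x F)) = f (g x) \<oplus>\<^bsub>N\<^esub> f (finsum M g F)"
      by (simp add: module_homD(2)[OF f] Pi_def)
    then show ?case using insert module_homD(1)[OF f] by (simp add: Pi_def)
  qed (simp_all add: module_hom_zero[OF M N f])
qed

lemma regular_module_simps [simp]:
  "carrier (regular_module R) = carrier R" "x \<oplus>\<^bsub>regular_module R\<^esub> y = x \<oplus>\<^bsub>R\<^esub> y"
  "\<zero>\<^bsub>regular_module R\<^esub> = \<zero>\<^bsub>R\<^esub>" "r \<odot>\<^bsub>regular_module R\<^esub> y = r \<otimes>\<^bsub>R\<^esub> y"
  by (simp_all add: regular_module_def)

lemma regular_module_module:
  assumes "cring R"
  shows "Module.module R (regular_module R)"
proof -
  interpret R: cring R by fact
  have "abelian_group (regular_module R)"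
    by (rule abelian_groupI) (auto simp: R.a_ac intro: R.l_neg bexI[of _ "\<ominus>\<^bsub>R\<^esub> x" for x])
  then show ?thesis
    by (intro moduleI assms) (auto simp: R.l_distr R.r_distr R.m_assoc)
qed

text \<open>A complex of free modules given by a sparse matrix: each basis index has one entry per
  direction \<open>j\<close>, with coefficient \<open>cf\<close> and position \<open>tg\<close>. As
  the coefficients are scalars, the same matrix acts on functions with values in any module.\<close>

locale matrix_complex =
  fixes R :: "('r, 'z) ring_scheme" and L :: "int \<Rightarrow> 'i set" and I :: "'j set"
    and cf :: "int \<Rightarrow> 'i \<Rightarrow> 'j \<Rightarrow> 'r" and tg :: "int \<Rightarrow> 'i \<Rightarrow> 'j \<Rightarrow> 'i"
  assumes R_cring: "cring R" and cf_closed: "\<nu> \<in> L (i - 1) \<Longrightarrow> j \<in> I \<Longrightarrow> cf i \<nu> j \<in> carrier R"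
begin

text \<open>For finite \<open>L i\<close> this is \<open>M\<close> tensored with the free module on
  \<open>L i\<close>. Functions are zero off \<open>L i\<close>, so a position outside the index set
  contributes nothing to the differential.\<close>

definition chains :: "('r, 'b) module \<Rightarrow> int \<Rightarrow> ('r, 'i \<Rightarrow> 'b) module" where
  "chains M i = \<lparr>carrier = {z. (\<forall>\<nu>\<in>L i. z \<nu> \<in> carrier M) \<and> (\<forall>\<nu>. \<nu> \<notin> L i \<longrightarrow> z \<nu> = \<zero>\<^bsub>M\<^esub>)},
     monoid.mult = undefined, one = undefined, ring.zero = (\<lambda>_. \<zero>\<^bsub>M\<^esub>),
     add = (\<lambda>z w \<nu>. z \<nu> \<oplus>\<^bsub>M\<^esub> w \<nu>), module.smult = (\<lambda>r z \<nu>. r \<odot>\<^bsub>M\<^esub> z \<nu>)\<rparr>"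

definition mdiff :: "('r, 'b) module \<Rightarrow> int \<Rightarrow> ('i \<Rightarrow> 'b) \<Rightarrow> 'i \<Rightarrow> 'b" where
  "mdiff M i z \<nu> = (if \<nu> \<in> L (i - 1) then \<Oplus>\<^bsub>M\<^esub>j\<in>I. cf i \<nu> j \<odot>\<^bsub>M\<^esub> z (tg i \<nu> j) else \<zero>\<^bsub>M\<^esub>)"

lemma chains_simps [simp]:
  "z \<oplus>\<^bsub>chains M i\<^esub> w = (\<lambda>\<nu>. z \<nu> \<oplus>\<^bsub>M\<^esub> w \<nu>)" "\<zero>\<^bsub>chains M i\<^esub> = (\<lambda>_. \<zero>\<^bsub>M\<^esub>)"
  "r \<odot>\<^bsub>chains M i\<^esub> z = (\<lambda>\<nu>. r \<odot>\<^bsub>M\<^esub> z \<nu>)"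
  by (simp_all add: chains_def)

lemma chains_iff:
  "z \<in> carrier (chains M i) \<longleftrightarrow> (\<forall>\<nu>\<in>L i. z \<nu> \<in> carrier M) \<and> (\<forall>\<nu>. \<nu> \<notin> L i \<longrightarrow> z \<nu> = \<zero>\<^bsub>M\<^esub>)"
  by (simp add: chains_def)

lemma chains_closed:
  assumes "Module.module R M" "z \<in> carrier (chains M i)"
  shows "z \<nu> \<in> carrier M"
proof -
  interpret M: Module.module R M by fact
  show ?thesis using assms(2) by (cases "\<nu> \<in> L i") (auto simp: chains_iff)
qed

lemma chains_module:
  assumes M: "Module.module R M"
  shows "Module.module R (chains M i)"
proof -
  interpret M: Module.module R M by fact
  note c = chains_closed[OF M]
  have "abelian_group (chains M i)"
  proof (rule abelian_groupI)
    fix z assume z: "z \<in> carrier (chains M i)"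
    show "\<exists>w\<in>carrier (chains M i). w \<oplus>\<^bsub>chains M i\<^esub> z = \<zero>\<^bsub>chains M i\<^esub>"
      by (rule bexI[of _ "\<lambda>\<nu>. \<ominus>\<^bsub>M\<^esub> z \<nu>"]) (use z c[OF z] in \<open>auto simp: M.l_neg chains_iff\<close>)
  qed (auto simp: c M.a_ac, auto simp: chains_iff)
  then show ?thesis
    by (intro moduleI R_cring) (auto simp: c M.smult_l_distr M.smult_r_distr M.smult_assoc1, auto simp: chains_iff)
qed

lemma mdiff_hom:
  assumes M: "Module.module R M"
  shows "mdiff M i \<in> Hom R (chains M i) (chains M (i - 1))"
proof -
  interpret M: Module.module R M by fact
  note c = chains_closed[OF M]
  show ?thesis
  proof (rule module_homI)
    fix z assume z: "z \<in> carrier (chains M i)"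
    then show "mdiff M i z \<in> carrier (chains M (i - 1))"
      using c[OF z] cf_closed by (auto simp: chains_iff mdiff_def intro!: M.finsum_closed)
    fix w assume w: "w \<in> carrier (chains M i)"
    show "mdiff M i (z \<oplus>\<^bsub>chains M i\<^esub> w) = mdiff M i z \<oplus>\<^bsub>chains M (i - 1)\<^esub> mdiff M i w"
      using c[OF z] c[OF w] cf_closed
      by (auto simp: mdiff_def fun_eq_iff M.smult_r_distr Pi_def simp flip: M.finsum_addf intro!: M.finsum_cong')
  next
    fix r z assume r: "r \<in> carrier R" and z: "z \<in> carrier (chains M i)"
    have "(\<Oplus>\<^bsub>M\<^esub>j\<in>I. cf i \<nu> j \<odot>\<^bsub>M\<^esub> (r \<odot>\<^bsub>M\<^esub> z (tg i \<nu> j))) = r \<odot>\<^bsub>M\<^esub> (\<Oplus>\<^bsub>M\<^esub>j\<in>I. cf i \<nu> j \<odot>\<^bsub>M\<^esub> z (tg i \<nu> j))"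
      if \<nu>: "\<nu> \<in> L (i - 1)" for \<nu>
    proof -
      have "cf i \<nu> j \<odot>\<^bsub>M\<^esub> (r \<odot>\<^bsub>M\<^esub> z (tg i \<nu> j)) = r \<odot>\<^bsub>M\<^esub> (cf i \<nu> j \<odot>\<^bsub>M\<^esub> z (tg i \<nu> j))" if "j \<in> I" for j
        using r c[OF z] cf_closed[OF \<nu> that] by (simp add: M.smult_assoc1[symmetric] M.R.m_comm)
      then have "(\<Oplus>\<^bsub>M\<^esub>j\<in>I. cf i \<nu> j \<odot>\<^bsub>M\<^esub> (r \<odot>\<^bsub>M\<^esub> z (tg i \<nu> j))) = (\<Oplus>\<^bsub>M\<^esub>j\<in>I. r \<odot>\<^bsub>M\<^esub> (cf i \<nu> j \<odot>\<^bsub>M\<^esub> z (tg i \<nu> j)))"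
        using r c[OF z] cf_closed[OF \<nu>] by (intro M.finsum_cong') auto
      also have "\<dots> = r \<odot>\<^bsub>M\<^esub> (\<Oplus>\<^bsub>M\<^esub>j\<in>I. cf i \<nu> j \<odot>\<^bsub>M\<^esub> z (tg i \<nu> j))"
        using r c[OF z] cf_closed[OF \<nu>] by (intro M.finsum_smult[symmetric]) auto
      finally show ?thesis .
    qed
    then show "mdiff M i (r \<odot>\<^bsub>chains M i\<^esub> z) = r \<odot>\<^bsub>chains M (i - 1)\<^esub> mdiff M i z"
      using r by (auto simp: mdiff_def fun_eq_iff)
  qed
qed

text \<open>Scalars commute with module homomorphisms. This compares the complexes with values in
  \<open>A\<close> and in \<open>R\<close>, in both directions.\<close>

lemma mdiff_natural:
  assumes M: "Module.module R M" "Module.module R M'" and f: "f \<in> Hom R M M'"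
    and z: "z \<in> carrier (chains M i)"
  shows "mdiff M' i (\<lambda>\<nu>. f (z \<nu>)) = (\<lambda>\<nu>. f (mdiff M i z \<nu>))"
proof -
  interpret M: Module.module R M by fact
  interpret M': Module.module R M' by fact
  note c = chains_closed[OF M(1) z]
  show ?thesis
  proof
    fix \<nu>
    show "mdiff M' i (\<lambda>\<nu>. f (z \<nu>)) \<nu> = f (mdiff M i z \<nu>)"
    proof (cases "\<nu> \<in> L (i - 1)")
      case True
      have "f (\<Oplus>\<^bsub>M\<^esub>j\<in>I. cf i \<nu> j \<odot>\<^bsub>M\<^esub> z (tg i \<nu> j)) = (\<Oplus>\<^bsub>M'\<^esub>j\<in>I. f (cf i \<nu> j \<odot>\<^bsub>M\<^esub> z (tg i \<nu> j)))"
        using cf_closed[OF True] c by (intro module_hom_finsum[OF M f]) auto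
      also have "\<dots> = (\<Oplus>\<^bsub>M'\<^esub>j\<in>I. cf i \<nu> j \<odot>\<^bsub>M'\<^esub> f (z (tg i \<nu> j)))"
        using cf_closed[OF True] c module_homD(1)[OF f] by (intro M'.finsum_cong') (auto simp: module_homD(3)[OF f])
      finally show ?thesis using True by (simp add: mdiff_def)
    qed (simp add: mdiff_def module_hom_zero[OF M f])
  qed
qed

lemma chains_map:
  assumes M: "Module.module R M" "Module.module R M'" and f: "f \<in> Hom R M M'"
    and z: "z \<in> carrier (chains M i)"
  shows "(\<lambda>\<nu>. f (z \<nu>)) \<in> carrier (chains M' i)"
  using z module_homD(1)[OF f] module_hom_zero[OF M f] by (auto simp: chains_iff)

end

text \<open>Abstract form of the splice. \<open>A\<close> is cyclic on \<open>gen\<close>; its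
  annihilator J is also the annihilator of \<open>N\<close>, and whatever J annihilates is a
  multiple of \<open>N\<close>. So R N is isomorphic to \<open>A\<close> and equals the annihilator
  of J. Degrees 0 and -1 have rank one, and \<open>N\<close> is the map between them.\<close>

locale tate_setup = matrix_complex R L I cf tg
  for R :: "('r, 'z) ring_scheme" and L :: "int \<Rightarrow> 'i set" and I :: "'j set" and cf tg +
  fixes A :: "('r, 'b) module" and T :: "('r, 'm) mod_complex" and gen :: 'b and N :: 'r and pt :: 'i
  assumes T: "complete_resolution R A T" and A_module: "Module.module R A" and gen: "gen \<in> carrier A"
    and cyclic: "b \<in> carrier A \<Longrightarrow> \<exists>r\<in>carrier R. b = r \<odot>\<^bsub>A\<^esub> gen"
    and N: "N \<in> carrier R"
    and ann_N: "r \<in> carrier R \<Longrightarrow> r \<otimes>\<^bsub>R\<^esub> N = \<zero>\<^bsub>R\<^esub> \<longleftrightarrow> r \<odot>\<^bsub>A\<^esub> gen = \<zero>\<^bsub>A\<^esub>"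
    and ann_gen: "r \<in> carrier R \<Longrightarrow> (\<And>s. s \<in> carrier R \<Longrightarrow> s \<odot>\<^bsub>A\<^esub> gen = \<zero>\<^bsub>A\<^esub> \<Longrightarrow> s \<otimes>\<^bsub>R\<^esub> r = \<zero>\<^bsub>R\<^esub>)
      \<Longrightarrow> \<exists>t\<in>carrier R. r = t \<otimes>\<^bsub>R\<^esub> N"
    and L_0: "L 0 = {pt}" and L_m1: "L (- 1) = {pt}"
    and mdiff_0: "z \<in> carrier (chains (regular_module R) 0) \<Longrightarrow> mdiff (regular_module R) 0 z pt = N \<otimes>\<^bsub>R\<^esub> z pt"
    and exact: "z \<in> carrier (chains (regular_module R) i) \<Longrightarrow>
      mdiff (regular_module R) i z = (\<lambda>_. \<zero>\<^bsub>R\<^esub>) \<longleftrightarrow>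
      (\<exists>y\<in>carrier (chains (regular_module R) (i + 1)). mdiff (regular_module R) (i + 1) y = z)"
begin

interpretation R: cring R by (rule R_cring)
interpretation A: Module.module R A by (rule A_module)

abbreviation "RR \<equiv> regular_module R"

lemma RR: "Module.module R RR" by (rule regular_module_module[OF R_cring])

lemma T_chain: "chain_complex R T" and T_projective: "projective_module R (cobj T n)"
  and T_mod: "Module.module R (cobj T n)"
  and T_cdiff: "cdiff T n \<in> Hom R (cobj T n) (cobj T (n - 1))"
  using T by (auto simp: complete_resolution_def chain_complex_def)

lemma T_cdiff1: "cdiff T (n + 1) \<in> Hom R (cobj T (n + 1)) (cobj T n)"
  using T_cdiff[of "n + 1"] by simp

lemma hom_extend_regular:
  assumes f: "f \<in> Hom R (cobj T n) RR"
    and cyc: "\<And>x. x \<in> carrier (cobj T (n + 1)) \<Longrightarrow> f (cdiff T (n + 1) x) = \<zero>\<^bsub>R\<^esub>"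
  shows "\<exists>h\<in>Hom R (cobj T (n - 1)) RR. \<forall>x\<in>carrier (cobj T n). f x = h (cdiff T n x)"
proof -
  have ex: "coboundary T (n - 1) ` carrier (hom_module R (cobj T (n - 1)) RR)
      = kernel_of (hom_module R (cobj T n) RR) (coboundary T n) (hom_module R (cobj T (n + 1)) RR)"
    using T by (auto simp: complete_resolution_def exact_at_def)
  interpret Tn: Module.module R "cobj T n" by (rule T_mod)
  have "restrict f (carrier (cobj T n)) \<in> carrier (hom_module R (cobj T n) RR)"
    using module_homD[OF f] by (auto simp: hom_module_def intro!: module_homI)
  moreover have "coboundary T n (restrict f (carrier (cobj T n))) = \<zero>\<^bsub>hom_module R (cobj T (n + 1)) RR\<^esub>"
    using cyc module_homD(1)[OF T_cdiff1] by (auto simp: coboundary_def hom_module_def fun_eq_iff)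
  ultimately have "restrict f (carrier (cobj T n)) \<in> coboundary T (n - 1) ` carrier (hom_module R (cobj T (n - 1)) RR)"
    unfolding ex kernel_of_def by simp
  then obtain h where h: "h \<in> carrier (hom_module R (cobj T (n - 1)) RR)"
    "restrict f (carrier (cobj T n)) = coboundary T (n - 1) h" by auto
  have "f x = h (cdiff T n x)" if "x \<in> carrier (cobj T n)" for x
    using fun_cong[OF h(2), of x] that by (simp add: coboundary_def)
  then show ?thesis using h(1) by (auto simp: hom_module_def)
qed

sublocale cp: complex_pair R T "chains RR" "mdiff RR"
proof (rule complex_pair.intro)
  show "mdiff RR i \<in> Hom R (chains RR i) (chains RR (i - 1))" for i
    by (rule mdiff_hom[OF RR])
  fix f n i assume f: "f \<in> Hom R (cobj T n) (chains RR i)"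
    and cyc: "\<And>x. x \<in> carrier (cobj T (n + 1)) \<Longrightarrow> f (cdiff T (n + 1) x) = \<zero>\<^bsub>chains RR i\<^esub>"
  \<comment> \<open>A map into functions on \<open>L i\<close> is extended one coordinate at a
    time.\<close>
  have "\<exists>h\<in>Hom R (cobj T (n - 1)) RR. \<forall>x\<in>carrier (cobj T n). f x \<nu> = h (cdiff T n x)" for \<nu>
  proof (rule hom_extend_regular)
    show "(\<lambda>x. f x \<nu>) \<in> Hom R (cobj T n) RR"
      using chains_closed[OF RR module_homD(1)[OF f]] by (auto intro!: module_homI simp: module_homD(2,3)[OF f])
  qed (use cyc in simp)
  then obtain h where h: "\<And>\<nu>. h \<nu> \<in> Hom R (cobj T (n - 1)) RR"
    "\<And>x \<nu>. x \<in> carrier (cobj T n) \<Longrightarrow> f x \<nu> = h \<nu> (cdiff T n x)" by metis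
  show "\<exists>h\<in>Hom R (cobj T (n - 1)) (chains RR i). \<forall>x\<in>carrier (cobj T n). f x = h (cdiff T n x)"
  proof (rule bexI[of _ "\<lambda>x \<nu>. if \<nu> \<in> L i then h \<nu> x else \<zero>\<^bsub>R\<^esub>"], intro ballI)
    fix x assume x: "x \<in> carrier (cobj T n)"
    show "f x = (\<lambda>\<nu>. if \<nu> \<in> L i then h \<nu> (cdiff T n x) else \<zero>\<^bsub>R\<^esub>)"
      using h(2)[OF x] module_homD(1)[OF f x] by (auto simp: chains_iff)
  next
    show "(\<lambda>x \<nu>. if \<nu> \<in> L i then h \<nu> x else \<zero>\<^bsub>R\<^esub>) \<in> Hom R (cobj T (n - 1)) (chains RR i)"
      using module_homD[OF h(1)] by (intro module_homI) (auto simp: chains_iff fun_eq_iff)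
  qed
next
  show "\<And>x i. x \<in> carrier (chains RR i) \<Longrightarrow>
    (mdiff RR i x = \<zero>\<^bsub>chains RR (i - 1)\<^esub>) = (\<exists>y\<in>carrier (chains RR (i + 1)). mdiff RR (i + 1) y = x)"
    using exact by simp
qed (use T_chain T_projective chains_module[OF RR] in auto)

text \<open>The embedding of \<open>A\<close> into \<open>R\<close> that takes r gen to r N. It is
  well defined and injective because \<open>gen\<close> and \<open>N\<close> have the same
  annihilator.\<close>

definition \<theta> :: "'b \<Rightarrow> 'r" where
  "\<theta> b = (SOME r. r \<in> carrier R \<and> b = r \<odot>\<^bsub>A\<^esub> gen) \<otimes>\<^bsub>R\<^esub> N"

text \<open>The difference of the two scalars annihilates \<open>gen\<close>, hence also
  \<open>z\<close>. This makes maps out of the cyclic module \<open>A\<close> well defined.\<close>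

lemma same_action:
  assumes M: "Module.module R M" and r: "r \<in> carrier R" "s \<in> carrier R" "r \<odot>\<^bsub>A\<^esub> gen = s \<odot>\<^bsub>A\<^esub> gen"
    and z: "z \<in> carrier M" "\<And>t. t \<in> carrier R \<Longrightarrow> t \<odot>\<^bsub>A\<^esub> gen = \<zero>\<^bsub>A\<^esub> \<Longrightarrow> t \<odot>\<^bsub>M\<^esub> z = \<zero>\<^bsub>M\<^esub>"
  shows "r \<odot>\<^bsub>M\<^esub> z = s \<odot>\<^bsub>M\<^esub> z"
proof -
  interpret M: Module.module R M by fact
  have "(r \<ominus>\<^bsub>R\<^esub> s) \<odot>\<^bsub>A\<^esub> gen = r \<odot>\<^bsub>A\<^esub> gen \<ominus>\<^bsub>A\<^esub> s \<odot>\<^bsub>A\<^esub> gen"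
    using r gen by (simp add: R.minus_eq A.minus_eq A.smult_l_distr A.smult_l_minus)
  then have "(r \<ominus>\<^bsub>R\<^esub> s) \<odot>\<^bsub>A\<^esub> gen = \<zero>\<^bsub>A\<^esub>" using r gen by (simp add: A.minus_eq A.r_neg)
  then have "(r \<ominus>\<^bsub>R\<^esub> s) \<odot>\<^bsub>M\<^esub> z = \<zero>\<^bsub>M\<^esub>" using z(2) r by simp
  moreover have "r \<odot>\<^bsub>M\<^esub> z = ((r \<ominus>\<^bsub>R\<^esub> s) \<oplus>\<^bsub>R\<^esub> s) \<odot>\<^bsub>M\<^esub> z"
    using r by (simp add: R.minus_eq R.a_assoc R.l_neg)
  ultimately show ?thesis using r z(1) by (simp add: M.smult_l_distr)
qed

lemma gen_choice:
  assumes "b \<in> carrier A"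
  shows "(SOME r. r \<in> carrier R \<and> b = r \<odot>\<^bsub>A\<^esub> gen) \<in> carrier R"
    "(SOME r. r \<in> carrier R \<and> b = r \<odot>\<^bsub>A\<^esub> gen) \<odot>\<^bsub>A\<^esub> gen = b"
proof -
  have "\<exists>r. r \<in> carrier R \<and> b = r \<odot>\<^bsub>A\<^esub> gen" using cyclic[OF assms] by auto
  from someI_ex[OF this] show "(SOME r. r \<in> carrier R \<and> b = r \<odot>\<^bsub>A\<^esub> gen) \<in> carrier R"
    "(SOME r. r \<in> carrier R \<and> b = r \<odot>\<^bsub>A\<^esub> gen) \<odot>\<^bsub>A\<^esub> gen = b" by simp_all
qed

lemma \<theta>_gen: "r \<in> carrier R \<Longrightarrow> \<theta> (r \<odot>\<^bsub>A\<^esub> gen) = r \<otimes>\<^bsub>R\<^esub> N"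
  using same_action[OF RR, of "SOME s. s \<in> carrier R \<and> r \<odot>\<^bsub>A\<^esub> gen = s \<odot>\<^bsub>A\<^esub> gen" r N] gen_choice[of "r \<odot>\<^bsub>A\<^esub> gen"] gen N ann_N
  by (simp add: \<theta>_def)

lemma \<theta>_hom: "\<theta> \<in> Hom R A RR"
proof (rule module_homI)
  fix x y assume "x \<in> carrier A" "y \<in> carrier A"
  then obtain r s where r: "r \<in> carrier R" "s \<in> carrier R" "x = r \<odot>\<^bsub>A\<^esub> gen" "y = s \<odot>\<^bsub>A\<^esub> gen" using cyclic by metis
  show "\<theta> x \<in> carrier RR" using r N by (simp add: \<theta>_gen)
  have "x \<oplus>\<^bsub>A\<^esub> y = (r \<oplus>\<^bsub>R\<^esub> s) \<odot>\<^bsub>A\<^esub> gen" using r gen by (simp add: A.smult_l_distr)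
  then have "\<theta> (x \<oplus>\<^bsub>A\<^esub> y) = (r \<oplus>\<^bsub>R\<^esub> s) \<otimes>\<^bsub>R\<^esub> N" using r by (simp add: \<theta>_gen)
  then show "\<theta> (x \<oplus>\<^bsub>A\<^esub> y) = \<theta> x \<oplus>\<^bsub>RR\<^esub> \<theta> y" using r N by (simp add: \<theta>_gen R.l_distr)
next
  fix r x assume r: "r \<in> carrier R" and "x \<in> carrier A"
  then obtain s where s: "s \<in> carrier R" "x = s \<odot>\<^bsub>A\<^esub> gen" using cyclic by metis
  have "r \<odot>\<^bsub>A\<^esub> x = (r \<otimes>\<^bsub>R\<^esub> s) \<odot>\<^bsub>A\<^esub> gen" using r s gen by (simp add: A.smult_assoc1)
  then show "\<theta> (r \<odot>\<^bsub>A\<^esub> x) = r \<odot>\<^bsub>RR\<^esub> \<theta> x" using r s N by (simp add: \<theta>_gen R.m_assoc)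
qed

lemma \<theta>_inj:
  assumes "x \<in> carrier A" "\<theta> x = \<zero>\<^bsub>R\<^esub>"
  shows "x = \<zero>\<^bsub>A\<^esub>"
proof -
  obtain r where r: "r \<in> carrier R" "x = r \<odot>\<^bsub>A\<^esub> gen" using cyclic[OF assms(1)] by metis
  then show ?thesis using assms(2) ann_N by (simp add: \<theta>_gen)
qed

lemma hom_inj:
  assumes M: "Module.module R M" "Module.module R M'" and f: "f \<in> Hom R M M'"
    and ker: "\<And>x. x \<in> carrier M \<Longrightarrow> f x = \<zero>\<^bsub>M'\<^esub> \<Longrightarrow> x = \<zero>\<^bsub>M\<^esub>"
    and xy: "x \<in> carrier M" "y \<in> carrier M" "f x = f y"
  shows "x = y"
proof -
  interpret M: Module.module R M by fact
  interpret M': Module.module R M' by fact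
  have x: "x = (x \<ominus>\<^bsub>M\<^esub> y) \<oplus>\<^bsub>M\<^esub> y" using xy by (simp add: M.minus_eq M.a_assoc M.l_neg)
  have "f x = f (x \<ominus>\<^bsub>M\<^esub> y) \<oplus>\<^bsub>M'\<^esub> f y" using xy by (subst x) (simp add: module_homD(2)[OF f])
  then have "f (x \<ominus>\<^bsub>M\<^esub> y) = \<zero>\<^bsub>M'\<^esub>"
    using xy module_homD(1)[OF f, of "x \<ominus>\<^bsub>M\<^esub> y"] module_homD(1)[OF f xy(2)] by (simp add: M'.add.r_cancel_one')
  then have "x \<ominus>\<^bsub>M\<^esub> y = \<zero>\<^bsub>M\<^esub>" using ker[of "x \<ominus>\<^bsub>M\<^esub> y"] xy by simp
  then show ?thesis using x xy by simp
qed

text \<open>By \<open>ann_gen\<close> the image of \<open>\<theta>\<close> is all that the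
  annihilator of \<open>gen\<close> annihilates.\<close>

lemma \<theta>_image:
  assumes "r \<in> carrier R" "\<And>s. s \<in> carrier R \<Longrightarrow> s \<odot>\<^bsub>A\<^esub> gen = \<zero>\<^bsub>A\<^esub> \<Longrightarrow> s \<otimes>\<^bsub>R\<^esub> r = \<zero>\<^bsub>R\<^esub>"
  shows "\<exists>b\<in>carrier A. \<theta> b = r"
  using ann_gen[OF assms] \<theta>_gen gen by (metis A.smult_closed)

lemma ann_\<theta>:
  assumes s: "s \<in> carrier R" "s \<odot>\<^bsub>A\<^esub> gen = \<zero>\<^bsub>A\<^esub>" and b: "b \<in> carrier A"
  shows "s \<otimes>\<^bsub>R\<^esub> \<theta> b = \<zero>\<^bsub>R\<^esub>"
proof -
  obtain r where r: "r \<in> carrier R" "b = r \<odot>\<^bsub>A\<^esub> gen" using cyclic[OF b] by metis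
  have "s \<otimes>\<^bsub>R\<^esub> (r \<otimes>\<^bsub>R\<^esub> N) = r \<otimes>\<^bsub>R\<^esub> (s \<otimes>\<^bsub>R\<^esub> N)" using s r N by (simp add: R.m_lcomm)
  then show ?thesis using r s ann_N[OF s(1)] by (simp add: \<theta>_gen)
qed

text \<open>The isomorphism from \<open>A\<close> onto the cycles in degree -1.\<close>

definition up :: "'b \<Rightarrow> 'i \<Rightarrow> 'r" where
  "up b \<nu> = (if \<nu> = pt then \<theta> b else \<zero>\<^bsub>R\<^esub>)"

lemma up_hom: "up \<in> Hom R A (chains RR (- 1))"
  using module_homD[OF \<theta>_hom] by (intro module_homI) (auto simp: up_def chains_iff L_m1 fun_eq_iff)

lemma up_ker:
  assumes "x \<in> carrier A" "up x = \<zero>\<^bsub>chains RR (- 1)\<^esub>"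
  shows "x = \<zero>\<^bsub>A\<^esub>"
proof (rule \<theta>_inj[OF assms(1)])
  show "\<theta> x = \<zero>\<^bsub>R\<^esub>" using fun_cong[OF assms(2), of pt] unfolding up_def by simp
qed

lemma mdiff_0_eq:
  assumes "y \<in> carrier (chains RR 0)"
  shows "mdiff RR 0 y = up (y pt \<odot>\<^bsub>A\<^esub> gen)"
proof -
  have y: "y pt \<in> carrier R" using assms by (simp add: chains_iff L_0)
  show ?thesis
    using mdiff_0[OF assms] y N by (auto simp: fun_eq_iff up_def \<theta>_gen R.m_comm mdiff_def[of _ 0] L_m1)
qed

text \<open>The element r gen is sent to the boundary of the degree 0 chain with entry r, and
  boundaries are cycles.\<close>

lemma up_cycle: "b \<in> carrier A \<Longrightarrow> mdiff RR (- 1) (up b) = (\<lambda>_. \<zero>\<^bsub>R\<^esub>)"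
proof -
  assume b: "b \<in> carrier A"
  then obtain r where r: "r \<in> carrier R" "b = r \<odot>\<^bsub>A\<^esub> gen" using cyclic by metis
  have "(\<lambda>\<nu>. if \<nu> = pt then r else \<zero>\<^bsub>R\<^esub>) \<in> carrier (chains RR 0)" using r by (simp add: chains_iff L_0)
  from this mdiff_0_eq[OF this] show ?thesis
    using exact[OF module_homD(1)[OF up_hom b]] r by auto
qed

lemma cycle_up:
  assumes "z \<in> carrier (chains RR (- 1))" "mdiff RR (- 1) z = (\<lambda>_. \<zero>\<^bsub>R\<^esub>)"
  shows "\<exists>b\<in>carrier A. up b = z"
proof -
  obtain y where y: "y \<in> carrier (chains RR 0)" "mdiff RR 0 y = z" using exact[OF assms(1)] assms(2) by auto
  then have "y pt \<in> carrier R" by (simp add: chains_iff L_0)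
  then show ?thesis using y mdiff_0_eq[OF y(1)] gen by auto
qed

definition "coA n =
  ({f \<in> Hom R (cobj T n) A. \<forall>x\<in>carrier (cobj T (n + 1)). f (cdiff T (n + 1) x) = \<zero>\<^bsub>A\<^esub>},
   (\<lambda>f. \<exists>h\<in>Hom R (cobj T (n - 1)) A. \<forall>x\<in>carrier (cobj T n). f x = h (cdiff T n x)),
   (\<lambda>r f f' x. r \<odot>\<^bsub>A\<^esub> f x \<oplus>\<^bsub>A\<^esub> f' x))"

lemma hom_down:
  assumes M: "Module.module R M" and f: "f \<in> Hom R M (chains RR (- 1))"
    and cyc: "\<And>x. x \<in> carrier M \<Longrightarrow> mdiff RR (- 1) (f x) = (\<lambda>_. \<zero>\<^bsub>R\<^esub>)"
  shows "\<exists>h\<in>Hom R M A. \<forall>x\<in>carrier M. f x = up (h x)"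
proof -
  interpret M: Module.module R M by fact
  have "\<exists>b. x \<in> carrier M \<longrightarrow> b \<in> carrier A \<and> up b = f x" for x
    using cycle_up[OF module_homD(1)[OF f] cyc, of x] by auto
  then obtain h where h: "\<And>x. x \<in> carrier M \<Longrightarrow> h x \<in> carrier A" "\<And>x. x \<in> carrier M \<Longrightarrow> up (h x) = f x" by metis
  have inj: "a = b" if "a \<in> carrier A" "b \<in> carrier A" "up a = up b" for a b
    by (rule hom_inj[OF A_module chains_module[OF RR] up_hom up_ker that])
  have "h \<in> Hom R M A"
    by (rule module_homI) (auto intro!: inj simp: h module_homD(2,3)[OF up_hom] module_homD(2,3)[OF f])
  then show ?thesis using h(2) by (intro bexI[of _ h]) auto
qed

text \<open>Replacing \<open>A\<close> by the isomorphic module of cycles in degree -1 turns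
  cohomology with coefficients in \<open>A\<close> into the starting point of the shift.\<close>

lemma coA_corr: "correspond (carrier R) (coA n) (cp.coc n (- 1))"
  unfolding coA_def cp.coc_def
proof (rule correspondI[where Q = "\<lambda>f f'. \<forall>x\<in>carrier (cobj T n). f' x = up (f x)"])
  fix f assume "f \<in> {f \<in> Hom R (cobj T n) A. \<forall>x\<in>carrier (cobj T (n + 1)). f (cdiff T (n + 1) x) = \<zero>\<^bsub>A\<^esub>}"
  then have f: "f \<in> Hom R (cobj T n) A" "\<And>x. x \<in> carrier (cobj T (n + 1)) \<Longrightarrow> f (cdiff T (n + 1) x) = \<zero>\<^bsub>A\<^esub>" by auto
  have "(\<lambda>x. up (f x)) \<in> cp.cocycles n (- 1)"
    using module_hom_comp[OF f(1) up_hom] f(2) module_hom_zero[OF A_module chains_module[OF RR] up_hom] module_homD(1)[OF f(1)]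
    by (auto simp: cp.cocycles_def up_cycle)
  then show "\<exists>f'\<in>cp.cocycles n (- 1). \<forall>x\<in>carrier (cobj T n). f' x = up (f x)" by (intro bexI) auto
next
  fix f' assume f': "f' \<in> cp.cocycles n (- 1)"
  then obtain h where h: "h \<in> Hom R (cobj T n) A" "\<And>x. x \<in> carrier (cobj T n) \<Longrightarrow> f' x = up (h x)"
    using hom_down[OF T_mod, of f' n] by (auto simp: cp.cocycles_def)
  have "h (cdiff T (n + 1) x) = \<zero>\<^bsub>A\<^esub>" if x: "x \<in> carrier (cobj T (n + 1))" for x
  proof (rule up_ker)
    show "h (cdiff T (n + 1) x) \<in> carrier A" by (rule module_homD(1)[OF h(1) module_homD(1)[OF T_cdiff1 x]])
    show "up (h (cdiff T (n + 1) x)) = \<zero>\<^bsub>chains RR (- 1)\<^esub>"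
      using f' x h(2)[OF module_homD(1)[OF T_cdiff1 x]] by (auto simp: cp.cocycles_def)
  qed
  then show "\<exists>f\<in>{f \<in> Hom R (cobj T n) A. \<forall>x\<in>carrier (cobj T (n + 1)). f (cdiff T (n + 1) x) = \<zero>\<^bsub>A\<^esub>}.
      \<forall>x\<in>carrier (cobj T n). f' x = up (f x)"
    using h by (intro bexI[of _ h]) auto
next
  fix f f' assume "f \<in> {f \<in> Hom R (cobj T n) A. \<forall>x\<in>carrier (cobj T (n + 1)). f (cdiff T (n + 1) x) = \<zero>\<^bsub>A\<^esub>}"
    and f': "f' \<in> cp.cocycles n (- 1)" and Q: "\<forall>x\<in>carrier (cobj T n). f' x = up (f x)"
  then have f: "f \<in> Hom R (cobj T n) A" by auto
  show "(\<exists>h\<in>Hom R (cobj T (n - 1)) A. \<forall>x\<in>carrier (cobj T n). f x = h (cdiff T n x)) = cp.is_cobound n (- 1) f'"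
  proof
    assume "\<exists>h\<in>Hom R (cobj T (n - 1)) A. \<forall>x\<in>carrier (cobj T n). f x = h (cdiff T n x)"
    then obtain h where h: "h \<in> Hom R (cobj T (n - 1)) A" "\<And>x. x \<in> carrier (cobj T n) \<Longrightarrow> f x = h (cdiff T n x)" by auto
    show "cp.is_cobound n (- 1) f'" unfolding cp.is_cobound_def
      by (rule bexI[OF _ module_hom_comp[OF h(1) up_hom]]) (use h Q module_homD(1)[OF h(1)] in \<open>auto simp: up_cycle\<close>)
  next
    assume "cp.is_cobound n (- 1) f'"
    then obtain g where g: "g \<in> Hom R (cobj T (n - 1)) (chains RR (- 1))"
      "\<And>x. x \<in> carrier (cobj T (n - 1)) \<Longrightarrow> mdiff RR (- 1) (g x) = (\<lambda>_. \<zero>\<^bsub>R\<^esub>)"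
      "\<And>x. x \<in> carrier (cobj T n) \<Longrightarrow> f' x = g (cdiff T n x)" by (auto simp: cp.is_cobound_def)
    obtain h where h: "h \<in> Hom R (cobj T (n - 1)) A" "\<And>x. x \<in> carrier (cobj T (n - 1)) \<Longrightarrow> g x = up (h x)"
      using hom_down[OF T_mod g(1,2)] by auto
    have "f x = h (cdiff T n x)" if x: "x \<in> carrier (cobj T n)" for x
      using x Q g(3)[OF x] h(2)[OF module_homD(1)[OF T_cdiff x]]
      by (intro hom_inj[OF A_module chains_module[OF RR] up_hom up_ker] module_homD(1)[OF f] module_homD(1)[OF h(1)] module_homD(1)[OF T_cdiff]) auto
    then show "\<exists>h\<in>Hom R (cobj T (n - 1)) A. \<forall>x\<in>carrier (cobj T n). f x = h (cdiff T n x)" using h(1) by blast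
  qed
next
  fix r f f' g g' assume r: "r \<in> carrier R"
    and "f \<in> {f \<in> Hom R (cobj T n) A. \<forall>x\<in>carrier (cobj T (n + 1)). f (cdiff T (n + 1) x) = \<zero>\<^bsub>A\<^esub>}"
    and "g \<in> {f \<in> Hom R (cobj T n) A. \<forall>x\<in>carrier (cobj T (n + 1)). f (cdiff T (n + 1) x) = \<zero>\<^bsub>A\<^esub>}"
    and Q: "\<forall>x\<in>carrier (cobj T n). f' x = up (f x)" "\<forall>x\<in>carrier (cobj T n). g' x = up (g x)"
  then have f: "f \<in> Hom R (cobj T n) A" "g \<in> Hom R (cobj T n) A" by auto
  show "\<forall>x\<in>carrier (cobj T n). cp.haxpy (- 1) r f' g' x = up (r \<odot>\<^bsub>A\<^esub> f x \<oplus>\<^bsub>A\<^esub> g x)"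
    using r Q module_homD(1)[OF f(1)] module_homD(1)[OF f(2)]
    by (auto simp: cp.haxpy_def module_homD[OF up_hom])
next
  fix r f g assume r: "r \<in> carrier R"
    and fg: "f \<in> {f \<in> Hom R (cobj T n) A. \<forall>x\<in>carrier (cobj T (n + 1)). f (cdiff T (n + 1) x) = \<zero>\<^bsub>A\<^esub>}"
    "g \<in> {f \<in> Hom R (cobj T n) A. \<forall>x\<in>carrier (cobj T (n + 1)). f (cdiff T (n + 1) x) = \<zero>\<^bsub>A\<^esub>}"
  then have f: "f \<in> Hom R (cobj T n) A" "g \<in> Hom R (cobj T n) A" by auto
  have "(\<lambda>x. r \<odot>\<^bsub>A\<^esub> f x \<oplus>\<^bsub>A\<^esub> g x) \<in> Hom R (cobj T n) A"
  proof (rule module_homI)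
    fix s x assume s: "s \<in> carrier R" and x: "x \<in> carrier (cobj T n)"
    have "r \<odot>\<^bsub>A\<^esub> (s \<odot>\<^bsub>A\<^esub> f x) = s \<odot>\<^bsub>A\<^esub> (r \<odot>\<^bsub>A\<^esub> f x)"
      using r s module_homD(1)[OF f(1) x] by (simp add: A.smult_assoc1[symmetric] R.m_comm)
    then show "r \<odot>\<^bsub>A\<^esub> f (s \<odot>\<^bsub>cobj T n\<^esub> x) \<oplus>\<^bsub>A\<^esub> g (s \<odot>\<^bsub>cobj T n\<^esub> x) = s \<odot>\<^bsub>A\<^esub> (r \<odot>\<^bsub>A\<^esub> f x \<oplus>\<^bsub>A\<^esub> g x)"
      using r s x module_homD(1)[OF f(1) x] module_homD(1)[OF f(2) x]
      by (simp add: module_homD(3)[OF f(1)] module_homD(3)[OF f(2)] A.smult_r_distr)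
  qed (use r in \<open>simp_all add: module_homD[OF f(1)] module_homD[OF f(2)] A.smult_r_distr A.a_ac\<close>)
  then show "(\<lambda>x. r \<odot>\<^bsub>A\<^esub> f x \<oplus>\<^bsub>A\<^esub> g x) \<in> {f \<in> Hom R (cobj T n) A. \<forall>x\<in>carrier (cobj T (n + 1)). f (cdiff T (n + 1) x) = \<zero>\<^bsub>A\<^esub>}"
    using r fg by auto
qed (rule cp.cocycles_haxpy)

text \<open>The augmentation of the projective resolution, pulled back along the chain map.
  Bijectivity in degrees 0 and 1 carries its kernel over.\<close>

lemma ex_augmentation:
  "\<exists>\<eta>\<in>Hom R (cobj T 0) A. \<eta> ` carrier (cobj T 0) = carrier A
     \<and> (\<forall>x\<in>carrier (cobj T 0). \<eta> x = \<zero>\<^bsub>A\<^esub> \<longleftrightarrow> (\<exists>y\<in>carrier (cobj T 1). x = cdiff T 1 y))"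
proof -
  obtain P :: "('r, 'm) mod_complex" and f where P: "projective_resolution R A P" and f: "chain_map R T P f"
    and bij: "\<And>n. n \<ge> 0 \<Longrightarrow> bij_betw (f n) (carrier (cobj T n)) (carrier (cobj P n))"
    using T unfolding complete_resolution_def by blast
  obtain \<epsilon> where e: "\<epsilon> \<in> Hom R (cobj P 0) A" "\<epsilon> ` carrier (cobj P 0) = carrier A"
    "exact_at (cobj P 1) (cdiff P 1) (cobj P 0) \<epsilon> A"
    using P unfolding projective_resolution_def by blast
  have fh: "f n \<in> Hom R (cobj T n) (cobj P n)" for n using f by (simp add: chain_map_def)
  have fc: "f 0 (cdiff T 1 y) = cdiff P 1 (f 1 y)" if "y \<in> carrier (cobj T 1)" for y
    using f that by (force simp: chain_map_def dest: spec[of _ 1])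
  have d1: "cdiff T 1 y \<in> carrier (cobj T 0)" if "y \<in> carrier (cobj T 1)" for y
    using module_homD(1)[OF T_cdiff[of 1]] that by simp
  have b0: "f 0 ` carrier (cobj T 0) = carrier (cobj P 0)" "inj_on (f 0) (carrier (cobj T 0))"
    and b1: "f 1 ` carrier (cobj T 1) = carrier (cobj P 1)" using bij[of 0] bij[of 1] by (auto simp: bij_betw_def)
  have "\<epsilon> (f 0 x) = \<zero>\<^bsub>A\<^esub> \<longleftrightarrow> (\<exists>y\<in>carrier (cobj T 1). x = cdiff T 1 y)" if x: "x \<in> carrier (cobj T 0)" for x
  proof -
    have "\<epsilon> (f 0 x) = \<zero>\<^bsub>A\<^esub> \<longleftrightarrow> f 0 x \<in> cdiff P 1 ` carrier (cobj P 1)"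
      using e(3) module_homD(1)[OF fh x] by (simp add: exact_at_def kernel_of_def)
    also have "\<dots> \<longleftrightarrow> (\<exists>y\<in>carrier (cobj T 1). f 0 x = f 0 (cdiff T 1 y))"
      unfolding b1[symmetric] using fc by auto
    also have "\<dots> \<longleftrightarrow> (\<exists>y\<in>carrier (cobj T 1). x = cdiff T 1 y)"
      using inj_on_eq_iff[OF b0(2) x d1] by auto
    finally show ?thesis .
  qed
  moreover have "(\<lambda>x. \<epsilon> (f 0 x)) ` carrier (cobj T 0) = carrier A"
    using e(2) by (simp flip: b0(1) add: image_image)
  ultimately show ?thesis using module_hom_comp[OF fh e(1)] by (intro bexI[of _ "\<lambda>x. \<epsilon> (f 0 x)"]) auto
qed

definition "wcyc i = ({w \<in> carrier (chains A i). mdiff A i w = (\<lambda>_. \<zero>\<^bsub>A\<^esub>)},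
   (\<lambda>w. \<exists>y\<in>carrier (chains A (i + 1)). mdiff A (i + 1) y = w), (\<lambda>r w w' \<nu>. r \<odot>\<^bsub>A\<^esub> w \<nu> \<oplus>\<^bsub>A\<^esub> w' \<nu>))"

lemma \<theta>_inj_eq: "x \<in> carrier A \<Longrightarrow> y \<in> carrier A \<Longrightarrow> \<theta> x = \<theta> y \<Longrightarrow> x = y"
  using hom_inj[OF A_module RR \<theta>_hom] \<theta>_inj by simp

lemma mdiff_\<theta>:
  "w \<in> carrier (chains A i) \<Longrightarrow> mdiff RR i (\<lambda>\<nu>. \<theta> (w \<nu>)) = (\<lambda>\<nu>. \<theta> (mdiff A i w \<nu>))"
  by (rule mdiff_natural[OF A_module RR \<theta>_hom])

lemma mdiff_A_closed: "w \<in> carrier (chains A i) \<Longrightarrow> mdiff A i w \<in> carrier (chains A (i - 1))"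
  by (rule module_homD(1)[OF mdiff_hom[OF A_module]])

lemma mdiff_A_closed1: "w \<in> carrier (chains A (i + 1)) \<Longrightarrow> mdiff A (i + 1) w \<in> carrier (chains A i)"
  using mdiff_A_closed[of w "i + 1"] by simp

lemma \<theta>_zero: "\<theta> \<zero>\<^bsub>A\<^esub> = \<zero>\<^bsub>R\<^esub>"
  using module_hom_zero[OF A_module RR \<theta>_hom] by simp

lemma mdiff_\<theta>_eq_0:
  assumes "w \<in> carrier (chains A i)"
  shows "mdiff RR i (\<lambda>\<nu>. \<theta> (w \<nu>)) = (\<lambda>_. \<zero>\<^bsub>R\<^esub>) \<longleftrightarrow> mdiff A i w = (\<lambda>_. \<zero>\<^bsub>A\<^esub>)"
proof
  assume *: "mdiff RR i (\<lambda>\<nu>. \<theta> (w \<nu>)) = (\<lambda>_. \<zero>\<^bsub>R\<^esub>)"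
  show "mdiff A i w = (\<lambda>_. \<zero>\<^bsub>A\<^esub>)"
  proof
    fix \<nu>
    have "\<theta> (mdiff A i w \<nu>) = \<zero>\<^bsub>R\<^esub>" using fun_cong[OF *, of \<nu>] by (simp add: mdiff_\<theta>[OF assms])
    then show "mdiff A i w \<nu> = \<zero>\<^bsub>A\<^esub>"
      by (rule \<theta>_inj[OF chains_closed[OF A_module mdiff_A_closed[OF assms]]])
  qed
qed (simp add: mdiff_\<theta>[OF assms] \<theta>_zero)

lemma chains_\<theta>: "w \<in> carrier (chains A i) \<Longrightarrow> (\<lambda>\<nu>. \<theta> (w \<nu>)) \<in> carrier (chains RR i)"
  by (rule chains_map[OF A_module RR \<theta>_hom])

lemma chains_\<theta>_image:
  assumes z: "z \<in> carrier (chains RR i)"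
    and ann: "\<And>s. s \<in> carrier R \<Longrightarrow> s \<odot>\<^bsub>A\<^esub> gen = \<zero>\<^bsub>A\<^esub> \<Longrightarrow> s \<odot>\<^bsub>chains RR i\<^esub> z = \<zero>\<^bsub>chains RR i\<^esub>"
  shows "\<exists>w\<in>carrier (chains A i). z = (\<lambda>\<nu>. \<theta> (w \<nu>))"
proof -
  have "\<exists>b\<in>carrier A. \<theta> b = z \<nu>" for \<nu>
  proof (rule \<theta>_image)
    show "z \<nu> \<in> carrier R" using chains_closed[OF RR z] by simp
    fix s assume "s \<in> carrier R" "s \<odot>\<^bsub>A\<^esub> gen = \<zero>\<^bsub>A\<^esub>"
    then show "s \<otimes>\<^bsub>R\<^esub> z \<nu> = \<zero>\<^bsub>R\<^esub>" using fun_cong[OF ann, of s \<nu>] by simp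
  qed
  then obtain w where w: "\<And>\<nu>. w \<nu> \<in> carrier A" "\<And>\<nu>. \<theta> (w \<nu>) = z \<nu>" by metis
  have "w \<nu> = \<zero>\<^bsub>A\<^esub>" if "\<nu> \<notin> L i" for \<nu>
    using \<theta>_inj[OF w(1), of \<nu>] w(2)[of \<nu>] z that by (simp add: chains_iff)
  then show ?thesis using w by (intro bexI[of _ w]) (auto simp: chains_iff)
qed

text \<open>A cocycle on T_0 kills the image of T_1, so it factors through the augmentation and is
  determined by its value at a preimage \<open>t1\<close> of \<open>gen\<close>. That value is a
  cycle killed by J, the annihilator of \<open>gen\<close>, hence a cycle with values in
  \<open>A\<close>. If the map factors through T_(-1), the value is \<open>N\<close> times a cycle
  over \<open>R\<close>, and this bounds in the complex with values in \<open>A\<close>.\<close>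

lemma wcyc_corr: "correspond (carrier R) (cp.coc 0 i) (wcyc i)"
proof -
  obtain \<eta> where \<eta>: "\<eta> \<in> Hom R (cobj T 0) A" "\<eta> ` carrier (cobj T 0) = carrier A"
    and \<eta>_ker: "\<And>x. x \<in> carrier (cobj T 0) \<Longrightarrow> \<eta> x = \<zero>\<^bsub>A\<^esub> \<longleftrightarrow> (\<exists>y\<in>carrier (cobj T 1). x = cdiff T 1 y)"
    using ex_augmentation by blast
  obtain t1 where t1: "t1 \<in> carrier (cobj T 0)" "\<eta> t1 = gen" using \<eta>(2) gen by (metis imageE)
  interpret T0: Module.module R "cobj T 0" by (rule T_mod)
  interpret S: Module.module R "chains RR i" by (rule chains_module[OF RR])
  interpret S': Module.module R "chains RR (i - 1)" by (rule chains_module[OF RR])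
  have d1: "cdiff T 1 y \<in> carrier (cobj T 0)" if "y \<in> carrier (cobj T 1)" for y
    using module_homD(1)[OF T_cdiff[of 1]] that by simp
  have fh: "f \<in> cp.THom 0 i" and fd: "\<And>x. x \<in> carrier (cobj T 0) \<Longrightarrow> mdiff RR i (f x) = (\<lambda>_. \<zero>\<^bsub>R\<^esub>)"
    and f1: "\<And>x. x \<in> carrier (cobj T 1) \<Longrightarrow> f (cdiff T 1 x) = (\<lambda>_. \<zero>\<^bsub>R\<^esub>)" if "f \<in> cp.cocycles 0 i" for f
    using that by (auto simp: cp.cocycles_def)
  have ann_t1: "s \<odot>\<^bsub>chains RR i\<^esub> f t1 = \<zero>\<^bsub>chains RR i\<^esub>"
    if f: "f \<in> cp.cocycles 0 i" and s: "s \<in> carrier R" "s \<odot>\<^bsub>A\<^esub> gen = \<zero>\<^bsub>A\<^esub>" for f s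
  proof -
    have "\<eta> (s \<odot>\<^bsub>cobj T 0\<^esub> t1) = \<zero>\<^bsub>A\<^esub>" using s t1 by (simp add: module_homD(3)[OF \<eta>(1)])
    then obtain y where y: "y \<in> carrier (cobj T 1)" "s \<odot>\<^bsub>cobj T 0\<^esub> t1 = cdiff T 1 y" using \<eta>_ker s t1 by auto
    show ?thesis using module_homD(3)[OF fh[OF f] s(1) t1(1)] f1[OF f y(1)] y(2) by simp
  qed
  \<comment> \<open>The element x - r t1 lies in the kernel of the augmentation, hence in the image
    of T_1, where \<open>f\<close> vanishes.\<close>
  have f_eq: "f x = r \<odot>\<^bsub>chains RR i\<^esub> f t1"
    if f: "f \<in> cp.cocycles 0 i" and x: "x \<in> carrier (cobj T 0)" and r: "r \<in> carrier R" "\<eta> x = r \<odot>\<^bsub>A\<^esub> gen" for f x r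
  proof -
    let ?u = "x \<oplus>\<^bsub>cobj T 0\<^esub> ((\<ominus>\<^bsub>R\<^esub> r) \<odot>\<^bsub>cobj T 0\<^esub> t1)"
    have u: "?u \<in> carrier (cobj T 0)" using x r t1 by simp
    have "\<eta> ?u = \<zero>\<^bsub>A\<^esub>"
      using x r t1 gen by (simp add: module_homD[OF \<eta>(1)] A.smult_l_minus A.r_neg)
    then obtain y where y: "y \<in> carrier (cobj T 1)" "?u = cdiff T 1 y" using \<eta>_ker[OF u] by auto
    then have "f ?u = \<zero>\<^bsub>chains RR i\<^esub>" using f1[OF f y(1)] by simp
    moreover have fc: "f x \<in> carrier (chains RR i)" "f t1 \<in> carrier (chains RR i)"
      using module_homD(1)[OF fh[OF f]] x t1 by auto
    moreover have "f ?u = f x \<oplus>\<^bsub>chains RR i\<^esub> \<ominus>\<^bsub>chains RR i\<^esub> (r \<odot>\<^bsub>chains RR i\<^esub> f t1)"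
      using x r t1 S.smult_l_minus[OF r(1) fc(2)] by (simp add: module_homD[OF fh[OF f]] del: chains_simps)
    ultimately have "f x \<oplus>\<^bsub>chains RR i\<^esub> \<ominus>\<^bsub>chains RR i\<^esub> (r \<odot>\<^bsub>chains RR i\<^esub> f t1) = \<zero>\<^bsub>chains RR i\<^esub>" by (simp only:)
    then have "\<ominus>\<^bsub>chains RR i\<^esub> (\<ominus>\<^bsub>chains RR i\<^esub> (r \<odot>\<^bsub>chains RR i\<^esub> f t1)) = f x"
      using fc S.smult_closed[OF r(1) fc(2)] by (intro S.minus_equality S.a_inv_closed)
    then show ?thesis using S.minus_minus[OF S.smult_closed[OF r(1) fc(2)]] by (simp only:)
  qed
  show ?thesis unfolding wcyc_def cp.coc_def
  proof (rule correspondI[where Q = "\<lambda>f w. f t1 = (\<lambda>\<nu>. \<theta> (w \<nu>))"])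
    fix f assume f: "f \<in> cp.cocycles 0 i"
    have z: "f t1 \<in> carrier (chains RR i)" using module_homD(1)[OF fh[OF f] t1(1)] .
    obtain w where w: "w \<in> carrier (chains A i)" "f t1 = (\<lambda>\<nu>. \<theta> (w \<nu>))"
      using chains_\<theta>_image[OF z ann_t1[OF f]] by auto
    then show "\<exists>w\<in>{w \<in> carrier (chains A i). mdiff A i w = (\<lambda>_. \<zero>\<^bsub>A\<^esub>)}. f t1 = (\<lambda>\<nu>. \<theta> (w \<nu>))"
      using fd[OF f t1(1)] mdiff_\<theta>_eq_0[OF w(1)] by auto
  next
    fix w assume "w \<in> {w \<in> carrier (chains A i). mdiff A i w = (\<lambda>_. \<zero>\<^bsub>A\<^esub>)}"
    then have w: "w \<in> carrier (chains A i)" "mdiff A i w = (\<lambda>_. \<zero>\<^bsub>A\<^esub>)" by auto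
    define z where "z = (\<lambda>\<nu>. \<theta> (w \<nu>))"
    have z: "z \<in> carrier (chains RR i)" unfolding z_def by (rule chains_\<theta>[OF w(1)])
    have dz: "mdiff RR i z = \<zero>\<^bsub>chains RR (i - 1)\<^esub>" using w mdiff_\<theta>_eq_0[OF w(1)] by (simp add: z_def)
    have ann: "s \<odot>\<^bsub>chains RR i\<^esub> z = \<zero>\<^bsub>chains RR i\<^esub>" if "s \<in> carrier R" "s \<odot>\<^bsub>A\<^esub> gen = \<zero>\<^bsub>A\<^esub>" for s
      using ann_\<theta>[OF that] chains_closed[OF A_module w(1)] by (simp add: z_def)
    \<comment> \<open>The map on \<open>A\<close> taking r gen to r z, well defined by
      \<open>same_action\<close>; composed with the augmentation it is the required cocycle.\<close>
    define act where "act b = (SOME r. r \<in> carrier R \<and> b = r \<odot>\<^bsub>A\<^esub> gen) \<odot>\<^bsub>chains RR i\<^esub> z" for b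
    have act: "act (r \<odot>\<^bsub>A\<^esub> gen) = r \<odot>\<^bsub>chains RR i\<^esub> z" if "r \<in> carrier R" for r
      unfolding act_def using gen_choice[of "r \<odot>\<^bsub>A\<^esub> gen"] gen that z ann
      by (intro same_action[OF chains_module[OF RR]]) auto
    have act_hom: "act \<in> Hom R A (chains RR i)"
    proof (rule module_homI)
      fix x y assume "x \<in> carrier A" "y \<in> carrier A"
      then obtain r s where r: "r \<in> carrier R" "s \<in> carrier R" "x = r \<odot>\<^bsub>A\<^esub> gen" "y = s \<odot>\<^bsub>A\<^esub> gen" using cyclic by metis
      show "act x \<in> carrier (chains RR i)" using r z S.smult_closed by (simp only: act)
      have "x \<oplus>\<^bsub>A\<^esub> y = (r \<oplus>\<^bsub>R\<^esub> s) \<odot>\<^bsub>A\<^esub> gen" using r gen by (simp add: A.smult_l_distr)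
      then have "act (x \<oplus>\<^bsub>A\<^esub> y) = (r \<oplus>\<^bsub>R\<^esub> s) \<odot>\<^bsub>chains RR i\<^esub> z" using r act[of "r \<oplus>\<^bsub>R\<^esub> s"] by simp
      then show "act (x \<oplus>\<^bsub>A\<^esub> y) = act x \<oplus>\<^bsub>chains RR i\<^esub> act y"
        using r S.smult_l_distr[OF r(1,2) z] act[OF r(1)] act[OF r(2)] by (simp del: chains_simps)
    next
      fix r x assume r: "r \<in> carrier R" and "x \<in> carrier A"
      then obtain s where s: "s \<in> carrier R" "x = s \<odot>\<^bsub>A\<^esub> gen" using cyclic by metis
      have "r \<odot>\<^bsub>A\<^esub> x = (r \<otimes>\<^bsub>R\<^esub> s) \<odot>\<^bsub>A\<^esub> gen" using r s gen by (simp add: A.smult_assoc1)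
      then show "act (r \<odot>\<^bsub>A\<^esub> x) = r \<odot>\<^bsub>chains RR i\<^esub> act x"
        using r s S.smult_assoc1[OF r s(1) z] act[OF s(1)] act[of "r \<otimes>\<^bsub>R\<^esub> s"] by (simp del: chains_simps)
    qed
    have act_d: "mdiff RR i (act b) = \<zero>\<^bsub>chains RR (i - 1)\<^esub>" if b: "b \<in> carrier A" for b
    proof -
      obtain r where r: "r \<in> carrier R" "b = r \<odot>\<^bsub>A\<^esub> gen" using cyclic[OF b] by metis
      show ?thesis using module_homD(3)[OF mdiff_hom[OF RR] r(1) z] dz S'.smult_r_null[OF r(1)] act[OF r(1)] r(2)
        by (simp del: chains_simps)
    qed
    have c: "(\<lambda>x. act (\<eta> x)) \<in> cp.cocycles 0 i"
      unfolding cp.cocycles_def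
    proof (intro CollectI conjI ballI)
      show "(\<lambda>x. act (\<eta> x)) \<in> cp.THom 0 i" by (rule module_hom_comp[OF \<eta>(1) act_hom])
      show "mdiff RR i (act (\<eta> x)) = \<zero>\<^bsub>chains RR (i - 1)\<^esub>" if "x \<in> carrier (cobj T 0)" for x
        by (rule act_d[OF module_homD(1)[OF \<eta>(1) that]])
      fix x assume "x \<in> carrier (cobj T (0 + 1))"
      then have "\<eta> (cdiff T (0 + 1) x) = \<zero>\<^bsub>A\<^esub>" using \<eta>_ker[OF d1, of x] by auto
      then show "act (\<eta> (cdiff T (0 + 1) x)) = \<zero>\<^bsub>chains RR i\<^esub>"
        using module_hom_zero[OF A_module chains_module[OF RR] act_hom] by simp
    qed
    have "act (\<eta> t1) = z" using act[of "\<one>\<^bsub>R\<^esub>"] gen z t1(2) by (simp del: chains_simps)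
    then show "\<exists>f\<in>cp.cocycles 0 i. f t1 = (\<lambda>\<nu>. \<theta> (w \<nu>))" using c by (intro bexI[OF _ c]) (simp add: z_def)
  next
    fix f w assume f: "f \<in> cp.cocycles 0 i" and "w \<in> {w \<in> carrier (chains A i). mdiff A i w = (\<lambda>_. \<zero>\<^bsub>A\<^esub>)}"
      and Q: "f t1 = (\<lambda>\<nu>. \<theta> (w \<nu>))"
    then have w: "w \<in> carrier (chains A i)" "mdiff A i w = (\<lambda>_. \<zero>\<^bsub>A\<^esub>)" by auto
    interpret S1: Module.module R "chains RR (i + 1)" by (rule chains_module[OF RR])
    have N_\<theta>: "(\<lambda>\<nu>. \<theta> (y \<nu> \<odot>\<^bsub>A\<^esub> gen)) = N \<odot>\<^bsub>chains RR (i + 1)\<^esub> y" if "y \<in> carrier (chains RR (i + 1))" for y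
      using chains_closed[OF RR that] N by (auto simp: \<theta>_gen R.m_comm)
    have gen_y: "(\<lambda>\<nu>. y \<nu> \<odot>\<^bsub>A\<^esub> gen) \<in> carrier (chains A (i + 1))" if "y \<in> carrier (chains RR (i + 1))" for y
      using that gen by (auto simp: chains_iff)
    have d_N: "mdiff RR (i + 1) (N \<odot>\<^bsub>chains RR (i + 1)\<^esub> y) = N \<odot>\<^bsub>chains RR i\<^esub> mdiff RR (i + 1) y"
      if "y \<in> carrier (chains RR (i + 1))" for y
      using module_homD(3)[OF mdiff_hom[OF RR] N that] by simp
    show "cp.is_cobound 0 i f = (\<exists>y\<in>carrier (chains A (i + 1)). mdiff A (i + 1) y = w)"
    proof
      assume "cp.is_cobound 0 i f"
      then obtain h where h: "h \<in> cp.THom (- 1) i" "\<And>x. x \<in> carrier (cobj T (- 1)) \<Longrightarrow> mdiff RR i (h x) = (\<lambda>_. \<zero>\<^bsub>R\<^esub>)"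
        "\<And>x. x \<in> carrier (cobj T 0) \<Longrightarrow> f x = h (cdiff T 0 x)" by (auto simp: cp.is_cobound_def)
      \<comment> \<open>The annihilator of \<open>gen\<close> moves \<open>t1\<close> into the image
        of T_1, so it kills the differential of \<open>t1\<close>, which is therefore divisible by
        \<open>N\<close> in the projective module T_(-1).\<close>
      define t where "t = cdiff T 0 t1"
      have t: "t \<in> carrier (cobj T (- 1))" using module_homD(1)[OF T_cdiff t1(1)] by (simp add: t_def)
      have "\<exists>t'\<in>carrier (cobj T (- 1)). t = N \<odot>\<^bsub>cobj T (- 1)\<^esub> t'"
      proof (rule projective_annihilated[OF T_projective t _ N, where J = "{s \<in> carrier R. s \<odot>\<^bsub>A\<^esub> gen = \<zero>\<^bsub>A\<^esub>}"])
        fix s assume s: "s \<in> {s \<in> carrier R. s \<odot>\<^bsub>A\<^esub> gen = \<zero>\<^bsub>A\<^esub>}"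
        then have "\<eta> (s \<odot>\<^bsub>cobj T 0\<^esub> t1) = \<zero>\<^bsub>A\<^esub>" using t1 by (simp add: module_homD(3)[OF \<eta>(1)])
        then obtain y where y: "y \<in> carrier (cobj T 1)" "s \<odot>\<^bsub>cobj T 0\<^esub> t1 = cdiff T 1 y" using \<eta>_ker s t1 by auto
        have "s \<odot>\<^bsub>cobj T (- 1)\<^esub> t = cdiff T 0 (cdiff T 1 y)"
          using module_homD(3)[OF T_cdiff[of 0], of s t1] s t1(1) y(2) by (simp add: t_def)
        then show "s \<odot>\<^bsub>cobj T (- 1)\<^esub> t = \<zero>\<^bsub>cobj T (- 1)\<^esub>" using cp.T_diff1[of y 0] y(1) by simp
      next
        fix r assume "r \<in> carrier R" "\<forall>s\<in>{s \<in> carrier R. s \<odot>\<^bsub>A\<^esub> gen = \<zero>\<^bsub>A\<^esub>}. s \<otimes>\<^bsub>R\<^esub> r = \<zero>\<^bsub>R\<^esub>"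
        then obtain r' where "r' \<in> carrier R" "r = r' \<otimes>\<^bsub>R\<^esub> N" using ann_gen[of r] by auto
        then show "\<exists>r'\<in>carrier R. r = N \<otimes>\<^bsub>R\<^esub> r'" using N R.m_comm by auto
      qed auto
      then obtain t' where t': "t' \<in> carrier (cobj T (- 1))" "t = N \<odot>\<^bsub>cobj T (- 1)\<^esub> t'" by auto
      \<comment> \<open>The cycle \<open>h t'\<close> bounds over \<open>R\<close>; multiplying its
        bounding chain by \<open>N\<close> gives one that comes from \<open>A\<close>.\<close>
      obtain y where y: "y \<in> carrier (chains RR (i + 1))" "mdiff RR (i + 1) y = h t'"
        using exact[OF module_homD(1)[OF h(1) t'(1)]] h(2)[OF t'(1)] by auto
      have "(\<lambda>\<nu>. \<theta> (w \<nu>)) = N \<odot>\<^bsub>chains RR i\<^esub> h t'"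
        using Q h(3)[OF t1(1)] t'(2) module_homD(3)[OF h(1) N t'(1)] by (simp add: t_def)
      also have "\<dots> = mdiff RR (i + 1) (\<lambda>\<nu>. \<theta> (y \<nu> \<odot>\<^bsub>A\<^esub> gen))"
        using d_N[OF y(1)] y(2) by (simp only: N_\<theta>[OF y(1)])
      also have "\<dots> = (\<lambda>\<nu>. \<theta> (mdiff A (i + 1) (\<lambda>\<nu>. y \<nu> \<odot>\<^bsub>A\<^esub> gen) \<nu>))"
        by (rule mdiff_\<theta>[OF gen_y[OF y(1)]])
      finally have eq: "(\<lambda>\<nu>. \<theta> (w \<nu>)) = (\<lambda>\<nu>. \<theta> (mdiff A (i + 1) (\<lambda>\<nu>. y \<nu> \<odot>\<^bsub>A\<^esub> gen) \<nu>))" .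
      have "mdiff A (i + 1) (\<lambda>\<nu>. y \<nu> \<odot>\<^bsub>A\<^esub> gen) = w"
      proof
        fix \<nu>
        show "mdiff A (i + 1) (\<lambda>\<nu>. y \<nu> \<odot>\<^bsub>A\<^esub> gen) \<nu> = w \<nu>"
          by (rule \<theta>_inj_eq[OF chains_closed[OF A_module mdiff_A_closed1[OF gen_y[OF y(1)]]] chains_closed[OF A_module w(1)]])
            (use fun_cong[OF eq, of \<nu>] in simp)
      qed
      then show "\<exists>y\<in>carrier (chains A (i + 1)). mdiff A (i + 1) y = w" using gen_y[OF y(1)] by blast
    next
      assume "\<exists>y\<in>carrier (chains A (i + 1)). mdiff A (i + 1) y = w"
      then obtain y' where y': "y' \<in> carrier (chains A (i + 1))" "mdiff A (i + 1) y' = w" by auto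
      \<comment> \<open>Conversely, a bounding chain with values in \<open>A\<close> is lifted to
        one over \<open>R\<close>, entry by entry.\<close>
      have "\<exists>r. r \<in> carrier R \<and> r \<odot>\<^bsub>A\<^esub> gen = y' \<nu>" for \<nu>
        using cyclic[OF chains_closed[OF A_module y'(1)]] by metis
      then obtain y0 where y0: "\<And>\<nu>. y0 \<nu> \<in> carrier R" "\<And>\<nu>. y0 \<nu> \<odot>\<^bsub>A\<^esub> gen = y' \<nu>" by metis
      define y where "y \<nu> = (if \<nu> \<in> L (i + 1) then y0 \<nu> else \<zero>\<^bsub>R\<^esub>)" for \<nu>
      have y: "y \<in> carrier (chains RR (i + 1))" using y0 by (auto simp: chains_iff y_def)
      have yg: "(\<lambda>\<nu>. y \<nu> \<odot>\<^bsub>A\<^esub> gen) = y'" using y0 y'(1) gen by (auto simp: y_def chains_iff)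
      define z' where "z' = mdiff RR (i + 1) y"
      have z': "z' \<in> carrier (chains RR i)" using module_homD(1)[OF mdiff_hom[OF RR] y] by (simp add: z'_def)
      have dz': "mdiff RR i z' = (\<lambda>_. \<zero>\<^bsub>R\<^esub>)" using exact[OF z'] y by (auto simp: z'_def)
      have ft1: "f t1 = N \<odot>\<^bsub>chains RR i\<^esub> z'"
        using Q mdiff_\<theta>[OF y'(1)] N_\<theta>[OF y] d_N[OF y] y'(2) fun_cong[OF yg] by (simp add: z'_def)
      \<comment> \<open>The augmentation followed by \<open>\<theta>\<close> vanishes on the image
        of T_1, so by acyclicity of Hom(T, R) it factors as \<open>\<phi>\<close> after the
        differential. The multiples of \<open>z'\<close> by \<open>\<phi>\<close> then bound
        \<open>f\<close>.\<close>
      have "\<exists>h\<in>Hom R (cobj T (0 - 1)) RR. \<forall>x\<in>carrier (cobj T 0). \<theta> (\<eta> x) = h (cdiff T 0 x)"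
      proof (rule hom_extend_regular[OF module_hom_comp[OF \<eta>(1) \<theta>_hom]])
        fix x assume "x \<in> carrier (cobj T (0 + 1))"
        then have "\<eta> (cdiff T (0 + 1) x) = \<zero>\<^bsub>A\<^esub>" using \<eta>_ker[OF d1, of x] by auto
        then show "\<theta> (\<eta> (cdiff T (0 + 1) x)) = \<zero>\<^bsub>R\<^esub>" by (simp add: \<theta>_zero)
      qed
      then obtain \<phi> where \<phi>: "\<phi> \<in> Hom R (cobj T (- 1)) RR" "\<And>x. x \<in> carrier (cobj T 0) \<Longrightarrow> \<theta> (\<eta> x) = \<phi> (cdiff T 0 x)" by auto
      have \<phi>c: "\<phi> x \<in> carrier R" if "x \<in> carrier (cobj T (- 1))" for x using module_homD(1)[OF \<phi>(1) that] by simp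
      show "cp.is_cobound 0 i f" unfolding cp.is_cobound_def
      proof (rule bexI[of _ "\<lambda>x. \<phi> x \<odot>\<^bsub>chains RR i\<^esub> z'"], intro conjI ballI)
        fix x assume "x \<in> carrier (cobj T (0 - 1))"
        then have x: "\<phi> x \<in> carrier R" using \<phi>c by simp
        show "mdiff RR i (\<phi> x \<odot>\<^bsub>chains RR i\<^esub> z') = \<zero>\<^bsub>chains RR (i - 1)\<^esub>"
          using module_homD(3)[OF mdiff_hom[OF RR] x z'] x by (simp add: dz')
      next
        fix x assume x: "x \<in> carrier (cobj T 0)"
        obtain r where r: "r \<in> carrier R" "\<eta> x = r \<odot>\<^bsub>A\<^esub> gen" using cyclic[OF module_homD(1)[OF \<eta>(1) x]] by metis
        have "\<phi> (cdiff T 0 x) = r \<otimes>\<^bsub>R\<^esub> N" using \<phi>(2)[OF x] r by (simp add: \<theta>_gen)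
        then show "f x = \<phi> (cdiff T 0 x) \<odot>\<^bsub>chains RR i\<^esub> z'"
          using f_eq[OF f x r] S.smult_assoc1[OF r(1) N z'] ft1 by (simp del: chains_simps)
      next
        have "(\<lambda>x. \<phi> x \<odot>\<^bsub>chains RR i\<^esub> z') \<in> Hom R (cobj T (- 1)) (chains RR i)"
          by (rule module_homI) (simp_all add: \<phi>c z' module_homD(2,3)[OF \<phi>(1)] S.smult_l_distr S.smult_assoc1 del: chains_simps)
        then show "(\<lambda>x. \<phi> x \<odot>\<^bsub>chains RR i\<^esub> z') \<in> cp.THom (0 - 1) i" by simp
      qed
    qed
  next
    fix r f w f' w' assume r: "r \<in> carrier R" and w: "w \<in> {w \<in> carrier (chains A i). mdiff A i w = (\<lambda>_. \<zero>\<^bsub>A\<^esub>)}"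
      "w' \<in> {w \<in> carrier (chains A i). mdiff A i w = (\<lambda>_. \<zero>\<^bsub>A\<^esub>)}"
      and Q: "f t1 = (\<lambda>\<nu>. \<theta> (w \<nu>))" "f' t1 = (\<lambda>\<nu>. \<theta> (w' \<nu>))"
    have wc: "w \<nu> \<in> carrier A" "w' \<nu> \<in> carrier A" for \<nu> using w chains_closed[OF A_module] by auto
    show "cp.haxpy i r f f' t1 = (\<lambda>\<nu>. \<theta> (r \<odot>\<^bsub>A\<^esub> w \<nu> \<oplus>\<^bsub>A\<^esub> w' \<nu>))"
      using r wc by (simp add: cp.haxpy_def Q module_homD(2,3)[OF \<theta>_hom])
  next
    fix r w w' assume r: "r \<in> carrier R" and "w \<in> {w \<in> carrier (chains A i). mdiff A i w = (\<lambda>_. \<zero>\<^bsub>A\<^esub>)}"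
      "w' \<in> {w \<in> carrier (chains A i). mdiff A i w = (\<lambda>_. \<zero>\<^bsub>A\<^esub>)}"
    then have w: "w \<in> carrier (chains A i)" "mdiff A i w = (\<lambda>_. \<zero>\<^bsub>A\<^esub>)"
      "w' \<in> carrier (chains A i)" "mdiff A i w' = (\<lambda>_. \<zero>\<^bsub>A\<^esub>)" by auto
    interpret C: Module.module R "chains A i" by (rule chains_module[OF A_module])
    have eq: "(\<lambda>\<nu>. r \<odot>\<^bsub>A\<^esub> w \<nu> \<oplus>\<^bsub>A\<^esub> w' \<nu>) = r \<odot>\<^bsub>chains A i\<^esub> w \<oplus>\<^bsub>chains A i\<^esub> w'" by simp
    have "mdiff A i (r \<odot>\<^bsub>chains A i\<^esub> w \<oplus>\<^bsub>chains A i\<^esub> w') = (\<lambda>_. \<zero>\<^bsub>A\<^esub>)"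
      using r w module_homD(2)[OF mdiff_hom[OF A_module] C.smult_closed[OF r w(1)] w(3)]
        module_homD(3)[OF mdiff_hom[OF A_module] r w(1)] by simp
    then show "(\<lambda>\<nu>. r \<odot>\<^bsub>A\<^esub> w \<nu> \<oplus>\<^bsub>A\<^esub> w' \<nu>) \<in> {w \<in> carrier (chains A i). mdiff A i w = (\<lambda>_. \<zero>\<^bsub>A\<^esub>)}"
      unfolding eq using C.a_closed[OF C.smult_closed[OF r w(1)] w(3)] by blast
  qed (rule cp.cocycles_haxpy)
qed

text \<open>Bidegree (n, -1) is shifted by -n to (0, -1-n), where T_0 can be compared with
  \<open>A\<close>.\<close>

theorem tate_correspond: "correspond (carrier R) (coA n) (wcyc (- 1 - n))"
  using correspond_trans[OF coA_corr correspond_trans[OF cp.shift_int[of n "- 1" "- n"]]] wcyc_corr[of "- 1 - n"]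
  by simp

end

section \<open>Dual coordinates\<close>

definition function_space :: "'x set \<Rightarrow> ('k::field, 'x \<Rightarrow> 'k) module" where
  "function_space S = \<lparr>carrier = {w. \<forall>i. i \<notin> S \<longrightarrow> w i = 0}, monoid.mult = undefined, one = undefined,
     ring.zero = (\<lambda>_. 0), add = (\<lambda>v w i. v i + w i), module.smult = (\<lambda>r w i. r * w i)\<rparr>"

lemma function_space_module: "Module.module (ground_field :: 'k::field ring) (function_space S :: ('k, 'x \<Rightarrow> 'k) module)"
proof -
  let ?V = "function_space S :: ('k, 'x \<Rightarrow> 'k) module"
  have "abelian_group ?V"
  proof (rule abelian_groupI)
    fix w :: "'x \<Rightarrow> 'k" assume "w \<in> carrier ?V"
    then show "\<exists>v\<in>carrier ?V. v \<oplus>\<^bsub>?V\<^esub> w = \<zero>\<^bsub>?V\<^esub>"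
      by (intro bexI[of _ "\<lambda>i. - w i"]) (auto simp: function_space_def)
  qed (auto simp: function_space_def algebra_simps)
  moreover have "cring (ground_field :: 'k ring)"
    using field_from_type_algebra[where ?'a = 'k] by (simp add: Ring.field_def Ring.domain_def)
  ultimately show ?thesis
    by (intro moduleI) (auto simp: function_space_def algebra_simps)
qed

lemma functional_on_function_space:
  fixes \<psi> :: "('x \<Rightarrow> 'k::field) \<Rightarrow> 'k"
  assumes S: "finite S" and \<psi>: "functional_on (function_space S) (carrier (function_space S)) \<psi>"
    and w: "w \<in> carrier (function_space S)"
  shows "\<psi> w = (\<Sum>i\<in>S. w i * \<psi> (\<lambda>j. if j = i then 1 else 0))"
proof -
  have lin: "\<psi> (\<lambda>i. r * v i + u i) = r * \<psi> v + \<psi> u" if "\<And>i. i \<notin> S \<Longrightarrow> v i = 0" "\<And>i. i \<notin> S \<Longrightarrow> u i = 0" for r v u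
    using \<psi> that by (simp add: functional_on_def function_space_def)
  have z: "\<psi> (\<lambda>_. 0) = 0" using lin[of "\<lambda>_. 0" "\<lambda>_. 0" "- 1"] by simp
  have "\<psi> (\<lambda>i. if i \<in> J then w i else 0) = (\<Sum>i\<in>J. w i * \<psi> (\<lambda>j. if j = i then 1 else 0))" if "finite J" "J \<subseteq> S" for J
    using that
  proof (induction J)
    case (insert i J)
    have "(\<lambda>j. if j \<in> insert i J then w j else 0) = (\<lambda>j. w i * (if j = i then 1 else 0) + (if j \<in> J then w j else 0))"
      using insert.hyps by auto
    moreover have "\<psi> (\<lambda>j. w i * (if j = i then 1 else 0) + (if j \<in> J then w j else 0))
        = w i * \<psi> (\<lambda>j. if j = i then 1 else 0) + \<psi> (\<lambda>j. if j \<in> J then w j else 0)"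
      using insert.prems by (intro lin) auto
    ultimately show ?case using insert by simp
  qed (simp add: z)
  moreover have "(\<lambda>i. if i \<in> S then w i else 0) = w" using w by (auto simp: function_space_def)
  ultimately show ?thesis using S by force
qed

text \<open>
  The functionals vanishing on \<open>B\<close>, modulo those vanishing on \<open>Z\<close>, form the dual of \<open>Z / B\<close>.
\<close>

lemma dual_coordinates:
  fixes V :: "('k::field, 'v) module" and \<Psi> :: "'f \<Rightarrow> 'v \<Rightarrow> 'k" and \<Theta> :: "'f \<Rightarrow> 'x \<Rightarrow> 'k"
  assumes V: "Module.module (ground_field :: 'k ring) V" and B: "axpy_closed (ground_field :: 'k ring) V B"
    and Z: "axpy_closed (ground_field :: 'k ring) V Z" and S: "finite S"
    and func: "\<And>f. f \<in> F \<Longrightarrow> functional_on V (carrier V) (\<Psi> f)" and van: "\<And>f u. f \<in> F \<Longrightarrow> u \<in> B \<Longrightarrow> \<Psi> f u = 0"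
    and rep: "\<And>\<psi>. functional_on V (carrier V) \<psi> \<Longrightarrow> (\<forall>u\<in>B. \<psi> u = 0) \<Longrightarrow> \<exists>f\<in>F. \<forall>x\<in>carrier V. \<Psi> f x = \<psi> x"
    and axpy: "\<And>r f g. f \<in> F \<Longrightarrow> g \<in> F \<Longrightarrow> \<exists>h\<in>F. (\<forall>x\<in>carrier V. \<Psi> h x = r * \<Psi> f x + \<Psi> g x) \<and> (\<forall>i. \<Theta> h i = r * \<Theta> f i + \<Theta> g i)"
    and supp: "\<And>f i. f \<in> F \<Longrightarrow> i \<notin> S \<Longrightarrow> \<Theta> f i = 0"
    and onto: "\<And>w. (\<And>i. i \<notin> S \<Longrightarrow> w i = 0) \<Longrightarrow> \<exists>f\<in>F. \<Theta> f = w"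
    and ker: "\<And>f. f \<in> F \<Longrightarrow> (\<forall>i. \<Theta> f i = 0) \<longleftrightarrow> (\<forall>z\<in>Z. \<Psi> f z = 0)"
  shows "\<exists>\<Lambda> :: 'v \<Rightarrow> 'x \<Rightarrow> 'k. (\<forall>i. functional_on V (carrier V) (\<lambda>x. \<Lambda> x i)) \<and> (\<forall>x i. i \<notin> S \<longrightarrow> \<Lambda> x i = 0)
    \<and> (\<forall>w. (\<forall>i. i \<notin> S \<longrightarrow> w i = 0) \<longrightarrow> (\<exists>z\<in>Z. \<Lambda> z = w)) \<and> (\<forall>z\<in>Z. (\<forall>i. \<Lambda> z i = 0) \<longleftrightarrow> z \<in> B)"
proof -
  note ZD = axpy_closedD[OF Z]
  \<comment> \<open>Elements of \<open>F\<close> with unit coordinates; the values of their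
    functionals are the coordinates \<open>\<Lambda>\<close> on \<open>V\<close>.\<close>
  define e where "e i = (SOME f. f \<in> F \<and> \<Theta> f = (\<lambda>j. if j = i then 1 else 0))" for i
  have e: "e i \<in> F \<and> \<Theta> (e i) = (\<lambda>j. if j = i then 1 else 0)" if "i \<in> S" for i
  proof -
    have "\<exists>f\<in>F. \<Theta> f = (\<lambda>j. if j = i then 1 else 0)" using that by (intro onto) auto
    from someI_ex[OF this[unfolded Bex_def]] show ?thesis unfolding e_def .
  qed
  define \<Lambda> where "\<Lambda> z i = (if i \<in> S then \<Psi> (e i) z else 0)" for z i
  \<comment> \<open>Removing the coordinates one by one ends with an element all of whose
    coordinates are zero, and its functional vanishes on \<open>Z\<close>.\<close>
  have expand: "\<Psi> f z = (\<Sum>i\<in>J. \<Theta> f i * \<Lambda> z i)"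
    if "finite J" "J \<subseteq> S" "f \<in> F" "\<And>i. i \<notin> J \<Longrightarrow> \<Theta> f i = 0" "z \<in> Z" for J f z
    using that
  proof (induction J arbitrary: f)
    case empty
    then show ?case using ker[of f] by simp
  next
    case (insert i J)
    have ei: "e i \<in> F" "\<Theta> (e i) = (\<lambda>j. if j = i then 1 else 0)" using e insert.prems by auto
    from axpy[OF ei(1) insert.prems(2), of "- \<Theta> f i"] obtain h where h: "h \<in> F"
      "\<And>x. x \<in> carrier V \<Longrightarrow> \<Psi> h x = - \<Theta> f i * \<Psi> (e i) x + \<Psi> f x" "\<And>j. \<Theta> h j = - \<Theta> f i * \<Theta> (e i) j + \<Theta> f j" by blast
    have hj: "\<Theta> h j = (if j = i then 0 else \<Theta> f j)" for j by (simp add: h(3) ei(2))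
    have "\<Psi> h z = (\<Sum>j\<in>J. \<Theta> h j * \<Lambda> z j)"
      using insert.prems h(1) hj by (intro insert.IH) auto
    also have "\<dots> = (\<Sum>j\<in>J. \<Theta> f j * \<Lambda> z j)" using insert.hyps by (intro sum.cong) (auto simp: hj)
    finally have "\<Psi> f z = \<Theta> f i * \<Psi> (e i) z + (\<Sum>j\<in>J. \<Theta> f j * \<Lambda> z j)"
      using h(2)[OF ZD(2)[OF insert.prems(4)]] by (simp add: diff_eq_eq add.commute)
    moreover have "\<Lambda> z i = \<Psi> (e i) z" using insert.prems(1) by (simp add: \<Lambda>_def)
    ultimately show ?case using insert.hyps by simp
  qed
  have expS: "\<Psi> f z = (\<Sum>i\<in>S. \<Theta> f i * \<Lambda> z i)" if "f \<in> F" "z \<in> Z" for f z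
    using expand[OF S order_refl that(1) supp[OF that(1)] that(2)] .
  have \<Lambda>_lin: "functional_on V (carrier V) (\<lambda>x. \<Lambda> x i)" for i
    using func e by (cases "i \<in> S") (auto simp: \<Lambda>_def functional_on_def)
  have kernel: "(\<forall>i. \<Lambda> z i = 0) \<longleftrightarrow> z \<in> B" if z: "z \<in> Z" for z
  proof
    \<comment> \<open>All functionals that kill \<open>B\<close> then vanish at \<open>z\<close>, so
      \<open>z\<close> cannot be separated from \<open>B\<close>.\<close>
    assume 0: "\<forall>i. \<Lambda> z i = 0"
    show "z \<in> B"
    proof (rule ccontr)
      assume "z \<notin> B"
      then obtain \<psi> where \<psi>: "functional_on V (carrier V) \<psi>" "\<forall>u\<in>B. \<psi> u = 0" "\<psi> z = 1"
        using functional_separation[OF V B ZD(2)[OF z]] by blast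
      then obtain f where f: "f \<in> F" "\<forall>x\<in>carrier V. \<Psi> f x = \<psi> x" using rep by blast
      then show False using expS[OF f(1) z] 0 \<psi>(3) ZD(2)[OF z] by simp
    qed
  qed (use van e in \<open>auto simp: \<Lambda>_def\<close>)
  have image: "\<exists>z\<in>Z. \<Lambda> z = w" if w: "\<forall>i. i \<notin> S \<longrightarrow> w i = 0" for w
  proof (rule ccontr)
    let ?W = "function_space S :: ('k, 'x \<Rightarrow> 'k) module"
    \<comment> \<open>A functional separating \<open>w\<close> from the image of \<open>Z\<close> is
      given by the coordinates of some \<open>f\<close>. That \<open>f\<close> vanishes on
      \<open>Z\<close>, so its coordinates are zero, and with them the functional.\<close>
    assume no: "\<not> (\<exists>z\<in>Z. \<Lambda> z = w)"
    have lin: "\<Lambda> (r \<odot>\<^bsub>V\<^esub> x \<oplus>\<^bsub>V\<^esub> y) = (\<lambda>i. r * \<Lambda> x i + \<Lambda> y i)" if "x \<in> carrier V" "y \<in> carrier V" for r x y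
      using \<Lambda>_lin that by (auto simp: functional_on_def)
    interpret V: Module.module "ground_field :: 'k ring" V by (rule V)
    have lz: "\<Lambda> \<zero>\<^bsub>V\<^esub> = (\<lambda>_. 0)"
      using lin[of "\<zero>\<^bsub>V\<^esub>" "\<zero>\<^bsub>V\<^esub>" "- 1"] V.smult_r_null[of "- 1"] by simp
    have "axpy_closed (ground_field :: 'k ring) ?W (\<Lambda> ` Z)"
      unfolding axpy_closed_def
    proof (intro conjI ballI)
      show "\<zero>\<^bsub>?W\<^esub> \<in> \<Lambda> ` Z" using ZD(1) lz by (auto simp: function_space_def intro!: image_eqI[of _ _ "\<zero>\<^bsub>V\<^esub>"])
      show "\<Lambda> ` Z \<subseteq> carrier ?W" by (auto simp: function_space_def \<Lambda>_def)
      fix r u v assume "u \<in> \<Lambda> ` Z" "v \<in> \<Lambda> ` Z"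
      then obtain x y where xy: "x \<in> Z" "u = \<Lambda> x" "y \<in> Z" "v = \<Lambda> y" by auto
      have "r \<odot>\<^bsub>?W\<^esub> u \<oplus>\<^bsub>?W\<^esub> v = \<Lambda> (r \<odot>\<^bsub>V\<^esub> x \<oplus>\<^bsub>V\<^esub> y)" using xy ZD(2) by (simp add: lin function_space_def)
      then show "r \<odot>\<^bsub>?W\<^esub> u \<oplus>\<^bsub>?W\<^esub> v \<in> \<Lambda> ` Z" using ZD(3)[OF xy(1,3)] by simp
    qed
    then obtain \<psi> where \<psi>: "functional_on ?W (carrier ?W) \<psi>" "\<forall>u\<in>\<Lambda> ` Z. \<psi> u = 0" "\<psi> w = 1"
      using functional_separation[OF function_space_module, of S "\<Lambda> ` Z" w] w no by (auto simp: function_space_def)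
    define p where "p i = (if i \<in> S then \<psi> (\<lambda>j. if j = i then 1 else 0) else 0)" for i
    have \<psi>_sum: "\<psi> v = (\<Sum>i\<in>S. p i * v i)" if "\<And>i. i \<notin> S \<Longrightarrow> v i = 0" for v
      using functional_on_function_space[OF S \<psi>(1), of v] that
      by (auto simp: function_space_def p_def mult.commute intro!: sum.cong)
    obtain f where f: "f \<in> F" "\<Theta> f = p" using onto[of p] by (auto simp: p_def)
    have "\<Psi> f z = 0" if "z \<in> Z" for z
      using expS[OF f(1) that] \<psi>(2) that \<psi>_sum[of "\<Lambda> z"] by (simp add: f(2) \<Lambda>_def)
    then have "p i = 0" for i using ker[OF f(1)] f(2) by simp
    then have "\<psi> w = 0" using \<psi>_sum[of w] w by simp
    then show False using \<psi>(3) by simp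
  qed
  show ?thesis using \<Lambda>_lin image kernel by (intro exI[of _ \<Lambda>]) (auto simp: \<Lambda>_def)
qed

text \<open>Coordinates on one side are read off from any partner on the other side; the kernel
  condition makes them independent of the partner.\<close>

lemma correspond_coordinates:
  fixes \<theta> :: "'y \<Rightarrow> 'x \<Rightarrow> 'k::field"
  assumes C: "correspond K (U, bU, aU) (V, bV, aV)" and \<sigma>: "\<And>r. \<sigma> r \<in> K"
    and add: "\<And>r y y' i. y \<in> V \<Longrightarrow> y' \<in> V \<Longrightarrow> \<theta> (aV (\<sigma> r) y y') i = r * \<theta> y i + \<theta> y' i"
    and ker: "\<And>y. y \<in> V \<Longrightarrow> bV y \<longleftrightarrow> (\<forall>i. \<theta> y i = 0)"
  shows "\<exists>\<Theta>. (\<forall>r. \<forall>x\<in>U. \<forall>x'\<in>U. aU (\<sigma> r) x x' \<in> U \<and> (\<forall>i. \<Theta> (aU (\<sigma> r) x x') i = r * \<Theta> x i + \<Theta> x' i))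
    \<and> (\<forall>x\<in>U. bU x \<longleftrightarrow> (\<forall>i. \<Theta> x i = 0)) \<and> \<Theta> ` U = \<theta> ` V"
proof -
  from C obtain Q where Q': "(\<forall>x\<in>U. \<exists>y\<in>V. Q x y) \<and> (\<forall>y\<in>V. \<exists>x\<in>U. Q x y)
     \<and> (\<forall>x\<in>U. \<forall>y\<in>V. Q x y \<longrightarrow> bU x = bV y)
     \<and> (\<forall>r\<in>K. \<forall>x\<in>U. \<forall>y\<in>V. \<forall>x'\<in>U. \<forall>y'\<in>V. Q x y \<longrightarrow> Q x' y' \<longrightarrow> Q (aU r x x') (aV r y y'))
     \<and> (\<forall>r\<in>K. \<forall>x\<in>U. \<forall>x'\<in>U. aU r x x' \<in> U) \<and> (\<forall>r\<in>K. \<forall>y\<in>V. \<forall>y'\<in>V. aV r y y' \<in> V)"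
    unfolding correspond_def prod.case by blast
  have Q: "\<And>x. x \<in> U \<Longrightarrow> \<exists>y\<in>V. Q x y" "\<And>y. y \<in> V \<Longrightarrow> \<exists>x\<in>U. Q x y"
    "\<And>x y. x \<in> U \<Longrightarrow> y \<in> V \<Longrightarrow> Q x y \<Longrightarrow> bU x = bV y"
    "\<And>r x y x' y'. r \<in> K \<Longrightarrow> x \<in> U \<Longrightarrow> y \<in> V \<Longrightarrow> x' \<in> U \<Longrightarrow> y' \<in> V \<Longrightarrow> Q x y \<Longrightarrow> Q x' y' \<Longrightarrow> Q (aU r x x') (aV r y y')"
    "\<And>r x x'. r \<in> K \<Longrightarrow> x \<in> U \<Longrightarrow> x' \<in> U \<Longrightarrow> aU r x x' \<in> U"
    "\<And>r y y'. r \<in> K \<Longrightarrow> y \<in> V \<Longrightarrow> y' \<in> V \<Longrightarrow> aV r y y' \<in> V"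
    using Q' by simp_all
  have unique: "\<theta> y = \<theta> y'" if x: "x \<in> U" and y: "y \<in> V" "Q x y" and y': "y' \<in> V" "Q x y'" for x y y'
  proof -
    \<comment> \<open>The element -x + x has both -y + y and -y + y' as partners. The first has zero
      coordinates, so it is a boundary, and then so is the second.\<close>
    let ?r = "\<sigma> (- 1)"
    have "bV (aV ?r y y)" using ker[OF Q(6)[OF \<sigma> y(1) y(1)]] add[OF y(1) y(1)] by simp
    then have "bV (aV ?r y y')"
      using Q(3)[OF Q(5)[OF \<sigma> x x] Q(6)[OF \<sigma> y(1) y(1)] Q(4)[OF \<sigma> x y(1) x y(1) y(2) y(2)]]
        Q(3)[OF Q(5)[OF \<sigma> x x] Q(6)[OF \<sigma> y(1) y'(1)] Q(4)[OF \<sigma> x y(1) x y'(1) y(2) y'(2)]] by simp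
    then show ?thesis using ker[OF Q(6)[OF \<sigma> y(1) y'(1)]] add[OF y(1) y'(1), of "- 1"] by (intro ext) simp
  qed
  define \<Theta> where "\<Theta> x = \<theta> (SOME y. y \<in> V \<and> Q x y)" for x
  have \<Theta>: "\<Theta> x = \<theta> y" if "x \<in> U" "y \<in> V" "Q x y" for x y
    using someI[of "\<lambda>y. y \<in> V \<and> Q x y" y] that unfolding \<Theta>_def by (intro unique) auto
  show ?thesis
  proof (intro exI[of _ \<Theta>] conjI allI ballI)
    fix r x x' assume x: "x \<in> U" "x' \<in> U"
    show a: "aU (\<sigma> r) x x' \<in> U" by (rule Q(5)[OF \<sigma> x])
    obtain y y' where y: "y \<in> V" "Q x y" "y' \<in> V" "Q x' y'" using Q(1) x by blast
    show "\<Theta> (aU (\<sigma> r) x x') i = r * \<Theta> x i + \<Theta> x' i" for i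
      using \<Theta>[OF a Q(6)[OF \<sigma> y(1,3)] Q(4)[OF \<sigma> x(1) y(1) x(2) y(3) y(2,4)]] \<Theta>[OF x(1) y(1,2)] \<Theta>[OF x(2) y(3,4)]
        add[OF y(1,3)] by simp
  next
    fix x assume x: "x \<in> U"
    then obtain y where "y \<in> V" "Q x y" using Q(1) by blast
    then show "bU x \<longleftrightarrow> (\<forall>i. \<Theta> x i = 0)" using Q(3)[OF x] ker \<Theta>[OF x] by simp
  next
    show "\<Theta> ` U = \<theta> ` V"
    proof (intro equalityI image_subsetI)
      fix x assume x: "x \<in> U"
      then obtain y where "y \<in> V" "Q x y" using Q(1) by blast
      then show "\<Theta> x \<in> \<theta> ` V" using \<Theta>[OF x] by auto
    next
      fix y assume y: "y \<in> V"
      then obtain x where "x \<in> U" "Q x y" using Q(2) by blast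
      then show "\<theta> y \<in> \<Theta> ` U" using \<Theta>[OF _ y] by (metis imageI)
    qed
  qed
qed

section \<open>Counting compositions\<close>

lemma inverse_one_minus_fps_X_power_nth:
  "inverse ((1 - fps_X :: real fps) ^ Suc s) $ n = of_nat ((s + n) choose n)"
  using one_minus_const_fps_X_neg_power'[of "Suc s" "1 :: real"] by simp

text \<open>\<open>natpermute n c\<close> lists the compositions of \<open>n\<close> into
  \<open>c\<close> parts, zero allowed, so a weight that is a product over the parts sums to a
  coefficient of a power of one series.\<close>

lemma sum_natpermute:
  assumes "c \<ge> 1"
  shows "real (\<Sum>v\<in>natpermute n c. \<Prod>j<c. g (v ! j)) = (Abs_fps (\<lambda>l. real (g l)) ^ c) $ n"
proof -
  have "{0..c - 1} = {..<c}" using assms by auto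
  then show ?thesis using assms by (simp add: fps_power_nth)
qed

lemma card_natpermute:
  assumes "c \<ge> 1"
  shows "card (natpermute n c) = (c + n - 1) choose n"
proof -
  have c: "Suc (c - 1) = c" using assms by simp
  have "real (card (natpermute n c)) = (Abs_fps (\<lambda>_. 1 :: real) ^ c) $ n"
    using sum_natpermute[OF assms, of "\<lambda>_. 1" n] by simp
  also have "Abs_fps (\<lambda>_. 1 :: real) ^ c = inverse ((1 - fps_X) ^ c)"
    by (simp add: fps_inverse_power fps_inverse_one_minus_fps_X)
  also have "\<dots> $ n = real ((c + n - 1) choose n)"
    using inverse_one_minus_fps_X_power_nth[of "c - 1" n] assms unfolding c by simp
  finally show ?thesis by simp
qed

text \<open>A zero part has weight \<open>a\<close> and a positive part weight \<open>a - 1\<close>,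
  so the series is the c-th power of a + (a - 1) Y with Y = X / (1 - X). The index \<open>t\<close>
  counts the zero parts.\<close>

lemma sum_natpermute_zeros:
  assumes "c \<ge> 1" "n \<ge> 1" "a \<ge> 1"
  shows "(\<Sum>v\<in>natpermute n c. \<Prod>j<c. if v ! j = 0 then a else a - 1) =
    (\<Sum>t=0..c. (c choose t) * binom (n - 1) (int n - int c + int t) * a ^ t * (a - 1) ^ (c - t))"
proof -
  define Y :: "real fps" where "Y = fps_X * inverse (1 - fps_X)"
  have Y_nth: "Y $ l = (if l = 0 then 0 else 1)" for l
    by (simp add: Y_def fps_inverse_one_minus_fps_X)
  \<comment> \<open>The number of compositions of \<open>n\<close> into \<open>s\<close> positive
    parts; for \<open>s = 0\<close> both sides vanish because \<open>n\<close> is positive.\<close>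
  have Yp: "(Y ^ s) $ n = real (binom (n - 1) (int n - int s))" for s
  proof (cases s)
    case 0
    then show ?thesis using assms by (simp add: binom_def)
  next
    case (Suc r)
    have "Y ^ s = fps_X ^ s * inverse ((1 - fps_X) ^ s)" by (simp add: Y_def power_mult_distrib fps_inverse_power)
    then have "(Y ^ s) $ n = (if n < s then 0 else real ((r + (n - s)) choose (n - s)))"
      using inverse_one_minus_fps_X_power_nth[of r "n - s"] Suc by (simp add: fps_X_power_mult_nth del: power_Suc)
    moreover have "r + (n - s) = n - 1" if "\<not> n < s" using that Suc by simp
    moreover have "nat (int n - int s) = n - s" by linarith
    ultimately show ?thesis by (simp add: binom_def)
  qed
  have "Abs_fps (\<lambda>l. real (if l = 0 then a else a - 1)) = fps_const (real a) + fps_const (real (a - 1)) * Y"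
    by (rule fps_ext) (simp add: Y_nth)
  then have "real (\<Sum>v\<in>natpermute n c. \<Prod>j<c. if v ! j = 0 then a else a - 1)
      = ((fps_const (real a) + fps_const (real (a - 1)) * Y) ^ c) $ n"
    using sum_natpermute[OF assms(1), of "\<lambda>l. if l = 0 then a else a - 1" n] by simp
  also have "\<dots> = (\<Sum>t\<le>c. real (c choose t) * real a ^ t * (real (a - 1) ^ (c - t) * (Y ^ (c - t)) $ n))"
    by (simp add: binomial_ring fps_sum_nth power_mult_distrib fps_const_power fps_mult_left_const_nth mult.assoc
        flip: fps_of_nat)
  also have "\<dots> = real (\<Sum>t=0..c. (c choose t) * binom (n - 1) (int n - int c + int t) * a ^ t * (a - 1) ^ (c - t))"
    by (auto simp: Yp atMost_atLeast0 of_nat_diff algebra_simps intro!: sum.cong)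
  finally show ?thesis by linarith
qed

section \<open>The truncated polynomial algebra\<close>

lemma poly_mapping_sum_single:
  "(\<Sum>x\<in>Poly_Mapping.keys f. Poly_Mapping.single x (Poly_Mapping.lookup f x)) = f"
proof (rule poly_mapping_eqI)
  fix k
  have "(\<Sum>x\<in>Poly_Mapping.keys f. Poly_Mapping.lookup f x when x = k) = Poly_Mapping.lookup f k"
    by (simp add: when_def in_keys_iff)
  then show "Poly_Mapping.lookup (\<Sum>x\<in>Poly_Mapping.keys f. Poly_Mapping.single x (Poly_Mapping.lookup f x)) k = Poly_Mapping.lookup f k"
    by (simp add: lookup_sum lookup_single)
qed

lemma lookup_single_mult:
  fixes q :: "('i \<Rightarrow>\<^sub>0 nat) \<Rightarrow>\<^sub>0 'k::comm_ring_1"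
  shows "Poly_Mapping.lookup (Poly_Mapping.single u r * q) (u + k) = r * Poly_Mapping.lookup q k"
    and "(\<And>k'. k \<noteq> u + k') \<Longrightarrow> Poly_Mapping.lookup (Poly_Mapping.single u r * q) k = 0"
  by (simp_all add: lookup_mult lookup_single when_mult)

locale truncated_algebra =
  fixes c a :: nat and A :: "('k::field, 'k mpoly set) module"
  assumes A_def: "A = ci_algebra c a" and a_ge: "a \<ge> 2"
begin

abbreviation P :: "('k, 'k mpoly) module" where "P \<equiv> poly_algebra c"

definition I :: "'k mpoly set" where
  "I = genideal P ((\<lambda>i. poly_var i ^ a) ` {1..c})"

text \<open>Exponents of the monomials that survive in the quotient, as plain functions so that
  single indices are easily shifted.\<close>

definition box :: "(nat \<Rightarrow> nat) set" where
  "box = {m. \<forall>i. if i \<in> {1..c} then m i < a else m i = 0}"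

definition crd :: "'k mpoly \<Rightarrow> (nat \<Rightarrow> nat) \<Rightarrow> 'k" where
  "crd q m = (if m \<in> box then Poly_Mapping.lookup q (Abs_poly_mapping m) else 0)"

lemma P_simps: "q \<in> carrier P \<longleftrightarrow> (\<forall>m\<in>Poly_Mapping.keys q. Poly_Mapping.keys m \<subseteq> {1..c})"
  "x \<oplus>\<^bsub>P\<^esub> y = x + y" "x \<otimes>\<^bsub>P\<^esub> y = x * y" "\<zero>\<^bsub>P\<^esub> = 0" "\<one>\<^bsub>P\<^esub> = 1" "r \<odot>\<^bsub>P\<^esub> y = Poly_Mapping.single 0 r * y"
  by (simp_all add: poly_algebra_def ring_of_type_algebra_def)

lemma P_closed: "p \<in> carrier P \<Longrightarrow> q \<in> carrier P \<Longrightarrow> p + q \<in> carrier P"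
  "p \<in> carrier P \<Longrightarrow> - p \<in> carrier P" "0 \<in> carrier P" "1 \<in> carrier P"
  "p \<in> carrier P \<Longrightarrow> q \<in> carrier P \<Longrightarrow> p * q \<in> carrier P"
  "Poly_Mapping.keys m \<subseteq> {1..c} \<Longrightarrow> Poly_Mapping.single m r \<in> carrier P"
proof -
  show "p \<in> carrier P \<Longrightarrow> q \<in> carrier P \<Longrightarrow> p + q \<in> carrier P" unfolding P_simps using keys_add[of p q] by blast
  show "p \<in> carrier P \<Longrightarrow> - p \<in> carrier P" by (simp add: P_simps keys_minus)
  show "0 \<in> carrier P" by (simp add: P_simps)
  show "1 \<in> carrier P" by (simp add: P_simps)
  show "Poly_Mapping.keys m \<subseteq> {1..c} \<Longrightarrow> Poly_Mapping.single m r \<in> carrier P" by (simp add: P_simps)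
  assume pq: "p \<in> carrier P" "q \<in> carrier P"
  have "Poly_Mapping.keys m \<subseteq> {1..c}" if m: "m \<in> Poly_Mapping.keys (p * q)" for m
  proof -
    obtain u v where "u \<in> Poly_Mapping.keys p" "v \<in> Poly_Mapping.keys q" "m = u + v"
      using m keys_mult[of p q] by blast
    then show ?thesis using pq keys_add[of u v] unfolding P_simps by blast
  qed
  then show "p * q \<in> carrier P" by (simp add: P_simps)
qed

lemma P_cring: "cring P"
proof (rule cringI)
  show "abelian_group P"
  proof (rule abelian_groupI)
    fix x assume "x \<in> carrier P"
    then show "\<exists>y\<in>carrier P. y \<oplus>\<^bsub>P\<^esub> x = \<zero>\<^bsub>P\<^esub>"
      by (intro bexI[of _ "- x"] P_closed) (simp_all add: P_simps(2,4))
  qed (simp_all add: P_closed P_simps(2-6) add_ac)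
  show "comm_monoid P"
    by (rule comm_monoidI) (simp_all add: P_closed P_simps(2-6) mult_ac)
qed (simp add: P_simps(2-6) distrib_right)

lemma crd_add: "crd (p + q) m = crd p m + crd q m"
  and crd_minus: "crd (p - q) m = crd p m - crd q m"
  and crd_0: "crd 0 m = 0"
  by (simp_all add: crd_def lookup_add lookup_minus)

lemma box_fin: "m \<in> box \<Longrightarrow> finite {x. m x \<noteq> 0}"
  by (rule finite_subset[of _ "{1..c}"]) (auto simp: box_def split: if_splits)

lemma box_lookup: "m \<in> box \<Longrightarrow> Poly_Mapping.lookup (Abs_poly_mapping m) = m"
  by (rule Abs_poly_mapping_inverse) (use box_fin in simp)

lemma box_le:
  assumes "m \<in> box" "\<And>i. m' i \<le> m i"
  shows "m' \<in> box"
proof -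
  have "if i \<in> {1..c} then m' i < a else m' i = 0" for i
    using assms(1) assms(2)[of i] unfolding box_def by (auto dest!: spec[of _ i] split: if_splits)
  then show ?thesis by (simp add: box_def)
qed

lemma box_sub: "m \<in> box \<Longrightarrow> Abs_poly_mapping m = l + r \<Longrightarrow> Poly_Mapping.lookup r \<in> box"
  by (rule box_le[of m]) (use box_lookup[of m] in \<open>auto simp: lookup_add\<close>)

text \<open>The box is closed downwards: a monomial of a product lies in the box only if it arises
  from factors in the box.\<close>

lemma crd_mult_0:
  assumes "\<And>m. crd q m = 0"
  shows "crd (p * q) m = 0"
proof (cases "m \<in> box")
  case True
  have "(Poly_Mapping.lookup q r when Abs_poly_mapping m = l + r) = 0" for l r
  proof (cases "Abs_poly_mapping m = l + r")
    case True
    have "Poly_Mapping.lookup r \<in> box" by (rule box_sub[OF \<open>m \<in> box\<close> True])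
    then show ?thesis using assms[of "Poly_Mapping.lookup r"] by (simp add: crd_def)
  qed simp
  then show ?thesis using True by (simp add: crd_def lookup_mult)
qed (simp add: crd_def)

lemma crd_mult_0': "(\<And>m. crd q m = 0) \<Longrightarrow> crd (q * p) m = 0"
  using crd_mult_0[of q p m] by (simp add: mult.commute)

lemma poly_var_power: "(poly_var i :: 'k mpoly) ^ n = Poly_Mapping.single (Poly_Mapping.single i n) 1"
  by (induction n) (simp_all add: poly_var_def mult_single single_add[symmetric])

text \<open>The polynomials without coefficients in the box form an ideal containing the generators;
  conversely, each monomial outside the box is divisible by some X_i^a.\<close>

lemma I_eq: "I = {q \<in> carrier P. \<forall>m. crd q m = 0}"
proof -
  interpret P: cring P by (rule P_cring)
  have gens: "(\<lambda>i. poly_var i ^ a) ` {1..c} \<subseteq> carrier P"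
    by (auto simp: poly_var_power intro!: P_closed split: if_splits)
  have J: "ideal {q \<in> carrier P. \<forall>m. crd q m = 0} P"
  proof (rule idealI)
    show "Ring.ring P" by (rule P.ring_axioms)
    show "subgroup {q \<in> carrier P. \<forall>m. crd q m = 0} (add_monoid P)"
    proof (rule P.add.subgroupI)
      show "{q \<in> carrier P. \<forall>m. crd q m = 0} \<noteq> {}" using P_closed(3) crd_0 by blast
      fix x assume x: "x \<in> {q \<in> carrier P. \<forall>m. crd q m = 0}"
      have "\<ominus>\<^bsub>P\<^esub> x = - x" by (rule P.minus_equality) (use x P_closed(2) in \<open>auto simp: P_simps(2,4)\<close>)
      then show "\<ominus>\<^bsub>P\<^esub> x \<in> {q \<in> carrier P. \<forall>m. crd q m = 0}"
        using x P_closed(2) crd_minus[of 0 x] by (simp add: crd_0)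
    qed (auto simp: P_simps(2) crd_add P_closed)
  qed (auto simp: P_simps(3) P_closed crd_mult_0 crd_mult_0')
  show ?thesis
  proof
    show "I \<subseteq> {q \<in> carrier P. \<forall>m. crd q m = 0}"
      unfolding I_def
    proof (rule P.genideal_minimal[OF J], safe)
      fix i assume i: "i \<in> {1..c}"
      show "poly_var i ^ a \<in> carrier P" using gens i by auto
      fix m
      show "crd (poly_var i ^ a) m = 0"
      proof (cases "m \<in> box")
        case True
        have "Poly_Mapping.single i a \<noteq> Abs_poly_mapping m"
        proof
          assume eq: "Poly_Mapping.single i a = Abs_poly_mapping m"
          have "m i = a" using box_lookup[OF True] lookup_single_eq[of i a] by (simp flip: eq)
          then show False using True i by (auto simp: box_def dest: spec[of _ i])
        qed
        then show ?thesis by (simp add: crd_def poly_var_power lookup_single)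
      qed (simp add: crd_def)
    qed
    show "{q \<in> carrier P. \<forall>m. crd q m = 0} \<subseteq> I"
    proof
      fix q assume q: "q \<in> {q \<in> carrier P. \<forall>m. crd q m = 0}"
      interpret I: ideal I P unfolding I_def by (rule P.genideal_ideal[OF gens])
      have mon: "Poly_Mapping.single M (Poly_Mapping.lookup q M) \<in> I" if M: "M \<in> Poly_Mapping.keys q" for M
      proof -
        have kM: "Poly_Mapping.keys M \<subseteq> {1..c}" using q M by (auto simp: P_simps)
        have "Poly_Mapping.lookup M \<notin> box"
        proof
          assume "Poly_Mapping.lookup M \<in> box"
          then have "crd q (Poly_Mapping.lookup M) = Poly_Mapping.lookup q M" by (simp add: crd_def)
          then show False using q M by (simp add: in_keys_iff)
        qed
        moreover have "Poly_Mapping.lookup M i = 0" if "i \<notin> {1..c}" for i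
          using kM that by (auto simp: in_keys_iff subset_iff)
        moreover have "Poly_Mapping.lookup M \<in> box"
          if "\<forall>i\<in>{1..c}. Poly_Mapping.lookup M i < a" "\<And>i. i \<notin> {1..c} \<Longrightarrow> Poly_Mapping.lookup M i = 0"
        proof -
          have "if i \<in> {1..c} then Poly_Mapping.lookup M i < a else Poly_Mapping.lookup M i = 0" for i
            using that by (cases "i \<in> {1..c}") simp_all
          then show ?thesis by (simp add: box_def)
        qed
        ultimately have "\<not> (\<forall>i\<in>{1..c}. Poly_Mapping.lookup M i < a)" by blast
        then obtain i where i: "i \<in> {1..c}" "a \<le> Poly_Mapping.lookup M i" by (auto simp: not_less)
        have Ms: "M = (M - Poly_Mapping.single i a) + Poly_Mapping.single i a"
          by (intro poly_mapping_eqI) (use i(2) in \<open>auto simp: lookup_add lookup_minus lookup_single when_def\<close>)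
        have "Poly_Mapping.keys (M - Poly_Mapping.single i a) \<subseteq> {1..c}"
          using kM by (auto simp: in_keys_iff lookup_minus subset_iff)
        then have "Poly_Mapping.single (M - Poly_Mapping.single i a) (Poly_Mapping.lookup q M) \<otimes>\<^bsub>P\<^esub> poly_var i ^ a \<in> I"
          using i(1) P.genideal_self[OF gens] by (intro I.I_l_closed P_closed) (auto simp: I_def)
        then show ?thesis using Ms by (simp add: P_simps(3) poly_var_power mult_single)
      qed
      have sumI: "sum f S \<in> I" if "finite S" "\<And>x. x \<in> S \<Longrightarrow> f x \<in> I" for f :: "_ \<Rightarrow> 'k mpoly" and S
        using that I.a_closed I.zero_closed by (induction S) (simp_all add: P_simps(2,4))
      have "(\<Sum>x\<in>Poly_Mapping.keys q. Poly_Mapping.single x (Poly_Mapping.lookup q x)) \<in> I"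
        by (rule sumI[OF finite_keys mon])
      then show "q \<in> I" by (simp add: poly_mapping_sum_single)
    qed
  qed
qed

section \<open>Coordinates on the quotient algebra\<close>

definition cls :: "'k mpoly \<Rightarrow> 'k mpoly set" where
  "cls q = I +>\<^bsub>P\<^esub> q"

lemma cls_eq: "cls q = {h + q | h. h \<in> I}"
  by (auto simp: cls_def a_r_coset_def' P_simps(2))

lemma cls_eq_iff: "p \<in> carrier P \<Longrightarrow> q \<in> carrier P \<Longrightarrow> cls p = cls q \<longleftrightarrow> (\<forall>m. crd p m = crd q m)"
proof -
  assume pq: "p \<in> carrier P" "q \<in> carrier P"
  have m: "u - v \<in> I" if "u \<in> carrier P" "v \<in> carrier P" "\<forall>m. crd u m = crd v m" for u v
    using that P_closed(1)[of u "- v"] P_closed(2)[of v] by (simp add: I_eq crd_minus)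
  have sub: "cls u \<subseteq> cls v" if "u \<in> carrier P" "v \<in> carrier P" "\<forall>m. crd u m = crd v m" for u v
  proof
    fix w assume "w \<in> cls u"
    then obtain h where h: "h \<in> I" "w = h + u" by (auto simp: cls_eq)
    have "h + (u - v) \<in> I" using h(1) m[OF that] P_closed(1) by (auto simp: I_eq crd_add)
    then show "w \<in> cls v" unfolding cls_eq by (intro CollectI exI[of _ "h + (u - v)"]) (simp add: h)
  qed
  show ?thesis
  proof
    assume eq: "cls p = cls q"
    have "p \<in> cls p" unfolding cls_eq by (intro CollectI exI[of _ 0]) (simp add: I_eq crd_0 P_closed)
    then have "p \<in> cls q" by (simp only: eq)
    then obtain h where "h \<in> I" "p = h + q" by (auto simp: cls_eq)
    then show "\<forall>m. crd p m = crd q m" by (auto simp: I_eq crd_add)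
  qed (use sub[OF pq] sub[OF pq(2,1)] in auto)
qed

lemma cls_mem: "q \<in> carrier P \<Longrightarrow> p \<in> cls q \<Longrightarrow> p \<in> carrier P \<and> (\<forall>m. crd p m = crd q m)"
  by (auto simp: cls_eq I_eq crd_add P_closed)

lemma cls_self: "q \<in> cls q"
  unfolding cls_eq by (intro CollectI exI[of _ 0]) (simp add: I_eq crd_0 P_closed)

lemma A_quotient: "A = quotient P I"
  by (simp add: A_def ci_algebra_def I_def)

lemma carrier_A: "carrier A = cls ` carrier P"
  by (auto simp: A_quotient quotient_simps cls_def)

lemma A_add: "p \<in> carrier P \<Longrightarrow> q \<in> carrier P \<Longrightarrow> cls p \<oplus>\<^bsub>A\<^esub> cls q = cls (p + q)"
proof -
  have "cls p \<oplus>\<^bsub>A\<^esub> cls q = {u + v | u v. u \<in> cls p \<and> v \<in> cls q}"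
    by (auto simp: A_quotient quotient_simps set_add_def' P_simps(2))
  also have "\<dots> = cls (p + q)"
  proof (intro equalityI subsetI)
    fix w assume "w \<in> {u + v | u v. u \<in> cls p \<and> v \<in> cls q}"
    then obtain h k where "h \<in> I" "k \<in> I" "w = (h + k) + (p + q)" by (auto simp: cls_eq algebra_simps)
    moreover have "h + k \<in> I" using calculation(1,2) P_closed(1) by (auto simp: I_eq crd_add)
    ultimately show "w \<in> cls (p + q)" by (auto simp: cls_eq)
  next
    fix w assume "w \<in> cls (p + q)"
    then obtain h where "h \<in> I" "w = (h + p) + q" by (auto simp: cls_eq algebra_simps)
    moreover have "h + p \<in> cls p" using calculation by (auto simp: cls_eq)
    ultimately show "w \<in> {u + v | u v. u \<in> cls p \<and> v \<in> cls q}" using cls_self[of q] by blast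
  qed
  finally show ?thesis .
qed

lemma crd_mult_cong:
  assumes "\<And>m. crd p m = crd p' m" "\<And>m. crd q m = crd q' m"
  shows "crd (p * q) m = crd (p' * q') m"
proof -
  have "p * q - p' * q' = q * (p - p') + p' * (q - q')" by (simp add: algebra_simps)
  then have "crd (p * q - p' * q') m = 0"
    using assms by (simp add: crd_add crd_mult_0 crd_minus)
  then show ?thesis by (simp add: crd_minus)
qed

lemma A_mult: "p \<in> carrier P \<Longrightarrow> q \<in> carrier P \<Longrightarrow> cls p \<otimes>\<^bsub>A\<^esub> cls q = cls (p * q)"
proof -
  assume pq: "p \<in> carrier P" "q \<in> carrier P"
  have "cls p \<otimes>\<^bsub>A\<^esub> cls q = (\<Union>u\<in>cls p. \<Union>v\<in>cls q. cls (u * v))"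
    by (simp add: A_quotient quotient_def FactRing_def rcoset_mult_def P_simps(3) cls_def)
  also have "\<dots> = (\<Union>u\<in>cls p. \<Union>v\<in>cls q. cls (p * q))"
  proof (intro SUP_cong refl)
    fix u v assume "u \<in> cls p" "v \<in> cls q"
    then show "cls (u * v) = cls (p * q)"
      using cls_mem[OF pq(1), of u] cls_mem[OF pq(2), of v] pq
      by (subst cls_eq_iff) (auto intro!: P_closed crd_mult_cong)
  qed
  also have "\<dots> = cls (p * q)" using cls_self by blast
  finally show ?thesis .
qed

lemma A_smult: "q \<in> carrier P \<Longrightarrow> r \<odot>\<^bsub>A\<^esub> cls q = cls (Poly_Mapping.single 0 r * q)"
proof -
  assume q: "q \<in> carrier P"
  have r: "Poly_Mapping.single 0 r \<in> carrier P" by (rule P_closed) simp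
  have "r \<odot>\<^bsub>A\<^esub> cls q = (\<Union>u\<in>cls q. cls (Poly_Mapping.single 0 r * u))"
    by (simp add: A_quotient quotient_simps P_simps(6) cls_def)
  also have "\<dots> = (\<Union>u\<in>cls q. cls (Poly_Mapping.single 0 r * q))"
  proof (intro SUP_cong refl)
    fix u assume "u \<in> cls q"
    then show "cls (Poly_Mapping.single 0 r * u) = cls (Poly_Mapping.single 0 r * q)"
      using cls_mem[OF q, of u] q r by (subst cls_eq_iff) (auto intro!: P_closed(5) crd_mult_cong)
  qed
  also have "\<dots> = cls (Poly_Mapping.single 0 r * q)" using cls_self by blast
  finally show ?thesis .
qed

lemma A_zero: "\<zero>\<^bsub>A\<^esub> = cls 0"
  by (simp add: A_quotient quotient_simps cls_eq)

lemma A_one: "\<one>\<^bsub>A\<^esub> = cls 1"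
  by (simp add: A_quotient quotient_def FactRing_def P_simps(5) cls_def)

lemma A_cring: "cring A"
proof (rule cringI)
  show "abelian_group A"
  proof (rule abelian_groupI)
    fix x assume "x \<in> carrier A"
    then obtain q where "q \<in> carrier P" "x = cls q" by (auto simp: carrier_A)
    then show "\<exists>y\<in>carrier A. y \<oplus>\<^bsub>A\<^esub> x = \<zero>\<^bsub>A\<^esub>"
      by (intro bexI[of _ "cls (- q)"]) (auto simp: A_add A_zero P_closed carrier_A)
  qed (auto simp: carrier_A A_add A_zero P_closed add_ac)
  show "comm_monoid A"
    by (rule comm_monoidI) (auto simp: carrier_A A_mult A_one P_closed mult_ac)
qed (auto simp: carrier_A A_mult A_add P_closed distrib_right)

lemma A_module_K: "Module.module (ground_field :: 'k ring) A"
proof -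
  interpret A: cring A by (rule A_cring)
  have s: "Poly_Mapping.single 0 r \<in> carrier P" for r :: 'k by (rule P_closed) simp
  show ?thesis
    by (rule moduleI)
      (auto simp: carrier_A A_smult A_add P_closed(1,5) s single_add distrib_left distrib_right mult_single[symmetric] mult.assoc
         intro: cring_from_type_algebra A.abelian_group_axioms simp flip: single_one, simp_all add: mult_single flip: mult.assoc)
qed

definition co :: "'k mpoly set \<Rightarrow> (nat \<Rightarrow> nat) \<Rightarrow> 'k" where
  "co C = crd (SOME q. q \<in> C)"

lemma co_cls: "q \<in> carrier P \<Longrightarrow> co (cls q) m = crd q m"
  unfolding co_def using cls_mem[of q "SOME p. p \<in> cls q"] someI[of "\<lambda>p. p \<in> cls q", OF cls_self] by blast

lemma co_add: "x \<in> carrier A \<Longrightarrow> y \<in> carrier A \<Longrightarrow> co (x \<oplus>\<^bsub>A\<^esub> y) m = co x m + co y m"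
  by (auto simp: carrier_A A_add co_cls P_closed crd_add)

lemma co_smult: "x \<in> carrier A \<Longrightarrow> co (r \<odot>\<^bsub>A\<^esub> x) m = r * co x m"
proof -
  assume "x \<in> carrier A"
  then obtain q where q: "q \<in> carrier P" "x = cls q" by (auto simp: carrier_A)
  have "Poly_Mapping.single 0 r * q \<in> carrier P" using q by (intro P_closed) auto
  then show ?thesis using q lookup_single_mult(1)[of 0 r q]
    by (simp add: A_smult co_cls crd_def)
qed

lemma co_zero: "co \<zero>\<^bsub>A\<^esub> m = 0"
  by (simp add: A_zero co_cls P_closed crd_0)

lemma co_outside: "x \<in> carrier A \<Longrightarrow> m \<notin> box \<Longrightarrow> co x m = 0"
  by (auto simp: carrier_A co_cls crd_def)

lemma co_eqI: "x \<in> carrier A \<Longrightarrow> y \<in> carrier A \<Longrightarrow> (\<And>m. co x m = co y m) \<Longrightarrow> x = y"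
proof -
  assume x: "x \<in> carrier A" and y: "y \<in> carrier A" and eq: "\<And>m. co x m = co y m"
  obtain p q where pq: "p \<in> carrier P" "x = cls p" "q \<in> carrier P" "y = cls q" using x y by (auto simp: carrier_A)
  then have "\<forall>m. crd p m = crd q m" using eq co_cls by simp
  then show "x = y" using cls_eq_iff[OF pq(1,3)] pq by simp
qed

lemma finite_box: "finite box"
proof -
  have "inj_on (\<lambda>m. restrict m {1..c}) box"
  proof (rule inj_onI, rule ext)
    fix m m' i assume m: "m \<in> box" "m' \<in> box" and eq: "restrict m {1..c} = restrict m' {1..c}"
    show "m i = m' i"
    proof (cases "i \<in> {1..c}")
      case True
      then show ?thesis using fun_cong[OF eq, of i] by simp
    next
      case False
      then show ?thesis using m unfolding box_def by (metis (mono_tags, lifting) mem_Collect_eq)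
    qed
  qed
  moreover have "(\<lambda>m. restrict m {1..c}) ` box \<subseteq> {1..c} \<rightarrow>\<^sub>E {..<a}"
  proof (rule image_subsetI, rule PiE_I)
    fix m i assume "m \<in> box" "i \<in> {1..c}"
    then show "restrict m {1..c} i \<in> {..<a}" by (auto simp: box_def)
  qed auto
  ultimately show ?thesis by (meson finite_PiE finite_atLeastAtMost finite_lessThan inj_on_finite)
qed

lemma card_box: "card box = a ^ c"
proof -
  have "bij_betw (\<lambda>m. restrict m {1..c}) box ({1..c} \<rightarrow>\<^sub>E {..<a})"
  proof (rule bij_betw_byWitness[where f' = "\<lambda>g i. if i \<in> {1..c} then g i else 0"])
    show "\<forall>m\<in>box. (\<lambda>i. if i \<in> {1..c} then restrict m {1..c} i else 0) = m"
      by (auto simp: box_def fun_eq_iff)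
    show "\<forall>g\<in>{1..c} \<rightarrow>\<^sub>E {..<a}. restrict (\<lambda>i. if i \<in> {1..c} then g i else 0) {1..c} = g"
      by (auto simp: fun_eq_iff PiE_iff extensional_def)
    show "(\<lambda>m. restrict m {1..c}) ` box \<subseteq> {1..c} \<rightarrow>\<^sub>E {..<a}"
      by (auto simp: box_def)
    show "(\<lambda>g i. if i \<in> {1..c} then g i else 0) ` ({1..c} \<rightarrow>\<^sub>E {..<a}) \<subseteq> box"
      by (auto simp: box_def PiE_iff)
  qed
  then show ?thesis by (simp add: bij_betw_same_card card_PiE)
qed

lemma co_surj:
  assumes "\<And>m. m \<notin> box \<Longrightarrow> f m = 0"
  shows "\<exists>x\<in>carrier A. \<forall>m. co x m = f m"
proof -
  define q where "q = (\<Sum>m\<in>box. Poly_Mapping.single (Abs_poly_mapping m) (f m))"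
  have s: "Poly_Mapping.single (Abs_poly_mapping m) (f m) \<in> carrier P" if "m \<in> box" for m
    using that box_lookup[OF that]
    by (intro P_closed) (auto simp: box_def in_keys_iff split: if_splits)
  have sumP: "sum g S \<in> carrier P" if "finite S" "\<And>x. x \<in> S \<Longrightarrow> g x \<in> carrier P" for g :: "(nat \<Rightarrow> nat) \<Rightarrow> 'k mpoly" and S
    using that by (induction S) (simp_all add: P_closed)
  have q: "q \<in> carrier P" unfolding q_def by (rule sumP[OF finite_box s])
  have inj: "Abs_poly_mapping m = Abs_poly_mapping m' \<longleftrightarrow> m = m'" if "m \<in> box" "m' \<in> box" for m m'
    using that box_lookup by metis
  have "crd q m = f m" for m
  proof (cases "m \<in> box")
    case True
    have "Poly_Mapping.lookup q (Abs_poly_mapping m) = (\<Sum>m'\<in>box. if m' = m then f m' else 0)"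
      unfolding q_def lookup_sum lookup_single
      by (intro sum.cong refl) (use True inj in \<open>auto simp: when_def\<close>)
    then show ?thesis using True finite_box by (simp add: crd_def)
  qed (use assms in \<open>simp add: crd_def\<close>)
  then show ?thesis using q by (intro bexI[of _ "cls q"]) (auto simp: co_cls carrier_A)
qed

definition var :: "nat \<Rightarrow> 'k mpoly set" where
  "var i = cls (poly_var i)"

lemma var_closed: "i \<in> {1..c} \<Longrightarrow> var i \<in> carrier A"
  unfolding var_def carrier_A by (intro imageI) (auto simp: poly_var_def intro!: P_closed)

lemma co_var_mult:
  assumes i: "i \<in> {1..c}" and x: "x \<in> carrier A"
  shows "co (var i \<otimes>\<^bsub>A\<^esub> x) m = (if m \<in> box \<and> m i > 0 then co x (m(i := m i - 1)) else 0)"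
proof -
  obtain q where q: "q \<in> carrier P" "x = cls q" using x by (auto simp: carrier_A)
  have v: "poly_var i \<in> carrier P" using i by (auto simp: poly_var_def intro!: P_closed)
  have "crd (poly_var i * q) m = (if m i > 0 then crd q (m(i := m i - 1)) else 0)" if m: "m \<in> box"
  proof (cases "m i > 0")
    case True
    define k where "k = m(i := m i - 1)"
    have mb: "k \<in> box" unfolding k_def by (rule box_le[OF m]) simp
    have mk: "m j = (if j = i then k j + 1 else k j)" for j using True by (simp add: k_def)
    have "Abs_poly_mapping m = Poly_Mapping.single i 1 + Abs_poly_mapping k"
      by (intro poly_mapping_eqI) (simp add: lookup_add box_lookup[OF m] box_lookup[OF mb] lookup_single when_def mk)
    moreover have "m(i := m i - Suc 0) = k" by (simp add: k_def)
    ultimately show ?thesis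
      using True m mb lookup_single_mult(1)[of "Poly_Mapping.single i 1" 1 q] by (simp add: crd_def poly_var_def)
  next
    case False
    have "Abs_poly_mapping m \<noteq> Poly_Mapping.single i 1 + k" for k
    proof
      assume "Abs_poly_mapping m = Poly_Mapping.single i 1 + k"
      then have "Poly_Mapping.lookup (Abs_poly_mapping m) i = Poly_Mapping.lookup (Poly_Mapping.single i 1 + k) i" by simp
      then show False using False by (simp add: box_lookup[OF m] lookup_add)
    qed
    then show ?thesis using m False lookup_single_mult(2)[of "Abs_poly_mapping m" "Poly_Mapping.single i 1" 1 q]
      by (simp add: crd_def poly_var_def)
  qed
  moreover have "crd (poly_var i * q) m = 0" if "m \<notin> box" using that by (simp add: crd_def)
  ultimately show ?thesis using q v by (cases "m \<in> box") (simp_all add: var_def A_mult co_cls P_closed)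
qed

lemma co_one: "co \<one>\<^bsub>A\<^esub> m = (if m = (\<lambda>_. 0) then 1 else 0)"
proof -
  have z: "(\<lambda>_. 0) \<in> box" using a_ge by (auto simp: box_def)
  have "Abs_poly_mapping (\<lambda>_. 0) = (0 :: nat \<Rightarrow>\<^sub>0 nat)" by (rule poly_mapping_eqI) (use box_lookup[OF z] in simp)
  moreover have "Abs_poly_mapping m = 0 \<longleftrightarrow> m = (\<lambda>_. 0)" if "m \<in> box"
    using box_lookup[OF that] box_lookup[OF z] calculation by metis
  ultimately show ?thesis using z by (auto simp: A_one co_cls P_closed crd_def lookup_one when_def)
qed

text \<open>Monomials are reached from 1 by multiplying with variables, and every element is a
  linear combination of monomials.\<close>

lemma A_induct [consumes 1, case_names one var axpy]:
  assumes x: "x \<in> carrier A" and one: "Q \<one>\<^bsub>A\<^esub>"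
    and var: "\<And>i y. i \<in> {1..c} \<Longrightarrow> y \<in> carrier A \<Longrightarrow> Q y \<Longrightarrow> Q (var i \<otimes>\<^bsub>A\<^esub> y)"
    and axpy: "\<And>r y z. y \<in> carrier A \<Longrightarrow> z \<in> carrier A \<Longrightarrow> Q y \<Longrightarrow> Q z \<Longrightarrow> Q (r \<odot>\<^bsub>A\<^esub> y \<oplus>\<^bsub>A\<^esub> z)"
  shows "Q x"
proof -
  interpret A: cring A by (rule A_cring)
  interpret AK: Module.module "ground_field :: 'k ring" A by (rule A_module_K)
  have sc: "r \<odot>\<^bsub>A\<^esub> y \<in> carrier A" if "y \<in> carrier A" for r y using AK.smult_closed[of r y] that by simp
  have mono: "\<exists>y\<in>carrier A. Q y \<and> (\<forall>m'. co y m' = (if m' = m then 1 else 0))" if "m \<in> box" "(\<Sum>i\<in>{1..c}. m i) = n" for n m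
    using that
  proof (induction n arbitrary: m)
    case 0
    then have "m i = 0" for i by (cases "i \<in> {1..c}") (auto simp: box_def)
    then have "m = (\<lambda>_. 0)" by auto
    then show ?case using one co_one by (intro bexI[of _ "\<one>\<^bsub>A\<^esub>"]) auto
  next
    case (Suc n)
    then have "(\<Sum>i\<in>{1..c}. m i) \<noteq> 0" by simp
    then obtain i where i: "i \<in> {1..c}" "m i \<noteq> 0" by (meson sum.neutral)
    define k where "k = m(i := m i - 1)"
    have mb: "k \<in> box" unfolding k_def by (rule box_le[OF Suc.prems(1)]) simp
    have "(\<Sum>j\<in>{1..c} - {i}. m j) = (\<Sum>j\<in>{1..c} - {i}. k j)" by (rule sum.cong) (auto simp: k_def)
    moreover have "(\<Sum>j\<in>{1..c}. m j) = m i + (\<Sum>j\<in>{1..c} - {i}. m j)" "(\<Sum>j\<in>{1..c}. k j) = k i + (\<Sum>j\<in>{1..c} - {i}. k j)"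
      using i(1) by (intro sum.remove; simp)+
    moreover have "k i = m i - 1" by (simp add: k_def)
    ultimately have "(\<Sum>j\<in>{1..c}. k j) = n" using Suc.prems(2) i(2) by linarith
    then obtain y where y: "y \<in> carrier A" "Q y" "\<And>m'. co y m' = (if m' = k then 1 else 0)"
      using Suc.IH[OF mb] by auto
    have "m'(i := m' i - 1) = k \<longleftrightarrow> m' = m" if pos: "m' i > 0" for m'
    proof
      assume *: "m'(i := m' i - 1) = k"
      show "m' = m"
      proof
        fix j show "m' j = m j" using fun_cong[OF *, of j] pos i(2) by (cases "j = i") (auto simp: k_def)
      qed
    qed (simp add: k_def)
    then have "co (var i \<otimes>\<^bsub>A\<^esub> y) m' = (if m' = m then 1 else 0)" for m'
      using i Suc.prems(1) y by (auto simp: co_var_mult)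
    then show ?case using var[OF i(1) y(1,2)] var_closed[OF i(1)] y(1) by (intro bexI[of _ "var i \<otimes>\<^bsub>A\<^esub> y"]) auto
  qed
  have zero: "Q \<zero>\<^bsub>A\<^esub>"
  proof -
    have "(-1) \<odot>\<^bsub>A\<^esub> \<one>\<^bsub>A\<^esub> \<oplus>\<^bsub>A\<^esub> \<one>\<^bsub>A\<^esub> = \<zero>\<^bsub>A\<^esub>"
      by (rule co_eqI) (auto simp: sc co_add co_smult co_zero)
    then show ?thesis using axpy[OF _ _ one one, of "-1"] by simp
  qed
  have "\<exists>y\<in>carrier A. Q y \<and> (\<forall>m. co y m = (if m \<in> S then co x m else 0))" if "finite S" "S \<subseteq> box" for S
    using that
  proof (induction S)
    case empty
    then show ?case using zero by (intro bexI[of _ "\<zero>\<^bsub>A\<^esub>"]) (auto simp: co_zero)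
  next
    case (insert m S)
    then obtain y where y: "y \<in> carrier A" "Q y" "\<And>m. co y m = (if m \<in> S then co x m else 0)" by auto
    obtain z where z: "z \<in> carrier A" "Q z" "\<And>m'. co z m' = (if m' = m then 1 else 0)"
      using mono[of m] insert by auto
    show ?case
      by (rule bexI[of _ "co x m \<odot>\<^bsub>A\<^esub> z \<oplus>\<^bsub>A\<^esub> y"])
        (use insert y z axpy[OF z(1) y(1) z(2) y(2)] in \<open>auto simp: co_add co_smult sc\<close>)
  qed
  from this[OF finite_box] obtain y where y: "y \<in> carrier A" "Q y" "\<And>m. co y m = (if m \<in> box then co x m else 0)" by auto
  have "y = x" by (rule co_eqI[OF y(1) x]) (use y(3) co_outside[OF x] in auto)
  then show ?thesis using y by simp
qed

end

section \<open>Shift operators on functions of pairs of multi-indices\<close>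

text \<open>
  A function supported where all indices are below \<open>a\<close> is a family of coefficients of
  \<open>k[X, Y] / (X\<^sup>a, Y\<^sup>a)\<close>.  Splitting each index axis into blocks of length \<open>a\<close> and shifting
  within the blocks makes the operator identities hold for all functions, whatever their support.
\<close>

type_synonym 'k coeffs = "(nat \<Rightarrow> nat) \<times> (nat \<Rightarrow> nat) \<Rightarrow> 'k"

text \<open>The parameter \<open>b\<close> is the largest exponent, which makes
  \<open>a = Suc b\<close> positive by construction; the type argument fixes the field.\<close>

locale shift_operators =
  fixes b :: nat and ty :: "'k::field itself"
begin

abbreviation "a \<equiv> Suc b"

definition XX :: "nat \<Rightarrow> nat \<Rightarrow> 'k coeffs \<Rightarrow> 'k coeffs" where
  "XX i k f = (\<lambda>(m, n). if m i mod a < k then 0 else f (m(i := m i - k), n))"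

definition YY :: "nat \<Rightarrow> nat \<Rightarrow> 'k coeffs \<Rightarrow> 'k coeffs" where
  "YY i k f = (\<lambda>(m, n). if n i mod a < k then 0 else f (m, n(i := n i - k)))"

text \<open>Division by Y_i^k with the lower powers discarded, within each block: the partial
  inverse from which the homotopies are built.\<close>

definition Sh :: "nat \<Rightarrow> nat \<Rightarrow> 'k coeffs \<Rightarrow> 'k coeffs" where
  "Sh i k f = (\<lambda>(m, n). if n i mod a + k < a then f (m, n(i := n i + k)) else 0)"

lemma additive:
  "XX i k (f + g) = XX i k f + XX i k g" "YY i k (f + g) = YY i k f + YY i k g" "Sh i k (f + g) = Sh i k f + Sh i k g"
  "XX i k (- f) = - XX i k f" "YY i k (- f) = - YY i k f" "Sh i k (- f) = - Sh i k f"
  "XX i k 0 = 0" "YY i k 0 = 0" "Sh i k 0 = 0"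
  by (auto simp: XX_def YY_def Sh_def fun_eq_iff)

lemma additive_diff:
  "XX i k (f - g) = XX i k f - XX i k g" "YY i k (f - g) = YY i k f - YY i k g" "Sh i k (f - g) = Sh i k f - Sh i k g"
  by (auto simp: XX_def YY_def Sh_def fun_eq_iff)

lemma additive_sum:
  "XX i k (\<Sum>j\<in>J. f j) = (\<Sum>j\<in>J. XX i k (f j))" "YY i k (\<Sum>j\<in>J. f j) = (\<Sum>j\<in>J. YY i k (f j))"
  "Sh i k (\<Sum>j\<in>J. f j) = (\<Sum>j\<in>J. Sh i k (f j))"
  using sum_comp_morphism[of "XX i k" f J] sum_comp_morphism[of "YY i k" f J] sum_comp_morphism[of "Sh i k" f J]
  by (simp_all only: additive o_def simp_thms)

lemma XX_0 [simp]: "XX i 0 f = f" and YY_0 [simp]: "YY i 0 f = f" and Sh_0 [simp]: "Sh i 0 f = f"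
  by (auto simp: XX_def YY_def Sh_def fun_eq_iff)

lemma XX_a [simp]: "XX i a f = 0" and YY_a [simp]: "YY i a f = 0"
  by (auto simp: XX_def YY_def fun_eq_iff)

lemma mod_pred: "n mod a \<noteq> 0 \<Longrightarrow> (n - Suc 0) mod a = n mod a - 1"
  by (metis One_nat_def Suc_pred diff_Suc_1 gr0I mod_0 mod_Suc)

lemma XX_Suc: "XX i (Suc 0) (XX i k f) = XX i (Suc k) f"
proof -
  have "m mod a < Suc k \<longleftrightarrow> m mod a = 0 \<or> (m mod a \<noteq> 0 \<and> (m - Suc 0) mod a < k)" for m
    using mod_pred[of m] by auto
  then show ?thesis by (auto simp: XX_def fun_eq_iff)
qed

lemma YY_Suc: "YY i (Suc 0) (YY i k f) = YY i (Suc k) f"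
proof -
  have "m mod a < Suc k \<longleftrightarrow> m mod a = 0 \<or> (m mod a \<noteq> 0 \<and> (m - Suc 0) mod a < k)" for m
    using mod_pred[of m] by auto
  then show ?thesis by (auto simp: YY_def fun_eq_iff)
qed

lemma XX_Suc': "XX i k (XX i (Suc 0) g) = XX i (Suc k) g"
proof (induction k)
  case (Suc k)
  then show ?case using XX_Suc[of i k "XX i (Suc 0) g"] XX_Suc[of i "Suc k" g] by simp
qed simp

lemma YY_Suc': "YY i k (YY i (Suc 0) g) = YY i (Suc k) g"
proof (induction k)
  case (Suc k)
  then show ?case using YY_Suc[of i k "YY i (Suc 0) g"] YY_Suc[of i "Suc k" g] by simp
qed simp

lemma comm_same: "XX i k (YY j l f) = YY j l (XX i k f)" "XX i k (Sh j l f) = Sh j l (XX i k f)"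
  by (auto simp: XX_def YY_def Sh_def fun_eq_iff)

lemma comm_diff: "i \<noteq> j \<Longrightarrow> XX i k (XX j l f) = XX j l (XX i k f)" "i \<noteq> j \<Longrightarrow> YY i k (YY j l f) = YY j l (YY i k f)"
  "i \<noteq> j \<Longrightarrow> YY i k (Sh j l f) = Sh j l (YY i k f)" "i \<noteq> j \<Longrightarrow> Sh i k (Sh j l f) = Sh j l (Sh i k f)"
  by (auto simp: XX_def YY_def Sh_def fun_eq_iff fun_upd_twist)

lemma mod_add_small: "n mod a + k < a \<Longrightarrow> (n + k) mod a = n mod a + k"
  by (metis mod_add_left_eq mod_less)

lemma mod_sub_small:
  assumes "k \<le> n mod a"
  shows "(n - k) mod a = n mod a - k"
proof -
  have eq: "n - k = (n mod a - k) + a * (n div a)"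
    using assms mod_mult_div_eq[of n a] by linarith
  have "n mod a - k < a" by (rule le_less_trans[OF diff_le_self]) simp
  then show ?thesis by (subst eq) (simp only: mod_mult_self2 mod_less)
qed

text \<open>Multiplying by Y loses the top coefficient, which sits at place b - k after division by
  Y^k; \<open>Sh i b\<close> isolates it.\<close>

lemma Sh_YY:
  assumes "k < b"
  shows "Sh i (Suc k) (YY i (Suc 0) f) = Sh i k f - YY i (b - k) (Sh i b f)"
proof (rule ext, clarify)
  fix m n :: "nat \<Rightarrow> nat"
  let ?r = "n i mod a"
  have r: "?r < a" by simp
  consider "?r + k < b" | "?r + k = b" | "?r + k > b" by linarith
  then show "Sh i (Suc k) (YY i (Suc 0) f) (m, n) = (Sh i k f - YY i (b - k) (Sh i b f)) (m, n)"
  proof cases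
    case 1
    then have "(n i + Suc k) mod a = ?r + Suc k" by (intro mod_add_small) simp
    then show ?thesis using 1 assms by (auto simp: Sh_def YY_def)
  next
    case 2
    then have "(n i - (b - k)) mod a = 0" using assms by (subst mod_sub_small) auto
    moreover have "n i \<ge> b - k" using 2 mod_less_eq_dividend[of "n i" a] by linarith
    ultimately show ?thesis using 2 assms by (auto simp: Sh_def YY_def)
  next
    case 3
    then have "(n i - (b - k)) mod a \<noteq> 0" using assms r by (subst mod_sub_small) auto
    then show ?thesis using 3 assms r by (auto simp: Sh_def YY_def)
  qed
qed

text \<open>Dividing once more by Y and multiplying back loses the constant term of the quotient by
  Y^k. That term is isolated by moving it to the top place and taking the top coefficient.\<close>

lemma YY_Sh:
  assumes "k < b"
  shows "YY i (Suc 0) (Sh i (Suc k) f) = Sh i k f - Sh i b (YY i (b - k) f)"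
proof (rule ext, clarify)
  fix m n :: "nat \<Rightarrow> nat"
  let ?r = "n i mod a"
  have r: "?r < a" by simp
  show "YY i (Suc 0) (Sh i (Suc k) f) (m, n) = (Sh i k f - Sh i b (YY i (b - k) f)) (m, n)"
  proof (cases "?r = 0")
    case True
    then have "(n i + b) mod a = b" using mod_add_small[of "n i" b] by simp
    then show ?thesis using True assms by (auto simp: Sh_def YY_def)
  next
    case False
    moreover from this have "n i \<noteq> 0" by (metis mod_0)
    moreover have "(n i - Suc 0) mod a = ?r - 1" using False by (rule mod_pred)
    ultimately have "(n i - Suc 0) mod a = ?r - 1" "n i \<noteq> 0" by auto
    then show ?thesis using False assms r by (auto simp: Sh_def YY_def)
  qed
qed

definition u :: "nat \<Rightarrow> 'k coeffs \<Rightarrow> 'k coeffs" where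
  "u i f = XX i (Suc 0) f - YY i (Suc 0) f"

definition v :: "nat \<Rightarrow> 'k coeffs \<Rightarrow> 'k coeffs" where
  "v i f = (\<Sum>k<a. XX i k (YY i (b - k) f))"

text \<open>On Y^n with n < a this is the divided difference (Y^n - X^n) / (X - Y), extended
  linearly over the powers of X, so it divides by \<open>u\<close> up to the value at Y = X. The
  other homotopy \<open>h1\<close> takes the coefficient of Y^b, which is 1 on
  \<open>v\<close>.\<close>

definition h0 :: "nat \<Rightarrow> 'k coeffs \<Rightarrow> 'k coeffs" where
  "h0 i f = - (\<Sum>k<b. XX i k (Sh i (Suc k) f))"

abbreviation h1 :: "nat \<Rightarrow> 'k coeffs \<Rightarrow> 'k coeffs" where
  "h1 i f \<equiv> Sh i b f"

lemma uv_additive: "u i (f + g) = u i f + u i g" "v i (f + g) = v i f + v i g" "h0 i (f + g) = h0 i f + h0 i g"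
  by (simp_all add: u_def v_def h0_def additive sum.distrib)

text \<open>The product telescopes to X^a - Y^a, and both powers are zero.\<close>

lemma uv: "u i (v i f) = 0" and vu: "v i (u i f) = 0"
proof -
  have e: "(\<Sum>k<a. XX i (Suc k) (YY i (b - k) f) - XX i k (YY i (Suc (b - k)) f)) = 0"
  proof -
    have "(\<Sum>k<a. XX i (Suc k) (YY i (b - k) f) - XX i k (YY i (Suc (b - k)) f))
        = (\<Sum>k<a. XX i (Suc k) (YY i (a - Suc k) f) - XX i k (YY i (a - k) f))"
      by (rule sum.cong) (auto simp: Suc_diff_le)
    also have "\<dots> = XX i a (YY i (a - a) f) - XX i 0 (YY i (a - 0) f)"
      by (rule sum_lessThan_telescope)
    finally show ?thesis by simp
  qed
  show "u i (v i f) = 0"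
    unfolding u_def v_def additive_sum XX_Suc comm_same(1)[symmetric] YY_Suc sum_subtractf[symmetric] by (rule e)
  show "v i (u i f) = 0"
    unfolding u_def v_def additive_diff comm_same(1)[symmetric] XX_Suc' YY_Suc' sum_subtractf[symmetric] by (rule e)
qed

lemma h_telescope: "(\<Sum>k<b. XX i k (Sh i k f)) - (\<Sum>k<b. XX i (Suc k) (Sh i (Suc k) f)) = f - XX i b (h1 i f)"
proof -
  have "(\<Sum>k<b. XX i k (Sh i k f) - XX i (Suc k) (Sh i (Suc k) f)) = XX i 0 (Sh i 0 f) - XX i b (Sh i b f)"
    by (rule sum_lessThan_telescope')
  then show ?thesis by (simp only: sum_subtractf XX_0 Sh_0)
qed

text \<open>The terms that carry the top coefficient, collected in \<open>q\<close>, cancel between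
  the two summands; what remains is the telescoping sum of \<open>h_telescope\<close>.\<close>

lemma v_h1_h0_u: "v i (h1 i f) + h0 i (u i f) = f"
proof -
  define p q s r where "p = (\<Sum>k<b. XX i k (Sh i k f))" and "q = (\<Sum>k<b. XX i k (YY i (b - k) (h1 i f)))"
    and "s = (\<Sum>k<b. XX i (Suc k) (Sh i (Suc k) f))" and "r = XX i b (h1 i f)"
  have "(\<Sum>k<b. XX i k (Sh i (Suc k) (YY i (Suc 0) f))) = p - q"
    unfolding p_def q_def sum_subtractf[symmetric]
    by (rule sum.cong) (simp_all only: Sh_YY lessThan_iff additive_diff)
  moreover have "(\<Sum>k<b. XX i k (Sh i (Suc k) (XX i (Suc 0) f))) = s"
    unfolding s_def comm_same(2)[symmetric] XX_Suc' ..
  ultimately have "h0 i (u i f) = - (s - (p - q))"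
    by (simp only: h0_def u_def additive_diff sum_subtractf)
  moreover have "v i (h1 i f) = q + r"
    unfolding v_def q_def r_def by (simp only: sum.lessThan_Suc diff_self_eq_0 YY_0)
  moreover have "p - s = f - r" unfolding p_def s_def r_def by (rule h_telescope)
  then have "p - s + r = f" by (simp only: diff_add_cancel)
  moreover have "q + r + - (s - (p - q)) = p - s + r" for p q r s :: "'k coeffs"
    by (rule ext) (simp only: plus_fun_apply minus_apply uminus_apply, simp)
  ultimately show ?thesis by (simp only:)
qed

lemma u_h0_h1_v: "u i (h0 i f) + h1 i (v i f) = f"
proof -
  define p q s r where "p = (\<Sum>k<b. XX i k (Sh i k f))" and "q = (\<Sum>k<b. XX i k (h1 i (YY i (b - k) f)))"
    and "s = (\<Sum>k<b. XX i (Suc k) (Sh i (Suc k) f))" and "r = XX i b (h1 i f)"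
  have "(\<Sum>k<b. YY i (Suc 0) (XX i k (Sh i (Suc k) f))) = p - q"
    unfolding p_def q_def sum_subtractf[symmetric] comm_same(1)[symmetric]
    by (rule sum.cong) (simp_all only: YY_Sh lessThan_iff additive_diff)
  then have "u i (h0 i f) = (- s) - (- (p - q))"
    by (simp only: h0_def u_def additive additive_sum XX_Suc s_def)
  moreover have "h1 i (v i f) = q + r"
    unfolding v_def q_def r_def by (simp only: sum.lessThan_Suc diff_self_eq_0 YY_0 additive additive_sum comm_same(2))
  moreover have "p - s = f - r" unfolding p_def s_def r_def by (rule h_telescope)
  then have "p - s + r = f" by (simp only: diff_add_cancel)
  moreover have "(- s) - (- (p - q)) + (q + r) = p - s + r" for p q r s :: "'k coeffs"
    by (rule ext) (simp only: plus_fun_apply minus_apply uminus_apply, simp)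
  ultimately show ?thesis by (simp only:)
qed

lemma comm_uv:
  assumes "i \<noteq> j"
  shows "u i (u j f) = u j (u i f)" "u i (v j f) = v j (u i f)" "v i (v j f) = v j (v i f)"
    "u i (h0 j f) = h0 j (u i f)" "u i (h1 j f) = h1 j (u i f)" "v i (h0 j f) = h0 j (v i f)" "v i (h1 j f) = h1 j (v i f)"
    "h1 i (h1 j f) = h1 j (h1 i f)"
proof -
  have x: "XX j k (YY i l g) = YY i l (XX j k g)" "XX j k (Sh i l g) = Sh i l (XX j k g)" "XX j k (XX i l g) = XX i l (XX j k g)"
    "YY j k (YY i l g) = YY i l (YY j k g)" "YY j k (Sh i l g) = Sh i l (YY j k g)" "YY j k (XX i l g) = XX i l (YY j k g)"
    "Sh j k (YY i l g) = YY i l (Sh j k g)" "Sh j k (Sh i l g) = Sh i l (Sh j k g)" "Sh j k (XX i l g) = XX i l (Sh j k g)" for k l g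
    using assms assms[symmetric] by (simp_all only: comm_same comm_diff not_False_eq_True)
  note lin = u_def v_def h0_def additive additive_diff additive_sum sum_negf sum_subtractf x
  show "u i (u j f) = u j (u i f)" by (simp only: lin) (simp only: diff_diff_eq2 diff_diff_add diff_diff_eq add_diff_eq diff_add_eq add.commute add.left_commute)
  show "u i (v j f) = v j (u i f)" by (simp only: lin)
  have "- p - - q = - (p - q)" for p q :: "'k coeffs"
    by (rule ext) (simp only: minus_apply uminus_apply, simp)
  then show "u i (h0 j f) = h0 j (u i f)" by (simp only: lin)
  show "v i (v j f) = v j (v i f)" unfolding lin by (rule sum.swap)
  show "v i (h0 j f) = h0 j (v i f)" unfolding lin by (rule arg_cong[of _ _ uminus], rule sum.swap)
  show "u i (h1 j f) = h1 j (u i f)" "v i (h1 j f) = h1 j (v i f)" "h1 i (h1 j f) = h1 j (h1 i f)"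
    by (simp_all only: lin)
qed

end

section \<open>The enveloping algebra in coordinates\<close>

lemma op_algebra_simps [simp]:
  "carrier (op_algebra A) = carrier A" "x \<oplus>\<^bsub>op_algebra A\<^esub> y = x \<oplus>\<^bsub>A\<^esub> y" "\<zero>\<^bsub>op_algebra A\<^esub> = \<zero>\<^bsub>A\<^esub>"
  "\<one>\<^bsub>op_algebra A\<^esub> = \<one>\<^bsub>A\<^esub>" "r \<odot>\<^bsub>op_algebra A\<^esub> y = r \<odot>\<^bsub>A\<^esub> y" "x \<otimes>\<^bsub>op_algebra A\<^esub> y = y \<otimes>\<^bsub>A\<^esub> x"
  by (simp_all add: op_algebra_def)

context truncated_algebra
begin

abbreviation "Kf \<equiv> (ground_field :: 'k ring)"
abbreviation "Aop \<equiv> op_algebra A"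

lemma Aop_module: "Module.module Kf Aop"
proof -
  interpret A: Module.module Kf A by (rule A_module_K)
  have "abelian_group Aop"
    by (rule abelian_groupI) (auto simp: A.a_ac intro: A.l_neg bexI[of _ "\<ominus>\<^bsub>A\<^esub> x" for x])
  then show ?thesis
    using A.smult_closed A.smult_l_distr A.smult_r_distr A.smult_assoc1 A.smult_one
    by (intro moduleI A.R.is_cring) auto
qed

sublocale TP: tensor_pair Kf A Aop
  by (intro tensor_pair.intro A_module_K Aop_module)

abbreviation "E \<equiv> enveloping_algebra Kf A"
abbreviation "tt \<equiv> TP.tens"
abbreviation mult_A (infixl "\<star>" 70) where "x \<star> y \<equiv> x \<otimes>\<^bsub>A\<^esub> y"

interpretation A: cring A by (rule A_cring)

lemma E_simps: "carrier E = carrier TP.BM" "x \<oplus>\<^bsub>E\<^esub> y = x \<oplus>\<^bsub>TP.BM\<^esub> y" "\<zero>\<^bsub>E\<^esub> = \<zero>\<^bsub>TP.BM\<^esub>"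
  "r \<odot>\<^bsub>E\<^esub> x = r \<odot>\<^bsub>TP.BM\<^esub> x" "\<one>\<^bsub>E\<^esub> = tt \<one>\<^bsub>A\<^esub> \<one>\<^bsub>A\<^esub>"
  by (simp_all add: enveloping_algebra_def tensor_algebra_def TP.tens_def)

lemma A_smult_closed: "x \<in> carrier A \<Longrightarrow> r \<odot>\<^bsub>A\<^esub> x \<in> carrier A" using TP.B.smult_closed[of r x] by simp

lemma A_smult_mult: "x \<in> carrier A \<Longrightarrow> y \<in> carrier A \<Longrightarrow> (r \<odot>\<^bsub>A\<^esub> x) \<star> y = r \<odot>\<^bsub>A\<^esub> (x \<star> y)"
  "x \<in> carrier A \<Longrightarrow> y \<in> carrier A \<Longrightarrow> x \<star> (r \<odot>\<^bsub>A\<^esub> y) = r \<odot>\<^bsub>A\<^esub> (x \<star> y)"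
proof -
  have s: "Poly_Mapping.single 0 r \<in> carrier P" for r :: 'k by (rule P_closed) simp
  show 1: "x \<in> carrier A \<Longrightarrow> y \<in> carrier A \<Longrightarrow> (r \<odot>\<^bsub>A\<^esub> x) \<star> y = r \<odot>\<^bsub>A\<^esub> (x \<star> y)" for x y
    by (auto simp: carrier_A A_smult A_mult P_closed(5) s mult.assoc)
  show "x \<in> carrier A \<Longrightarrow> y \<in> carrier A \<Longrightarrow> x \<star> (r \<odot>\<^bsub>A\<^esub> y) = r \<odot>\<^bsub>A\<^esub> (x \<star> y)"
    using 1[of y x] by (simp add: A.m_comm A_smult_closed)
qed

text \<open>The tensor product of two linear maps respects the relations; applied to multiplications
  from either side.\<close>

lemma rel_map:
  assumes f: "\<And>x. x \<in> carrier A \<Longrightarrow> f x \<in> carrier A" "\<And>x y. x \<in> carrier A \<Longrightarrow> y \<in> carrier A \<Longrightarrow> f (x \<oplus>\<^bsub>A\<^esub> y) = f x \<oplus>\<^bsub>A\<^esub> f y"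
      "\<And>r x. x \<in> carrier A \<Longrightarrow> f (r \<odot>\<^bsub>A\<^esub> x) = r \<odot>\<^bsub>A\<^esub> f x"
    and g: "\<And>x. x \<in> carrier A \<Longrightarrow> g x \<in> carrier A" "\<And>x y. x \<in> carrier A \<Longrightarrow> y \<in> carrier A \<Longrightarrow> g (x \<oplus>\<^bsub>A\<^esub> y) = g x \<oplus>\<^bsub>A\<^esub> g y"
      "\<And>r x. x \<in> carrier A \<Longrightarrow> g (r \<odot>\<^bsub>A\<^esub> x) = r \<odot>\<^bsub>A\<^esub> g x"
    and z: "z \<in> TP.rel"
  shows "frag_extend (\<lambda>(x, y). frag_of (f x, g y)) z \<in> TP.rel"
  using z
proof (induction rule: TP.rel_induct)
  case (gen q)
  then show ?case
  proof cases
    case (1 b b' m)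
    then show ?thesis using TP.gens.intros(1)[of "f b" "f b'" "g m"]
      by (auto simp: frag_extend_diff f g intro: TP.gens_rel)
  next
    case (2 b m m')
    then show ?thesis using TP.gens.intros(2)[of "f b" "g m" "g m'"]
      by (auto simp: frag_extend_diff f g intro: TP.gens_rel)
  next
    case (3 s b m)
    then show ?thesis using TP.gens.intros(3)[of s "f b" "g m"]
      by (auto simp: frag_extend_diff f g intro: TP.gens_rel)
  qed
qed (auto simp: frag_extend_add frag_extend_minus intro: TP.rel_closed)

text \<open>The product of \<open>E\<close> on formal sums, with opposite order in the second
  factor; in this form it is additive in each argument before passing to classes.\<close>

definition fmult :: "('k mpoly set \<times> 'k mpoly set \<Rightarrow>\<^sub>0 int) \<Rightarrow> ('k mpoly set \<times> 'k mpoly set \<Rightarrow>\<^sub>0 int) \<Rightarrow> ('k mpoly set \<times> 'k mpoly set \<Rightarrow>\<^sub>0 int)" where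
  "fmult z w = frag_extend (\<lambda>(x, y). frag_extend (\<lambda>(x', y'). frag_of (x \<star> x', y' \<star> y)) w) z"

lemma fmult_diff: "fmult (z - z') w = fmult z w - fmult z' w" "fmult z (w - w') = fmult z w - fmult z w'"
  by (simp_all add: fmult_def frag_extend_diff case_prod_unfold frag_extend_fun_diff)

lemma fmult_0 [simp]: "fmult 0 w = 0" "fmult z 0 = 0"
  using fmult_diff(1)[of 0 0 w] fmult_diff(2)[of z 0 0] by simp_all

lemma fmult_rel:
  assumes "z \<in> carrier TP.F" "w \<in> carrier TP.F" "z \<in> TP.rel \<or> w \<in> TP.rel"
  shows "fmult z w \<in> TP.rel"
proof -
  have one: "fmult (frag_of p) w \<in> TP.rel" if p: "p \<in> carrier A \<times> carrier A" and w: "w \<in> TP.rel" for p w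
    using rel_map[of "\<lambda>x. fst p \<star> x" "\<lambda>y. y \<star> snd p", OF _ _ _ _ _ _ w] p
    by (auto simp: fmult_def A_smult_mult A.l_distr A.r_distr case_prod_unfold)
  have two: "fmult z (frag_of p) \<in> TP.rel" if p: "p \<in> carrier A \<times> carrier A" and z: "z \<in> TP.rel" for p z
    using rel_map[of "\<lambda>x. x \<star> fst p" "\<lambda>y. snd p \<star> y", OF _ _ _ _ _ _ z] p
    by (auto simp: fmult_def A_smult_mult A.l_distr A.r_distr case_prod_unfold)
  have k: "Poly_Mapping.keys z \<subseteq> carrier A \<times> carrier A" "Poly_Mapping.keys w \<subseteq> carrier A \<times> carrier A"
    using assms by simp_all
  from assms(3) show ?thesis
  proof
    assume w: "w \<in> TP.rel"
    show ?thesis using k(1)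
      by (induction z rule: frag_induction) (auto simp: fmult_diff intro: TP.rel_closed one w)
  next
    assume z: "z \<in> TP.rel"
    show ?thesis using k(2)
      by (induction w rule: frag_induction) (auto simp: fmult_diff intro: TP.rel_closed two z)
  qed
qed

lemma E_mult_tc:
  assumes z: "z \<in> carrier TP.F" and w: "w \<in> carrier TP.F"
  shows "TP.tc z \<otimes>\<^bsub>E\<^esub> TP.tc w = TP.tc (fmult z w)"
proof -
  have F: "u + z \<in> carrier TP.F" if "u \<in> TP.rel" "z \<in> carrier TP.F" for u z
    by (rule TP.F_closed(1)[OF TP.rel_closed(5)]) fact+
  have "TP.tc z \<otimes>\<^bsub>E\<^esub> TP.tc w = (\<Union>z'\<in>TP.tc z. \<Union>w'\<in>TP.tc w. TP.tc (fmult z' w'))"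
    by (simp add: enveloping_algebra_def tensor_algebra_def fmult_def)
  also have "\<dots> = (\<Union>z'\<in>TP.tc z. TP.tc (fmult z' w))"
  proof (intro SUP_cong refl TP.UN_tc)
    fix z' u assume "z' \<in> TP.tc z" and u: "u \<in> TP.rel"
    then have "z' \<in> carrier TP.F" using F[OF TP.tc_rel[of z' z] z] by simp
    then have "fmult z' u \<in> TP.rel" using fmult_rel[of z' u] TP.rel_closed(5)[OF u] u by blast
    then show "TP.tc (fmult z' (u + w)) = TP.tc (fmult z' w)"
      using fmult_diff(2)[of z' "u + w" w] by (simp add: TP.tc_eq_iff)
  qed
  also have "\<dots> = TP.tc (fmult z w)"
  proof (rule TP.UN_tc)
    fix u assume u: "u \<in> TP.rel"
    then have "fmult u w \<in> TP.rel" using fmult_rel[of u w] TP.rel_closed(5)[OF u] w by blast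
    then show "TP.tc (fmult (u + z) w) = TP.tc (fmult z w)"
      using fmult_diff(1)[of "u + z" z w] by (simp add: TP.tc_eq_iff)
  qed
  finally show ?thesis .
qed

lemma E_mult_tt:
  assumes "x \<in> carrier A" "y \<in> carrier A" "x' \<in> carrier A" "y' \<in> carrier A"
  shows "tt x y \<otimes>\<^bsub>E\<^esub> tt x' y' = tt (x \<star> x') (y \<star> y')"
proof -
  have "frag_of (x, y) \<in> carrier TP.F" "frag_of (x', y') \<in> carrier TP.F"
    using assms by (auto intro!: TP.frag_of_in_F)
  from E_mult_tc[OF this] show ?thesis using assms by (simp add: TP.tens_def fmult_def A.m_comm)
qed

lemma co_finsum:
  assumes "h \<in> S \<rightarrow> carrier A"
  shows "co (finsum A h S) m = (\<Sum>j\<in>S. co (h j) m)"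
proof -
  show ?thesis using assms
    by (induction S rule: infinite_finite_induct) (simp_all add: co_zero co_add Pi_def)
qed

lemma co_a_inv: "x \<in> carrier A \<Longrightarrow> co (\<ominus>\<^bsub>A\<^esub> x) m = - co x m"
proof -
  assume x: "x \<in> carrier A"
  have "co (x \<oplus>\<^bsub>A\<^esub> \<ominus>\<^bsub>A\<^esub> x) m = 0" using x by (simp add: TP.B.r_neg co_zero)
  then show ?thesis using x by (simp add: co_add eq_neg_iff_add_eq_0 add.commute)
qed

lemma co_add_pow: "x \<in> carrier A \<Longrightarrow> co (add_pow A (n :: int) x) m = of_int n * co x m"
proof -
  assume x: "x \<in> carrier A"
  have nat: "co (add_pow A (k :: nat) x) m = of_nat k * co x m" for k
    by (induction k) (simp_all add: x co_zero co_add TP.B.add.nat_pow_Suc algebra_simps)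
  show ?thesis
    using nat[of "nat n"] nat[of "nat (- n)"] x
    by (cases "n \<ge> 0") (simp_all add: add_pow_int_ge add_pow_int_lt co_a_inv)
qed

definition bilinear :: "('k mpoly set \<Rightarrow> 'k mpoly set \<Rightarrow> 'k mpoly set) \<Rightarrow> bool" where
  "bilinear h \<longleftrightarrow> (\<forall>x\<in>carrier A. \<forall>y\<in>carrier A. h x y \<in> carrier A) \<and> (\<forall>m. TP.balanced (\<lambda>x y. co (h x y) m))"

text \<open>Values in \<open>A\<close> are compared coordinate by coordinate: each coordinate is a
  balanced map into the field, to which \<open>tlift\<close> applies. This shows that the image
  taken in \<open>env_eval\<close> is a singleton.\<close>

lemma env_eval:
  assumes h: "bilinear h" and C: "C \<in> carrier E"
  shows "env_eval A h C \<in> carrier A" "co (env_eval A h C) m = TP.tlift (\<lambda>x y. co (h x y) m) C"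
proof -
  define s where "s z = (\<Oplus>\<^bsub>A\<^esub>v\<in>Poly_Mapping.keys z. add_pow A (Poly_Mapping.lookup z v) (h (fst v) (snd v)))"
    for z :: "'k mpoly set \<times> 'k mpoly set \<Rightarrow>\<^sub>0 int"
  have bal: "TP.balanced (\<lambda>x y. co (h x y) m)" for m using h by (simp add: bilinear_def)
  obtain z where z: "z \<in> carrier TP.F" "C = TP.tc z"
    using C by (auto simp: E_simps TP.carrier_BM simp del: TP.F_simps)
  have hc: "h (fst v) (snd v) \<in> carrier A" if "w \<in> carrier TP.F" "v \<in> Poly_Mapping.keys w" for w v
    using that h by (auto simp: bilinear_def)
  have s: "s w \<in> carrier A" "co (s w) m = frag_eval (\<lambda>(x, y). co (h x y) m) w" if w: "w \<in> carrier TP.F" for w m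
    using hc[OF w] by (auto simp: s_def co_finsum co_add_pow frag_eval_def case_prod_unfold)
  have "s w = s z" if "w \<in> TP.tc z" for w
  proof -
    have w: "w \<in> carrier TP.F" using TP.F_closed(1)[OF TP.rel_closed(5)[OF TP.tc_rel[OF that]] z(1)] by simp
    show ?thesis by (rule co_eqI[OF s(1)[OF w] s(1)[OF z(1)]]) (simp only: s(2)[OF w] s(2)[OF z(1)] TP.frag_eval_tc[OF bal that])
  qed
  then have "s ` TP.tc z = (\<lambda>_. s z) ` TP.tc z" by (intro image_cong refl)
  then have "s ` C = {s z}" using z(2) TP.tc_self[of z] by (simp only: image_constant)
  then have "env_eval A h C = s z" by (simp add: env_eval_def s_def)
  then show "env_eval A h C \<in> carrier A" "co (env_eval A h C) m = TP.tlift (\<lambda>x y. co (h x y) m) C"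
    using s[OF z(1)] z(2) TP.tlift_tc[OF bal] by simp_all
qed

section \<open>The enveloping algebra acting on A\<close>

abbreviation "LA \<equiv> left_env_module A"
abbreviation act_LA (infixl "\<rhd>" 70) where "C \<rhd> b \<equiv> C \<odot>\<^bsub>LA\<^esub> b"

lemma LA_simps [simp]: "carrier LA = carrier A" "x \<oplus>\<^bsub>LA\<^esub> y = x \<oplus>\<^bsub>A\<^esub> y" "\<zero>\<^bsub>LA\<^esub> = \<zero>\<^bsub>A\<^esub>"
  by (simp_all add: left_env_module_def)

lemma bilinear_action: "b \<in> carrier A \<Longrightarrow> bilinear (\<lambda>x y. x \<star> b \<star> y)"
    by (auto simp: bilinear_def TP.balanced_def A.l_distr A.r_distr co_add A_smult_mult A_smult_closed)

lemma LA_closed: "C \<in> carrier E \<Longrightarrow> b \<in> carrier A \<Longrightarrow> C \<rhd> b \<in> carrier A"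
  by (simp add: left_env_module_def env_eval(1)[OF bilinear_action])

lemma LA_tt: "x \<in> carrier A \<Longrightarrow> y \<in> carrier A \<Longrightarrow> b \<in> carrier A \<Longrightarrow> tt x y \<rhd> b = x \<star> b \<star> y"
proof -
  assume xyb: "x \<in> carrier A" "y \<in> carrier A" "b \<in> carrier A"
  have "tt x y \<in> carrier E" using xyb by (simp add: E_simps)
  from env_eval[OF bilinear_action[OF xyb(3)] this] show ?thesis
    using bilinear_action[OF xyb(3)] xyb
    by (intro co_eqI) (auto simp: left_env_module_def TP.tlift_tens bilinear_def)
qed

lemma LA_add: "C \<in> carrier E \<Longrightarrow> D \<in> carrier E \<Longrightarrow> b \<in> carrier A \<Longrightarrow> (C \<oplus>\<^bsub>E\<^esub> D) \<rhd> b = C \<rhd> b \<oplus>\<^bsub>A\<^esub> D \<rhd> b"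
proof -
  assume C: "C \<in> carrier E" "D \<in> carrier E" and b: "b \<in> carrier A"
  note h = bilinear_action[OF b]
  have CD: "C \<oplus>\<^bsub>E\<^esub> D \<in> carrier E" using C TP.BM.a_closed by (simp add: E_simps)
  show ?thesis
    by (rule co_eqI)
      (use C CD h in \<open>auto simp: left_env_module_def env_eval co_add bilinear_def E_simps TP.tlift_add\<close>)
qed

lemma E_zero_LA: "b \<in> carrier A \<Longrightarrow> \<zero>\<^bsub>E\<^esub> \<rhd> b = \<zero>\<^bsub>A\<^esub>"
proof -
  assume b: "b \<in> carrier A"
  have z: "\<zero>\<^bsub>E\<^esub> \<in> carrier E" by (simp add: E_simps)
  show ?thesis
    by (rule co_eqI)
      (use b z bilinear_action[OF b] in \<open>auto simp: left_env_module_def env_eval co_zero bilinear_def E_simps TP.tlift_zero\<close>)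
qed

lemma E_induct [consumes 1, case_names zero tens]:
  assumes "C \<in> carrier E" "Q \<zero>\<^bsub>E\<^esub>"
    "\<And>x y D. x \<in> carrier A \<Longrightarrow> y \<in> carrier A \<Longrightarrow> D \<in> carrier E \<Longrightarrow> Q D \<Longrightarrow> Q (tt x y \<oplus>\<^bsub>E\<^esub> D)"
  shows "Q C"
  using TP.tens_induct[of C Q] assms by (simp add: E_simps)

lemma tt_closed [simp]: "x \<in> carrier A \<Longrightarrow> y \<in> carrier A \<Longrightarrow> tt x y \<in> carrier E"
  by (simp add: E_simps)

end

text \<open>Commutativity of \<open>E\<close> enters as an assumption here; in the theorem it is
  contained in the requirement that the terms of \<open>T\<close> are modules over
  \<open>E\<close>.\<close>

locale env_algebra = truncated_algebra c a A
  for c a :: nat and A :: "('k::field, 'k mpoly set) module" +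
  assumes E_cring: "cring (enveloping_algebra (ground_field :: 'k ring) A)"
begin

lemma LA_module: "Module.module E LA"
proof -
  interpret A: cring A by (rule A_cring)
  interpret E: cring E by (rule E_cring)
  have ab: "abelian_group LA"
    by (rule abelian_groupI) (auto simp: TP.B.a_ac intro: TP.B.l_neg bexI[of _ "\<ominus>\<^bsub>A\<^esub> x" for x])
  have radd: "C \<rhd> (b \<oplus>\<^bsub>A\<^esub> b') = C \<rhd> b \<oplus>\<^bsub>A\<^esub> C \<rhd> b'"
    if C: "C \<in> carrier E" and b: "b \<in> carrier A" "b' \<in> carrier A" for C b b'
    using C
  proof (induction rule: E_induct)
    case (tens x y D)
    then show ?case using b by (simp add: LA_add LA_tt LA_closed A.l_distr A.r_distr TP.B.a_ac)
  qed (use b in \<open>simp add: E_zero_LA\<close>)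
  have rzero: "C \<rhd> \<zero>\<^bsub>A\<^esub> = \<zero>\<^bsub>A\<^esub>" if C: "C \<in> carrier E" for C
    using radd[OF C, of "\<zero>\<^bsub>A\<^esub>" "\<zero>\<^bsub>A\<^esub>"] LA_closed[OF C, of "\<zero>\<^bsub>A\<^esub>"] by (simp add: TP.B.add.r_cancel_one)
  have assoc: "(C \<otimes>\<^bsub>E\<^esub> D) \<rhd> b = C \<rhd> (D \<rhd> b)"
    if C: "C \<in> carrier E" and D: "D \<in> carrier E" and b: "b \<in> carrier A" for C D b
    using D
  proof (induction rule: E_induct)
    case zero
    then show ?case using b C by (simp add: E_zero_LA rzero)
  next
    case (tens x y D)
    have "(C \<otimes>\<^bsub>E\<^esub> tt x y) \<rhd> b = C \<rhd> (tt x y \<rhd> b)"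
      using C
    proof (induction rule: E_induct)
      case zero
      then show ?case using b tens(1,2) LA_closed[of "tt x y" b] by (simp add: E_zero_LA)
    next
      case (tens x' y' D')
      have "tt x' y' \<rhd> (tt x y \<rhd> b) = (tt x' y' \<otimes>\<^bsub>E\<^esub> tt x y) \<rhd> b"
        using tens(1,2) \<open>x \<in> carrier A\<close> \<open>y \<in> carrier A\<close> b by (simp add: LA_tt E_mult_tt A.m_ac)
      then show ?case using tens \<open>x \<in> carrier A\<close> \<open>y \<in> carrier A\<close> b
        by (simp add: E.l_distr LA_add LA_closed)
    qed
    then show ?case using tens C b by (simp add: E.r_distr LA_add LA_closed radd)
  qed
  show ?thesis
    by (rule moduleI)
      (auto simp: E_cring ab radd assoc LA_add LA_closed E_simps(5) LA_tt)
qed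

end

section \<open>Coordinates on the enveloping algebra\<close>

context truncated_algebra
begin

sublocale SO: shift_operators "a - Suc 0" "TYPE('k)" .

lemma Suc_a [simp]: "Suc (a - Suc 0) = a"
  using a_ge by simp

text \<open>Coefficients of a tensor in the basis of pairs of monomials: this identifies
  \<open>E\<close> with the truncated polynomials in two sets of variables, and \<open>Psi\<close>
  is the inverse.\<close>

definition Phi :: "'k mpoly set env \<Rightarrow> 'k coeffs" where
  "Phi C = (\<lambda>(m, n). TP.tlift (\<lambda>x y. co x m * co y n) C)"

lemma Phi_balanced: "TP.balanced (\<lambda>x y. co x m * co y n)"
  by (auto simp: TP.balanced_def co_add co_smult algebra_simps)

lemma Phi_add: "C \<in> carrier E \<Longrightarrow> D \<in> carrier E \<Longrightarrow> Phi (C \<oplus>\<^bsub>E\<^esub> D) = Phi C + Phi D"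
  by (auto simp: Phi_def fun_eq_iff E_simps TP.tlift_add[OF Phi_balanced])

lemma Phi_zero: "Phi \<zero>\<^bsub>E\<^esub> = 0"
  by (auto simp: Phi_def fun_eq_iff E_simps TP.tlift_zero[OF Phi_balanced])

lemma Phi_tt: "Phi (tt x y) (m, n) = co x m * co y n"
  by (simp add: Phi_def TP.tlift_tens[OF Phi_balanced])

lemma Phi_outside: "C \<in> carrier E \<Longrightarrow> m \<notin> box \<or> n \<notin> box \<Longrightarrow> Phi C (m, n) = 0"
  by (induction rule: E_induct) (auto simp: Phi_zero Phi_add Phi_tt co_outside)

definition basis :: "(nat \<Rightarrow> nat) \<Rightarrow> 'k mpoly set" where
  "basis m = (SOME x. x \<in> carrier A \<and> (\<forall>m'. co x m' = (if m' = m then 1 else 0)))"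

lemma basis: "m \<in> box \<Longrightarrow> basis m \<in> carrier A" "m \<in> box \<Longrightarrow> co (basis m) m' = (if m' = m then 1 else 0)"
proof -
  have "basis m \<in> carrier A \<and> (\<forall>m'. co (basis m) m' = (if m' = m then 1 else 0))" if m: "m \<in> box"
    unfolding basis_def by (rule someI_ex) (use co_surj[of "\<lambda>m'. if m' = m then 1 else 0"] m in force)
  then show "m \<in> box \<Longrightarrow> basis m \<in> carrier A" "m \<in> box \<Longrightarrow> co (basis m) m' = (if m' = m then 1 else 0)" by auto
qed

lemma basis_expansion: "x \<in> carrier A \<Longrightarrow> x = (\<Oplus>\<^bsub>A\<^esub>m\<in>box. co x m \<odot>\<^bsub>A\<^esub> basis m)"
proof -
  interpret A: cring A by (rule A_cring)
  assume x: "x \<in> carrier A"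
  have "co (\<Oplus>\<^bsub>A\<^esub>m\<in>box. co x m \<odot>\<^bsub>A\<^esub> basis m) m' = co x m'" for m'
  proof -
    have "co (\<Oplus>\<^bsub>A\<^esub>m\<in>box. co x m \<odot>\<^bsub>A\<^esub> basis m) m' = (\<Sum>m\<in>box. if m' = m then co x m else 0)"
      by (subst co_finsum) (auto simp: basis A_smult_closed co_smult intro!: sum.cong)
    then show ?thesis using finite_box co_outside[OF x, of m'] by auto
  qed
  then show ?thesis using x basis by (intro co_eqI) (auto simp: A_smult_closed intro!: TP.B.finsum_closed)
qed

lemma tt_hom: "y \<in> carrier A \<Longrightarrow> (\<lambda>x. tt x y) \<in> Hom Kf A TP.BM"
  "x \<in> carrier A \<Longrightarrow> (\<lambda>y. tt x y) \<in> Hom Kf A TP.BM"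
proof -
  show "y \<in> carrier A \<Longrightarrow> (\<lambda>x. tt x y) \<in> Hom Kf A TP.BM"
    by (rule module_homI) (simp_all add: TP.tens_add_l TP.smult_tens)
  assume x: "x \<in> carrier A"
  have "tt x (r \<odot>\<^bsub>A\<^esub> y) = r \<odot>\<^bsub>TP.BM\<^esub> tt x y" if "y \<in> carrier A" for r y
    using TP.tens_balanced[of r x y] x that by (simp add: TP.smult_tens)
  moreover have "tt x (y \<oplus>\<^bsub>A\<^esub> y') = tt x y \<oplus>\<^bsub>TP.BM\<^esub> tt x y'" if "y \<in> carrier A" "y' \<in> carrier A" for y y'
    using TP.tens_add_r[of x y y'] x that by simp
  ultimately show "(\<lambda>y. tt x y) \<in> Hom Kf A TP.BM"
    using x by (intro module_homI) simp_all
qed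

lemma Phi_finsum:
  assumes "h \<in> S \<rightarrow> carrier TP.BM"
  shows "Phi (finsum TP.BM h S) p = (\<Sum>j\<in>S. Phi (h j) p)"
proof -
  have add: "Phi (C \<oplus>\<^bsub>TP.BM\<^esub> D) p = Phi C p + Phi D p" if "C \<in> carrier TP.BM" "D \<in> carrier TP.BM" for C D
    using Phi_add[of C D] that by (simp add: E_simps)
  have zero: "Phi \<zero>\<^bsub>TP.BM\<^esub> p = 0" using Phi_zero by (simp add: E_simps)
  show ?thesis using assms
    by (induction S rule: infinite_finite_induct) (simp_all add: add zero Pi_def)
qed

definition Psi :: "'k coeffs \<Rightarrow> 'k mpoly set env" where
  "Psi f = (\<Oplus>\<^bsub>TP.BM\<^esub>m\<in>box. \<Oplus>\<^bsub>TP.BM\<^esub>n\<in>box. tt (f (m, n) \<odot>\<^bsub>A\<^esub> basis m) (basis n))"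

lemma Psi_closed: "Psi f \<in> carrier E"
  unfolding Psi_def E_simps using basis A_smult_closed by (intro TP.BM.finsum_closed) (auto intro!: TP.BM.finsum_closed)

lemma Phi_Psi:
  assumes "\<And>m n. m \<notin> box \<or> n \<notin> box \<Longrightarrow> f (m, n) = 0"
  shows "Phi (Psi f) = f"
proof (rule ext, clarify)
  fix m n
  have c: "tt (f (m', n') \<odot>\<^bsub>A\<^esub> basis m') (basis n') \<in> carrier TP.BM" if "m' \<in> box" "n' \<in> box" for m' n'
    using that basis A_smult_closed by simp
  have "Phi (Psi f) (m, n) = (\<Sum>m'\<in>box. \<Sum>n'\<in>box. Phi (tt (f (m', n') \<odot>\<^bsub>A\<^esub> basis m') (basis n')) (m, n))"
    unfolding Psi_def using c by (subst Phi_finsum) (auto intro!: TP.BM.finsum_closed sum.cong Phi_finsum)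
  also have "\<dots> = (\<Sum>m'\<in>box. \<Sum>n'\<in>box. if m = m' \<and> n = n' then f (m', n') else 0)"
    by (intro sum.cong refl) (auto simp: Phi_tt co_smult basis)
  also have "\<dots> = (\<Sum>m'\<in>box. if m = m' then (\<Sum>n'\<in>box. if n = n' then f (m', n') else 0) else 0)"
    by (intro sum.cong refl) auto
  also have "\<dots> = f (m, n)" using finite_box assms[of m n] by auto
  finally show "Phi (Psi f) (m, n) = f (m, n)" .
qed

lemma Psi_add: "Psi (f + g) = Psi f \<oplus>\<^bsub>E\<^esub> Psi g"
proof -
  have c: "tt (f (m, n) \<odot>\<^bsub>A\<^esub> basis m) (basis n) \<in> carrier TP.BM" if "m \<in> box" "n \<in> box" for m n f
    using that basis A_smult_closed by simp
  have *: "tt ((f + g) (m, n) \<odot>\<^bsub>A\<^esub> basis m) (basis n)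
      = tt (f (m, n) \<odot>\<^bsub>A\<^esub> basis m) (basis n) \<oplus>\<^bsub>TP.BM\<^esub> tt (g (m, n) \<odot>\<^bsub>A\<^esub> basis m) (basis n)"
    if "m \<in> box" "n \<in> box" for m n
    using that basis A_smult_closed TP.B.smult_l_distr[of "f (m, n)" "g (m, n)" "basis m"]
    by (simp add: TP.tens_add_l)
  have inner: "(\<Oplus>\<^bsub>TP.BM\<^esub>n\<in>box. tt ((f + g) (m, n) \<odot>\<^bsub>A\<^esub> basis m) (basis n)) = (\<Oplus>\<^bsub>TP.BM\<^esub>n\<in>box. tt (f (m, n) \<odot>\<^bsub>A\<^esub> basis m) (basis n)) \<oplus>\<^bsub>TP.BM\<^esub>
      (\<Oplus>\<^bsub>TP.BM\<^esub>n\<in>box. tt (g (m, n) \<odot>\<^bsub>A\<^esub> basis m) (basis n))" if "m \<in> box" for m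
  proof -
    have "(\<Oplus>\<^bsub>TP.BM\<^esub>n\<in>box. tt ((f + g) (m, n) \<odot>\<^bsub>A\<^esub> basis m) (basis n))
        = (\<Oplus>\<^bsub>TP.BM\<^esub>n\<in>box. tt (f (m, n) \<odot>\<^bsub>A\<^esub> basis m) (basis n) \<oplus>\<^bsub>TP.BM\<^esub> tt (g (m, n) \<odot>\<^bsub>A\<^esub> basis m) (basis n))"
      using that c by (intro TP.BM.finsum_cong' refl *) auto
    also have "\<dots> = (\<Oplus>\<^bsub>TP.BM\<^esub>n\<in>box. tt (f (m, n) \<odot>\<^bsub>A\<^esub> basis m) (basis n)) \<oplus>\<^bsub>TP.BM\<^esub>
      (\<Oplus>\<^bsub>TP.BM\<^esub>n\<in>box. tt (g (m, n) \<odot>\<^bsub>A\<^esub> basis m) (basis n))"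
      using that c by (intro TP.BM.finsum_addf) auto
    finally show ?thesis .
  qed
  have "Psi (f + g) = (\<Oplus>\<^bsub>TP.BM\<^esub>m\<in>box. (\<Oplus>\<^bsub>TP.BM\<^esub>n\<in>box. tt (f (m, n) \<odot>\<^bsub>A\<^esub> basis m) (basis n)) \<oplus>\<^bsub>TP.BM\<^esub>
      (\<Oplus>\<^bsub>TP.BM\<^esub>n\<in>box. tt (g (m, n) \<odot>\<^bsub>A\<^esub> basis m) (basis n)))"
    unfolding Psi_def using c
    by (intro TP.BM.finsum_cong' refl inner) (auto intro!: TP.BM.finsum_closed)
  also have "\<dots> = Psi f \<oplus>\<^bsub>TP.BM\<^esub> Psi g"
    unfolding Psi_def using c by (intro TP.BM.finsum_addf) (auto intro!: TP.BM.finsum_closed)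
  finally show ?thesis by (simp add: E_simps)
qed

lemma Psi_0: "Psi 0 = \<zero>\<^bsub>E\<^esub>"
proof -
  have "Psi 0 \<oplus>\<^bsub>TP.BM\<^esub> Psi 0 = Psi 0" using Psi_add[of 0 0] by (simp only: E_simps add_0)
  moreover have "Psi 0 \<in> carrier TP.BM" using Psi_closed[of 0] by (simp only: E_simps)
  ultimately show ?thesis unfolding E_simps by (metis TP.BM.add.r_cancel_one)
qed

lemma Psi_Phi: "C \<in> carrier E \<Longrightarrow> Psi (Phi C) = C"
proof (induction rule: E_induct)
  case zero
  then show ?case by (simp only: Phi_zero Psi_0)
next
  case (tens x y D)
  have b: "basis m \<in> carrier A" "r \<odot>\<^bsub>A\<^esub> basis m \<in> carrier A" if "m \<in> box" for r m using that basis A_smult_closed by auto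
  have "Psi (Phi (tt x y)) = (\<Oplus>\<^bsub>TP.BM\<^esub>m\<in>box. \<Oplus>\<^bsub>TP.BM\<^esub>n\<in>box. tt (co x m \<odot>\<^bsub>A\<^esub> basis m) (co y n \<odot>\<^bsub>A\<^esub> basis n))"
    unfolding Psi_def
  proof (intro TP.BM.finsum_cong' refl)
    fix m n assume mn: "m \<in> box" "n \<in> box"
    \<comment> \<open>One scalar is moved across the tensor sign, so that each factor can be summed
      over its own basis expansion.\<close>
    have "(co x m * co y n) \<odot>\<^bsub>A\<^esub> basis m = co y n \<odot>\<^bsub>A\<^esub> (co x m \<odot>\<^bsub>A\<^esub> basis m)"
      using TP.B.smult_assoc1[of "co y n" "co x m" "basis m"] b(1)[OF mn(1)] by (simp add: mult.commute)
    then show "tt (Phi (tt x y) (m, n) \<odot>\<^bsub>A\<^esub> basis m) (basis n) = tt (co x m \<odot>\<^bsub>A\<^esub> basis m) (co y n \<odot>\<^bsub>A\<^esub> basis n)"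
      using TP.tens_balanced[of "co y n" "co x m \<odot>\<^bsub>A\<^esub> basis m" "basis n"] b mn by (simp add: Phi_tt)
  qed (use b in \<open>auto intro!: TP.BM.finsum_closed\<close>)
  also have "\<dots> = (\<Oplus>\<^bsub>TP.BM\<^esub>m\<in>box. tt (co x m \<odot>\<^bsub>A\<^esub> basis m) y)"
  proof (intro TP.BM.finsum_cong' refl)
    fix m assume m: "m \<in> box"
    show "(\<Oplus>\<^bsub>TP.BM\<^esub>n\<in>box. tt (co x m \<odot>\<^bsub>A\<^esub> basis m) (co y n \<odot>\<^bsub>A\<^esub> basis n)) = tt (co x m \<odot>\<^bsub>A\<^esub> basis m) y"
      by (subst module_hom_finsum[OF A_module_K TP.BM_module tt_hom(2), symmetric])
        (use b m basis_expansion[OF tens(2)] in auto)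
  qed (use b tens in auto)
  also have "\<dots> = tt x y"
    by (subst module_hom_finsum[OF A_module_K TP.BM_module tt_hom(1), symmetric])
      (use b tens basis_expansion[OF tens(1)] in auto)
  finally show ?case using tens by (simp only: Phi_add[OF tt_closed[OF tens(1,2)] tens(3)] Psi_add)
qed

lemma Phi_inj: "C \<in> carrier E \<Longrightarrow> D \<in> carrier E \<Longrightarrow> Phi C = Phi D \<Longrightarrow> C = D"
  by (metis Psi_Phi)

text \<open>The block shift agrees with truncated multiplication off the box as well: if the lowered
  index lies in the box and the remainder is nonzero, then the index itself was in the box.\<close>

lemma co_var_mult_mod:
  assumes i: "i \<in> {1..c}" and x: "x \<in> carrier A"
  shows "co (var i \<star> x) m = (if m i mod a < Suc 0 then 0 else co x (m(i := m i - Suc 0)))"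
proof (cases "m \<in> box")
  case True
  then have "m i < a" using i by (auto simp: box_def)
  then show ?thesis using True by (simp add: co_var_mult[OF i x])
next
  case False
  have "co x (m(i := m i - Suc 0)) = 0" if nz: "m i mod a \<noteq> 0"
  proof (rule co_outside[OF x], rule notI)
    assume "m(i := m i - Suc 0) \<in> box"
    then have in_box: "if j \<in> {1..c} then (m(i := m i - Suc 0)) j < a else (m(i := m i - Suc 0)) j = 0" for j
      unfolding box_def by blast
    have "m i - Suc 0 < a" using in_box[of i] i by simp
    moreover have "m i \<noteq> a" using nz by (intro notI) simp
    ultimately have mi: "m i < a" by linarith
    have "if j \<in> {1..c} then m j < a else m j = 0" for j
      using in_box[of j] mi i by (cases "j = i"; cases "j \<in> {1..c}") auto
    then show False using \<open>m \<notin> box\<close> unfolding box_def by blast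
  qed
  then show ?thesis using False by (simp add: co_var_mult[OF i x])
qed

end

declare plus_fun_apply [simp del] zero_fun_apply [simp del] minus_apply [simp del] uminus_apply [simp del]

section \<open>Products of the operators over all variables, and the projections at the ends of each
  direction\<close>

context shift_operators
begin

fun vprod :: "nat \<Rightarrow> 'k coeffs \<Rightarrow> 'k coeffs" where
  "vprod 0 f = f" | "vprod (Suc n) f = v (Suc n) (vprod n f)"

fun hprod :: "nat \<Rightarrow> 'k coeffs \<Rightarrow> 'k coeffs" where
  "hprod 0 f = f" | "hprod (Suc n) f = h1 (Suc n) (hprod n f)"

lemma v_hprod: "n < i \<Longrightarrow> v i (hprod n f) = hprod n (v i f)"
  by (induction n) (simp_all add: comm_uv)

lemma h1_vprod: "n < i \<Longrightarrow> h1 i (vprod n f) = vprod n (h1 i f)"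
  by (induction n) (simp_all flip: comm_uv(7))

lemma u_vprod: "1 \<le> i \<Longrightarrow> i \<le> n \<Longrightarrow> u i (vprod n f) = 0"
proof (induction n)
  case (Suc n)
  then show ?case
    by (cases "i = Suc n") (simp_all add: uv comm_uv, simp add: v_def additive)
qed simp

lemma vprod_u: "1 \<le> i \<Longrightarrow> i \<le> n \<Longrightarrow> vprod n (u i f) = 0"
proof -
  have "vprod n (u i f) = u i (vprod n f)" if "n < i" for n
    using that by (induction n) (simp_all add: comm_uv)
  moreover have v0: "v i 0 = 0" for i by (simp add: v_def additive)
  ultimately show "1 \<le> i \<Longrightarrow> i \<le> n \<Longrightarrow> vprod n (u i f) = 0"
    by (induction n) (auto simp: vu le_Suc_eq)
qed

end

text \<open>\<open>k l\<close> tells which differential arrives at coordinate \<open>l\<close>, the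
  same in every direction. Adjacent nonzero kinds differ, so consecutive maps compose to
  zero.\<close>

locale kinded_shift_operators = shift_operators b ty for b :: nat and ty :: "'k::field itself" +
  fixes k :: "int \<Rightarrow> nat" and c :: nat
  assumes k_alternates: "k l \<noteq> 0 \<Longrightarrow> k (l + 1) \<noteq> 0 \<Longrightarrow> k l \<noteq> k (l + 1)" and k_range: "k l \<le> 2"
begin

definition W :: "nat \<Rightarrow> int \<Rightarrow> 'k coeffs \<Rightarrow> 'k coeffs" where
  "W j l f = (if k l = 1 then u (Suc j) f else if k l = 2 then v (Suc j) f else 0)"

text \<open>The index is \<open>l - 1\<close> because the homotopy runs against the differential
  from \<open>l\<close> to \<open>l - 1\<close>. Directions are counted from 0, variables from
  1.\<close>

definition H :: "nat \<Rightarrow> int \<Rightarrow> 'k coeffs \<Rightarrow> 'k coeffs" where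
  "H j l f = (if k (l - 1) = 1 then h0 (Suc j) f else if k (l - 1) = 2 then h1 (Suc j) f else 0)"

lemma op_0: "u i 0 = 0" "v i 0 = 0" "h0 i 0 = 0"
  by (simp_all add: u_def v_def h0_def additive)

sublocale M: multi_complex c W H
proof
  show "W j l (x + y) = W j l x + W j l y" for j l x y by (simp add: W_def uv_additive)
  show "H j l (x + y) = H j l x + H j l y" for j l x y by (simp add: H_def uv_additive additive)
  show "W i l (W j m x) = W j m (W i l x)" if "i \<noteq> j" for i j l m x
  proof -
    have n: "Suc i \<noteq> Suc j" "Suc j \<noteq> Suc i" using that by auto
    show ?thesis using comm_uv[OF n(1)] comm_uv[OF n(2)] by (simp add: W_def op_0)
  qed
  show "W i l (H j m x) = H j m (W i l x)" if "i \<noteq> j" for i j l m x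
  proof -
    have n: "Suc i \<noteq> Suc j" using that by auto
    show ?thesis using comm_uv[OF n] by (simp add: W_def H_def op_0 additive)
  qed
  show "W j l (W j (l + 1) x) = 0" for j l x
    using k_alternates[of l] by (auto simp: W_def uv vu op_0)
qed

text \<open>Where the arriving and the departing map are both nonzero, one is \<open>u\<close> and
  the other \<open>v\<close>, and their homotopies contract the direction.\<close>

lemma pproj_inner:
  assumes "k (\<nu> j) \<noteq> 0" "k (\<nu> j - 1) \<noteq> 0"
  shows "M.pproj j z \<nu> = 0"
proof -
  have "k (\<nu> j) = 1 \<and> k (\<nu> j - 1) = 2 \<or> k (\<nu> j) = 2 \<and> k (\<nu> j - 1) = 1"
    using assms k_alternates[of "\<nu> j - 1"] k_range[of "\<nu> j"] k_range[of "\<nu> j - 1"] by auto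
  then show ?thesis
    using u_h0_h1_v[of "Suc j" "z \<nu>"] v_h1_h0_u[of "Suc j" "z \<nu>"]
    by (auto simp: M.pproj_def W_def H_def diff_diff_eq add.commute)
qed

text \<open>At the end with \<open>u\<close> arriving and nothing departing, the cokernel of
  \<open>u\<close> remains; \<open>h1 v\<close> is the projection complementary to
  \<open>u h0\<close>.\<close>

lemma pproj_low:
  assumes "k (\<nu> j) = 1" "k (\<nu> j - 1) = 0"
  shows "M.pproj j z \<nu> = h1 (Suc j) (v (Suc j) (z \<nu>))"
  using assms u_h0_h1_v[of "Suc j" "z \<nu>"]
  by (simp add: M.pproj_def W_def H_def diff_eq_eq add.commute)

text \<open>At the end with nothing arriving and \<open>u\<close> departing, the kernel of
  \<open>u\<close> remains, which is the image of \<open>v\<close>.\<close>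

lemma pproj_high:
  assumes "k (\<nu> j) = 0" "k (\<nu> j - 1) = 1"
  shows "M.pproj j z \<nu> = v (Suc j) (h1 (Suc j) (z \<nu>))"
  using assms v_h1_h0_u[of "Suc j" "z \<nu>"]
  by (simp add: M.pproj_def W_def H_def diff_eq_eq add.commute)

lemma pproj_0: "z \<nu> = 0 \<Longrightarrow> M.pproj j z \<nu> = 0"
  by (simp add: M.pproj_def M.W_0 M.H_0)

lemma tproj_inner: "j < n \<Longrightarrow> k (\<nu> j) \<noteq> 0 \<Longrightarrow> k (\<nu> j - 1) \<noteq> 0 \<Longrightarrow> M.tproj n z \<nu> = 0"
proof (induction n)
  case (Suc n)
  then show ?case by (cases "j = n") (simp_all add: pproj_inner pproj_0)
qed simp

lemma tproj_low:
  assumes "\<And>j. j < n \<Longrightarrow> k (\<nu> j) = 1 \<and> k (\<nu> j - 1) = 0"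
  shows "M.tproj n z \<nu> = hprod n (vprod n (z \<nu>))"
  using assms by (induction n) (simp_all add: pproj_low v_hprod)

lemma tproj_high:
  assumes "\<And>j. j < n \<Longrightarrow> k (\<nu> j) = 0 \<and> k (\<nu> j - 1) = 1"
  shows "M.tproj n z \<nu> = vprod n (hprod n (z \<nu>))"
  using assms by (induction n) (simp_all add: pproj_high h1_vprod)

end

text \<open>
  The positive and the negative half of the complete resolution; the kinds 1 and 2 stand for
  multiplication by \<open>u\<close> and by \<open>v\<close>, the kind 0 for the zero map.
\<close>

definition kind_pos :: "int \<Rightarrow> nat" where
  "kind_pos l = (if l < 0 then 0 else if even l then 1 else 2)"

definition kind_neg :: "int \<Rightarrow> nat" where
  "kind_neg l = (if l \<ge> 0 then 0 else if odd l then 1 else 2)"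

context truncated_algebra
begin

sublocale KP: kinded_shift_operators "a - Suc 0" "TYPE('k)" kind_pos c
  by unfold_locales (auto simp: kind_pos_def)

sublocale KN: kinded_shift_operators "a - Suc 0" "TYPE('k)" kind_neg c
  by unfold_locales (auto simp: kind_neg_def)

text \<open>It commutes with \<open>u\<close> and \<open>v\<close>, so a solution found among all
  functions can be brought back into \<open>E\<close>.\<close>

definition trunc :: "'k coeffs \<Rightarrow> 'k coeffs" where
  "trunc f = (\<lambda>(m, n). if m \<in> box \<and> n \<in> box then f (m, n) else 0)"

text \<open>In each variable the box is the first block, and a shift within blocks neither enters
  nor leaves it.\<close>

lemma box_shift:
  assumes i: "i \<in> {1..c}" and l: "l \<le> m i mod a"
  shows "m(i := m i - l) \<in> box \<longleftrightarrow> m \<in> box"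
proof
  assume "m(i := m i - l) \<in> box"
  then have in_box: "if j \<in> {1..c} then (m(i := m i - l)) j < a else (m(i := m i - l)) j = 0" for j
    unfolding box_def by blast
  have "m i - l < a" using in_box[of i] i by simp
  have mi: "m i < a"
  proof (rule ccontr)
    assume "\<not> m i < a"
    then have "m i div a \<ge> 1" using a_ge div_le_mono[of a "m i" a] by simp
    then have "a * (m i div a) \<ge> a" by simp
    then have "m i \<ge> a + m i mod a" using mult_div_mod_eq[of a "m i"] by linarith
    then show False using l \<open>m i - l < a\<close> by linarith
  qed
  have "if j \<in> {1..c} then m j < a else m j = 0" for j
    using in_box[of j] mi i by (cases "j = i"; cases "j \<in> {1..c}") auto
  then show "m \<in> box" unfolding box_def by blast
qed (erule box_le, simp)

lemma trunc_XX: "i \<in> {1..c} \<Longrightarrow> trunc (SO.XX i l f) = SO.XX i l (trunc f)"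
  and trunc_YY: "i \<in> {1..c} \<Longrightarrow> trunc (SO.YY i l f) = SO.YY i l (trunc f)"
  using box_shift by (auto simp: trunc_def SO.XX_def SO.YY_def fun_eq_iff)

lemma trunc_add: "trunc (f + g) = trunc f + trunc g"
  and trunc_minus: "trunc (- f) = - trunc f"
  and trunc_0: "trunc 0 = 0"
  by (auto simp: trunc_def fun_eq_iff plus_fun_apply uminus_apply zero_fun_apply)

lemma trunc_diff: "trunc (f - g) = trunc f - trunc g"
  using trunc_add[of f "- g"] by (simp add: trunc_minus)

lemma trunc_sum: "trunc (\<Sum>j\<in>J. f j) = (\<Sum>j\<in>J. trunc (f j))"
  by (induction J rule: infinite_finite_induct) (simp_all add: trunc_add trunc_0)

lemma trunc_u: "i \<in> {1..c} \<Longrightarrow> trunc (SO.u i f) = SO.u i (trunc f)"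
  and trunc_v: "i \<in> {1..c} \<Longrightarrow> trunc (SO.v i f) = SO.v i (trunc f)"
  by (simp_all add: SO.u_def SO.v_def trunc_diff trunc_sum trunc_XX trunc_YY)

lemma trunc_vprod: "n \<le> c \<Longrightarrow> trunc (SO.vprod n f) = SO.vprod n (trunc f)"
  by (induction n) (simp_all add: trunc_v)

lemma trunc_Phi: "C \<in> carrier E \<Longrightarrow> trunc (Phi C) = Phi C"
  using Phi_outside by (auto simp: trunc_def fun_eq_iff)

lemma Phi_Psi_trunc: "Phi (Psi (trunc f)) = trunc f"
  by (rule Phi_Psi) (auto simp: trunc_def)

end

section \<open>The elements u, v and N of the enveloping algebra\<close>

context env_algebra
begin

definition ux :: "nat \<Rightarrow> 'k mpoly set env" where "ux i = tt (var i) \<one>\<^bsub>A\<^esub>"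
definition uy :: "nat \<Rightarrow> 'k mpoly set env" where "uy i = tt \<one>\<^bsub>A\<^esub> (var i)"

definition U :: "nat \<Rightarrow> 'k mpoly set env" where "U i = ux i \<ominus>\<^bsub>E\<^esub> uy i"
definition V :: "nat \<Rightarrow> 'k mpoly set env" where
  "V i = (\<Oplus>\<^bsub>E\<^esub>k\<in>{..<a}. ux i [^]\<^bsub>E\<^esub> k \<otimes>\<^bsub>E\<^esub> uy i [^]\<^bsub>E\<^esub> (a - Suc 0 - k))"

fun NN :: "nat \<Rightarrow> 'k mpoly set env" where
  "NN 0 = \<one>\<^bsub>E\<^esub>" | "NN (Suc n) = V (Suc n) \<otimes>\<^bsub>E\<^esub> NN n"

interpretation E: cring E by (rule E_cring)
interpretation A: cring A by (rule A_cring)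

lemma uxy_closed: "i \<in> {1..c} \<Longrightarrow> ux i \<in> carrier E" "i \<in> {1..c} \<Longrightarrow> uy i \<in> carrier E"
  using var_closed by (auto simp: ux_def uy_def)

lemma U_closed: "i \<in> {1..c} \<Longrightarrow> U i \<in> carrier E" and V_closed: "i \<in> {1..c} \<Longrightarrow> V i \<in> carrier E"
  using uxy_closed by (auto simp: U_def V_def intro!: E.finsum_closed)

lemma NN_closed: "n \<le> c \<Longrightarrow> NN n \<in> carrier E"
  by (induction n) (auto simp: V_closed)

lemma Phi_E_finsum:
  assumes "h \<in> S \<rightarrow> carrier E"
  shows "Phi (finsum E h S) = (\<Sum>j\<in>S. Phi (h j))"
  using assms by (induction S rule: infinite_finite_induct) (simp_all add: Phi_zero Phi_add Pi_def)

lemma Phi_minus: "C \<in> carrier E \<Longrightarrow> Phi (\<ominus>\<^bsub>E\<^esub> C) = - Phi C"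
  using Phi_add[of "\<ominus>\<^bsub>E\<^esub> C" C] by (simp add: E.l_neg Phi_zero eq_neg_iff_add_eq_0)

lemma Phi_ux:
  assumes i: "i \<in> {1..c}" and C: "C \<in> carrier E"
  shows "Phi (ux i \<otimes>\<^bsub>E\<^esub> C) = SO.XX i (Suc 0) (Phi C)"
  using C
proof (induction rule: E_induct)
  case zero
  then show ?case using uxy_closed[OF i] by (simp add: Phi_zero SO.additive)
next
  case (tens x y D)
  have "ux i \<otimes>\<^bsub>E\<^esub> tt x y = tt (var i \<star> x) y"
    using tens var_closed[OF i] by (simp add: ux_def E_mult_tt)
  then have "Phi (ux i \<otimes>\<^bsub>E\<^esub> tt x y) = SO.XX i (Suc 0) (Phi (tt x y))"
    using tens i by (auto simp: SO.XX_def fun_eq_iff Phi_tt co_var_mult_mod)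
  then show ?case using tens uxy_closed[OF i] by (simp add: E.r_distr Phi_add SO.additive)
qed

lemma Phi_uy:
  assumes i: "i \<in> {1..c}" and C: "C \<in> carrier E"
  shows "Phi (uy i \<otimes>\<^bsub>E\<^esub> C) = SO.YY i (Suc 0) (Phi C)"
  using C
proof (induction rule: E_induct)
  case zero
  then show ?case using uxy_closed[OF i] by (simp add: Phi_zero SO.additive)
next
  case (tens x y D)
  have "uy i \<otimes>\<^bsub>E\<^esub> tt x y = tt x (var i \<star> y)"
    using tens var_closed[OF i] by (simp add: uy_def E_mult_tt)
  then have "Phi (uy i \<otimes>\<^bsub>E\<^esub> tt x y) = SO.YY i (Suc 0) (Phi (tt x y))"
    using tens i by (auto simp: SO.YY_def fun_eq_iff Phi_tt co_var_mult_mod)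
  then show ?case using tens uxy_closed[OF i] by (simp add: E.r_distr Phi_add SO.additive)
qed

lemma Phi_U: "i \<in> {1..c} \<Longrightarrow> C \<in> carrier E \<Longrightarrow> Phi (U i \<otimes>\<^bsub>E\<^esub> C) = SO.u i (Phi C)"
  using uxy_closed[of i]
  by (simp add: U_def E.minus_eq E.l_distr E.l_minus Phi_add Phi_minus Phi_ux Phi_uy SO.u_def)

lemma Phi_ux_pow: "i \<in> {1..c} \<Longrightarrow> C \<in> carrier E \<Longrightarrow> Phi (ux i [^]\<^bsub>E\<^esub> (k::nat) \<otimes>\<^bsub>E\<^esub> C) = SO.XX i k (Phi C)"
proof (induction k arbitrary: C)
  case (Suc k)
  then show ?case using uxy_closed[of i] by (simp add: E.m_assoc Phi_ux SO.XX_Suc')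
qed simp

lemma Phi_uy_pow: "i \<in> {1..c} \<Longrightarrow> C \<in> carrier E \<Longrightarrow> Phi (uy i [^]\<^bsub>E\<^esub> (k::nat) \<otimes>\<^bsub>E\<^esub> C) = SO.YY i k (Phi C)"
proof (induction k arbitrary: C)
  case (Suc k)
  then show ?case using uxy_closed[of i] by (simp add: E.m_assoc Phi_uy SO.YY_Suc')
qed simp

lemma Phi_V: "i \<in> {1..c} \<Longrightarrow> C \<in> carrier E \<Longrightarrow> Phi (V i \<otimes>\<^bsub>E\<^esub> C) = SO.v i (Phi C)"
proof -
  assume i: "i \<in> {1..c}" and C: "C \<in> carrier E"
  note uc = uxy_closed[OF i]
  have VC: "V i \<otimes>\<^bsub>E\<^esub> C = (\<Oplus>\<^bsub>E\<^esub>k\<in>{..<a}. (ux i [^]\<^bsub>E\<^esub> k \<otimes>\<^bsub>E\<^esub> uy i [^]\<^bsub>E\<^esub> (a - Suc 0 - k)) \<otimes>\<^bsub>E\<^esub> C)"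
    unfolding V_def using uc C by (intro E.finsum_ldistr) auto
  have "Phi (V i \<otimes>\<^bsub>E\<^esub> C) = (\<Sum>k\<in>{..<a}. Phi ((ux i [^]\<^bsub>E\<^esub> k \<otimes>\<^bsub>E\<^esub> uy i [^]\<^bsub>E\<^esub> (a - Suc 0 - k)) \<otimes>\<^bsub>E\<^esub> C))"
    unfolding VC using uc C by (intro Phi_E_finsum) auto
  also have "\<dots> = (\<Sum>k\<in>{..<a}. SO.XX i k (SO.YY i (a - Suc 0 - k) (Phi C)))"
    using uc C i by (intro sum.cong refl) (simp add: E.m_assoc Phi_ux_pow Phi_uy_pow)
  finally show ?thesis by (simp add: SO.v_def)
qed

lemma Phi_NN: "n \<le> c \<Longrightarrow> C \<in> carrier E \<Longrightarrow> Phi (NN n \<otimes>\<^bsub>E\<^esub> C) = SO.vprod n (Phi C)"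
proof (induction n)
  case (Suc n)
  then show ?case using NN_closed[of n] V_closed[of "Suc n"] by (simp add: E.m_assoc Phi_V)
qed simp

end

section \<open>The complete resolution of the truncated polynomial algebra\<close>

locale ci_setup = env_algebra c a A
  for c a :: nat and A :: "('k::field, 'k mpoly set) module" +
  assumes c_ge: "c \<ge> 1"
begin

interpretation E: cring E by (rule E_cring)
interpretation A: cring A by (rule A_cring)

definition kind :: "int \<Rightarrow> int \<Rightarrow> nat" where
  "kind i = (if i > 0 then kind_pos else kind_neg)"

definition wE :: "nat \<Rightarrow> nat \<Rightarrow> 'k mpoly set env" where
  "wE d j = (if d = 1 then U (Suc j) else if d = 2 then V (Suc j) else \<zero>\<^bsub>E\<^esub>)"

definition WtE :: "nat \<Rightarrow> nat \<Rightarrow> 'k coeffs \<Rightarrow> 'k coeffs" where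
  "WtE d j f = (if d = 1 then SO.u (Suc j) f else if d = 2 then SO.v (Suc j) f else 0)"

text \<open>
  Both halves of the complex begin with a single point: degree 0 and degree -1 are joined by \<open>N\<close>,
  and the coordinate sum in a negative degree \<open>i\<close> is \<open>i + 1\<close>.
\<close>

definition lattice :: "int \<Rightarrow> (nat \<Rightarrow> int) set" where
  "lattice i = {\<nu>. (\<forall>j\<ge>c. \<nu> j = 0) \<and> (if i \<ge> 0 then (\<forall>j. \<nu> j \<ge> 0) \<and> (\<Sum>j<c. \<nu> j) = i
     else (\<forall>j. \<nu> j \<le> 0) \<and> (\<Sum>j<c. \<nu> j) = i + 1)}"

text \<open>The splice joins the origin in degree 0 to the origin in degree -1, so it moves no
  coordinate.\<close>

definition target :: "int \<Rightarrow> (nat \<Rightarrow> int) \<Rightarrow> nat \<Rightarrow> nat \<Rightarrow> int" where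
  "target i \<nu> j = (if i = 0 then \<nu> else \<nu>(j := \<nu> j + 1))"

text \<open>In degree 0 the sum over the directions must yield \<open>N\<close> exactly once, so
  \<open>N\<close> is placed in direction 0, which exists as \<open>c\<close> is positive. Elsewhere
  the sign is that of \<open>pdiff\<close>.\<close>

definition coef :: "int \<Rightarrow> (nat \<Rightarrow> int) \<Rightarrow> nat \<Rightarrow> 'k mpoly set env" where
  "coef i \<nu> j = (if i = 0 then (if j = 0 then NN c else \<zero>\<^bsub>E\<^esub>)
     else if even (\<Sum>l<j. \<nu> l) then wE (kind i (\<nu> j)) j else \<ominus>\<^bsub>E\<^esub> wE (kind i (\<nu> j)) j)"

lemma wE_closed: "j < c \<Longrightarrow> wE d j \<in> carrier E"
  using U_closed[of "Suc j"] V_closed[of "Suc j"] by (auto simp: wE_def)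

lemma coef_closed: "j < c \<Longrightarrow> coef i \<nu> j \<in> carrier E"
  using wE_closed NN_closed by (auto simp: coef_def)

sublocale MC: matrix_complex E lattice "{..<c}" coef target
  by unfold_locales (auto simp: E_cring coef_closed)

abbreviation "zero_index \<equiv> (\<lambda>_. 0) :: nat \<Rightarrow> int"

lemma lattice_0: "lattice 0 = {zero_index}"
proof -
  have "\<nu> j = 0" if "\<nu> \<in> lattice 0" for \<nu> j
  proof (cases "j < c")
    case True
    have "(\<Sum>j<c. \<nu> j) = 0" "\<forall>j. \<nu> j \<ge> 0" using that by (auto simp: lattice_def)
    then show ?thesis using True sum_nonneg_eq_0_iff[of "{..<c}" \<nu>] by auto
  qed (use that in \<open>auto simp: lattice_def\<close>)
  then show ?thesis by (auto simp: fun_eq_iff) (auto simp: lattice_def)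
qed

text \<open>The offset i + 1 in negative degrees is what lets negation exchange the degrees i and
  -1-i.\<close>

lemma lattice_neg: "\<nu> \<in> lattice (- 1 - i) \<longleftrightarrow> (\<lambda>j. - \<nu> j) \<in> lattice i"
  by (auto simp: lattice_def sum_negf)

lemma lattice_m1: "lattice (- 1) = {zero_index}"
  using lattice_neg[of _ 0] by (auto simp: lattice_0 fun_eq_iff)

lemma sum_upd: "j < c \<Longrightarrow> (\<Sum>l<c. (\<nu>(j := x)) l) = (\<Sum>l<c. \<nu> l) - \<nu> j + (x :: int)"
proof -
  assume j: "j < c"
  have "(\<Sum>l<c. \<mu> l) = \<mu> j + (\<Sum>l\<in>{..<c} - {j}. \<mu> l)" for \<mu> :: "nat \<Rightarrow> int"
    using j by (intro sum.remove) auto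
  from this[of \<nu>] this[of "\<nu>(j := x)"] show ?thesis by simp
qed

text \<open>A nonzero differential of either half does not cross the coordinate 0, so a step along
  it stays in that half and changes the degree by one.\<close>

lemma lattice_step:
  assumes i: "i \<noteq> 0" and j: "j < c" and k: "kind i (\<nu> j) \<noteq> 0"
  shows "\<nu>(j := \<nu> j + 1) \<in> lattice i \<longleftrightarrow> \<nu> \<in> lattice (i - 1)"
proof -
  have sum: "(\<Sum>l<c. (\<nu>(j := \<nu> j + 1)) l) = (\<Sum>l<c. \<nu> l) + 1" using sum_upd[OF j] by simp
  show ?thesis
  proof (cases "i > 0")
    case True
    then have "\<nu> j \<ge> 0" using k by (auto simp: kind_def kind_pos_def split: if_splits)
    then have "(\<nu>(j := \<nu> j + 1)) l \<ge> 0 \<longleftrightarrow> \<nu> l \<ge> 0" for l by (cases "l = j") auto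
    moreover have "(\<forall>l\<ge>c. (\<nu>(j := \<nu> j + 1)) l = 0) \<longleftrightarrow> (\<forall>l\<ge>c. \<nu> l = 0)" using j by auto
    moreover have "(\<Sum>l<c. \<nu> l) + 1 = i \<longleftrightarrow> (\<Sum>l<c. \<nu> l) = i - 1" by linarith
    ultimately show ?thesis using True sum unfolding lattice_def by (simp del: fun_upd_apply)
  next
    case False
    then have "\<nu> j < 0" using k by (auto simp: kind_def kind_neg_def split: if_splits)
    then have "(\<nu>(j := \<nu> j + 1)) l \<le> 0 \<longleftrightarrow> \<nu> l \<le> 0" for l by (cases "l = j") auto
    moreover have "(\<forall>l\<ge>c. (\<nu>(j := \<nu> j + 1)) l = 0) \<longleftrightarrow> (\<forall>l\<ge>c. \<nu> l = 0)" using j by auto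
    ultimately show ?thesis using False i sum unfolding lattice_def by (simp del: fun_upd_apply)
  qed
qed

text \<open>Used twice, for \<open>Phi\<close> on \<open>E\<close> and for \<open>co\<close> on
  \<open>A\<close>: away from the splice the matrix differential is the total differential of a
  multigraded complex of coefficient functions.\<close>

lemma mdiff_coordinates:
  fixes \<kappa> :: "'b \<Rightarrow> 'g::ab_group_add"
  assumes M: "Module.module E M" and add: "\<And>x y. x \<in> carrier M \<Longrightarrow> y \<in> carrier M \<Longrightarrow> \<kappa> (x \<oplus>\<^bsub>M\<^esub> y) = \<kappa> x + \<kappa> y"
    and act: "\<And>d j x. j < c \<Longrightarrow> x \<in> carrier M \<Longrightarrow> \<kappa> (wE d j \<odot>\<^bsub>M\<^esub> x) = Wt d j (\<kappa> x)"
    and mc: "multi_complex (\<lambda>j l. Wt (kind i l) j) H"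
    and i: "i \<noteq> 0" and z: "z \<in> carrier (MC.chains M i)"
  shows "(\<lambda>\<nu>. \<kappa> (MC.mdiff M i z \<nu>)) = multi_complex.tdiff (\<lambda>j l. Wt (kind i l) j) c (\<lambda>\<nu>. \<kappa> (z \<nu>))"
proof
  fix \<nu>
  interpret M: Module.module E M by fact
  interpret X: multi_complex c "\<lambda>j l. Wt (kind i l) j" H by fact
  have zc: "z \<mu> \<in> carrier M" for \<mu> by (rule MC.chains_closed[OF M z])
  have k0: "\<kappa> \<zero>\<^bsub>M\<^esub> = 0" using add[of "\<zero>\<^bsub>M\<^esub>" "\<zero>\<^bsub>M\<^esub>"] by simp
  have km: "\<kappa> (\<ominus>\<^bsub>M\<^esub> x) = - \<kappa> x" if "x \<in> carrier M" for x
    using add[of "\<ominus>\<^bsub>M\<^esub> x" x] that by (simp add: M.l_neg k0 eq_neg_iff_add_eq_0)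
  have ksum: "\<kappa> (finsum M f S) = (\<Sum>j\<in>S. \<kappa> (f j))" if "f \<in> S \<rightarrow> carrier M" for f and S :: "nat set"
    using that by (induction S rule: infinite_finite_induct) (simp_all add: k0 add Pi_def)
  have w: "wE d j \<odot>\<^bsub>M\<^esub> x \<in> carrier M" if "j < c" "x \<in> carrier M" for d j x using that wE_closed by simp
  have W0: "Wt d j 0 = 0" if "j < c" for d j
    using act[OF that, of "\<zero>\<^bsub>M\<^esub>" d] wE_closed[OF that] by (simp add: k0)
  have W00: "Wt 0 j (\<kappa> x) = 0" if "j < c" "x \<in> carrier M" for j x
    using act[OF that, of 0] that by (simp add: wE_def k0)
  show "\<kappa> (MC.mdiff M i z \<nu>) = X.tdiff c (\<lambda>\<nu>. \<kappa> (z \<nu>)) \<nu>"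
  proof (cases "\<nu> \<in> lattice (i - 1)")
    case True
    have "\<kappa> (coef i \<nu> j \<odot>\<^bsub>M\<^esub> x) = parity_sign (\<Sum>l<j. \<nu> l) (Wt (kind i (\<nu> j)) j (\<kappa> x))" if "j < c" "x \<in> carrier M" for j x
      using that i wE_closed[of j] w[of j x] by (simp add: coef_def parity_sign_def act M.smult_l_minus km)
    then have "(\<Sum>j<c. \<kappa> (coef i \<nu> j \<odot>\<^bsub>M\<^esub> z (target i \<nu> j))) = X.tdiff c (\<lambda>\<nu>. \<kappa> (z \<nu>)) \<nu>"
      using zc i by (auto simp: X.tdiff_def X.pdiff_def X.prefix_def target_def intro!: sum.cong)
    then show ?thesis using True zc coef_closed by (simp add: MC.mdiff_def ksum Pi_def)
  next
    case False
    \<comment> \<open>Off the lattice the total differential vanishes too: either the kind is 0 or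
      the point stepped to is off the lattice.\<close>
    have "X.pdiff j (\<lambda>\<nu>. \<kappa> (z \<nu>)) \<nu> = 0" if j: "j < c" for j
    proof (cases "kind i (\<nu> j) = 0")
      case True
      then show ?thesis using W00[OF j zc] by (simp add: X.pdiff_def)
    next
      case kn: False
      have "z (\<nu>(j := \<nu> j + 1)) = \<zero>\<^bsub>M\<^esub>" using z False lattice_step[where \<nu> = \<nu> and j = j, OF i j kn] by (simp add: MC.chains_iff)
      then show ?thesis by (simp add: X.pdiff_def k0 W0[OF j])
    qed
    then show ?thesis using False by (simp add: MC.mdiff_def k0 X.tdiff_def)
  qed
qed

abbreviation "RE \<equiv> regular_module E"

lemma RE: "Module.module E RE" by (rule regular_module_module[OF E_cring])

lemma Phi_wE: "j < c \<Longrightarrow> x \<in> carrier E \<Longrightarrow> Phi (wE d j \<otimes>\<^bsub>E\<^esub> x) = WtE d j (Phi x)"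
  by (simp add: wE_def WtE_def Phi_U Phi_V Phi_zero)

lemma kinded_kind: "kinded_shift_operators (kind i)"
  by (simp add: kind_def KP.kinded_shift_operators_axioms KN.kinded_shift_operators_axioms)

lemma Phi_mdiff:
  assumes i: "i \<noteq> 0" and z: "z \<in> carrier (MC.chains RE i)"
  shows "(\<lambda>\<nu>. Phi (MC.mdiff RE i z \<nu>)) = multi_complex.tdiff (\<lambda>j l. WtE (kind i l) j) c (\<lambda>\<nu>. Phi (z \<nu>))"
proof -
  interpret K: kinded_shift_operators "a - Suc 0" "TYPE('k)" "kind i" c by (rule kinded_kind)
  have W: "K.W = (\<lambda>j l. WtE (kind i l) j)" by (intro ext) (simp add: K.W_def WtE_def)
  have mc: "multi_complex (\<lambda>j l. WtE (kind i l) j) K.H" using K.M.multi_complex_axioms by (simp add: W)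
  show ?thesis
    by (rule mdiff_coordinates[OF RE _ _ mc i z]) (simp_all add: Phi_add Phi_wE)
qed

text \<open>The solution \<open>Y\<close> may be nonzero off the lattice and off the box. At lattice
  points the differential reads lattice points only, and it commutes with \<open>trunc\<close>, so
  cutting \<open>Y\<close> down to both gives a solution over \<open>E\<close>.\<close>

lemma mdiff_lift:
  assumes i: "i \<noteq> 0" and z: "z \<in> carrier (MC.chains RE (i - 1))"
    and Y: "\<And>\<nu>. \<nu> \<in> lattice (i - 1) \<Longrightarrow> multi_complex.tdiff (\<lambda>j l. WtE (kind i l) j) c Y \<nu> = Phi (z \<nu>)"
  shows "\<exists>y\<in>carrier (MC.chains RE i). MC.mdiff RE i y = z"
proof -
  interpret K: kinded_shift_operators "a - Suc 0" "TYPE('k)" "kind i" c by (rule kinded_kind)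
  have W: "K.W = (\<lambda>j l. WtE (kind i l) j)" by (intro ext) (simp add: K.W_def WtE_def)
  define y where "y \<nu> = (if \<nu> \<in> lattice i then Psi (trunc (Y \<nu>)) else \<zero>\<^bsub>E\<^esub>)" for \<nu>
  have y: "y \<in> carrier (MC.chains RE i)" by (auto simp: MC.chains_iff y_def Psi_closed)
  have "MC.mdiff RE i y \<nu> = z \<nu>" for \<nu>
  proof (cases "\<nu> \<in> lattice (i - 1)")
    case True
    have pd: "K.M.pdiff j (\<lambda>\<nu>. Phi (y \<nu>)) \<nu> = trunc (K.M.pdiff j Y \<nu>)" if j: "j < c" for j
    proof (cases "kind i (\<nu> j) = 0")
      case True
      then show ?thesis by (simp add: K.M.pdiff_def K.W_def trunc_0)
    next
      case False
      then have "\<nu>(j := \<nu> j + 1) \<in> lattice i" using lattice_step[where \<nu> = \<nu> and j = j, OF i j False] True by simp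
      then have "Phi (y (\<nu>(j := \<nu> j + 1))) = trunc (Y (\<nu>(j := \<nu> j + 1)))" by (simp add: y_def Phi_Psi_trunc)
      then show ?thesis using j
        by (simp add: K.M.pdiff_def K.W_def parity_sign_def trunc_minus trunc_u trunc_v trunc_0)
    qed
    have "Phi (MC.mdiff RE i y \<nu>) = K.M.tdiff c (\<lambda>\<nu>. Phi (y \<nu>)) \<nu>"
      using fun_cong[OF Phi_mdiff[OF i y], of \<nu>] by (simp only: W)
    also have "\<dots> = trunc (K.M.tdiff c Y \<nu>)"
      unfolding K.M.tdiff_def trunc_sum by (rule sum.cong) (simp_all add: pd)
    also have "\<dots> = Phi (z \<nu>)"
      using Y[OF True] trunc_Phi MC.chains_closed[OF RE z, of \<nu>] by (simp add: W)
    finally show ?thesis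
      using MC.chains_closed[OF RE z, of \<nu>] MC.chains_closed[OF RE module_homD(1)[OF MC.mdiff_hom[OF RE] y], of \<nu>]
      by (intro Phi_inj) simp_all
  next
    case False
    then show ?thesis using z by (simp add: MC.mdiff_def MC.chains_iff)
  qed
  then show ?thesis using y by auto
qed

lemma mdiff_0: "z \<in> carrier (MC.chains M 0) \<Longrightarrow> Module.module E M \<Longrightarrow> MC.mdiff M 0 z zero_index = NN c \<odot>\<^bsub>M\<^esub> z zero_index"
proof -
  assume z: "z \<in> carrier (MC.chains M 0)" and M: "Module.module E M"
  interpret M: Module.module E M by fact
  have zc: "z zero_index \<in> carrier M" by (rule MC.chains_closed[OF M z])
  have N: "NN c \<in> carrier E" by (simp add: NN_closed)
  have "(\<Oplus>\<^bsub>M\<^esub>j\<in>{..<c}. coef 0 zero_index j \<odot>\<^bsub>M\<^esub> z zero_index) = (\<Oplus>\<^bsub>M\<^esub>j\<in>{..<c}. if 0 = j then NN c \<odot>\<^bsub>M\<^esub> z zero_index else \<zero>\<^bsub>M\<^esub>)"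
    using zc N by (intro M.finsum_cong') (auto simp: coef_def)
  also have "\<dots> = NN c \<odot>\<^bsub>M\<^esub> z zero_index"
    using zc N c_ge by (intro M.finsum_singleton) auto
  finally show ?thesis by (simp add: MC.mdiff_def target_def lattice_m1)
qed

lemma mdiff_0': "\<nu> \<noteq> zero_index \<Longrightarrow> MC.mdiff M 0 z \<nu> = \<zero>\<^bsub>M\<^esub>"
  by (simp add: MC.mdiff_def lattice_m1)

lemma vprod_add: "SO.vprod n (f + g) = SO.vprod n f + SO.vprod n g" and vprod_0: "SO.vprod n 0 = 0"
  and vprod_minus: "SO.vprod n (- f) = - SO.vprod n f"
proof -
  show add: "SO.vprod n (f + g) = SO.vprod n f + SO.vprod n g" for f g
    by (induction n) (simp_all add: SO.uv_additive)
  show zero: "SO.vprod n 0 = 0" by (induction n) (simp_all add: KP.op_0)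
  show "SO.vprod n (- f) = - SO.vprod n f"
    using add[of "- f" f] by (simp add: zero eq_neg_iff_add_eq_0)
qed

lemma vprod_sum: "SO.vprod n (\<Sum>j\<in>J. f j) = (\<Sum>j\<in>J. SO.vprod n (f j))"
  by (induction J rule: infinite_finite_induct) (simp_all add: vprod_add vprod_0)

lemma chain_eqI:
  assumes "x \<in> carrier (MC.chains RE i)" "y \<in> carrier (MC.chains RE i)" "\<And>\<nu>. Phi (x \<nu>) = Phi (y \<nu>)"
  shows "x = y"
  using MC.chains_closed[OF RE assms(1)] MC.chains_closed[OF RE assms(2)] assms(3) by (intro ext Phi_inj) simp_all

lemma mdiff_closed: "z \<in> carrier (MC.chains RE i) \<Longrightarrow> MC.mdiff RE i z \<in> carrier (MC.chains RE (i - 1))"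
  by (rule module_homD(1)[OF MC.mdiff_hom[OF RE]])

lemma mdiff_mdiff:
  assumes y: "y \<in> carrier (MC.chains RE (i + 1))"
  shows "MC.mdiff RE i (MC.mdiff RE (i + 1) y) = (\<lambda>_. \<zero>\<^bsub>E\<^esub>)"
proof -
  define z where "z = MC.mdiff RE (i + 1) y"
  have z: "z \<in> carrier (MC.chains RE i)" using mdiff_closed[OF y] by (simp add: z_def)
  have zero: "(\<lambda>_. \<zero>\<^bsub>E\<^esub>) \<in> carrier (MC.chains RE (i - 1))" by (simp add: MC.chains_iff)
  have "Phi (MC.mdiff RE i z \<nu>) = 0" for \<nu>
  proof -
    \<comment> \<open>At the splice the composites are \<open>N\<close> times a sum of multiples of
      the \<open>u\<close>, and the \<open>u\<close> times \<open>N\<close>; both vanish since u v =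
      0 in each variable. Elsewhere both differentials lie in the same half.\<close>
    consider "i = 0" | "i = - 1" | "i \<noteq> 0" "i + 1 \<noteq> 0" "kind i = kind (i + 1)"
      by (fastforce simp: kind_def)
    then show ?thesis
    proof cases
      case 1
      have zc: "z zero_index \<in> carrier E" using MC.chains_closed[OF RE z] by simp
      interpret K: kinded_shift_operators "a - Suc 0" "TYPE('k)" "kind 1" c by (rule kinded_kind)
      have W: "K.W = (\<lambda>j l. WtE (kind 1 l) j)" by (intro ext) (simp add: K.W_def WtE_def)
      have k0: "kind 1 0 = 1" by (simp add: kind_def kind_pos_def)
      have "Phi (z zero_index) = K.M.tdiff c (\<lambda>\<nu>. Phi (y \<nu>)) zero_index"
        using fun_cong[OF Phi_mdiff[OF _ y], of zero_index] 1 by (simp add: z_def W)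
      also have "\<dots> = (\<Sum>j<c. SO.u (Suc j) (Phi (y (zero_index(j := 1)))))"
        by (simp add: K.M.tdiff_def K.M.pdiff_def K.M.prefix_def parity_sign_def K.W_def k0)
      finally have "SO.vprod c (Phi (z zero_index)) = (\<Sum>j<c. SO.vprod c (SO.u (Suc j) (Phi (y (zero_index(j := 1))))))"
        by (simp add: vprod_sum)
      also have "\<dots> = 0" by (rule sum.neutral) (auto simp: SO.vprod_u)
      finally have "Phi (NN c \<otimes>\<^bsub>E\<^esub> z zero_index) = 0" using zc by (simp add: Phi_NN)
      then show ?thesis using 1 mdiff_0[of z RE] RE z mdiff_0'[of \<nu> RE z] by (cases "\<nu> = zero_index") (auto simp: Phi_zero)
    next
      case 2
      interpret K: kinded_shift_operators "a - Suc 0" "TYPE('k)" "kind (- 1)" c by (rule kinded_kind)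
      have W: "K.W = (\<lambda>j l. WtE (kind (- 1) l) j)" by (intro ext) (simp add: K.W_def WtE_def)
      have y0: "y \<in> carrier (MC.chains RE 0)" using y 2 by simp
      have yc: "y zero_index \<in> carrier E" using MC.chains_closed[OF RE y] by simp
      have zz: "Phi (z \<nu>) = (if \<nu> = zero_index then SO.vprod c (Phi (y zero_index)) else 0)" for \<nu>
        using 2 mdiff_0[OF y0 RE] mdiff_0'[of \<nu> RE y] yc by (auto simp: z_def Phi_NN Phi_zero)
      have "K.M.pdiff j (\<lambda>\<nu>. Phi (z \<nu>)) \<nu> = 0" if j: "j < c" for j
      proof (cases "\<nu>(j := \<nu> j + 1) = zero_index")
        case True
        have "kind (- 1) (\<nu> j) = 1" using fun_cong[OF True, of j] by (simp add: kind_def kind_neg_def eq_neg_iff_add_eq_0[symmetric])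
        then have "K.W j (\<nu> j) (SO.vprod c (Phi (y zero_index))) = 0" using SO.u_vprod[of "Suc j" c] j by (simp add: K.W_def)
        then show ?thesis by (simp only: K.M.pdiff_def zz True) simp
      qed (simp add: K.M.pdiff_def zz K.M.W_0)
      then show ?thesis using fun_cong[OF Phi_mdiff[OF _ z], of \<nu>] 2 by (simp add: W[symmetric] K.M.tdiff_def)
    next
      case 3
      interpret K: kinded_shift_operators "a - Suc 0" "TYPE('k)" "kind i" c by (rule kinded_kind)
      have W: "K.W = (\<lambda>j l. WtE (kind i l) j)" by (intro ext) (simp add: K.W_def WtE_def)
      have e1: "(\<lambda>\<nu>. Phi (MC.mdiff RE i z \<nu>)) = K.M.tdiff c (\<lambda>\<nu>. Phi (z \<nu>))"
        using Phi_mdiff[OF 3(1) z] by (simp only: W)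
      have e2: "(\<lambda>\<nu>. Phi (z \<nu>)) = K.M.tdiff c (\<lambda>\<nu>. Phi (y \<nu>))"
        using Phi_mdiff[OF 3(2) y] by (simp only: z_def W 3(3)[symmetric])
      show ?thesis using fun_cong[OF e1, of \<nu>] by (simp only: e2 K.M.tdiff_tdiff)
    qed
  qed
  then show ?thesis
    using chain_eqI[OF mdiff_closed[OF z] zero] by (simp add: z_def Phi_zero)
qed

text \<open>Exactness is tested in coordinates with the homotopies of one half. A cycle is a
  boundary up to its iterated projection, which vanishes away from the origin; at the origin
  \<open>N\<close> accounts for it.\<close>

lemma mdiff_exact:
  assumes z: "z \<in> carrier (MC.chains RE i)" and dz: "MC.mdiff RE i z = (\<lambda>_. \<zero>\<^bsub>E\<^esub>)"
  shows "\<exists>y\<in>carrier (MC.chains RE (i + 1)). MC.mdiff RE (i + 1) y = z"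
proof -
  have zc: "z \<nu> \<in> carrier E" for \<nu> using MC.chains_closed[OF RE z] by simp
  have out: "\<nu> \<notin> lattice i \<Longrightarrow> z \<nu> = \<zero>\<^bsub>E\<^esub>" for \<nu> using z by (simp add: MC.chains_iff)
  \<comment> \<open>A degree standing for the half in which the chain lives. It must not be
    \<open>i\<close> itself in degree 0: the chain belongs to the positive half there, although its
    own differential is the splice.\<close>
  define k :: int where "k = (if i \<ge> 0 then 1 else - 1)"
  have kpos: "kind k = kind_pos" if "i \<ge> 0" using that by (simp add: k_def kind_def)
  have kneg: "kind k = kind_neg" if "i < 0" using that by (simp add: k_def kind_def)
  interpret K: kinded_shift_operators "a - Suc 0" "TYPE('k)" "kind k" c by (rule kinded_kind)
  have W: "K.W = (\<lambda>j l. WtE (kind k l) j)" by (intro ext) (simp add: K.W_def WtE_def)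
  \<comment> \<open>In degree 0 the chain sits at the origin, which no differential of the positive
    half leaves.\<close>
  have cyc: "K.M.tdiff c (\<lambda>\<nu>. Phi (z \<nu>)) = (\<lambda>\<nu>. 0)"
  proof (cases "i = 0")
    case True
    have "K.M.pdiff j (\<lambda>\<nu>. Phi (z \<nu>)) \<nu> = 0" for j \<nu>
    proof (cases "\<nu>(j := \<nu> j + 1) = zero_index")
      case True
      have "\<nu> j < 0" using fun_cong[OF True, of j] by simp
      then have "kind k (\<nu> j) = 0" using kpos \<open>i = 0\<close> by (simp add: kind_pos_def)
      then show ?thesis by (simp add: K.M.pdiff_def K.W_def)
    next
      case False
      then show ?thesis using out[of "\<nu>(j := \<nu> j + 1)"] \<open>i = 0\<close> by (simp add: K.M.pdiff_def lattice_0 Phi_zero K.M.W_0)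
    qed
    then show ?thesis by (simp add: K.M.tdiff_def[abs_def])
  next
    case False
    have k: "kind k = kind i" using False by (simp add: k_def kind_def)
    show ?thesis using Phi_mdiff[OF False z] by (simp only: W k[symmetric] dz Phi_zero)
  qed
  obtain Y where Y: "(\<lambda>\<nu>. Phi (z \<nu>)) = (\<lambda>\<nu>. K.M.tproj c (\<lambda>\<nu>. Phi (z \<nu>)) \<nu> + K.M.tdiff c Y \<nu>)"
    using K.M.cycle_minus_tproj_is_boundary[OF cyc, of c] by auto
  show ?thesis
  proof (cases "i = - 1")
    case True
    \<comment> \<open>In degree -1 no differential of the negative half arrives at the origin, so
      the cycle equals its projection, which is a multiple of \<open>N\<close>.\<close>
    define f where "f = SO.hprod c (Phi (z zero_index))"
    have "K.M.tproj c (\<lambda>\<nu>. Phi (z \<nu>)) zero_index = SO.vprod c f"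
      unfolding f_def using True by (intro K.tproj_high) (simp add: kneg kind_neg_def)
    moreover have "K.M.tdiff c Y zero_index = 0"
    proof -
      have "kind k 0 = 0" using True kneg by (simp add: kind_neg_def)
      then show ?thesis by (simp add: K.M.tdiff_def K.M.pdiff_def K.W_def)
    qed
    ultimately have "Phi (z zero_index) = SO.vprod c f" using fun_cong[OF Y, of zero_index] by simp
    then have vf: "Phi (z zero_index) = SO.vprod c (trunc f)"
      using trunc_Phi[OF zc, of zero_index] by (simp add: trunc_vprod)
    define y where "y \<nu> = (if \<nu> = zero_index then Psi (trunc f) else \<zero>\<^bsub>E\<^esub>)" for \<nu> :: "nat \<Rightarrow> int"
    have y: "y \<in> carrier (MC.chains RE 0)" by (simp add: MC.chains_iff lattice_0 y_def Psi_closed)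
    have "MC.mdiff RE 0 y = z"
    proof (rule chain_eqI)
      show "MC.mdiff RE 0 y \<in> carrier (MC.chains RE i)" using mdiff_closed[OF y] True by simp
      fix \<nu> show "Phi (MC.mdiff RE 0 y \<nu>) = Phi (z \<nu>)"
        using mdiff_0[OF y RE] mdiff_0'[of \<nu> RE y] out[of \<nu>] True vf
        by (cases "\<nu> = zero_index") (simp_all add: y_def Phi_NN Psi_closed Phi_Psi_trunc lattice_m1)
    qed (rule z)
    then show ?thesis using y True by auto
  next
    case False
    \<comment> \<open>In degree 0 the projection factors through multiplication by \<open>N\<close>,
      which kills the cycle. In the remaining degrees some coordinate is nonzero, and that direction
      is contracted.\<close>
    have tp: "K.M.tproj c (\<lambda>\<nu>. Phi (z \<nu>)) \<nu> = 0" if \<nu>: "\<nu> \<in> lattice i" for \<nu>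
    proof (cases "i = 0")
      case True
      have "K.M.tproj c (\<lambda>\<nu>. Phi (z \<nu>)) zero_index = SO.hprod c (SO.vprod c (Phi (z zero_index)))"
        using True by (intro K.tproj_low) (simp add: kpos kind_pos_def)
      moreover have "SO.vprod c (Phi (z zero_index)) = 0"
      proof -
        have "NN c \<otimes>\<^bsub>E\<^esub> z zero_index = \<zero>\<^bsub>E\<^esub>"
          using fun_cong[OF dz, of zero_index] True mdiff_0[of z RE] RE z by simp
        then show ?thesis using Phi_NN[OF order_refl zc, of zero_index] by (simp only: Phi_zero)
      qed
      moreover have "SO.hprod n 0 = 0" for n by (induction n) (simp_all add: SO.additive)
      ultimately show ?thesis using \<nu> True by (simp add: lattice_0)
    next
      case i0: False
      have "(\<Sum>j<c. \<nu> j) \<noteq> 0" using \<nu> i0 False by (auto simp: lattice_def split: if_splits)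
      then obtain j where j: "j < c" "\<nu> j \<noteq> 0" by (meson lessThan_iff sum.neutral)
      have "kind k (\<nu> j) \<noteq> 0 \<and> kind k (\<nu> j - 1) \<noteq> 0"
      proof (cases "i \<ge> 0")
        case True
        then have "\<nu> j \<ge> 0" using \<nu> by (auto simp: lattice_def)
        then show ?thesis using True j(2) by (simp add: kpos kind_pos_def)
      next
        case False
        then have "\<nu> j \<le> 0" using \<nu> by (auto simp: lattice_def)
        then show ?thesis using False j(2) by (simp add: kneg kind_neg_def)
      qed
      then show ?thesis using K.tproj_inner[OF j(1)] by blast
    qed
    have k: "kind (i + 1) = kind k" using False by (simp add: k_def kind_def)
    have "K.M.tdiff c Y \<nu> = Phi (z \<nu>)" if "\<nu> \<in> lattice i" for \<nu>
      using fun_cong[OF Y, of \<nu>] tp[OF that] by simp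
    then have Yz: "multi_complex.tdiff (\<lambda>j l. WtE (kind (i + 1) l) j) c Y \<nu> = Phi (z \<nu>)" if "\<nu> \<in> lattice (i + 1 - 1)" for \<nu>
      using that by (simp only: W[symmetric] k add_diff_cancel_right')
    have "z \<in> carrier (MC.chains RE (i + 1 - 1))" using z by simp
    from mdiff_lift[OF _ this Yz] False show ?thesis by (simp add: add_eq_0_iff2)
  qed
qed

section \<open>The multiplication map and the annihilator of N\<close>

interpretation LA: Module.module E LA by (rule LA_module)

lemma ux_LA: "i \<in> {1..c} \<Longrightarrow> b \<in> carrier A \<Longrightarrow> ux i \<rhd> b = var i \<star> b"
  and uy_LA: "i \<in> {1..c} \<Longrightarrow> b \<in> carrier A \<Longrightarrow> uy i \<rhd> b = var i \<star> b"
  using var_closed[of i] by (simp_all add: ux_def uy_def LA_tt A.m_comm)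

lemma U_LA: "i \<in> {1..c} \<Longrightarrow> b \<in> carrier A \<Longrightarrow> U i \<rhd> b = \<zero>\<^bsub>A\<^esub>"
proof -
  assume i: "i \<in> {1..c}" and b: "b \<in> carrier A"
  note uc = uxy_closed[OF i]
  have "U i \<rhd> b = ux i \<rhd> b \<oplus>\<^bsub>LA\<^esub> \<ominus>\<^bsub>LA\<^esub> (uy i \<rhd> b)"
    using uc b LA.smult_l_distr[of "ux i" "\<ominus>\<^bsub>E\<^esub> uy i" b] LA.smult_l_minus[of "uy i" b]
    by (simp only: U_def E.minus_eq LA_simps E.a_inv_closed)
  also have "\<dots> = \<zero>\<^bsub>LA\<^esub>"
    using LA.r_neg[of "var i \<star> b"] i b var_closed[OF i] by (simp only: ux_LA uy_LA LA_simps A.m_closed)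
  finally show ?thesis by simp
qed

text \<open>The multiplication map from \<open>E\<close> to \<open>A\<close>, whose kernel is the
  annihilator of 1.\<close>

definition rho :: "'k mpoly set env \<Rightarrow> 'k mpoly set" where
  "rho C = C \<rhd> \<one>\<^bsub>A\<^esub>"

lemma rho_hom: "rho \<in> Hom E RE LA"
proof (rule module_homI)
  fix r x assume "r \<in> carrier E" "x \<in> carrier RE"
  then show "rho (r \<odot>\<^bsub>RE\<^esub> x) = r \<rhd> rho x"
    using LA.smult_assoc1[of r x "\<one>\<^bsub>A\<^esub>"] by (simp add: rho_def)
qed (simp_all add: rho_def LA_closed LA_add)

definition at_zero :: "'k mpoly set env \<Rightarrow> (nat \<Rightarrow> int) \<Rightarrow> 'k mpoly set env" where
  "at_zero r \<nu> = (if \<nu> = zero_index then r else \<zero>\<^bsub>E\<^esub>)"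

lemma at_zero_chains: "r \<in> carrier E \<Longrightarrow> at_zero r \<in> carrier (MC.chains RE 0)" "r \<in> carrier E \<Longrightarrow> at_zero r \<in> carrier (MC.chains RE (- 1))"
  by (auto simp: at_zero_def MC.chains_iff lattice_0 lattice_m1)

text \<open>\<open>N\<close> annihilates \<open>u\<close> in each variable, so it does not
  distinguish the two sides.\<close>

lemma NN_same: "i \<in> {1..c} \<Longrightarrow> C \<in> carrier E \<Longrightarrow> NN c \<otimes>\<^bsub>E\<^esub> (ux i \<otimes>\<^bsub>E\<^esub> C) = NN c \<otimes>\<^bsub>E\<^esub> (uy i \<otimes>\<^bsub>E\<^esub> C)"
proof -
  assume i: "i \<in> {1..c}" and C: "C \<in> carrier E"
  have "SO.vprod c (SO.u i (Phi C)) = 0" using i by (intro SO.vprod_u) auto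
  then have "SO.vprod c (SO.XX i (Suc 0) (Phi C)) = SO.vprod c (SO.YY i (Suc 0) (Phi C))"
    using vprod_add[of c "SO.XX i (Suc 0) (Phi C)" "- SO.YY i (Suc 0) (Phi C)"] by (simp add: SO.u_def vprod_minus)
  then show ?thesis
    using i C uxy_closed[OF i] NN_closed[of c] by (intro Phi_inj) (simp_all add: Phi_NN Phi_ux Phi_uy)
qed

text \<open>Variables cross the tensor sign one at a time by \<open>NN_same\<close>, in an induction
  on \<open>y\<close> for all \<open>x\<close> at once.\<close>

lemma NN_tt_right: "x \<in> carrier A \<Longrightarrow> y \<in> carrier A \<Longrightarrow> NN c \<otimes>\<^bsub>E\<^esub> tt x y = NN c \<otimes>\<^bsub>E\<^esub> tt (x \<star> y) \<one>\<^bsub>A\<^esub>"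
proof -
  have N: "NN c \<in> carrier E" by (simp add: NN_closed)
  have "y \<in> carrier A \<Longrightarrow> \<forall>x\<in>carrier A. NN c \<otimes>\<^bsub>E\<^esub> tt x y = NN c \<otimes>\<^bsub>E\<^esub> tt (x \<star> y) \<one>\<^bsub>A\<^esub>"
  proof (induction rule: A_induct)
    case one
    then show ?case by simp
  next
    case (var i y)
    show ?case
    proof
      fix x assume x: "x \<in> carrier A"
      note vc = var_closed[OF var(1)]
      have "NN c \<otimes>\<^bsub>E\<^esub> tt x (var i \<star> y) = NN c \<otimes>\<^bsub>E\<^esub> (uy i \<otimes>\<^bsub>E\<^esub> tt x y)"
        using x var vc by (simp add: uy_def E_mult_tt)
      also have "\<dots> = NN c \<otimes>\<^bsub>E\<^esub> (ux i \<otimes>\<^bsub>E\<^esub> tt x y)"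
        using NN_same[OF var(1), of "tt x y"] x var by simp
      also have "\<dots> = ux i \<otimes>\<^bsub>E\<^esub> (NN c \<otimes>\<^bsub>E\<^esub> tt x y)"
        using x var(2) uxy_closed[OF var(1)] N by (intro E.m_lcomm) simp_all
      also have "\<dots> = ux i \<otimes>\<^bsub>E\<^esub> (NN c \<otimes>\<^bsub>E\<^esub> tt (x \<star> y) \<one>\<^bsub>A\<^esub>)" using var x by simp
      also have "\<dots> = NN c \<otimes>\<^bsub>E\<^esub> (ux i \<otimes>\<^bsub>E\<^esub> tt (x \<star> y) \<one>\<^bsub>A\<^esub>)"
        using x var(2) uxy_closed[OF var(1)] N by (intro E.m_lcomm) simp_all
      also have "ux i \<otimes>\<^bsub>E\<^esub> tt (x \<star> y) \<one>\<^bsub>A\<^esub> = tt (x \<star> (var i \<star> y)) \<one>\<^bsub>A\<^esub>"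
        using x var vc by (simp add: ux_def E_mult_tt A.m_lcomm)
      finally show "NN c \<otimes>\<^bsub>E\<^esub> tt x (var i \<star> y) = NN c \<otimes>\<^bsub>E\<^esub> tt (x \<star> (var i \<star> y)) \<one>\<^bsub>A\<^esub>" .
    qed
  next
    case (axpy r y z)
    show ?case
    proof
      fix x assume x: "x \<in> carrier A"
      have rx: "r \<odot>\<^bsub>A\<^esub> x \<in> carrier A" by (rule A_smult_closed[OF x])
      have ry: "r \<odot>\<^bsub>A\<^esub> y \<in> carrier A" by (rule A_smult_closed[OF axpy(1)])
      have "tt x (r \<odot>\<^bsub>A\<^esub> y \<oplus>\<^bsub>A\<^esub> z) = tt (r \<odot>\<^bsub>A\<^esub> x) y \<oplus>\<^bsub>E\<^esub> tt x z"
        using TP.tens_add_r[of x "r \<odot>\<^bsub>A\<^esub> y" z] TP.tens_balanced[of r x y] x ry axpy by (simp add: E_simps)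
      moreover have "x \<star> (r \<odot>\<^bsub>A\<^esub> y \<oplus>\<^bsub>A\<^esub> z) = (r \<odot>\<^bsub>A\<^esub> x) \<star> y \<oplus>\<^bsub>A\<^esub> x \<star> z"
        using x ry axpy by (simp add: A.r_distr A_smult_mult)
      moreover have "tt ((r \<odot>\<^bsub>A\<^esub> x) \<star> y \<oplus>\<^bsub>A\<^esub> x \<star> z) \<one>\<^bsub>A\<^esub> = tt ((r \<odot>\<^bsub>A\<^esub> x) \<star> y) \<one>\<^bsub>A\<^esub> \<oplus>\<^bsub>E\<^esub> tt (x \<star> z) \<one>\<^bsub>A\<^esub>"
        using TP.tens_add_l[of "(r \<odot>\<^bsub>A\<^esub> x) \<star> y" "x \<star> z" "\<one>\<^bsub>A\<^esub>"] x rx axpy by (simp add: E_simps)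
      ultimately show "NN c \<otimes>\<^bsub>E\<^esub> tt x (r \<odot>\<^bsub>A\<^esub> y \<oplus>\<^bsub>A\<^esub> z) = NN c \<otimes>\<^bsub>E\<^esub> tt (x \<star> (r \<odot>\<^bsub>A\<^esub> y \<oplus>\<^bsub>A\<^esub> z)) \<one>\<^bsub>A\<^esub>"
        using axpy x rx N by (simp add: E.r_distr)
    qed
  qed
  then show "x \<in> carrier A \<Longrightarrow> y \<in> carrier A \<Longrightarrow> NN c \<otimes>\<^bsub>E\<^esub> tt x y = NN c \<otimes>\<^bsub>E\<^esub> tt (x \<star> y) \<one>\<^bsub>A\<^esub>" by blast
qed

lemma NN_rho: "C \<in> carrier E \<Longrightarrow> NN c \<otimes>\<^bsub>E\<^esub> C = NN c \<otimes>\<^bsub>E\<^esub> tt (rho C) \<one>\<^bsub>A\<^esub>"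
proof (induction rule: E_induct)
  case zero
  have "tt \<zero>\<^bsub>A\<^esub> \<one>\<^bsub>A\<^esub> = \<zero>\<^bsub>TP.BM\<^esub>"
    using TP.tens_add_l[of "\<zero>\<^bsub>A\<^esub>" "\<zero>\<^bsub>A\<^esub>" "\<one>\<^bsub>A\<^esub>"] TP.tens_closed[of "\<zero>\<^bsub>A\<^esub>" "\<one>\<^bsub>A\<^esub>"] by (simp add: TP.BM.add.r_cancel_one)
  moreover have "rho \<zero>\<^bsub>E\<^esub> = \<zero>\<^bsub>A\<^esub>" by (simp add: rho_def E_zero_LA)
  ultimately show ?case by (simp only: E_simps(3))
next
  case (tens x y D)
  have N: "NN c \<in> carrier E" by (simp add: NN_closed)
  have r: "rho D \<in> carrier A" using tens by (simp add: rho_def LA_closed)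
  have "rho (tt x y \<oplus>\<^bsub>E\<^esub> D) = x \<star> y \<oplus>\<^bsub>A\<^esub> rho D"
    using tens by (simp add: rho_def LA_add LA_tt)
  moreover have "tt (x \<star> y \<oplus>\<^bsub>A\<^esub> rho D) \<one>\<^bsub>A\<^esub> = tt (x \<star> y) \<one>\<^bsub>A\<^esub> \<oplus>\<^bsub>E\<^esub> tt (rho D) \<one>\<^bsub>A\<^esub>"
    using TP.tens_add_l[of "x \<star> y" "rho D" "\<one>\<^bsub>A\<^esub>"] tens r by (simp add: E_simps)
  ultimately show ?case using tens r N NN_tt_right[OF tens(1,2)] by (simp add: E.r_distr)
qed

text \<open>Such an \<open>r\<close>, placed at the origin, is a cycle in degree 0, hence by
  exactness a combination of the \<open>u\<close>, and these act as zero on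
  \<open>A\<close>.\<close>

lemma U_ideal:
  assumes r: "r \<in> carrier E" and N: "r \<otimes>\<^bsub>E\<^esub> NN c = \<zero>\<^bsub>E\<^esub>"
  shows "rho r = \<zero>\<^bsub>A\<^esub>"
proof -
  have NE: "NN c \<in> carrier E" by (simp add: NN_closed)
  have "MC.mdiff RE 0 (at_zero r) = (\<lambda>_. \<zero>\<^bsub>E\<^esub>)"
  proof
    fix \<nu> show "MC.mdiff RE 0 (at_zero r) \<nu> = \<zero>\<^bsub>E\<^esub>"
      using mdiff_0[OF at_zero_chains(1)[OF r] RE] mdiff_0'[of \<nu> RE "at_zero r"] N r NE
      by (cases "\<nu> = zero_index") (simp_all add: at_zero_def E.m_comm)
  qed
  then obtain y where y: "y \<in> carrier (MC.chains RE 1)" "MC.mdiff RE 1 y = at_zero r"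
    using mdiff_exact[OF at_zero_chains(1)[OF r]] by auto
  have "MC.mdiff LA 1 (\<lambda>\<nu>. rho (y \<nu>)) zero_index = rho (at_zero r zero_index)"
    using fun_cong[OF MC.mdiff_natural[OF RE LA_module rho_hom y(1)], of zero_index] by (simp only: y(2))
  moreover have "MC.mdiff LA 1 (\<lambda>\<nu>. rho (y \<nu>)) zero_index = \<zero>\<^bsub>A\<^esub>"
  proof -
    have yc: "rho (y \<nu>) \<in> carrier A" for \<nu>
      using module_homD(1)[OF rho_hom MC.chains_closed[OF RE y(1)]] by simp
    have "coef 1 zero_index j \<rhd> rho (y (target 1 zero_index j)) = \<zero>\<^bsub>LA\<^esub>" if "j < c" for j
      using that U_LA[of "Suc j"] yc by (simp add: coef_def kind_def kind_pos_def wE_def)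
    then have "(\<Oplus>\<^bsub>LA\<^esub>j\<in>{..<c}. coef 1 zero_index j \<rhd> rho (y (target 1 zero_index j))) = (\<Oplus>\<^bsub>LA\<^esub>j\<in>{..<c}. \<zero>\<^bsub>LA\<^esub>)"
      by (intro LA.finsum_cong') auto
    then show ?thesis by (simp add: MC.mdiff_def LA.finsum_zero)
  qed
  ultimately show ?thesis by (simp add: at_zero_def)
qed

text \<open>One implication is \<open>U_ideal\<close>; for the other, N r depends only on
  \<open>rho r\<close>.\<close>

lemma ann_NN: "r \<in> carrier E \<Longrightarrow> r \<otimes>\<^bsub>E\<^esub> NN c = \<zero>\<^bsub>E\<^esub> \<longleftrightarrow> r \<rhd> \<one>\<^bsub>A\<^esub> = \<zero>\<^bsub>LA\<^esub>"
proof
  assume r: "r \<in> carrier E" and z: "r \<rhd> \<one>\<^bsub>A\<^esub> = \<zero>\<^bsub>LA\<^esub>"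
  have N: "NN c \<in> carrier E" by (simp add: NN_closed)
  have "tt \<zero>\<^bsub>A\<^esub> \<one>\<^bsub>A\<^esub> = \<zero>\<^bsub>TP.BM\<^esub>"
    using TP.tens_add_l[of "\<zero>\<^bsub>A\<^esub>" "\<zero>\<^bsub>A\<^esub>" "\<one>\<^bsub>A\<^esub>"] TP.tens_closed[of "\<zero>\<^bsub>A\<^esub>" "\<one>\<^bsub>A\<^esub>"] by (simp add: TP.BM.add.r_cancel_one)
  then have "NN c \<otimes>\<^bsub>E\<^esub> r = NN c \<otimes>\<^bsub>E\<^esub> \<zero>\<^bsub>E\<^esub>" using NN_rho[OF r] z by (simp add: rho_def E_simps(3))
  then show "r \<otimes>\<^bsub>E\<^esub> NN c = \<zero>\<^bsub>E\<^esub>" using r N by (simp add: E.m_comm)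
qed (use U_ideal in \<open>simp add: rho_def\<close>)

text \<open>The hypothesis applies to each \<open>u\<close>, so \<open>r\<close> at the origin is a
  cycle in degree -1, and exactness there makes it a multiple of \<open>N\<close>.\<close>

lemma ann_ideal:
  assumes r: "r \<in> carrier E" and J: "\<And>s. s \<in> carrier E \<Longrightarrow> s \<rhd> \<one>\<^bsub>A\<^esub> = \<zero>\<^bsub>LA\<^esub> \<Longrightarrow> s \<otimes>\<^bsub>E\<^esub> r = \<zero>\<^bsub>E\<^esub>"
  shows "\<exists>t\<in>carrier E. r = t \<otimes>\<^bsub>E\<^esub> NN c"
proof -
  have Ur: "U (Suc j) \<otimes>\<^bsub>E\<^esub> r = \<zero>\<^bsub>E\<^esub>" if "j < c" for j
    using J[of "U (Suc j)"] U_closed[of "Suc j"] U_LA[of "Suc j" "\<one>\<^bsub>A\<^esub>"] that by simp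
  have "MC.mdiff RE (- 1) (at_zero r) \<nu> = \<zero>\<^bsub>E\<^esub>" for \<nu>
  proof -
    interpret RE: Module.module E RE by (rule RE)
    have "coef (- 1) \<nu> j \<odot>\<^bsub>RE\<^esub> at_zero r (target (- 1) \<nu> j) = \<zero>\<^bsub>RE\<^esub>" if j: "j < c" for j
    proof (cases "\<nu>(j := \<nu> j + 1) = zero_index")
      case True
      have "kind (- 1) (\<nu> j) = 1" using fun_cong[OF True, of j] by (simp add: kind_def kind_neg_def eq_neg_iff_add_eq_0[symmetric])
      then show ?thesis using Ur[OF j] r U_closed[of "Suc j"] j True
        by (simp add: coef_def wE_def target_def at_zero_def E.l_minus)
    next
      case False
      then show ?thesis using coef_closed[OF j] by (simp add: target_def at_zero_def)
    qed
    then have "(\<Oplus>\<^bsub>RE\<^esub>j\<in>{..<c}. coef (- 1) \<nu> j \<odot>\<^bsub>RE\<^esub> at_zero r (target (- 1) \<nu> j)) = (\<Oplus>\<^bsub>RE\<^esub>j\<in>{..<c}. \<zero>\<^bsub>RE\<^esub>)"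
      by (intro RE.finsum_cong') auto
    also have "\<dots> = \<zero>\<^bsub>RE\<^esub>" by (rule RE.finsum_zero)
    finally show ?thesis by (simp add: MC.mdiff_def)
  qed
  then obtain y where y: "y \<in> carrier (MC.chains RE 0)" "MC.mdiff RE 0 y = at_zero r"
    using mdiff_exact[OF at_zero_chains(2)[OF r]] by auto
  have yc: "y zero_index \<in> carrier E" using MC.chains_closed[OF RE y(1)] by simp
  have "r = NN c \<otimes>\<^bsub>E\<^esub> y zero_index"
    using fun_cong[OF y(2), of zero_index] mdiff_0[OF y(1) RE] by (simp add: at_zero_def)
  then show ?thesis using yc NN_closed[of c] by (intro bexI[of _ "y zero_index"]) (simp_all add: E.m_comm)
qed

lemma tate_setup:
  assumes T: "complete_resolution E LA T"
  shows "tate_setup E lattice {..<c} coef target LA T \<one>\<^bsub>A\<^esub> (NN c) zero_index"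
proof (intro tate_setup.intro tate_setup_axioms.intro)
  show "matrix_complex E lattice {..<c} coef" by (rule MC.matrix_complex_axioms)
  show "complete_resolution E LA T" by (rule T)
  show "Module.module E LA" by (rule LA_module)
  show "\<exists>r\<in>carrier E. b = r \<rhd> \<one>\<^bsub>A\<^esub>" if "b \<in> carrier LA" for b
    using that by (intro bexI[of _ "tt b \<one>\<^bsub>A\<^esub>"]) (simp_all add: LA_tt)
  show "MC.mdiff RE 0 z zero_index = NN c \<otimes>\<^bsub>E\<^esub> z zero_index" if "z \<in> carrier (MC.chains RE 0)" for z
    using mdiff_0[OF that RE] by simp
  show "(MC.mdiff RE i z = (\<lambda>_. \<zero>\<^bsub>E\<^esub>)) = (\<exists>y\<in>carrier (MC.chains RE (i + 1)). MC.mdiff RE (i + 1) y = z)"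
    if "z \<in> carrier (MC.chains RE i)" for z i
    using mdiff_exact[OF that] mdiff_mdiff[of _ i] by auto
qed (simp_all add: NN_closed ann_NN ann_ideal lattice_0 lattice_m1)

section \<open>Homology of the resolution tensored with the algebra\<close>

definition q :: nat where "q = a - Suc 0"

lemma Suc_q: "Suc q = a" and mod_q: "Suc (n mod a) = a \<longleftrightarrow> n mod a = q"
  using a_ge by (auto simp: q_def)

lemma boxD: "m \<in> box \<Longrightarrow> i \<in> {1..c} \<Longrightarrow> m i < a" "m \<in> box \<Longrightarrow> i \<notin> {1..c} \<Longrightarrow> m i = 0"
proof -
  have *: "m \<in> box \<Longrightarrow> if i \<in> {1..c} then m i < a else m i = 0" unfolding box_def by blast
  show "m \<in> box \<Longrightarrow> i \<in> {1..c} \<Longrightarrow> m i < a" using * by (simp only: if_True)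
  show "m \<in> box \<Longrightarrow> i \<notin> {1..c} \<Longrightarrow> m i = 0" using * by (simp only: if_False)
qed

definition XA :: "nat \<Rightarrow> nat \<Rightarrow> ((nat \<Rightarrow> nat) \<Rightarrow> 'k) \<Rightarrow> (nat \<Rightarrow> nat) \<Rightarrow> 'k" where
  "XA i l f m = (if m i mod a < l then 0 else f (m(i := m i - l)))"

text \<open>On \<open>A\<close> the element \<open>v\<close> acts as \<open>a x\<^sup>a\<^sup>-\<^sup>1\<close>; \<open>KA\<close> inverts this as far as possible.\<close>

definition VA :: "nat \<Rightarrow> ((nat \<Rightarrow> nat) \<Rightarrow> 'k) \<Rightarrow> (nat \<Rightarrow> nat) \<Rightarrow> 'k" where
  "VA i f m = (if Suc (m i mod a) = a then of_nat a * f (m(i := m i - q)) else 0)"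

definition KA :: "nat \<Rightarrow> ((nat \<Rightarrow> nat) \<Rightarrow> 'k) \<Rightarrow> (nat \<Rightarrow> nat) \<Rightarrow> 'k" where
  "KA i f m = (if m i mod a = 0 then inverse (of_nat a) * f (m(i := m i + q)) else 0)"

definition WtA :: "nat \<Rightarrow> nat \<Rightarrow> ((nat \<Rightarrow> nat) \<Rightarrow> 'k) \<Rightarrow> (nat \<Rightarrow> nat) \<Rightarrow> 'k" where
  "WtA d j f = (if d = 2 then VA (Suc j) f else 0)"

text \<open>If p divides a, the inverse of 0 is 0 and this homotopy is zero, so both cases of the
  theorem share one construction.\<close>

definition HtA :: "int \<Rightarrow> nat \<Rightarrow> int \<Rightarrow> ((nat \<Rightarrow> nat) \<Rightarrow> 'k) \<Rightarrow> (nat \<Rightarrow> nat) \<Rightarrow> 'k" where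
  "HtA i j l f = (if kind i (l - 1) = 2 then KA (Suc j) f else 0)"

lemma mod_sub: "l \<le> n mod a \<Longrightarrow> (n - l) mod a = n mod a - l"
  using SO.mod_sub_small[of l n] by simp

lemma mod_add: "n mod a + l < a \<Longrightarrow> (n + l) mod a = n mod a + l"
  using SO.mod_add_small[of n l] by simp

lemma XA_XA: "XA i l (XA i k f) = XA i (l + k) f"
  by (rule ext) (auto simp: XA_def mod_sub add.commute)

lemma XA_VA: "of_nat a * XA i q f m = VA i f m"
proof -
  have "\<not> m i mod a < q \<longleftrightarrow> Suc (m i mod a) = a"
    using mod_less_divisor[of a "m i"] a_ge Suc_q by linarith
  then show ?thesis by (auto simp: XA_def VA_def)
qed

lemma co_ux_pow: "i \<in> {1..c} \<Longrightarrow> b \<in> carrier A \<Longrightarrow> co (ux i [^]\<^bsub>E\<^esub> (l::nat) \<rhd> b) = XA i l (co b)"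
proof (induction l arbitrary: b)
  case 0
  then show ?case using LA.smult_one[of b] by (auto simp: XA_def)
next
  case (Suc l)
  note uc = uxy_closed[OF Suc.prems(1)]
  have "ux i [^]\<^bsub>E\<^esub> Suc l \<rhd> b = ux i [^]\<^bsub>E\<^esub> l \<rhd> (var i \<star> b)"
    using uc Suc.prems LA.smult_assoc1[of "ux i [^]\<^bsub>E\<^esub> l" "ux i" b] by (simp add: ux_LA)
  moreover have "co (var i \<star> b) = XA i (Suc 0) (co b)"
    using Suc.prems by (intro ext) (simp add: co_var_mult_mod XA_def)
  ultimately show ?case using Suc var_closed[of i] by (simp add: XA_XA)
qed

lemma co_uy_pow: "i \<in> {1..c} \<Longrightarrow> b \<in> carrier A \<Longrightarrow> co (uy i [^]\<^bsub>E\<^esub> (l::nat) \<rhd> b) = XA i l (co b)"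
proof (induction l arbitrary: b)
  case 0
  then show ?case using LA.smult_one[of b] by (auto simp: XA_def)
next
  case (Suc l)
  note uc = uxy_closed[OF Suc.prems(1)]
  have "uy i [^]\<^bsub>E\<^esub> Suc l \<rhd> b = uy i [^]\<^bsub>E\<^esub> l \<rhd> (var i \<star> b)"
    using uc Suc.prems LA.smult_assoc1[of "uy i [^]\<^bsub>E\<^esub> l" "uy i" b] by (simp add: uy_LA)
  moreover have "co (var i \<star> b) = XA i (Suc 0) (co b)"
    using Suc.prems by (intro ext) (simp add: co_var_mult_mod XA_def)
  ultimately show ?case using Suc var_closed[of i] by (simp add: XA_XA)
qed

lemma co_LA_finsum:
  assumes "h \<in> S \<rightarrow> carrier A"
  shows "co (finsum LA h S) m = (\<Sum>j\<in>S. co (h j) m)"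
  using assms by (induction S rule: infinite_finite_induct) (simp_all add: co_zero co_add Pi_def LA.finsum_closed[simplified])

text \<open>Both tensor factors act alike on the commutative algebra, so each of the
  \<open>a\<close> summands of \<open>V i\<close> acts as x^(a-1).\<close>

lemma co_V: "i \<in> {1..c} \<Longrightarrow> b \<in> carrier A \<Longrightarrow> co (V i \<rhd> b) = VA i (co b)"
proof
  fix m
  assume i: "i \<in> {1..c}" and b: "b \<in> carrier A"
  note uc = uxy_closed[OF i]
  have t: "co ((ux i [^]\<^bsub>E\<^esub> l \<otimes>\<^bsub>E\<^esub> uy i [^]\<^bsub>E\<^esub> (a - Suc 0 - l)) \<rhd> b) m = XA i q (co b) m"
    if "l < a" for l :: nat
    using uc b i that LA.smult_assoc1[of "ux i [^]\<^bsub>E\<^esub> l" "uy i [^]\<^bsub>E\<^esub> (a - Suc 0 - l)" b]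
    by (simp add: co_ux_pow co_uy_pow XA_XA LA_closed q_def)
  have "V i \<rhd> b = (\<Oplus>\<^bsub>LA\<^esub>l\<in>{..<a}. (ux i [^]\<^bsub>E\<^esub> l \<otimes>\<^bsub>E\<^esub> uy i [^]\<^bsub>E\<^esub> (a - Suc 0 - l)) \<rhd> b)"
    unfolding V_def using uc b by (intro LA.finsum_smult_r) auto
  then have "co (V i \<rhd> b) m = (\<Sum>l<a. XA i q (co b) m)"
    using uc b t by (simp add: co_LA_finsum Pi_def LA_closed)
  then show "co (V i \<rhd> b) m = VA i (co b) m" by (simp add: XA_VA)
qed

lemma co_wE: "j < c \<Longrightarrow> x \<in> carrier A \<Longrightarrow> co (wE d j \<rhd> x) = WtA d j (co x)"
proof -
  have z: "co \<zero>\<^bsub>A\<^esub> = 0" by (rule ext) (simp add: co_zero zero_fun_apply)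
  show "j < c \<Longrightarrow> x \<in> carrier A \<Longrightarrow> co (wE d j \<rhd> x) = WtA d j (co x)"
    using U_LA[of "Suc j" x] co_V[of "Suc j" x] E_zero_LA[of x]
    by (auto simp: wE_def WtA_def z)
qed

lemma kind_alternates: "kind i l = 2 \<Longrightarrow> kind i (l + 1) \<noteq> 2"
  by (auto simp: kind_def kind_pos_def kind_neg_def split: if_splits)

lemma VA_additive: "VA i (f + g) = VA i f + VA i g" "KA i (f + g) = KA i f + KA i g" "VA i 0 = 0" "KA i 0 = 0"
  by (auto simp: VA_def KA_def fun_eq_iff plus_fun_apply zero_fun_apply algebra_simps)

lemma VA_comm: "i \<noteq> j \<Longrightarrow> VA i (VA j f) = VA j (VA i f)" "i \<noteq> j \<Longrightarrow> VA i (KA j f) = KA j (VA i f)"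
  by (auto simp: VA_def KA_def fun_eq_iff fun_upd_twist)

lemma multi_complex_A: "multi_complex (\<lambda>j l. WtA (kind i l) j) (HtA i)"
proof
  show "WtA (kind i l) j (x + y) = WtA (kind i l) j x + WtA (kind i l) j y" for j l x y
    by (simp add: WtA_def VA_additive)
  show "HtA i j l (x + y) = HtA i j l x + HtA i j l y" for j l x y
    by (simp add: HtA_def VA_additive)
  show "WtA (kind i l) i' (WtA (kind i m) j x) = WtA (kind i m) j (WtA (kind i l) i' x)" if "i' \<noteq> j" for i' j l m x
    using that by (simp add: WtA_def VA_additive VA_comm)
  show "WtA (kind i l) i' (HtA i j m x) = HtA i j m (WtA (kind i l) i' x)" if "i' \<noteq> j" for i' j l m x
    using that by (simp add: WtA_def HtA_def VA_additive VA_comm)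
  show "WtA (kind i l) j (WtA (kind i (l + 1)) j x) = 0" for j l x
    using kind_alternates[of i l] by (simp add: WtA_def VA_additive)
qed

text \<open>The cells that survive in the first \<open>n\<close> directions. If a is nonzero in the
  field, \<open>v\<close> takes 1 to a nonzero multiple of x^(a-1): exponent a - 1 is hit where
  \<open>v\<close> arrives, and exponent 0 is not a cycle where \<open>v\<close> departs.\<close>

definition critical :: "nat \<Rightarrow> int \<Rightarrow> (nat \<Rightarrow> int) \<Rightarrow> (nat \<Rightarrow> nat) \<Rightarrow> bool" where
  "critical n i \<nu> m \<longleftrightarrow> (of_nat a :: 'k) = 0 \<or> (\<forall>j<n. \<not> (kind i (\<nu> j) = 2 \<and> Suc (m (Suc j) mod a) = a)
     \<and> \<not> (kind i (\<nu> j - 1) = 2 \<and> m (Suc j) mod a = 0))"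

lemma VA_KA: "VA i (KA i f) m = (if Suc (m i mod a) = a \<and> (of_nat a :: 'k) \<noteq> 0 then f m else 0)"
proof (cases "Suc (m i mod a) = a")
  case True
  then have l: "q \<le> m i mod a" by (simp add: mod_q)
  have "m i \<ge> q" by (rule le_trans[OF l]) simp
  then show ?thesis using True mod_sub[OF l] by (simp add: VA_def KA_def mod_q)
qed (simp add: VA_def)

lemma KA_VA: "KA i (VA i f) m = (if m i mod a = 0 \<and> (of_nat a :: 'k) \<noteq> 0 then f m else 0)"
proof (cases "m i mod a = 0")
  case True
  have "m i mod a + q < a" using True Suc_q by simp
  then have "(m i + q) mod a = q" using mod_add[of "m i" q] True by simp
  then show ?thesis using True by (simp add: VA_def KA_def mod_q Suc_q)
qed (simp add: KA_def)

text \<open>The two composites of \<open>VA\<close> and \<open>KA\<close> restrict to remainder a -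
  1 and to remainder 0. By alternation of kinds at most one of them is active in a direction, and
  removing it leaves the critical cells.\<close>

lemma tproj_A: "multi_complex.tproj (\<lambda>j l. WtA (kind i l) j) (HtA i) n z \<nu> = (\<lambda>m. if critical n i \<nu> m then z \<nu> m else 0)"
proof -
  interpret X: multi_complex c "\<lambda>j l. WtA (kind i l) j" "HtA i" by (rule multi_complex_A)
  show ?thesis
  proof (induction n)
    case (Suc n)
    show ?case
    proof
      fix m
      have one: "X.pproj n w \<nu> m = (if critical n i \<nu> m \<and> \<not> critical (Suc n) i \<nu> m then 0 else w \<nu> m)"
        if w: "\<not> critical n i \<nu> m \<Longrightarrow> w \<nu> m = 0" for w
      proof (cases "critical n i \<nu> m")
        case True
        then have "critical (Suc n) i \<nu> m \<longleftrightarrow> (of_nat a :: 'k) = 0 \<or> (\<not> (kind i (\<nu> n) = 2 \<and> Suc (m (Suc n) mod a) = a)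
             \<and> \<not> (kind i (\<nu> n - 1) = 2 \<and> m (Suc n) mod a = 0))"
          by (auto simp: critical_def less_Suc_eq)
        moreover have "\<not> (kind i (\<nu> n) = 2 \<and> kind i (\<nu> n - 1) = 2)" using kind_alternates[of i "\<nu> n - 1"] by auto
        ultimately show ?thesis using True
          by (auto simp: X.pproj_def WtA_def HtA_def VA_KA KA_VA minus_apply zero_fun_apply VA_additive)
      next
        case False
        then show ?thesis using w
          by (simp add: X.pproj_def WtA_def HtA_def VA_KA KA_VA minus_apply zero_fun_apply VA_additive)
      qed
      have imp: "critical (Suc n) i \<nu> m \<Longrightarrow> critical n i \<nu> m" by (auto simp: critical_def)
      show "X.tproj (Suc n) z \<nu> m = (if critical (Suc n) i \<nu> m then z \<nu> m else 0)"
        using one[of "X.tproj n z"] imp by (auto simp: Suc.IH)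
    qed
  qed (simp add: critical_def)
qed

lemma co_mdiff:
  assumes i: "i \<noteq> 0" and z: "z \<in> carrier (MC.chains LA i)"
  shows "(\<lambda>\<nu>. co (MC.mdiff LA i z \<nu>)) = multi_complex.tdiff (\<lambda>j l. WtA (kind i l) j) c (\<lambda>\<nu>. co (z \<nu>))"
  by (rule mdiff_coordinates[OF LA_module _ _ multi_complex_A i z])
    (auto simp: co_add co_wE plus_fun_apply fun_eq_iff)

definition mk :: "int \<Rightarrow> ((nat \<Rightarrow> int) \<Rightarrow> (nat \<Rightarrow> nat) \<Rightarrow> 'k) \<Rightarrow> (nat \<Rightarrow> int) \<Rightarrow> 'k mpoly set" where
  "mk i F \<nu> = (if \<nu> \<in> lattice i then SOME x. x \<in> carrier A \<and> (\<forall>m. co x m = (if m \<in> box then F \<nu> m else 0)) else \<zero>\<^bsub>A\<^esub>)"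

lemma mk: "mk i F \<in> carrier (MC.chains LA i)" "co (mk i F \<nu>) m = (if \<nu> \<in> lattice i \<and> m \<in> box then F \<nu> m else 0)"
proof -
  have "mk i F \<nu> \<in> carrier A \<and> (\<forall>m. co (mk i F \<nu>) m = (if m \<in> box then F \<nu> m else 0))" if \<nu>: "\<nu> \<in> lattice i" for \<nu>
  proof -
    have "\<exists>x. x \<in> carrier A \<and> (\<forall>m. co x m = (if m \<in> box then F \<nu> m else 0))"
      using co_surj[of "\<lambda>m. if m \<in> box then F \<nu> m else 0"] by auto
    from someI_ex[OF this] show ?thesis using \<nu> by (simp add: mk_def)
  qed
  then show "mk i F \<in> carrier (MC.chains LA i)" "co (mk i F \<nu>) m = (if \<nu> \<in> lattice i \<and> m \<in> box then F \<nu> m else 0)"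
    by (auto simp: MC.chains_iff mk_def co_zero)
qed

lemma chain_LA_eqI:
  assumes "x \<in> carrier (MC.chains LA i)" "y \<in> carrier (MC.chains LA i)" "\<And>\<nu> m. co (x \<nu>) m = co (y \<nu>) m"
  shows "x = y"
  using MC.chains_closed[OF LA_module assms(1)] MC.chains_closed[OF LA_module assms(2)] assms(3) by (intro ext co_eqI) simp_all

lemma mdiff_LA_closed: "z \<in> carrier (MC.chains LA i) \<Longrightarrow> MC.mdiff LA i z \<in> carrier (MC.chains LA (i - 1))"
  by (rule module_homD(1)[OF MC.mdiff_hom[OF LA_module]])

lemma VA_box: "i \<in> {1..c} \<Longrightarrow> VA i f m = (if m \<in> box then VA i g m else 0)"
  if fg: "\<And>m. f m = (if m \<in> box then g m else 0)" for f g
  using box_shift[of i q m] fg by (auto simp: VA_def mod_q)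

lemma mdiff_mk:
  assumes i: "i \<noteq> 0"
  shows "co (MC.mdiff LA i (mk i F) \<nu>) m = (if \<nu> \<in> lattice (i - 1) \<and> m \<in> box
    then multi_complex.tdiff (\<lambda>j l. WtA (kind i l) j) c F \<nu> m else 0)"
proof -
  interpret X: multi_complex c "\<lambda>j l. WtA (kind i l) j" "HtA i" by (rule multi_complex_A)
  show ?thesis
  proof (cases "\<nu> \<in> lattice (i - 1)")
    case True
    have pd: "X.pdiff j (\<lambda>\<nu>. co (mk i F \<nu>)) \<nu> m = (if m \<in> box then X.pdiff j F \<nu> m else 0)" if j: "j < c" for j
    proof (cases "kind i (\<nu> j) = 2")
      case False
      then show ?thesis by (simp add: X.pdiff_def WtA_def zero_fun_apply)
    next
      case k: True
      then have "\<nu>(j := \<nu> j + 1) \<in> lattice i" using lattice_step[where \<nu> = \<nu> and j = j, OF i j] True by simp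
      then have "co (mk i F (\<nu>(j := \<nu> j + 1))) m' = (if m' \<in> box then F (\<nu>(j := \<nu> j + 1)) m' else 0)" for m' by (simp add: mk(2))
      from VA_box[OF this, of "Suc j" m] j show ?thesis using k
        by (simp add: X.pdiff_def WtA_def parity_sign_def uminus_apply)
    qed
    have sum_app: "(\<Sum>j<c. (h j :: (nat \<Rightarrow> nat) \<Rightarrow> 'k)) m = (\<Sum>j<c. h j m)" for h
      by (induction c) (simp_all add: plus_fun_apply zero_fun_apply)
    have "co (MC.mdiff LA i (mk i F) \<nu>) m = X.tdiff c (\<lambda>\<nu>. co (mk i F \<nu>)) \<nu> m"
      using fun_cong[OF co_mdiff[OF i mk(1)], of F \<nu>] by simp
    then show ?thesis using True pd by (simp add: X.tdiff_def sum_app)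
  qed (simp add: MC.mdiff_def co_zero)
qed

lemma sum_fun_apply: "(\<Sum>j\<in>J. (h j :: 'x \<Rightarrow> 'g::comm_monoid_add)) m = (\<Sum>j\<in>J. h j m)"
  by (induction J rule: infinite_finite_induct) (simp_all add: plus_fun_apply zero_fun_apply)

lemma tdiff_A_critical:
  assumes "critical c i \<nu> m"
  shows "multi_complex.tdiff (\<lambda>j l. WtA (kind i l) j) c F \<nu> m = 0"
proof -
  interpret X: multi_complex c "\<lambda>j l. WtA (kind i l) j" "HtA i" by (rule multi_complex_A)
  have "X.pdiff j F \<nu> m = 0" if "j < c" for j
    using assms that by (auto simp: critical_def X.pdiff_def WtA_def VA_def parity_sign_def uminus_apply zero_fun_apply)
  then show ?thesis by (simp add: X.tdiff_def sum_fun_apply)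
qed

text \<open>An arriving \<open>v\<close> reads exponent 0 at the point from which it departs, and
  such cells are not critical when a is nonzero in the field.\<close>

lemma tdiff_A_of_critical:
  assumes "\<And>\<nu> m. \<not> critical c i \<nu> m \<Longrightarrow> F \<nu> m = 0"
  shows "multi_complex.tdiff (\<lambda>j l. WtA (kind i l) j) c F \<nu> m = 0"
proof -
  interpret X: multi_complex c "\<lambda>j l. WtA (kind i l) j" "HtA i" by (rule multi_complex_A)
  have "VA (Suc j) (F (\<nu>(j := \<nu> j + 1))) m = 0" if j: "j < c" and k: "kind i (\<nu> j) = 2" for j
  proof (cases "Suc (m (Suc j) mod a) = a \<and> (of_nat a :: 'k) \<noteq> 0")
    case True
    then have "(m (Suc j) - q) mod a = 0" by (subst mod_sub) (simp_all add: mod_q)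
    then have "\<not> critical c i (\<nu>(j := \<nu> j + 1)) (m(Suc j := m (Suc j) - q))"
      using True j k by (auto simp: critical_def intro!: exI[of _ j])
    then show ?thesis using assms by (simp add: VA_def)
  qed (auto simp: VA_def)
  then have "X.pdiff j F \<nu> m = 0" if "j < c" for j
    using that by (auto simp: X.pdiff_def WtA_def parity_sign_def uminus_apply zero_fun_apply)
  then show ?thesis by (simp add: X.tdiff_def sum_fun_apply)
qed

text \<open>The exponent of the socle monomial of \<open>A\<close>.\<close>

definition top :: "nat \<Rightarrow> nat" where "top i = (if i \<in> {1..c} then q else 0)"

lemma top_box: "top \<in> box" and zero_box: "(\<lambda>_. 0) \<in> box"
  using a_ge Suc_q by (auto simp: box_def top_def)

text \<open>Each \<open>v\<close> acts as a x^(a-1), so their product keeps only the part constant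
  in the first \<open>n\<close> variables, multiplies it by a^n and moves it to exponent a - 1 in
  each of them.\<close>

lemma co_NN_aux: "n \<le> c \<Longrightarrow> b \<in> carrier A \<Longrightarrow> co (NN n \<rhd> b) m =
    (if \<forall>i\<in>{1..n}. Suc (m i mod a) = a then of_nat a ^ n * co b (\<lambda>i. if i \<in> {1..n} then m i - q else m i) else 0)"
proof (induction n arbitrary: m)
  case 0
  then show ?case using LA.smult_one[of b] by simp
next
  case (Suc n)
  have "NN (Suc n) \<rhd> b = V (Suc n) \<rhd> (NN n \<rhd> b)"
    using Suc.prems V_closed[of "Suc n"] NN_closed[of n] LA.smult_assoc1[of "V (Suc n)" "NN n" b] by simp
  then have co1: "co (NN (Suc n) \<rhd> b) m = VA (Suc n) (co (NN n \<rhd> b)) m"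
    using Suc.prems NN_closed[of n] LA_closed[of "NN n" b] by (simp add: co_V)
  let ?m = "m(Suc n := m (Suc n) - q)"
  have e1: "(\<forall>i\<in>{1..n}. Suc (?m i mod a) = a) \<longleftrightarrow> (\<forall>i\<in>{1..n}. Suc (m i mod a) = a)" by auto
  have e2: "(\<lambda>i. if i \<in> {1..n} then ?m i - q else ?m i) = (\<lambda>i. if i \<in> {1..Suc n} then m i - q else m i)"
    by (auto simp: fun_eq_iff)
  have e3: "(\<forall>i\<in>{1..Suc n}. Suc (m i mod a) = a) \<longleftrightarrow> Suc (m (Suc n) mod a) = a \<and> (\<forall>i\<in>{1..n}. Suc (m i mod a) = a)"
    by (auto simp: le_Suc_eq)
  have "co (NN n \<rhd> b) ?m = (if \<forall>i\<in>{1..n}. Suc (m i mod a) = a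
      then of_nat a ^ n * co b (\<lambda>i. if i \<in> {1..Suc n} then m i - q else m i) else 0)"
    using Suc.IH[of ?m] Suc.prems by (simp only: e1 e2)
  then show ?case unfolding co1 VA_def e3 by simp
qed

lemma co_NN: "b \<in> carrier A \<Longrightarrow> co (NN c \<rhd> b) m = (if m = top then of_nat a ^ c * co b (\<lambda>_. 0) else 0)"
proof (cases "m \<in> box")
  case True
  assume b: "b \<in> carrier A"
  note lt = boxD(1)[OF True] and out = boxD(2)[OF True]
  have "(\<forall>i\<in>{1..c}. Suc (m i mod a) = a) \<longleftrightarrow> m = top"
  proof
    assume *: "\<forall>i\<in>{1..c}. Suc (m i mod a) = a"
    show "m = top"
    proof
      fix i show "m i = top i"
      proof (cases "i \<in> {1..c}")
        case True
        then have "Suc (m i) = a" using * lt[OF True] by (metis mod_less)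
        then show ?thesis using True Suc_q by (simp add: top_def)
      next
        case False
        then show ?thesis using out[OF False] by (simp only: top_def if_False)
      qed
    qed
  qed (use Suc_q in \<open>auto simp: top_def\<close>)
  moreover have "(\<lambda>i. if i \<in> {1..c} then top i - q else top i) = (\<lambda>_. 0)" by (auto simp: top_def)
  ultimately show ?thesis using co_NN_aux[OF order_refl b, of m] by auto
next
  case False
  assume b: "b \<in> carrier A"
  then show ?thesis using False top_box co_outside[OF LA_closed[OF NN_closed[OF order_refl] b] False] by auto
qed

text \<open>A basis of the homology with values in \<open>A\<close>. Between degrees 0 and -1,
  \<open>N\<close> takes the constant monomial to a^c times the socle monomial and kills the other
  monomials; if a is nonzero in the field, exactly these two drop out.\<close>

definition cells :: "int \<Rightarrow> ((nat \<Rightarrow> int) \<times> (nat \<Rightarrow> nat)) set" where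
  "cells i = {(\<nu>, m). \<nu> \<in> lattice i \<and> m \<in> box \<and> (if i = 0 then (of_nat a :: 'k) = 0 \<or> m \<noteq> (\<lambda>_. 0)
     else if i = - 1 then (of_nat a :: 'k) = 0 \<or> m \<noteq> top else critical c i \<nu> m)}"

text \<open>The differentials next to the splice involve only the \<open>u\<close>, which act as
  zero on \<open>A\<close>.\<close>

lemma mdiff_LA_unit:
  assumes i: "i = 1 \<or> i = - 1" and z: "z \<in> carrier (MC.chains LA i)"
  shows "MC.mdiff LA i z = (\<lambda>_. \<zero>\<^bsub>A\<^esub>)"
proof (rule chain_LA_eqI[of _ "i - 1"])
  have i0: "i \<noteq> 0" using i by auto
  interpret M: multi_complex c "\<lambda>j l. WtA (kind i l) j" "HtA i" by (rule multi_complex_A)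
  have pd: "M.pdiff j (\<lambda>\<nu>. co (z \<nu>)) \<nu> = 0" if j: "j < c" for j \<nu>
  proof (cases "kind i (\<nu> j) = 2")
    case True
    have "\<nu>(j := \<nu> j + 1) \<notin> lattice i"
    proof
      assume *: "\<nu>(j := \<nu> j + 1) \<in> lattice i"
      show False
      proof (cases "i = 1")
        case i1: True
        then have nn: "0 \<le> (\<nu>(j := \<nu> j + 1)) l" for l using * unfolding lattice_def by (simp del: fun_upd_apply)
        have "(\<nu>(j := \<nu> j + 1)) j \<le> (\<Sum>l<c. (\<nu>(j := \<nu> j + 1)) l)"
          using j nn by (intro member_le_sum) (auto simp del: fun_upd_apply)
        moreover have "\<dots> = 1" using * i1 unfolding lattice_def by (simp del: fun_upd_apply)
        ultimately show False using True i1 by (auto simp: kind_def kind_pos_def split: if_splits)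
      next
        case False
        then have im: "i = - 1" using i by simp
        then have "\<nu>(j := \<nu> j + 1) = zero_index" using * by (simp only: lattice_m1 singleton_iff)
        from fun_cong[OF this, of j] have "\<nu> j = - 1" by simp
        then show False using True im by (auto simp: kind_def kind_neg_def split: if_splits)
      qed
    qed
    then have "z (\<nu>(j := \<nu> j + 1)) = \<zero>\<^bsub>A\<^esub>" using z by (simp add: MC.chains_iff)
    moreover have "co \<zero>\<^bsub>A\<^esub> = 0" by (rule ext) (simp add: co_zero zero_fun_apply)
    ultimately show ?thesis by (simp add: M.pdiff_def WtA_def VA_additive)
  qed (simp add: M.pdiff_def WtA_def)
  show "co (MC.mdiff LA i z \<nu>) m = co \<zero>\<^bsub>A\<^esub> m" for \<nu> m
    using fun_cong[OF co_mdiff[OF i0 z], of \<nu>] pd by (simp add: M.tdiff_def co_zero zero_fun_apply)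
  show "MC.mdiff LA i z \<in> carrier (MC.chains LA (i - 1))" by (rule mdiff_LA_closed[OF z])
  show "(\<lambda>_. \<zero>\<^bsub>A\<^esub>) \<in> carrier (MC.chains LA (i - 1))" by (simp add: MC.chains_iff)
qed

lemma mdiff_LA_0:
  assumes z: "z \<in> carrier (MC.chains LA 0)"
  shows "co (MC.mdiff LA 0 z \<nu>) m = (if \<nu> = zero_index \<and> m = top then of_nat a ^ c * co (z zero_index) (\<lambda>_. 0) else 0)"
proof (cases "\<nu> = zero_index")
  case True
  have "z zero_index \<in> carrier A" using MC.chains_closed[OF LA_module z] by simp
  then show ?thesis using True mdiff_0[OF z LA_module] by (simp add: co_NN)
next
  case False
  then show ?thesis using mdiff_0'[OF False, of LA z] by (simp add: co_zero)
qed

lemma kind_succ: "i \<noteq> 0 \<Longrightarrow> i \<noteq> - 1 \<Longrightarrow> kind (i + 1) = kind i"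
  by (auto simp: kind_def)

lemma critical_succ: "i \<noteq> 0 \<Longrightarrow> i \<noteq> - 1 \<Longrightarrow> critical c (i + 1) = critical c i"
  by (simp add: critical_def kind_succ fun_eq_iff)

text \<open>With the next two lemmas: coefficients at the cells can be prescribed by cycles, vanish
  on boundaries, and detect boundaries among cycles.\<close>

lemma cells_cycle:
  assumes F: "\<And>\<nu> m. (\<nu>, m) \<notin> cells i \<Longrightarrow> F \<nu> m = 0"
  shows "MC.mdiff LA i (mk i F) = (\<lambda>_. \<zero>\<^bsub>A\<^esub>)"
proof -
  consider "i = - 1" | "i = 0" | "i \<noteq> 0" "i \<noteq> - 1" by blast
  then show ?thesis
  proof cases
    case 1
    then show ?thesis using mdiff_LA_unit[OF _ mk(1)] by simp
  next
    case 2
    have z: "of_nat a ^ c * co (mk i F zero_index) (\<lambda>_. 0) = (0::'k)"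
      using F[of zero_index "\<lambda>_. 0"] 2 c_ge by (cases "(of_nat a :: 'k) = 0") (auto simp: mk(2) cells_def)
    show ?thesis
    proof (rule chain_LA_eqI[of _ "i - 1"])
      show "co (MC.mdiff LA i (mk i F) \<nu>) m = co \<zero>\<^bsub>A\<^esub> m" for \<nu> m
        using mdiff_LA_0[of "mk i F" \<nu> m] mk(1)[of i F] z 2 by (simp add: co_zero)
    qed (rule mdiff_LA_closed[OF mk(1)], simp add: MC.chains_iff)
  next
    case 3
    define F' where "F' \<nu> m = (if critical c i \<nu> m then F \<nu> m else 0)" for \<nu> m
    have "mk i F = mk i F'"
    proof (rule chain_LA_eqI[of _ i])
      show "co (mk i F \<nu>) m = co (mk i F' \<nu>) m" for \<nu> m
        using F[of \<nu> m] 3 by (auto simp: mk(2) F'_def cells_def)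
    qed (simp_all add: mk(1))
    moreover have "MC.mdiff LA i (mk i F') = (\<lambda>_. \<zero>\<^bsub>A\<^esub>)"
    proof (rule chain_LA_eqI[of _ "i - 1"])
      show "co (MC.mdiff LA i (mk i F') \<nu>) m = co \<zero>\<^bsub>A\<^esub> m" for \<nu> m
        using tdiff_A_of_critical[of i F' \<nu> m] by (simp add: mdiff_mk[OF 3(1)] co_zero F'_def)
    qed (rule mdiff_LA_closed[OF mk(1)], simp add: MC.chains_iff)
    ultimately show ?thesis by simp
  qed
qed

lemma boundary_cells:
  assumes y: "y \<in> carrier (MC.chains LA (i + 1))" and cell: "(\<nu>, m) \<in> cells i"
  shows "co (MC.mdiff LA (i + 1) y \<nu>) m = 0"
proof -
  consider "i = - 1" | "i = 0" | "i \<noteq> 0" "i \<noteq> - 1" by blast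
  then show ?thesis
  proof cases
    case 1
    then show ?thesis using mdiff_LA_0[of y \<nu> m] y cell c_ge by (auto simp: cells_def)
  next
    case 2
    then show ?thesis using mdiff_LA_unit[OF _ y] by (simp add: co_zero)
  next
    case 3
    then show ?thesis using fun_cong[OF fun_cong[OF co_mdiff[OF _ y]], of \<nu> m] tdiff_A_critical[of "i + 1" \<nu> m] cell
      by (simp add: cells_def critical_succ)
  qed
qed

lemma cells_boundary:
  assumes w: "w \<in> carrier (MC.chains LA i)" and cyc: "MC.mdiff LA i w = (\<lambda>_. \<zero>\<^bsub>A\<^esub>)"
    and van: "\<And>\<nu> m. (\<nu>, m) \<in> cells i \<Longrightarrow> co (w \<nu>) m = 0"
  shows "\<exists>y\<in>carrier (MC.chains LA (i + 1)). MC.mdiff LA (i + 1) y = w"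
proof -
  have wc: "w \<nu> \<in> carrier A" for \<nu> using MC.chains_closed[OF LA_module w] by simp
  have w_out: "co (w \<nu>) m = 0" if "\<not> (\<nu> \<in> lattice i \<and> m \<in> box)" for \<nu> m
    using that co_outside[OF wc[of \<nu>], of m] w by (auto simp: MC.chains_iff co_zero)
  consider "i = - 1" | "i = 0" | "i \<noteq> 0" "i \<noteq> - 1" by blast
  then show ?thesis
  proof cases
    case 1
    \<comment> \<open>The factor undoes the multiplication by a^c that \<open>N\<close> performs; if
      a is zero in the field, every coefficient is a cell and \<open>w\<close> vanishes.\<close>
    define y where "y = mk 0 (\<lambda>\<nu> m. inverse (of_nat a ^ c) * co (w zero_index) top)"
    have y: "y \<in> carrier (MC.chains LA 0)" by (simp add: y_def mk(1))
    have "MC.mdiff LA 0 y = w"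
    proof (rule chain_LA_eqI[of _ "- 1"])
      show "MC.mdiff LA 0 y \<in> carrier (MC.chains LA (- 1))" using mdiff_LA_closed[OF y] by simp
      show "w \<in> carrier (MC.chains LA (- 1))" using w 1 by simp
      fix \<nu> m
      have "co (w \<nu>) m = (if \<nu> = zero_index \<and> m = top \<and> (of_nat a :: 'k) \<noteq> 0 then co (w zero_index) top else 0)"
        using van[of \<nu> m] w_out[of \<nu> m] 1 by (auto simp: cells_def lattice_m1)
      then show "co (MC.mdiff LA 0 y \<nu>) m = co (w \<nu>) m"
        using c_ge zero_box by (simp add: mdiff_LA_0[OF y]) (auto simp: y_def mk(2) lattice_0)
    qed
    then show ?thesis using y 1 by auto
  next
    case 2
    have "mk 1 0 \<in> carrier (MC.chains LA 1)" by (rule mk(1))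
    moreover have "MC.mdiff LA 1 (mk 1 0) = w"
    proof (rule chain_LA_eqI[of _ 0])
      show "MC.mdiff LA 1 (mk 1 0) \<in> carrier (MC.chains LA 0)" using mdiff_LA_closed[OF mk(1)[of 1 0]] by simp
      show "w \<in> carrier (MC.chains LA 0)" using w 2 by simp
      fix \<nu> m
      \<comment> \<open>The cycle condition removes the constant coefficient when a is nonzero in
        the field; all other coefficients belong to cells, so \<open>w\<close> is zero.\<close>
      have "of_nat a ^ c * co (w zero_index) (\<lambda>_. 0) = 0"
        using mdiff_LA_0[of w zero_index top] w cyc 2 by (simp add: co_zero)
      then have "co (w \<nu>) m = 0"
        using van[of \<nu> m] w_out[of \<nu> m] 2 by (cases "m = (\<lambda>_. 0)") (auto simp: cells_def lattice_0)
      then show "co (MC.mdiff LA 1 (mk 1 0) \<nu>) m = co (w \<nu>) m"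
        using mdiff_LA_unit[OF _ mk(1)[of 1 0]] by (simp add: co_zero)
    qed
    ultimately show ?thesis using 2 by auto
  next
    case 3
    interpret M: multi_complex c "\<lambda>j l. WtA (kind i l) j" "HtA i" by (rule multi_complex_A)
    have "M.tdiff c (\<lambda>\<nu>. co (w \<nu>)) = (\<lambda>\<nu>. 0)"
      unfolding co_mdiff[OF 3(1) w, symmetric] cyc by (intro ext) (simp add: co_zero zero_fun_apply)
    then obtain Y where Y: "(\<lambda>\<nu>. co (w \<nu>)) = (\<lambda>\<nu>. M.tproj c (\<lambda>\<nu>. co (w \<nu>)) \<nu> + M.tdiff c Y \<nu>)"
      using M.cycle_minus_tproj_is_boundary[of _ c] by blast
    \<comment> \<open>The projection keeps only critical cells, where \<open>w\<close> vanishes by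
      assumption.\<close>
    have tp: "M.tproj c (\<lambda>\<nu>. co (w \<nu>)) \<nu> m = 0" for \<nu> m
      using van[of \<nu> m] w_out[of \<nu> m] 3 unfolding tproj_A by (auto simp: cells_def)
    have cow: "co (w \<nu>) m = M.tdiff c Y \<nu> m" for \<nu> m
      using fun_cong[OF fun_cong[OF Y], of \<nu> m] tp by (simp add: plus_fun_apply)
    have i1: "i + 1 \<noteq> 0" using 3 by simp
    have "MC.mdiff LA (i + 1) (mk (i + 1) Y) = w"
    proof (rule chain_LA_eqI[OF _ w])
      show "MC.mdiff LA (i + 1) (mk (i + 1) Y) \<in> carrier (MC.chains LA i)" using mdiff_LA_closed[OF mk(1)[of "i + 1" Y]] by simp
      show "co (MC.mdiff LA (i + 1) (mk (i + 1) Y) \<nu>) m = co (w \<nu>) m" for \<nu> m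
        using w_out[of \<nu> m] cow[of \<nu> m] by (auto simp: mdiff_mk[OF i1] kind_succ[OF 3])
    qed
    then show ?thesis using mk(1) by blast
  qed
qed

section \<open>Counting the cells\<close>

lemma card_box_restricted: "card {m \<in> box. \<forall>j<c. ok j (m (Suc j))} = (\<Prod>j<c. card {x. x < a \<and> ok j x})"
proof -
  have "bij_betw (\<lambda>m. \<lambda>j\<in>{..<c}. m (Suc j)) {m \<in> box. \<forall>j<c. ok j (m (Suc j))} (PiE {..<c} (\<lambda>j. {x. x < a \<and> ok j x}))"
  proof (rule bij_betw_byWitness[where f' = "\<lambda>g i. if i \<in> {1..c} then g (i - 1) else 0"])
    show "\<forall>m\<in>{m \<in> box. \<forall>j<c. ok j (m (Suc j))}. (\<lambda>i. if i \<in> {1..c} then (\<lambda>j\<in>{..<c}. m (Suc j)) (i - 1) else 0) = m"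
    proof (intro ballI ext)
      fix m i assume "m \<in> {m \<in> box. \<forall>j<c. ok j (m (Suc j))}"
      then have m: "m \<in> box" by simp
      show "(if i \<in> {1..c} then (\<lambda>j\<in>{..<c}. m (Suc j)) (i - 1) else 0) = m i"
      proof (cases "i \<in> {1..c}")
        case True
        then have "i - 1 < c" "Suc (i - 1) = i" by auto
        then show ?thesis using True by simp
      next
        case False
        then show ?thesis using boxD(2)[OF m False] by (simp only: if_False)
      qed
    qed
    show "\<forall>g\<in>PiE {..<c} (\<lambda>j. {x. x < a \<and> ok j x}). (\<lambda>j\<in>{..<c}. (\<lambda>i. if i \<in> {1..c} then g (i - 1) else 0) (Suc j)) = g"
      by (auto simp: fun_eq_iff PiE_iff extensional_def)
    show "(\<lambda>m. \<lambda>j\<in>{..<c}. m (Suc j)) ` {m \<in> box. \<forall>j<c. ok j (m (Suc j))} \<subseteq> PiE {..<c} (\<lambda>j. {x. x < a \<and> ok j x})"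
    proof (intro image_subsetI PiE_I)
      fix m j assume "m \<in> {m \<in> box. \<forall>j<c. ok j (m (Suc j))}" "j \<in> {..<c}"
      then show "(\<lambda>j\<in>{..<c}. m (Suc j)) j \<in> {x. x < a \<and> ok j x}" using boxD(1)[of m "Suc j"] by simp
    qed simp
    show "(\<lambda>g i. if i \<in> {1..c} then g (i - 1) else 0) ` PiE {..<c} (\<lambda>j. {x. x < a \<and> ok j x}) \<subseteq> {m \<in> box. \<forall>j<c. ok j (m (Suc j))}"
    proof (intro image_subsetI, rule CollectI, rule conjI)
      fix g assume g: "g \<in> PiE {..<c} (\<lambda>j. {x. x < a \<and> ok j x})"
      then have g': "g j < a \<and> ok j (g j)" if "j < c" for j using that by auto
      have "if i \<in> {1..c} then (if i \<in> {1..c} then g (i - 1) else 0) < a else (if i \<in> {1..c} then g (i - 1) else 0) = 0" for i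
        using g'[of "i - 1"] by auto
      then show "(\<lambda>i. if i \<in> {1..c} then g (i - 1) else 0) \<in> box" unfolding box_def by blast
      show "\<forall>j<c. ok j (if Suc j \<in> {1..c} then g (Suc j - 1) else 0)" using g' by auto
    qed
  qed
  then show ?thesis by (simp add: bij_betw_same_card card_PiE)
qed

text \<open>For a nonzero in the field: a direction with coordinate 0 meets no \<open>v\<close> and
  allows every exponent, while any other direction meets exactly one \<open>v\<close>, which
  excludes one exponent.\<close>

lemma card_critical:
  assumes i: "i \<noteq> 0" "i \<noteq> - 1" and \<nu>: "\<nu> \<in> lattice i"
  shows "card {m \<in> box. critical c i \<nu> m} = (\<Prod>j<c. if \<nu> j = 0 \<or> (of_nat a :: 'k) = 0 then a else a - 1)"
proof (cases "(of_nat a :: 'k) = 0")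
  case True
  then show ?thesis using card_box by (simp add: critical_def)
next
  case False
  define ok where "ok j x \<longleftrightarrow> \<not> (kind i (\<nu> j) = 2 \<and> Suc (x mod a) = a) \<and> \<not> (kind i (\<nu> j - 1) = 2 \<and> x mod a = 0)" for j and x :: nat
  have "card {x. x < a \<and> ok j x} = (if \<nu> j = 0 then a else a - 1)" if "j < c" for j
  proof -
    have sign: "if i > 0 then \<nu> j \<ge> 0 else \<nu> j \<le> 0" using \<nu> i by (auto simp: lattice_def split: if_splits)
    then consider "\<nu> j = 0" "kind i (\<nu> j) \<noteq> 2" "kind i (\<nu> j - 1) \<noteq> 2" | "\<nu> j \<noteq> 0" "kind i (\<nu> j) = 2" "kind i (\<nu> j - 1) \<noteq> 2"
      | "\<nu> j \<noteq> 0" "kind i (\<nu> j) \<noteq> 2" "kind i (\<nu> j - 1) = 2"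
      by (cases "i > 0"; cases "even (\<nu> j)"; cases "\<nu> j = 0") (auto simp: kind_def kind_pos_def kind_neg_def)
    then show ?thesis
    proof cases
      case 1
      then have "{x. x < a \<and> ok j x} = {..<a}" by (auto simp: ok_def)
      then show ?thesis using 1 by simp
    next
      case 2
      then have "{x. x < a \<and> ok j x} = {..<a} - {q}" using Suc_q by (auto simp: ok_def)
      moreover have "q < a" using Suc_q by simp
      ultimately show ?thesis using 2 by (simp add: card_Diff_singleton)
    next
      case 3
      then have "{x. x < a \<and> ok j x} = {..<a} - {0}" by (auto simp: ok_def)
      then show ?thesis using 3 a_ge by (simp add: card_Diff_singleton)
    qed
  qed
  moreover have "{m \<in> box. critical c i \<nu> m} = {m \<in> box. \<forall>j<c. ok j (m (Suc j))}"
    using False by (simp add: critical_def ok_def)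
  ultimately show ?thesis using False by (simp add: card_box_restricted)
qed

lemma bij_lattice: "bij_betw (\<lambda>v j. if j < c then int (v ! j) else 0) (natpermute n c) (lattice (int n))"
proof (rule bij_betw_byWitness[where f' = "\<lambda>\<nu>. map (\<lambda>j. nat (\<nu> j)) [0..<c]"])
  have s: "sum_list v = (\<Sum>j<c. v ! j)" if "length v = c" for v :: "nat list"
    using that by (simp add: sum_list_sum_nth atLeast0LessThan)
  show "\<forall>v\<in>natpermute n c. map (\<lambda>j. nat (if j < c then int (v ! j) else 0)) [0..<c] = v"
    by (auto simp: natpermute_def intro: nth_equalityI)
  show "\<forall>\<nu>\<in>lattice (int n). (\<lambda>j. if j < c then int (map (\<lambda>j. nat (\<nu> j)) [0..<c] ! j) else 0) = \<nu>"
    by (auto simp: lattice_def fun_eq_iff)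
  show "(\<lambda>v j. if j < c then int (v ! j) else 0) ` natpermute n c \<subseteq> lattice (int n)"
    by (auto simp: natpermute_def lattice_def s simp flip: of_nat_sum)
  show "(\<lambda>\<nu>. map (\<lambda>j. nat (\<nu> j)) [0..<c]) ` lattice (int n) \<subseteq> natpermute n c"
  proof (rule image_subsetI)
    fix \<nu> assume "\<nu> \<in> lattice (int n)"
    then have nn: "\<nu> j \<ge> 0" and sum: "(\<Sum>j<c. \<nu> j) = int n" for j by (auto simp: lattice_def)
    have "int (\<Sum>j<c. nat (\<nu> j)) = int n" using nn sum by simp
    then show "map (\<lambda>j. nat (\<nu> j)) [0..<c] \<in> natpermute n c"
      by (simp add: natpermute_def s del: of_nat_sum)
  qed
qed

lemma bij_lattice_neg: "bij_betw (\<lambda>\<nu> j. - \<nu> j) (lattice i) (lattice (- 1 - i))"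
  by (rule bij_betw_byWitness[where f' = "\<lambda>\<nu> j. - \<nu> j"]) (auto simp: lattice_neg)

lemma finite_lattice: "finite (lattice i)"
proof (cases "i \<ge> 0")
  case True
  then show ?thesis using bij_betw_finite[OF bij_lattice[of "nat i"]] natpermute_finite by simp
next
  case False
  then show ?thesis using bij_betw_finite[OF bij_lattice[of "nat (- 1 - i)"]] natpermute_finite
      bij_betw_finite[OF bij_lattice_neg[of i]] by simp
qed

lemma finite_cells: "finite (cells i)"
  by (rule finite_subset[of _ "lattice i \<times> box"]) (auto simp: cells_def finite_lattice finite_box)

lemma card_cells_sum:
  assumes i: "i \<noteq> 0" "i \<noteq> - 1"
  shows "card (cells i) = (\<Sum>\<nu>\<in>lattice i. \<Prod>j<c. if \<nu> j = 0 \<or> (of_nat a :: 'k) = 0 then a else a - 1)"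
proof -
  have "cells i = Sigma (lattice i) (\<lambda>\<nu>. {m \<in> box. critical c i \<nu> m})" using i by (auto simp: cells_def)
  then show ?thesis using i by (simp add: card_SigmaI finite_lattice finite_box card_critical)
qed

lemma card_cells_0: "i = 0 \<or> i = - 1 \<Longrightarrow> card (cells i) = (if (of_nat a :: 'k) = 0 then a ^ c else a ^ c - 1)"
proof -
  assume i: "i = 0 \<or> i = - 1"
  have "cells i = {zero_index} \<times> (if (of_nat a :: 'k) = 0 then box else box - {if i = 0 then (\<lambda>_. 0) else top})"
    using i by (auto simp: cells_def lattice_0 lattice_m1)
  then show ?thesis using top_box zero_box finite_box
    by (simp add: card_cartesian_product card_box card_Diff_singleton)
qed

lemma card_cells_neg: "card (cells (- 1 - i)) = card (cells i)"
proof (cases "i = 0 \<or> i = - 1")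
  case True
  then show ?thesis using card_cells_0[of i] card_cells_0[of "- 1 - i"] by auto
next
  case False
  then have "- 1 - i \<noteq> 0" "- 1 - i \<noteq> - 1" by auto
  then show ?thesis using False
    by (simp add: card_cells_sum sum.reindex_bij_betw[OF bij_lattice_neg[of i], symmetric])
qed

lemma card_cells:
  "card (cells (int n)) = (if (of_nat a :: 'k) = 0 then ((c + n - 1) choose n) * a ^ c
     else if n = 0 then a ^ c - 1
     else (\<Sum>t=0..c. (c choose t) * binom (n - 1) (int n - int c + int t) * a ^ t * (a - 1) ^ (c - t)))"
proof (cases "n = 0")
  case True
  then show ?thesis using card_cells_0[of 0] by simp
next
  case False
  let ?g = "\<lambda>l. if l = 0 \<or> (of_nat a :: 'k) = 0 then a else a - 1"
  have "card (cells (int n)) = (\<Sum>\<nu>\<in>lattice (int n). \<Prod>j<c. if \<nu> j = 0 \<or> (of_nat a :: 'k) = 0 then a else a - 1)"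
    using False by (intro card_cells_sum) auto
  also have "\<dots> = (\<Sum>v\<in>natpermute n c. \<Prod>j<c. ?g (v ! j))"
    by (subst sum.reindex_bij_betw[OF bij_lattice[of n], symmetric]) (auto intro!: sum.cong prod.cong)
  finally have card: "card (cells (int n)) = (\<Sum>v\<in>natpermute n c. \<Prod>j<c. ?g (v ! j))" .
  show ?thesis
  proof (cases "(of_nat a :: 'k) = 0")
    case True
    then show ?thesis using card card_natpermute[OF c_ge, of n] by simp
  next
    case nz: False
    then show ?thesis using card sum_natpermute_zeros[of c n a] c_ge a_ge False by simp
  qed
qed

section \<open>Scalars in the enveloping algebra\<close>

definition scalar :: "'k \<Rightarrow> 'k mpoly set env" where "scalar r = r \<odot>\<^bsub>E\<^esub> \<one>\<^bsub>E\<^esub>"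

lemma scalar_tt: "scalar r = tt (r \<odot>\<^bsub>A\<^esub> \<one>\<^bsub>A\<^esub>) \<one>\<^bsub>A\<^esub>"
proof -
  show ?thesis by (simp add: scalar_def E_simps TP.smult_tens)
qed

lemma scalar_closed [simp]: "scalar r \<in> carrier E"
proof -
  show ?thesis by (simp add: scalar_tt A_smult_closed)
qed

lemma scalar_LA: "b \<in> carrier A \<Longrightarrow> scalar r \<rhd> b = r \<odot>\<^bsub>A\<^esub> b"
    by (simp add: scalar_tt LA_tt A_smult_closed A_smult_mult)

lemma scalar_ring:
  "scalar (r + s) = scalar r \<oplus>\<^bsub>E\<^esub> scalar s" "scalar (r * s) = scalar r \<otimes>\<^bsub>E\<^esub> scalar s" "scalar 1 = \<one>\<^bsub>E\<^esub>"
proof -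
  interpret AK: Module.module Kf A by (rule A_module_K)
  show "scalar (r + s) = scalar r \<oplus>\<^bsub>E\<^esub> scalar s"
    using TP.B.smult_l_distr[of r s "\<one>\<^bsub>A\<^esub>"] by (simp add: scalar_tt E_simps A_smult_closed flip: TP.tens_add_l)
  show "scalar (r * s) = scalar r \<otimes>\<^bsub>E\<^esub> scalar s"
    using TP.B.smult_assoc1[of s r "\<one>\<^bsub>A\<^esub>"]
    by (subst mult.commute) (simp add: scalar_tt E_mult_tt A_smult_closed A_smult_mult)
  show "scalar 1 = \<one>\<^bsub>E\<^esub>"
    using TP.B.smult_one[of "\<one>\<^bsub>A\<^esub>"] by (simp add: scalar_tt E_simps)
qed

section \<open>The Frobenius form\<close>

abbreviation "RA \<equiv> right_env_module A"

lemma RA_simps [simp]: "carrier RA = carrier A" "x \<oplus>\<^bsub>RA\<^esub> y = x \<oplus>\<^bsub>A\<^esub> y" "\<zero>\<^bsub>RA\<^esub> = \<zero>\<^bsub>A\<^esub>"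
  by (simp_all add: right_env_module_def)

text \<open>\<open>A\<close> is commutative, so the right action coincides with the left
  one.\<close>

lemma RA_eq:
  assumes C: "C \<in> carrier E" and b: "b \<in> carrier A"
  shows "C \<odot>\<^bsub>RA\<^esub> b = C \<rhd> b"
proof -
  let ?l = "\<lambda>x y. x \<star> b \<star> y" and ?r = "\<lambda>x y. y \<star> b \<star> x"
  have eq: "?r x y = ?l x y" if "x \<in> carrier A" "y \<in> carrier A" for x y
    using that b by (simp add: A.m_ac)
  have l: "bilinear ?l" by (rule bilinear_action[OF b])
  then have r: "bilinear ?r"
    using b by (auto simp: bilinear_def TP.balanced_def eq A_smult_closed)
  have bal: "TP.balanced (\<lambda>x y. co (?l x y) m)" "TP.balanced (\<lambda>x y. co (?r x y) m)" for m
    using l r by (simp_all add: bilinear_def)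
  have "TP.tlift (\<lambda>x y. co (?r x y) m) C = TP.tlift (\<lambda>x y. co (?l x y) m) C" for m
    using C unfolding E_simps
  proof (induction rule: TP.tens_induct)
    case zero
    then show ?case by (simp only: TP.tlift_zero[OF bal(1)] TP.tlift_zero[OF bal(2)])
  next
    case (tens x y D)
    then have "x \<in> carrier A" "y \<in> carrier A" by simp_all
    then show ?case using tens
      by (simp only: TP.tlift_add[OF bal(1)] TP.tlift_add[OF bal(2)] TP.tlift_tens[OF bal(1)] TP.tlift_tens[OF bal(2)] TP.tens_closed eq)
  qed
  then have "env_eval A ?r C = env_eval A ?l C"
    using env_eval[OF l C] env_eval[OF r C] by (intro co_eqI) simp_all
  then show ?thesis by (simp add: right_env_module_def left_env_module_def)
qed

lemma RA_module: "Module.module E RA"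
proof -
  have "abelian_group RA"
  proof (rule abelian_groupI)
    fix x assume "x \<in> carrier RA"
    then show "\<exists>y\<in>carrier RA. y \<oplus>\<^bsub>RA\<^esub> x = \<zero>\<^bsub>RA\<^esub>" by (intro bexI[of _ "\<ominus>\<^bsub>A\<^esub> x"]) (simp_all add: TP.B.l_neg)
  qed (simp_all add: TP.B.a_ac)
  then show ?thesis
    using LA.smult_l_distr LA.smult_r_distr LA.smult_assoc1 LA.smult_one
    by (intro moduleI E_cring) (simp_all add: RA_eq LA_closed)
qed

text \<open>\<open>E\<close> acts by multiplications of \<open>A\<close>, so it is self-adjoint for
  any form that depends on the product only.\<close>

lemma action_adjoint:
  assumes "C \<in> carrier E" and b: "b \<in> carrier A" and s: "s \<in> carrier A"
  shows "(C \<rhd> b) \<star> s = b \<star> (C \<rhd> s)"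
  using assms(1)
proof (induction rule: E_induct)
  case zero
  then show ?case using b s by (simp add: E_zero_LA)
next
  case (tens x y D)
  then show ?case using b s
    by (simp add: LA_add LA_tt LA_closed A.l_distr A.r_distr A.m_ac)
qed

lemma basis_var:
  assumes m: "m \<in> box" and i: "i \<in> {1..c}" and pos: "m i > 0"
  shows "m(i := m i - 1) \<in> box" "basis m = var i \<star> basis (m(i := m i - 1))"
proof -
  have l: "(m(i := m i - 1)) j < a" if "j \<in> {1..c}" for j using boxD(1)[OF m that] by auto
  have "(m(i := m i - 1)) j = 0" if "j \<notin> {1..c}" for j using boxD(2)[OF m that] i that by auto
  then have "if j \<in> {1..c} then (m(i := m i - 1)) j < a else (m(i := m i - 1)) j = 0" for j
    using l by (cases "j \<in> {1..c}") (simp_all only: if_True if_False)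
  then show m': "m(i := m i - 1) \<in> box" unfolding box_def by blast
  have eq: "\<mu>(i := \<mu> i - 1) = m(i := m i - 1) \<longleftrightarrow> \<mu> = m" if "\<mu> i > 0" for \<mu>
  proof
    assume e: "\<mu>(i := \<mu> i - 1) = m(i := m i - 1)"
    show "\<mu> = m"
    proof
      show "\<mu> j = m j" for j using fun_cong[OF e, of j] pos that by (cases "j = i") auto
    qed
  qed simp
  show "basis m = var i \<star> basis (m(i := m i - 1))"
  proof (rule co_eqI)
    show "co (basis m) \<mu> = co (var i \<star> basis (m(i := m i - 1))) \<mu>" for \<mu>
      using m pos eq[of \<mu>] by (simp only: basis[OF m] basis[OF m'] co_var_mult[OF i basis(1)[OF m']]) auto
    show "basis m \<in> carrier A" by (rule basis(1)[OF m])
    show "var i \<star> basis (m(i := m i - 1)) \<in> carrier A" by (rule A.m_closed[OF var_closed[OF i] basis(1)[OF m']])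
  qed
qed

lemma top_minus_box: "(\<lambda>i. top i - m i) \<in> box"
proof -
  have "if j \<in> {1..c} then top j - m j < a else top j - m j = 0" for j
  proof (cases "j \<in> {1..c}")
    case True
    then show ?thesis using boxD(1)[OF top_box True] by (simp only: if_True less_imp_diff_less)
  next
    case False
    then show ?thesis using boxD(2)[OF top_box False] by (simp only: if_False diff_0_eq_0)
  qed
  then show ?thesis unfolding box_def by blast
qed

text \<open>The form pairs each monomial with its complement in the socle monomial. By induction on
  the degree, one variable after another is moved to the second factor.\<close>

lemma co_basis_mult_top:
  "m \<in> box \<Longrightarrow> s \<in> carrier A \<Longrightarrow> co (basis m \<star> s) top = co s (\<lambda>i. top i - m i)"
proof (induction "\<Sum>i\<in>{1..c}. m i" arbitrary: m s)
  case 0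
  have "m = (\<lambda>_. 0)"
  proof
    fix i show "m i = 0"
      using 0(1) boxD(2)[OF 0(2), of i] by (cases "i \<in> {1..c}") auto
  qed
  then have "basis m = \<one>\<^bsub>A\<^esub>" using basis[OF 0(2)] by (intro co_eqI) (simp_all add: co_one)
  then show ?case using 0 \<open>m = (\<lambda>_. 0)\<close> by simp
next
  case (Suc k)
  have "\<exists>i\<in>{1..c}. m i > 0"
  proof (rule ccontr)
    assume "\<not> ?thesis"
    then have "(\<Sum>i\<in>{1..c}. m i) = 0" by (intro sum.neutral) (metis gr0I)
    then show False using Suc(2) by simp
  qed
  then obtain i where i: "i \<in> {1..c}" "m i > 0" by blast
  let ?m = "m(i := m i - 1)"
  note bv = basis_var[OF Suc(3) i]
  have "(\<Sum>j\<in>{1..c}. m j) = m i + (\<Sum>j\<in>{1..c} - {i}. m j)" "(\<Sum>j\<in>{1..c}. ?m j) = ?m i + (\<Sum>j\<in>{1..c} - {i}. ?m j)"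
    by (rule sum.remove[OF finite_atLeastAtMost i(1)])+
  moreover have "(\<Sum>j\<in>{1..c} - {i}. ?m j) = (\<Sum>j\<in>{1..c} - {i}. m j)" by (intro sum.cong) auto
  ultimately have k: "k = (\<Sum>j\<in>{1..c}. ?m j)" using Suc(2) i(2) by simp
  have vs: "var i \<star> s \<in> carrier A" using var_closed[OF i(1)] Suc(4) by simp
  have "basis m \<star> s = basis ?m \<star> (var i \<star> s)"
    unfolding bv(2) using var_closed[OF i(1)] basis(1)[OF bv(1)] Suc(4) by (simp only: A.m_ac A.m_closed)
  then have "co (basis m \<star> s) top = co (var i \<star> s) (\<lambda>j. top j - ?m j)"
    using Suc(1)[OF k bv(1) vs] by simp
  also have "co (var i \<star> s) (\<lambda>j. top j - ?m j) = co s ((\<lambda>j. top j - ?m j)(i := top i - ?m i - 1))"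
  proof -
    have "m i \<le> top i" using boxD(1)[OF Suc(3) i(1)] i(1) Suc_q by (simp add: top_def)
    then have "top i - ?m i > 0" using i(2) by simp
    then show ?thesis using top_minus_box[of ?m] co_var_mult[OF i(1) Suc(4), of "\<lambda>j. top j - ?m j"] by simp
  qed
  also have "(\<lambda>j. top j - ?m j)(i := top i - ?m i - 1) = (\<lambda>j. top j - m j)" using i(2) by auto
  finally show ?case .
qed

lemma top_minus_top_minus: "m \<in> box \<Longrightarrow> (\<lambda>i. top i - (top i - m i)) = m"
proof
  fix i assume m: "m \<in> box"
  show "top i - (top i - m i) = m i"
  proof (cases "i \<in> {1..c}")
    case True
    then have "m i \<le> top i" using boxD(1)[OF m True] Suc_q by (simp add: top_def)
    then show ?thesis by simp
  next
    case False
    then show ?thesis using boxD(2)[OF m False] by simp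
  qed
qed

lemma form_nondegenerate:
  assumes s: "s \<in> carrier A" "s' \<in> carrier A" and eq: "\<And>b. b \<in> carrier A \<Longrightarrow> co (b \<star> s) top = co (b \<star> s') top"
  shows "s = s'"
proof (rule co_eqI[OF s])
  fix m show "co s m = co s' m"
  proof (cases "m \<in> box")
    case True
    then show ?thesis
      using eq[OF basis(1)[OF top_minus_box[of m]]] s
      by (simp add: co_basis_mult_top top_minus_box top_minus_top_minus)
  qed (simp add: co_outside s)
qed

text \<open>The coefficient of \<open>s\<close> at an exponent is the value of the functional at the
  complementary monomial.\<close>

lemma form_represents:
  assumes add: "\<And>x y. x \<in> carrier A \<Longrightarrow> y \<in> carrier A \<Longrightarrow> \<chi> (x \<oplus>\<^bsub>A\<^esub> y) = \<chi> x + (\<chi> y :: 'k)"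
    and smult: "\<And>r x. x \<in> carrier A \<Longrightarrow> \<chi> (r \<odot>\<^bsub>A\<^esub> x) = r * \<chi> x"
  shows "\<exists>s\<in>carrier A. \<forall>b\<in>carrier A. co (b \<star> s) top = \<chi> b"
proof -
  obtain s where s: "s \<in> carrier A" "\<And>m. co s m = (if m \<in> box then \<chi> (basis (\<lambda>i. top i - m i)) else 0)"
    using co_surj[of "\<lambda>m. if m \<in> box then \<chi> (basis (\<lambda>i. top i - m i)) else 0"] by auto
  have \<chi>0: "\<chi> \<zero>\<^bsub>A\<^esub> = 0"
    using add[of "\<zero>\<^bsub>A\<^esub>" "\<zero>\<^bsub>A\<^esub>"] by (simp only: TP.B.r_zero TP.B.zero_closed add_cancel_right_right simp_thms)
  have fin: "\<chi> (finsum A h S) = (\<Sum>j\<in>S. \<chi> (h j))" if "h \<in> S \<rightarrow> carrier A" for h :: "(nat \<Rightarrow> nat) \<Rightarrow> 'k mpoly set" and S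
    using that by (induction S rule: infinite_finite_induct) (simp_all add: \<chi>0 add Pi_def)
  have "co (b \<star> s) top = \<chi> b" if b: "b \<in> carrier A" for b
  proof -
    have c: "(\<lambda>m. co b m \<odot>\<^bsub>A\<^esub> basis m) \<in> box \<rightarrow> carrier A" using basis A_smult_closed by auto
    have "b \<star> s = (\<Oplus>\<^bsub>A\<^esub>m\<in>box. (co b m \<odot>\<^bsub>A\<^esub> basis m) \<star> s)"
      by (subst basis_expansion[OF b]) (rule A.finsum_ldistr[OF finite_box s(1) c])
    then have "co (b \<star> s) top = (\<Sum>m\<in>box. co ((co b m \<odot>\<^bsub>A\<^esub> basis m) \<star> s) top)"
      using s(1) c by (simp add: co_finsum Pi_def)
    also have "\<dots> = (\<Sum>m\<in>box. \<chi> (co b m \<odot>\<^bsub>A\<^esub> basis m))"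
    proof (rule sum.cong[OF refl])
      fix m assume m: "m \<in> box"
      have "co ((co b m \<odot>\<^bsub>A\<^esub> basis m) \<star> s) top = co b m * co s (\<lambda>i. top i - m i)"
        using m s(1) basis(1)[OF m] by (simp add: A_smult_mult co_smult co_basis_mult_top)
      then show "co ((co b m \<odot>\<^bsub>A\<^esub> basis m) \<star> s) top = \<chi> (co b m \<odot>\<^bsub>A\<^esub> basis m)"
        using m basis(1)[OF m] by (simp add: s(2) top_minus_box top_minus_top_minus smult)
    qed
    also have "\<dots> = \<chi> b" by (simp only: fin[OF c, symmetric] basis_expansion[OF b, symmetric])
    finally show ?thesis .
  qed
  then show ?thesis using s(1) by blast
qed

end

section \<open>Cohomology\<close>

locale ci_resolution = ci_setup c a A
  for c a :: nat and A :: "('k::field, 'k mpoly set) module" +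
  fixes T :: "('k mpoly set env, 'm) mod_complex"
  assumes T: "complete_resolution E LA T"
begin

interpretation E: cring E by (rule E_cring)
interpretation A: cring A by (rule A_cring)
interpretation LA: Module.module E LA by (rule LA_module)
interpretation TS: tate_setup E lattice "{..<c}" coef target LA T "\<one>\<^bsub>A\<^esub>" "NN c" zero_index
  by (rule tate_setup[OF T])

lemma T_mod: "Module.module E (cobj T n)"
  and T_cdiff: "cdiff T n \<in> Hom E (cobj T n) (cobj T (n - 1))"
  and T_cdiff_cdiff: "x \<in> carrier (cobj T n) \<Longrightarrow> cdiff T (n - 1) (cdiff T n x) = \<zero>\<^bsub>cobj T (n - 2)\<^esub>"
  using T by (auto simp: complete_resolution_def chain_complex_def)

lemma T_cdiff1: "cdiff T (n + 1) \<in> Hom E (cobj T (n + 1)) (cobj T n)"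
  using T_cdiff[of "n + 1"] by simp

definition cocyc :: "int \<Rightarrow> ('m \<Rightarrow> 'k mpoly set) set" where
  "cocyc n = {f \<in> Hom E (cobj T n) LA. \<forall>x\<in>carrier (cobj T (n + 1)). f (cdiff T (n + 1) x) = \<zero>\<^bsub>A\<^esub>}"

definition cobound :: "int \<Rightarrow> ('m \<Rightarrow> 'k mpoly set) \<Rightarrow> bool" where
  "cobound n f \<longleftrightarrow> (\<exists>h\<in>Hom E (cobj T (n - 1)) LA. \<forall>x\<in>carrier (cobj T n). f x = h (cdiff T n x))"

text \<open>Coordinates for cohomology, kept on cocycles instead of classes so that the homology
  computation can dualize them. The cells have degree -1-n because of the shift.\<close>

definition coordinates_on :: "int \<Rightarrow> (('m \<Rightarrow> 'k mpoly set) \<Rightarrow> (nat \<Rightarrow> int) \<times> (nat \<Rightarrow> nat) \<Rightarrow> 'k) \<Rightarrow> bool" where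
  "coordinates_on n \<Theta> \<longleftrightarrow> (\<forall>r. \<forall>f\<in>cocyc n. \<forall>g\<in>cocyc n. (\<lambda>x. scalar r \<rhd> f x \<oplus>\<^bsub>A\<^esub> g x) \<in> cocyc n
      \<and> (\<forall>i. \<Theta> (\<lambda>x. scalar r \<rhd> f x \<oplus>\<^bsub>A\<^esub> g x) i = r * \<Theta> f i + \<Theta> g i))
    \<and> (\<forall>f\<in>cocyc n. cobound n f \<longleftrightarrow> (\<forall>i. \<Theta> f i = 0))
    \<and> \<Theta> ` cocyc n = {w :: (nat \<Rightarrow> int) \<times> (nat \<Rightarrow> nat) \<Rightarrow> 'k. \<forall>i. i \<notin> cells (- 1 - n) \<longrightarrow> w i = 0}"

lemma coordinates_onD:
  assumes "coordinates_on n \<Theta>"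
  shows "f \<in> cocyc n \<Longrightarrow> g \<in> cocyc n \<Longrightarrow> (\<lambda>x. scalar r \<rhd> f x \<oplus>\<^bsub>A\<^esub> g x) \<in> cocyc n"
    "f \<in> cocyc n \<Longrightarrow> g \<in> cocyc n \<Longrightarrow> \<Theta> (\<lambda>x. scalar r \<rhd> f x \<oplus>\<^bsub>A\<^esub> g x) i = r * \<Theta> f i + \<Theta> g i"
    "f \<in> cocyc n \<Longrightarrow> cobound n f \<longleftrightarrow> (\<forall>i. \<Theta> f i = 0)"
    "\<Theta> ` cocyc n = {w. \<forall>i. i \<notin> cells (- 1 - n) \<longrightarrow> w i = 0}"
  using assms unfolding coordinates_on_def by (simp_all del: split_paired_All)

lemma ex_coordinates_on: "\<exists>\<Theta>. coordinates_on n \<Theta>"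
proof -
  let ?i = "- 1 - n"
  define V where "V = {w \<in> carrier (MC.chains LA ?i). MC.mdiff LA ?i w = (\<lambda>_. \<zero>\<^bsub>A\<^esub>)}"
  define \<theta> where "\<theta> w p = (if p \<in> cells ?i then co (w (fst p)) (snd p) else 0)" for w :: "(nat \<Rightarrow> int) \<Rightarrow> 'k mpoly set" and p
  have Vc: "w \<nu> \<in> carrier A" if "w \<in> V" for w \<nu>
    using MC.chains_closed[OF LA_module, of w ?i \<nu>] that by (simp add: V_def)
  have corr: "correspond (carrier E) (cocyc n, cobound n, \<lambda>r f g x. r \<rhd> f x \<oplus>\<^bsub>A\<^esub> g x)
     (V, \<lambda>w. \<exists>y\<in>carrier (MC.chains LA (?i + 1)). MC.mdiff LA (?i + 1) y = w, \<lambda>r w w' \<nu>. r \<rhd> w \<nu> \<oplus>\<^bsub>A\<^esub> w' \<nu>)"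
    using TS.tate_correspond[of n] unfolding TS.coA_def TS.wcyc_def V_def cocyc_def cobound_def[abs_def] LA_simps .
  have lin: "\<theta> (\<lambda>\<nu>. scalar r \<rhd> w \<nu> \<oplus>\<^bsub>A\<^esub> w' \<nu>) p = r * \<theta> w p + \<theta> w' p" if "w \<in> V" "w' \<in> V" for r w w' p
    using Vc[OF that(1)] Vc[OF that(2)] by (simp add: \<theta>_def scalar_LA A_smult_closed co_add co_smult)
  have ker: "(\<exists>y\<in>carrier (MC.chains LA (?i + 1)). MC.mdiff LA (?i + 1) y = w) \<longleftrightarrow> (\<forall>p. \<theta> w p = 0)" if w: "w \<in> V" for w
  proof
    assume "\<exists>y\<in>carrier (MC.chains LA (?i + 1)). MC.mdiff LA (?i + 1) y = w"
    then show "\<forall>p. \<theta> w p = 0" using boundary_cells[of _ ?i] by (auto simp: \<theta>_def)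
  next
    assume 0: "\<forall>p. \<theta> w p = 0"
    show "\<exists>y\<in>carrier (MC.chains LA (?i + 1)). MC.mdiff LA (?i + 1) y = w"
    proof (rule cells_boundary)
      show "co (w \<nu>) m = 0" if "(\<nu>, m) \<in> cells ?i" for \<nu> m using 0[rule_format, of "(\<nu>, m)"] that by (simp add: \<theta>_def)
    qed (use w in \<open>simp_all add: V_def\<close>)
  qed
  have im: "\<theta> ` V = {w. \<forall>i. i \<notin> cells ?i \<longrightarrow> w i = 0}"
  proof (intro equalityI subsetI)
    fix w assume "w \<in> {w. \<forall>i. i \<notin> cells ?i \<longrightarrow> w i = (0 :: 'k)}"
    then have w: "w p = 0" if "p \<notin> cells ?i" for p using that by (simp only: mem_Collect_eq) blast
    have "mk ?i (\<lambda>\<nu> m. w (\<nu>, m)) \<in> V"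
      using mk(1) cells_cycle[of ?i "\<lambda>\<nu> m. w (\<nu>, m)"] w by (simp add: V_def)
    moreover have "\<theta> (mk ?i (\<lambda>\<nu> m. w (\<nu>, m))) = w"
      using w by (auto simp: \<theta>_def mk(2) cells_def fun_eq_iff)
    ultimately show "w \<in> \<theta> ` V" by (metis image_eqI)
  qed (auto simp: \<theta>_def)
  show ?thesis
    using correspond_coordinates[OF corr scalar_closed, of \<theta>, OF lin ker] unfolding im coordinates_on_def .
qed

lemma cobound_coboundary:
  assumes "f \<in> extensional (carrier (cobj T n))"
  shows "cobound n f \<longleftrightarrow> f \<in> coboundary T (n - 1) ` carrier (hom_module E (cobj T (n - 1)) LA)"
proof
  interpret Tn: Module.module E "cobj T (n - 1)" by (rule T_mod)
  assume "cobound n f"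
  then obtain h where h: "h \<in> Hom E (cobj T (n - 1)) LA"
    "\<And>x. x \<in> carrier (cobj T n) \<Longrightarrow> f x = h (cdiff T n x)" by (auto simp: cobound_def)
  have "f = coboundary T (n - 1) (restrict h (carrier (cobj T (n - 1))))"
    using assms h(2) module_homD(1)[OF T_cdiff[of n]] by (auto simp: coboundary_def fun_eq_iff extensional_def)
  then show "f \<in> coboundary T (n - 1) ` carrier (hom_module E (cobj T (n - 1)) LA)"
    using module_hom_restrict[OF T_mod h(1)] by (intro image_eqI) auto
next
  assume "f \<in> coboundary T (n - 1) ` carrier (hom_module E (cobj T (n - 1)) LA)"
  then show "cobound n f" by (auto simp: cobound_def coboundary_def)
qed

lemma kernel_coboundary:
  "f \<in> kernel_of (hom_module E (cobj T n) LA) (coboundary T n) (hom_module E (cobj T (n + 1)) LA)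
    \<longleftrightarrow> f \<in> cocyc n \<and> f \<in> extensional (carrier (cobj T n))"
  by (auto simp: kernel_of_def cocyc_def coboundary_def fun_eq_iff)

lemma restrict_cocyc: "f \<in> cocyc n \<Longrightarrow> restrict f (carrier (cobj T n)) \<in> cocyc n"
  using module_hom_restrict[OF T_mod, of f n LA] module_homD(1)[OF T_cdiff1[of n]] by (simp add: cocyc_def)

lemma zero_cocyc: "(\<lambda>_. \<zero>\<^bsub>A\<^esub>) \<in> cocyc n" and zero_cobound: "cobound n (\<lambda>_. \<zero>\<^bsub>A\<^esub>)"
  using module_hom_zero_map[OF T_mod LA_module, of n] module_hom_zero_map[OF T_mod LA_module, of "n - 1"]
  by (auto simp: cocyc_def cobound_def)

lemma cobound_cong: "(\<And>x. x \<in> carrier (cobj T n) \<Longrightarrow> f x = g x) \<Longrightarrow> cobound n f \<longleftrightarrow> cobound n g"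
  by (simp add: cobound_def)

lemma cocyc_closed: "f \<in> cocyc n \<Longrightarrow> x \<in> carrier (cobj T n) \<Longrightarrow> f x \<in> carrier A"
  using module_homD(1)[of f E "cobj T n" LA x] by (simp add: cocyc_def)

lemma dim_cohomology:
  "fd_space (tate_HH_cohomology Kf A T LA n) \<and> k_dim (tate_HH_cohomology Kf A T LA n) = card (cells (- 1 - n))"
proof -
  obtain \<Theta> where "coordinates_on n \<Theta>" using ex_coordinates_on by blast
  note \<Theta> = coordinates_onD[OF this]
  let ?H = "hom_module E (cobj T n) LA" and ?C = "carrier (cobj T n)"
  let ?Z = "kernel_of ?H (coboundary T n) (hom_module E (cobj T (n + 1)) LA)"
  let ?B = "coboundary T (n - 1) ` carrier (hom_module E (cobj T (n - 1)) LA)"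
  note hm = hom_module_module[OF T_mod LA_module]
  \<comment> \<open>The cochain module holds extensional maps only, whereas \<open>cocyc\<close>
    does not fix values off the carrier. Cocycles that agree on the carrier differ by a coboundary,
    so their coordinates agree.\<close>
  have cong: "\<Theta> f i = \<Theta> g i" if f: "f \<in> cocyc n" and g: "g \<in> cocyc n" and eq: "\<And>x. x \<in> ?C \<Longrightarrow> f x = g x" for f g i
  proof -
    have "cobound n (\<lambda>x. scalar (- 1) \<rhd> f x \<oplus>\<^bsub>A\<^esub> g x) \<longleftrightarrow> cobound n (\<lambda>_. \<zero>\<^bsub>A\<^esub>)"
    proof (rule cobound_cong)
      fix x assume x: "x \<in> ?C"
      have gx: "g x \<in> carrier A" by (rule cocyc_closed[OF g x])
      show "scalar (- 1) \<rhd> f x \<oplus>\<^bsub>A\<^esub> g x = \<zero>\<^bsub>A\<^esub>"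
        using gx by (intro co_eqI) (simp_all add: eq[OF x] scalar_LA A_smult_closed co_add co_smult co_zero)
    qed
    then show ?thesis using \<Theta>(3)[OF \<Theta>(1)[OF f g, of "- 1"]] \<Theta>(2)[OF f g, of "- 1" i] zero_cobound by (simp del: split_paired_All)
  qed
  have z0: "\<Theta> (\<lambda>_. \<zero>\<^bsub>A\<^esub>) i = 0" for i using \<Theta>(3)[OF zero_cocyc] zero_cobound by (simp del: split_paired_All)
  have bd: "coboundary T (n - 1) \<in> Hom E (hom_module E (cobj T (n - 1)) LA) ?H"
    using coboundary_hom[OF T_mod T_mod T_cdiff1 LA_module, of "n - 1"] by simp
  have "fd_space (restrict_scalars E (quotient (?H\<lparr>carrier := ?Z\<rparr>) ?B))
    \<and> k_dim (restrict_scalars E (quotient (?H\<lparr>carrier := ?Z\<rparr>) ?B)) = card (cells (- 1 - n))"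
  proof (rule dim_quotient[where \<Theta> = \<Theta>])
    show Z: "axpy_closed E ?H ?Z"
      by (rule axpy_closed_kernel[OF hm hom_module_module[OF T_mod LA_module] coboundary_hom[OF T_mod T_mod T_cdiff1 LA_module]])
    show "axpy_closed E ?H ?B" by (rule axpy_closed_image[OF hom_module_module[OF T_mod LA_module] hm bd])
    show "?B \<subseteq> ?Z"
    proof
      fix f assume f: "f \<in> ?B"
      then obtain h where h: "h \<in> Hom E (cobj T (n - 1)) LA" "f = coboundary T (n - 1) h" by auto
      have "f \<in> carrier ?H" using f module_homD(1)[OF bd] by blast
      moreover have "f (cdiff T (n + 1) x) = \<zero>\<^bsub>A\<^esub>" if "x \<in> carrier (cobj T (n + 1))" for x
        using that T_cdiff_cdiff[of x "n + 1"] module_homD(1)[OF T_cdiff1[of n] that] module_hom_zero[OF T_mod LA_module h(1)]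
        by (simp add: h(2) coboundary_def)
      ultimately show "f \<in> ?Z" by (simp add: kernel_coboundary cocyc_def)
    qed
    show "finite (cells (- 1 - n))" by (rule finite_cells)
    show "\<Theta> (f \<oplus>\<^bsub>?H\<^esub> g) i = \<Theta> f i + \<Theta> g i" if "f \<in> ?Z" "g \<in> ?Z" for f g i
    proof -
      have fg: "f \<in> cocyc n" "g \<in> cocyc n" "f \<oplus>\<^bsub>?H\<^esub> g \<in> cocyc n"
        using that submoduleD(3)[OF hm Z that] unfolding kernel_coboundary by blast+
      have "\<Theta> (f \<oplus>\<^bsub>?H\<^esub> g) i = \<Theta> (\<lambda>x. scalar 1 \<rhd> f x \<oplus>\<^bsub>A\<^esub> g x) i"
        using LA.smult_one cocyc_closed[OF fg(1)] by (intro cong fg \<Theta>(1)) (simp_all add: scalar_ring)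
      then show ?thesis using \<Theta>(2)[OF fg(1,2), of 1] by simp
    qed
    show "\<Theta> ((r \<odot>\<^bsub>E\<^esub> \<one>\<^bsub>E\<^esub>) \<odot>\<^bsub>?H\<^esub> f) i = r * \<Theta> f i" if "f \<in> ?Z" for r f i
    proof -
      have f: "f \<in> cocyc n" "scalar r \<odot>\<^bsub>?H\<^esub> f \<in> cocyc n"
        using that submoduleD(4)[OF hm Z scalar_closed that] unfolding kernel_coboundary by blast+
      have "\<Theta> (scalar r \<odot>\<^bsub>?H\<^esub> f) i = \<Theta> (\<lambda>x. scalar r \<rhd> f x \<oplus>\<^bsub>A\<^esub> \<zero>\<^bsub>A\<^esub>) i"
        using cocyc_closed[OF f(1)] LA_closed[OF scalar_closed] by (intro cong f \<Theta>(1) zero_cocyc) simp_all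
      then show ?thesis using \<Theta>(2)[OF f(1) zero_cocyc, of r] z0 by (simp add: scalar_def)
    qed
    show "\<Theta> f i = 0" if "f \<in> ?Z" "i \<notin> cells (- 1 - n)" for f i
    proof -
      have "\<Theta> f \<in> \<Theta> ` cocyc n" using that unfolding kernel_coboundary by blast
      then show ?thesis using that(2) unfolding \<Theta>(4) by blast
    qed
    show "\<exists>f\<in>?Z. \<Theta> f = w" if "\<And>i. i \<notin> cells (- 1 - n) \<Longrightarrow> w i = 0" for w
    proof -
      have "w \<in> \<Theta> ` cocyc n" unfolding \<Theta>(4) using that by blast
      then obtain f where f: "f \<in> cocyc n" "w = \<Theta> f" by blast
      have "\<Theta> (restrict f ?C) = w" unfolding f(2) by (rule ext, rule cong[OF restrict_cocyc[OF f(1)] f(1)]) simp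
      moreover have "restrict f ?C \<in> ?Z" unfolding kernel_coboundary using restrict_cocyc[OF f(1)] by simp
      ultimately show ?thesis by blast
    qed
    show "(\<forall>i. \<Theta> f i = 0) \<longleftrightarrow> f \<in> ?B" if "f \<in> ?Z" for f
    proof -
      have f: "f \<in> cocyc n" "f \<in> extensional ?C" using that unfolding kernel_coboundary by blast+
      show ?thesis using \<Theta>(3)[OF f(1)] cobound_coboundary[OF f(2)] by blast
    qed
  qed (rule hm, fold scalar_def, rule scalar_closed)
  then show ?thesis by (simp only: tate_HH_cohomology_def homology_at_def Let_def)
qed

section \<open>Homology\<close>

interpretation TN: tensor_pair E RA "cobj T n" for n
  by (intro tensor_pair.intro RA_module T_mod)

abbreviation "AT n \<equiv> tensor_module E RA (cobj T n)"
abbreviation "dAT n \<equiv> tensor_map E RA (cobj T (n - 1)) (cdiff T n)"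
abbreviation "AT_K n \<equiv> restrict_scalars E (AT n)"

lemma AT_module: "Module.module E (AT n)" by (rule TN.BM_module)

lemma AT_K_module: "Module.module Kf (AT_K n)"
  by (rule restrict_scalars_module[OF AT_module]) (use scalar_ring scalar_closed in \<open>simp_all add: scalar_def\<close>)

lemma dAT_hom: "dAT n \<in> Hom E (AT n) (AT (n - 1))"
  by (rule TN.tensor_map_hom[OF T_mod T_cdiff])

lemma dAT_tens: "b \<in> carrier A \<Longrightarrow> t \<in> carrier (cobj T n) \<Longrightarrow> dAT n (TN.tens n b t) = TN.tens (n - 1) b (cdiff T n t)"
  using TN.tensor_map_tens[OF T_mod T_cdiff, of b t] by simp

text \<open>The Frobenius form turns a map from T_n to \<open>A\<close> into a functional on
  \<open>A\<close> tensor T_n; through it Hom(T_n, A) becomes the dual space.\<close>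

definition pairing :: "int \<Rightarrow> ('m \<Rightarrow> 'k mpoly set) \<Rightarrow> ('k mpoly set \<times> 'm \<Rightarrow>\<^sub>0 int) set \<Rightarrow> 'k" where
  "pairing n f = TN.tlift (\<lambda>b t. co (b \<star> f t) top)"

lemma pairing_balanced:
  assumes f: "f \<in> Hom E (cobj T n) LA"
  shows "TN.balanced n (\<lambda>b t. co (b \<star> f t) top)"
proof -
  note fD = module_homD[OF f, simplified]
  show ?thesis
    by (auto simp: TN.balanced_def fD A.l_distr A.r_distr co_add RA_eq action_adjoint)
qed

lemma pairing_tens:
  "f \<in> Hom E (cobj T n) LA \<Longrightarrow> pairing n f (TN.tens n b t) = co (b \<star> f t) top"
  unfolding pairing_def by (rule TN.tlift_tens[OF pairing_balanced])

lemma pairing_add: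
  "f \<in> Hom E (cobj T n) LA \<Longrightarrow> x \<in> carrier (AT n) \<Longrightarrow> y \<in> carrier (AT n)
    \<Longrightarrow> pairing n f (x \<oplus>\<^bsub>AT n\<^esub> y) = pairing n f x + pairing n f y"
  unfolding pairing_def by (rule TN.tlift_add[OF pairing_balanced])

lemma pairing_zero:
  "f \<in> Hom E (cobj T n) LA \<Longrightarrow> pairing n f \<zero>\<^bsub>AT n\<^esub> = 0"
  unfolding pairing_def by (rule TN.tlift_zero[OF pairing_balanced])

lemma AT_eqI:
  fixes \<phi> \<psi> :: "('k mpoly set \<times> 'm \<Rightarrow>\<^sub>0 int) set \<Rightarrow> 'k"
  assumes z: "z \<in> carrier (AT n)"
    and add: "\<And>x y. x \<in> carrier (AT n) \<Longrightarrow> y \<in> carrier (AT n) \<Longrightarrow> \<phi> (x \<oplus>\<^bsub>AT n\<^esub> y) = \<phi> x + \<phi> y"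
      "\<And>x y. x \<in> carrier (AT n) \<Longrightarrow> y \<in> carrier (AT n) \<Longrightarrow> \<psi> (x \<oplus>\<^bsub>AT n\<^esub> y) = \<psi> x + \<psi> y"
    and tens: "\<And>b t. b \<in> carrier A \<Longrightarrow> t \<in> carrier (cobj T n) \<Longrightarrow> \<phi> (TN.tens n b t) = \<psi> (TN.tens n b t)"
  shows "\<phi> z = \<psi> z"
  using z
proof (induction rule: TN.tens_induct)
  case zero
  interpret X: Module.module E "AT n" by (rule AT_module)
  have "\<phi> \<zero>\<^bsub>AT n\<^esub> = 0" "\<psi> \<zero>\<^bsub>AT n\<^esub> = 0"
    using add[OF TN.BM.zero_closed TN.BM.zero_closed] by (simp_all only: TN.BM.r_zero TN.BM.zero_closed add_cancel_right_right simp_thms)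
  then show ?case by simp
next
  case (tens b t D)
  then have "b \<in> carrier A" by simp
  then show ?case using tens add assms(4) TN.tens_closed[of b t n] by simp
qed

lemma AT_smult_tens: "b \<in> carrier A \<Longrightarrow> scalar r \<odot>\<^bsub>AT n\<^esub> TN.tens n b t = TN.tens n (r \<odot>\<^bsub>A\<^esub> b) t"
  using TN.smult_tens[of "scalar r" n b t] by (simp add: RA_eq scalar_LA)

lemma pairing_smult:
  assumes f: "f \<in> Hom E (cobj T n) LA" and z: "z \<in> carrier (AT n)"
  shows "pairing n f (scalar r \<odot>\<^bsub>AT n\<^esub> z) = r * pairing n f z"
proof -
  interpret X: Module.module E "AT n" by (rule AT_module)
  show ?thesis
    using module_homD(1)[OF f]
    by (intro AT_eqI[OF z, of "\<lambda>z. pairing n f (scalar r \<odot>\<^bsub>AT n\<^esub> z)" "\<lambda>z. r * pairing n f z"])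
      (simp_all add: X.smult_r_distr pairing_add[OF f] distrib_left AT_smult_tens pairing_tens[OF f] A_smult_mult co_smult)
qed

lemma pairing_functional:
  assumes "f \<in> Hom E (cobj T n) LA"
  shows "functional_on (AT_K n) (carrier (AT_K n)) (pairing n f)"
proof -
  interpret X: Module.module E "AT n" by (rule AT_module)
  show ?thesis unfolding functional_on_def
    using pairing_add[OF assms] pairing_smult[OF assms] by (simp flip: scalar_def)
qed

text \<open>The coboundary is the transpose of the boundary.\<close>

lemma pairing_dAT:
  assumes h: "h \<in> Hom E (cobj T (n - 1)) LA" and z: "z \<in> carrier (AT n)"
  shows "pairing (n - 1) h (dAT n z) = pairing n (\<lambda>x. h (cdiff T n x)) z"
proof -
  note hd = module_hom_comp[OF T_cdiff[of n] h]
  note d = module_homD[OF dAT_hom[of n]]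
  show ?thesis
    by (intro AT_eqI[OF z, of "\<lambda>z. pairing (n - 1) h (dAT n z)"])
      (simp_all add: d pairing_add[OF h] pairing_add[OF hd] dAT_tens pairing_tens[OF h] pairing_tens[OF hd])
qed

text \<open>For fixed \<open>t\<close> the functional restricts to one on \<open>A\<close>, which
  the form represents by an element \<open>f t\<close>; nondegeneracy then makes \<open>f\<close>
  linear over \<open>E\<close>.\<close>

lemma pairing_represents:
  assumes \<psi>: "functional_on (AT_K n) (carrier (AT_K n)) \<psi>"
  shows "\<exists>f\<in>Hom E (cobj T n) LA. \<forall>z\<in>carrier (AT n). pairing n f z = \<psi> z"
proof -
  interpret X: Module.module E "AT n" by (rule AT_module)
  interpret Tn: Module.module E "cobj T n" by (rule T_mod)
  have lin: "\<psi> (scalar r \<odot>\<^bsub>AT n\<^esub> x \<oplus>\<^bsub>AT n\<^esub> y) = r * \<psi> x + \<psi> y" if "x \<in> carrier (AT n)" "y \<in> carrier (AT n)" for r x y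
    using \<psi> that by (simp add: functional_on_def scalar_def)
  have add: "\<psi> (x \<oplus>\<^bsub>AT n\<^esub> y) = \<psi> x + \<psi> y" if "x \<in> carrier (AT n)" "y \<in> carrier (AT n)" for x y
    using lin[OF that, of 1] that by (simp add: scalar_ring X.smult_one)
  have zero: "\<psi> \<zero>\<^bsub>AT n\<^esub> = 0"
    using add[OF TN.BM.zero_closed TN.BM.zero_closed] by (simp only: TN.BM.r_zero TN.BM.zero_closed add_cancel_right_right simp_thms)
  have smult: "\<psi> (scalar r \<odot>\<^bsub>AT n\<^esub> x) = r * \<psi> x" if "x \<in> carrier (AT n)" for r x
    using lin[OF that TN.BM.zero_closed, of r] that by (simp add: zero)
  have ex: "\<exists>s\<in>carrier A. \<forall>b\<in>carrier A. co (b \<star> s) top = \<psi> (TN.tens n b t)" if t: "t \<in> carrier (cobj T n)" for t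
    using t TN.tens_add_l[of _ _ t n] smult[of "TN.tens n _ t"]
    by (intro form_represents) (simp_all add: add flip: AT_smult_tens)
  define f where "f t = (SOME s. s \<in> carrier A \<and> (\<forall>b\<in>carrier A. co (b \<star> s) top = \<psi> (TN.tens n b t)))" for t
  have f: "f t \<in> carrier A" "\<And>b. b \<in> carrier A \<Longrightarrow> co (b \<star> f t) top = \<psi> (TN.tens n b t)"
    if "t \<in> carrier (cobj T n)" for t
    using someI_ex[OF ex[OF that, unfolded Bex_def]] unfolding f_def by blast+
  have hom: "f \<in> Hom E (cobj T n) LA"
  proof (rule module_homI)
    show "f (t \<oplus>\<^bsub>cobj T n\<^esub> u) = f t \<oplus>\<^bsub>LA\<^esub> f u" if "t \<in> carrier (cobj T n)" "u \<in> carrier (cobj T n)" for t u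
      using that by (intro form_nondegenerate) (simp_all add: f A.r_distr co_add TN.tens_add_r add)
    show "f (C \<odot>\<^bsub>cobj T n\<^esub> t) = C \<rhd> f t" if "C \<in> carrier E" "t \<in> carrier (cobj T n)" for C t
      using that TN.tens_balanced[of C _ t n]
      by (intro form_nondegenerate) (simp_all add: f LA_closed RA_eq flip: action_adjoint)
  qed (simp add: f)
  have "pairing n f z = \<psi> z" if "z \<in> carrier (AT n)" for z
    by (rule AT_eqI[OF that]) (simp_all add: pairing_add[OF hom] pairing_tens[OF hom] add f)
  then show ?thesis using hom by blast
qed

lemma pairing_nondegenerate:
  assumes f: "f \<in> Hom E (cobj T n) LA" and g: "g \<in> Hom E (cobj T n) LA"
    and eq: "\<And>z. z \<in> carrier (AT n) \<Longrightarrow> pairing n f z = pairing n g z" and t: "t \<in> carrier (cobj T n)"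
  shows "f t = g t"
  using module_homD(1)[OF f t] module_homD(1)[OF g t] eq[OF TN.tens_closed[OF _ t]]
  by (intro form_nondegenerate) (simp_all add: pairing_tens[OF f] pairing_tens[OF g])

lemma dAT_hom1: "dAT (n + 1) \<in> Hom E (AT (n + 1)) (AT n)"
  using dAT_hom[of "n + 1"] by simp

lemma pairing_dAT1:
  assumes "h \<in> Hom E (cobj T n) LA" "z \<in> carrier (AT (n + 1))"
  shows "pairing n h (dAT (n + 1) z) = pairing (n + 1) (\<lambda>x. h (cdiff T (n + 1) x)) z"
  using pairing_dAT[of h "n + 1" z] assms by simp

lemma pairing_zero_map:
  assumes f: "f \<in> Hom E (cobj T n) LA" and z: "z \<in> carrier (AT n)"
    and 0: "\<And>t. t \<in> carrier (cobj T n) \<Longrightarrow> f t = \<zero>\<^bsub>A\<^esub>"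
  shows "pairing n f z = 0"
  by (rule AT_eqI[OF z, of "pairing n f" "\<lambda>_. 0"]) (simp_all add: pairing_add[OF f] pairing_tens[OF f] 0 co_zero)

lemma cocyc_hom: "f \<in> cocyc n \<Longrightarrow> f \<in> Hom E (cobj T n) LA"
  by (simp add: cocyc_def)

lemma axpy_closed_ground:
  "axpy_closed E (AT n) S \<Longrightarrow> axpy_closed Kf (AT_K n) S"
  by (rule axpy_closed_restrict_scalars) (use scalar_closed in \<open>auto simp: scalar_def\<close>)

text \<open>If \<open>f\<close> vanishes on cycles, its functional factors through the boundary map.
  The factor extends from the boundaries to all of \<open>A\<close> tensor T_(n-1), and the map
  representing the extension bounds \<open>f\<close>.\<close>

lemma cobound_iff_pairing:
  assumes f: "f \<in> cocyc n"
  shows "cobound n f \<longleftrightarrow> (\<forall>z\<in>kernel_of (AT n) (dAT n) (AT (n - 1)). pairing n f z = 0)"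
proof
  note fh = cocyc_hom[OF f] and d = module_homD[OF dAT_hom[of n]]
  assume "cobound n f"
  then obtain h where h: "h \<in> Hom E (cobj T (n - 1)) LA"
    "\<And>x. x \<in> carrier (cobj T n) \<Longrightarrow> f x = h (cdiff T n x)" by (auto simp: cobound_def)
  note hd = module_hom_comp[OF T_cdiff[of n] h(1)]
  show "\<forall>z\<in>kernel_of (AT n) (dAT n) (AT (n - 1)). pairing n f z = 0"
  proof
    fix z assume z: "z \<in> kernel_of (AT n) (dAT n) (AT (n - 1))"
    then have zc: "z \<in> carrier (AT n)" by (simp add: kernel_of_def)
    have "pairing n f z = pairing n (\<lambda>x. h (cdiff T n x)) z"
      by (rule AT_eqI[OF zc]) (simp_all add: pairing_add[OF fh] pairing_add[OF hd] pairing_tens[OF fh] pairing_tens[OF hd] h(2))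
    also have "\<dots> = pairing (n - 1) h (dAT n z)" by (rule pairing_dAT[OF h(1) zc, symmetric])
    also have "\<dots> = 0" using z pairing_zero[OF h(1)] by (simp add: kernel_of_def)
    finally show "pairing n f z = 0" .
  qed
next
  note fh = cocyc_hom[OF f] and d = module_homD[OF dAT_hom[of n]]
  interpret X: Module.module E "AT n" by (rule AT_module)
  interpret Y: Module.module E "AT (n - 1)" by (rule AT_module)
  note func = pairing_functional[OF fh, unfolded functional_on_def restrict_scalars_simps, rule_format, folded scalar_def]
  assume 0: "\<forall>z\<in>kernel_of (AT n) (dAT n) (AT (n - 1)). pairing n f z = 0"
  \<comment> \<open>Two chains with the same boundary differ by a cycle, on which the functional
    vanishes.\<close>
  have well: "pairing n f z = pairing n f z'" if z: "z \<in> carrier (AT n)" "z' \<in> carrier (AT n)" "dAT n z = dAT n z'" for z z'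
  proof -
    let ?w = "scalar (- 1) \<odot>\<^bsub>AT n\<^esub> z \<oplus>\<^bsub>AT n\<^esub> z'"
    have w: "?w \<in> carrier (AT n)" using z X.smult_closed[of "scalar (- 1)" z] by simp
    have "scalar (- 1) \<odot>\<^bsub>AT (n - 1)\<^esub> dAT n z' \<oplus>\<^bsub>AT (n - 1)\<^esub> dAT n z'
        = (scalar (- 1) \<oplus>\<^bsub>E\<^esub> scalar 1) \<odot>\<^bsub>AT (n - 1)\<^esub> dAT n z'"
      using Y.smult_l_distr[of "scalar (- 1)" "scalar 1" "dAT n z'"] Y.smult_one[of "dAT n z'"] d(1)[OF z(2)] by (simp add: scalar_ring)
    also have "\<dots> = scalar 0 \<odot>\<^bsub>AT (n - 1)\<^esub> dAT n z'" by (simp flip: scalar_ring(1))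
    also have "scalar 0 = \<zero>\<^bsub>E\<^esub>" using scalar_ring(1)[of 0 0] scalar_closed[of 0] by (simp add: E.add.r_cancel_one')
    finally have "dAT n ?w = \<zero>\<^bsub>AT (n - 1)\<^esub>"
      using z d(1)[OF z(2)] X.smult_closed[of "scalar (- 1)" z] by (simp add: d)
    then have "pairing n f ?w = 0" using 0 w by (simp add: kernel_of_def)
    then show ?thesis using func[OF z(1,2), of "- 1"] by simp
  qed
  define g where "g w = pairing n f (SOME z. z \<in> carrier (AT n) \<and> dAT n z = w)" for w
  have g: "g (dAT n z) = pairing n f z" if "z \<in> carrier (AT n)" for z
    using someI[of "\<lambda>z'. z' \<in> carrier (AT n) \<and> dAT n z' = dAT n z" z] that unfolding g_def by (intro well) auto
  have "functional_on (AT_K (n - 1)) (dAT n ` carrier (AT n)) g"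
    unfolding functional_on_def restrict_scalars_simps scalar_def[symmetric]
  proof (intro allI ballI, elim imageE)
    fix r u v x y assume uv: "u = dAT n x" "x \<in> carrier (AT n)" "v = dAT n y" "y \<in> carrier (AT n)"
    then have "scalar r \<odot>\<^bsub>AT (n - 1)\<^esub> u \<oplus>\<^bsub>AT (n - 1)\<^esub> v = dAT n (scalar r \<odot>\<^bsub>AT n\<^esub> x \<oplus>\<^bsub>AT n\<^esub> y)"
      using X.smult_closed[of "scalar r" x] by (simp add: d)
    then show "g (scalar r \<odot>\<^bsub>AT (n - 1)\<^esub> u \<oplus>\<^bsub>AT (n - 1)\<^esub> v) = r * g u + g v"
      using uv func[of x y r] X.smult_closed[of "scalar r" x] by (simp add: g)
  qed
  then obtain \<psi> where \<psi>: "functional_on (AT_K (n - 1)) (carrier (AT_K (n - 1))) \<psi>"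
    "\<And>u. u \<in> dAT n ` carrier (AT n) \<Longrightarrow> \<psi> u = g u"
    using functional_extension[OF AT_K_module axpy_closed_ground[OF axpy_closed_image[OF AT_module AT_module dAT_hom]]] by blast
  then obtain h where h: "h \<in> Hom E (cobj T (n - 1)) LA"
    "\<And>u. u \<in> carrier (AT (n - 1)) \<Longrightarrow> pairing (n - 1) h u = \<psi> u"
    using pairing_represents[OF \<psi>(1)] by blast
  note hd = module_hom_comp[OF T_cdiff[of n] h(1)]
  have "f x = h (cdiff T n x)" if "x \<in> carrier (cobj T n)" for x
  proof (rule pairing_nondegenerate[OF fh hd _ that])
    fix z assume z: "z \<in> carrier (AT n)"
    show "pairing n f z = pairing n (\<lambda>x. h (cdiff T n x)) z"
      using pairing_dAT[OF h(1) z] h(2)[OF d(1)[OF z]] \<psi>(2)[OF imageI[OF z]] g[OF z] by simp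
  qed
  then show "cobound n f" using h(1) by (auto simp: cobound_def)
qed

text \<open>The functional is represented by some map; its coboundary pairs to zero with everything,
  hence is zero.\<close>

lemma cocyc_represents:
  assumes \<psi>: "functional_on (AT_K n) (carrier (AT_K n)) \<psi>" "\<forall>u\<in>dAT (n + 1) ` carrier (AT (n + 1)). \<psi> u = 0"
  shows "\<exists>f\<in>cocyc n. \<forall>x\<in>carrier (AT n). pairing n f x = \<psi> x"
proof -
  obtain f where f: "f \<in> Hom E (cobj T n) LA" "\<And>z. z \<in> carrier (AT n) \<Longrightarrow> pairing n f z = \<psi> z"
    using pairing_represents[OF \<psi>(1)] by blast
  note fd = module_hom_comp[OF T_cdiff1[of n] f(1)] and d = module_homD[OF dAT_hom1[of n]]
  note zm = module_hom_zero_map[OF T_mod[of "n + 1"] LA_module]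
  have "f (cdiff T (n + 1) t) = \<zero>\<^bsub>LA\<^esub>" if "t \<in> carrier (cobj T (n + 1))" for t
  proof (rule pairing_nondegenerate[OF fd zm _ that])
    fix z assume z: "z \<in> carrier (AT (n + 1))"
    have "pairing (n + 1) (\<lambda>x. f (cdiff T (n + 1) x)) z = 0"
      using pairing_dAT1[OF f(1) z] f(2)[OF d(1)[OF z]] \<psi>(2) z by simp
    then show "pairing (n + 1) (\<lambda>x. f (cdiff T (n + 1) x)) z = pairing (n + 1) (\<lambda>x. \<zero>\<^bsub>LA\<^esub>) z"
      using pairing_zero_map[OF zm z] by simp
  qed
  then show ?thesis using f by (intro bexI[of _ f]) (simp_all add: cocyc_def)
qed

text \<open>Under the pairing, cocycles are the functionals that vanish on boundaries, and
  coboundaries those that vanish on cycles; so homology is dual to cohomology in the same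
  degree.\<close>

lemma dim_homology:
  "fd_space (tate_HH_homology Kf A T RA n) \<and> k_dim (tate_HH_homology Kf A T RA n) = card (cells (- 1 - n))"
proof -
  let ?Z = "kernel_of (AT n) (dAT n) (AT (n - 1))" and ?B = "dAT (n + 1) ` carrier (AT (n + 1))" and ?S = "cells (- 1 - n)"
  obtain \<Theta> where "coordinates_on n \<Theta>" using ex_coordinates_on by blast
  note \<Theta> = coordinates_onD[OF this]
  interpret X: Module.module E "AT n" by (rule AT_module)
  note Z = axpy_closed_kernel[OF AT_module AT_module dAT_hom[of n]]
    and B = axpy_closed_image[OF AT_module AT_module dAT_hom1[of n]]
  have "\<exists>\<Lambda>. (\<forall>i. functional_on (AT_K n) (carrier (AT_K n)) (\<lambda>x. \<Lambda> x i)) \<and> (\<forall>x i. i \<notin> ?S \<longrightarrow> \<Lambda> x i = 0)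
    \<and> (\<forall>w. (\<forall>i. i \<notin> ?S \<longrightarrow> w i = (0 :: 'k)) \<longrightarrow> (\<exists>z\<in>?Z. \<Lambda> z = w)) \<and> (\<forall>z\<in>?Z. (\<forall>i. \<Lambda> z i = 0) \<longleftrightarrow> z \<in> ?B)"
  proof (rule dual_coordinates[where F = "cocyc n" and \<Psi> = "pairing n" and \<Theta> = \<Theta>,
        OF AT_K_module axpy_closed_ground[OF B] axpy_closed_ground[OF Z] finite_cells])
    show "functional_on (AT_K n) (carrier (AT_K n)) (pairing n f)" if "f \<in> cocyc n" for f
      by (rule pairing_functional[OF cocyc_hom[OF that]])
    show "pairing n f u = 0" if f: "f \<in> cocyc n" and u: "u \<in> ?B" for f u
    proof -
      from u obtain y where y: "y \<in> carrier (AT (n + 1))" "u = dAT (n + 1) y" by blast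
      show ?thesis unfolding y(2) pairing_dAT1[OF cocyc_hom[OF f] y(1)]
        using f by (intro pairing_zero_map[OF module_hom_comp[OF T_cdiff1 cocyc_hom[OF f]] y(1)]) (simp add: cocyc_def)
    qed
    show "\<exists>f\<in>cocyc n. \<forall>x\<in>carrier (AT_K n). pairing n f x = \<psi> x"
      if "functional_on (AT_K n) (carrier (AT_K n)) \<psi>" "\<forall>u\<in>?B. \<psi> u = 0" for \<psi>
      using cocyc_represents[OF that] by simp
    show "\<exists>h\<in>cocyc n. (\<forall>x\<in>carrier (AT_K n). pairing n h x = r * pairing n f x + pairing n g x) \<and> (\<forall>i. \<Theta> h i = r * \<Theta> f i + \<Theta> g i)"
      if f: "f \<in> cocyc n" and g: "g \<in> cocyc n" for r f g
    proof (intro bexI[of _ "\<lambda>x. scalar r \<rhd> f x \<oplus>\<^bsub>A\<^esub> g x"] conjI ballI allI)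
      show h: "(\<lambda>x. scalar r \<rhd> f x \<oplus>\<^bsub>A\<^esub> g x) \<in> cocyc n" by (rule \<Theta>(1)[OF f g])
      show "\<Theta> (\<lambda>x. scalar r \<rhd> f x \<oplus>\<^bsub>A\<^esub> g x) i = r * \<Theta> f i + \<Theta> g i" for i by (rule \<Theta>(2)[OF f g])
      fix x assume "x \<in> carrier (AT_K n)"
      then have x: "x \<in> carrier (AT n)" by simp
      note hs = cocyc_hom[OF h] cocyc_hom[OF f] cocyc_hom[OF g]
      show "pairing n (\<lambda>x. scalar r \<rhd> f x \<oplus>\<^bsub>A\<^esub> g x) x = r * pairing n f x + pairing n g x"
        using cocyc_closed[OF f] cocyc_closed[OF g]
        by (intro AT_eqI[OF x, of _ "\<lambda>x. r * pairing n f x + pairing n g x"])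
          (simp_all add: hs[THEN pairing_add] hs[THEN pairing_tens] distrib_left A.r_distr scalar_LA A_smult_closed A_smult_mult co_add co_smult)
    qed
    show "\<Theta> f i = 0" if "f \<in> cocyc n" "i \<notin> ?S" for f i
    proof -
      have "\<Theta> f \<in> \<Theta> ` cocyc n" using that(1) by blast
      then show ?thesis using that(2) unfolding \<Theta>(4) by blast
    qed
    show "\<exists>f\<in>cocyc n. \<Theta> f = w" if "\<And>i. i \<notin> ?S \<Longrightarrow> w i = 0" for w
    proof -
      have "w \<in> \<Theta> ` cocyc n" unfolding \<Theta>(4) using that by blast
      then show ?thesis by blast
    qed
    show "(\<forall>i. \<Theta> f i = 0) \<longleftrightarrow> (\<forall>z\<in>?Z. pairing n f z = 0)" if "f \<in> cocyc n" for f
      using \<Theta>(3)[OF that] cobound_iff_pairing[OF that] by blast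
  qed
  then obtain \<Lambda> where "(\<forall>i. functional_on (AT_K n) (carrier (AT_K n)) (\<lambda>x. \<Lambda> x i)) \<and> (\<forall>x i. i \<notin> ?S \<longrightarrow> \<Lambda> x i = 0)
    \<and> (\<forall>w. (\<forall>i. i \<notin> ?S \<longrightarrow> w i = (0 :: 'k)) \<longrightarrow> (\<exists>z\<in>?Z. \<Lambda> z = w)) \<and> (\<forall>z\<in>?Z. (\<forall>i. \<Lambda> z i = 0) \<longleftrightarrow> z \<in> ?B)" ..
  note L = this[THEN conjunct1, rule_format] this[THEN conjunct2, THEN conjunct1, rule_format]
    this[THEN conjunct2, THEN conjunct2, THEN conjunct1, rule_format]
    this[THEN conjunct2, THEN conjunct2, THEN conjunct2, THEN bspec]
  have lin: "\<Lambda> (scalar r \<odot>\<^bsub>AT n\<^esub> x \<oplus>\<^bsub>AT n\<^esub> y) i = r * \<Lambda> x i + \<Lambda> y i" if "x \<in> carrier (AT n)" "y \<in> carrier (AT n)" for r x y i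
    using L(1)[of i] that by (simp add: functional_on_def scalar_def)
  have add: "\<Lambda> (x \<oplus>\<^bsub>AT n\<^esub> y) i = \<Lambda> x i + \<Lambda> y i" if "x \<in> carrier (AT n)" "y \<in> carrier (AT n)" for x y i
    using lin[OF that, of 1 i] that by (simp add: scalar_ring X.smult_one)
  have zero: "\<Lambda> \<zero>\<^bsub>AT n\<^esub> i = 0" for i
    using add[OF TN.BM.zero_closed TN.BM.zero_closed] by (simp only: TN.BM.r_zero TN.BM.zero_closed add_cancel_right_right simp_thms)
  have "fd_space (restrict_scalars E (quotient (AT n\<lparr>carrier := ?Z\<rparr>) ?B))
    \<and> k_dim (restrict_scalars E (quotient (AT n\<lparr>carrier := ?Z\<rparr>) ?B)) = card ?S"
  proof (rule dim_quotient[where \<Theta> = \<Lambda>, OF AT_module Z B])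
    show "?B \<subseteq> ?Z"
    proof (rule image_subsetI)
      fix y assume y: "y \<in> carrier (AT (n + 1))"
      note d1 = module_homD[OF dAT_hom1[of n], simplified] and d0 = module_homD[OF dAT_hom[of n]]
      have "dAT n (dAT (n + 1) y) = \<zero>\<^bsub>AT (n - 1)\<^esub>"
        using y
      proof (induction rule: TN.tens_induct)
        case zero
        then show ?case using module_hom_zero[OF AT_module AT_module dAT_hom1] module_hom_zero[OF AT_module AT_module dAT_hom] by simp
      next
        case (tens b t D)
        have b: "b \<in> carrier A" using tens(1) by simp
        have "dAT n (dAT (n + 1) (TN.tens (n + 1) b t)) = TN.tens (n - 1) b (cdiff T n (cdiff T (n + 1) t))"
          using dAT_tens[of b t "n + 1"] dAT_tens[OF b module_homD(1)[OF T_cdiff1 tens(2)]] b tens(2) by simp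
        also have "cdiff T n (cdiff T (n + 1) t) = \<zero>\<^bsub>cobj T (n - 1)\<^esub>" using T_cdiff_cdiff[of t "n + 1"] tens(2) by simp
        also have "TN.tens (n - 1) b \<zero>\<^bsub>cobj T (n - 1)\<^esub> = \<zero>\<^bsub>AT (n - 1)\<^esub>"
        proof -
          interpret Tn: Module.module E "cobj T (n - 1)" by (rule T_mod)
          have "TN.tens (n - 1) b \<zero>\<^bsub>cobj T (n - 1)\<^esub> = TN.tens (n - 1) b \<zero>\<^bsub>cobj T (n - 1)\<^esub> \<oplus>\<^bsub>AT (n - 1)\<^esub> TN.tens (n - 1) b \<zero>\<^bsub>cobj T (n - 1)\<^esub>"
            using TN.tens_add_r[of b "\<zero>\<^bsub>cobj T (n - 1)\<^esub>" "n - 1" "\<zero>\<^bsub>cobj T (n - 1)\<^esub>"] b by simp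
          then show ?thesis using b TN.tens_closed[of b "\<zero>\<^bsub>cobj T (n - 1)\<^esub>" "n - 1"] by (simp add: TN.BM.add.r_cancel_one')
        qed
        finally show ?case
          using tens TN.tens_closed[OF tens(1,2)] d1(1) by (simp add: d1 d0 TN.BM.r_zero)
      qed
      then show "dAT (n + 1) y \<in> ?Z" using d1(1)[OF y] by (simp add: kernel_of_def)
    qed
    show "\<Lambda> (x \<oplus>\<^bsub>AT n\<^esub> y) i = \<Lambda> x i + \<Lambda> y i" if "x \<in> ?Z" "y \<in> ?Z" for x y i
      using that by (intro add) (simp_all add: kernel_of_def)
    show "\<Lambda> ((r \<odot>\<^bsub>E\<^esub> \<one>\<^bsub>E\<^esub>) \<odot>\<^bsub>AT n\<^esub> x) i = r * \<Lambda> x i" if "x \<in> ?Z" for r x i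
      using lin[of x "\<zero>\<^bsub>AT n\<^esub>" r i] X.smult_closed[of "scalar r" x] that zero by (simp add: kernel_of_def flip: scalar_def)
  qed (use L(2,3,4) scalar_closed finite_cells in \<open>simp_all add: scalar_def del: split_paired_All\<close>)
  then show ?thesis by (simp add: tate_HH_homology_def homology_at_def Let_def)
qed

end

theorem theorem4p4:
  fixes p c a :: nat
    and A :: "('k::field, 'k mpoly set) module"
    and T :: "('k mpoly set env, 'm) mod_complex"
    and HH_low :: "int \<Rightarrow> ('k, ('k mpoly set \<times> 'm \<Rightarrow>\<^sub>0 int) set set) module"
    and HH_up :: "int \<Rightarrow> ('k, ('m \<Rightarrow> 'k mpoly set) set) module"
  assumes "p = CHAR('k)"
    and "c \<ge> 1"
    and "a \<ge> 2"
    and A: "A = ci_algebra c a"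
    and T: "complete_resolution (enveloping_algebra ground_field A) (left_env_module A) T"
    and HH_low: "\<And>n. HH_low n = tate_HH_homology ground_field A T (right_env_module A) n"
    and HH_up: "\<And>n. HH_up n = tate_HH_cohomology ground_field A T (left_env_module A) n"
  shows "(\<forall>n. fd_space (HH_low n) \<and> fd_space (HH_up n))
    \<and> (\<forall>n::nat. k_dim (HH_low (int n)) =
         (if p dvd a then ((c + n - 1) choose n) * a ^ c
          else if n = 0 then a ^ c - 1
          else (\<Sum>t=0..c. (c choose t) * binom (n - 1) (int n - int c + int t)
                            * a ^ t * (a - 1) ^ (c - t))))
    \<and> (\<forall>n::int. k_dim (HH_low n) = k_dim (HH_up n)
         \<and> k_dim (HH_up n) = k_dim (HH_low (- (n + 1)))
         \<and> k_dim (HH_low (- (n + 1))) = k_dim (HH_up (- (n + 1))))"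
proof -
  \<comment> \<open>Being a module over \<open>E\<close> includes that \<open>E\<close> is a
    commutative ring.\<close>
  have "Module.module (enveloping_algebra ground_field A) (cobj T 0)"
    using T by (auto simp: complete_resolution_def chain_complex_def)
  then have "cring (enveloping_algebra ground_field A)" by (simp add: Module.module_def)
  then interpret ci_resolution c a A T
    using assms(2,3) A T
    by (intro ci_resolution.intro ci_setup.intro env_algebra.intro truncated_algebra.intro
        ci_resolution_axioms.intro ci_setup_axioms.intro env_algebra_axioms.intro)
  \<comment> \<open>Both dimension counts give the cells of degree -1-n; negation of the lattice
    replaces their number by that of degree n.\<close>
  have low: "fd_space (HH_low n)" "k_dim (HH_low n) = card (cells n)" for n
    using dim_homology[of n] card_cells_neg[of n] by (simp_all add: HH_low)
  have up: "fd_space (HH_up n)" "k_dim (HH_up n) = card (cells n)" for n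
    using dim_cohomology[of n] card_cells_neg[of n] by (simp_all add: HH_up)
  have neg: "card (cells (- n - 1)) = card (cells n)" for n
    using card_cells_neg[of n] by (simp only: minus_diff_commute)
  have "p dvd a \<longleftrightarrow> (of_nat a :: 'k) = 0"
    using assms(1) by (simp add: of_nat_eq_0_iff_char_dvd)
  then show ?thesis by (simp add: low up neg card_cells)
qed

end
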